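(* Let $\mathsf{k}$ be an algebraically closed field of characteristic $0$, let $Q=\mathsf{k}[x,y,z,w]$ be the standard graded polynomial ring, and let $I\subset Q$ be a homogeneous Gorenstein ideal with $(x,y,z,w)^4\subseteq I\subseteq (x,y,z,w)^2$ and such that $Q/I$ has Hilbert function $1+4t+4t^2+t^3$. Then the Betti table of $Q/I$ is one of three; that is, the graded minimal free resolution of $Q/I$ over $Q$ has one of the following three forms: $$0\to Q(-7)\to Q(-5)^6\to Q(-3)^5\oplus Q(-4)^5\to Q(-2)^6\to Q,$$ $$0\to Q(-7)\to Q(-4)\oplus Q(-5)^6\to Q(-3)^6\oplus Q(-4)^6\to Q(-2)^6\oplus Q(-3)\to Q,$$ $$0\to Q(-7)\to Q(-4)^3\oplus Q(-5)^6\to Q(-3)^8\oplus Q(-4)^8\to Q(-2)^6\oplus Q(-3)^3\to Q.$$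
   Context: An ideal $I$ of $Q$ is Gorenstein if it is perfect and $Q/I$ is a Gorenstein ring. *)

theory Defs
  imports
    "HOL-Algebra.Algebraic_Closure_Type"
    "HOL-Algebra.Ideal_Product"
    "HOL-Algebra.QuotRing"
    "HOL-Algebra.Embedded_Algebras"
    "HOL-Algebra.Ring_Divisibility"
    "HOL-Library.Poly_Mapping"
    "HOL-Library.Extended_Nat"
    "HOL-Library.Numeral_Type"
    "HOL-Library.More_List"
    "HOL-Library.Multiset"
begin

section \<open>Finite free modules and matrices over a commutative ring\<close>

definition vecs :: "('a, 'm) ring_scheme \<Rightarrow> nat \<Rightarrow> (nat \<Rightarrow> 'a) set" where
  "vecs R n = {..<n} \<rightarrow>\<^sub>E carrier R"

definition zero_vec :: "('a, 'm) ring_scheme \<Rightarrow> nat \<Rightarrow> nat \<Rightarrow> 'a" where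
  "zero_vec R n = (\<lambda>i\<in>{..<n}. \<zero>\<^bsub>R\<^esub>)"

definition row_app :: "('a, 'm) ring_scheme \<Rightarrow> nat \<Rightarrow> (nat \<Rightarrow> 'a) \<Rightarrow> (nat \<Rightarrow> 'a) \<Rightarrow> 'a" where
  "row_app R n u v = (\<Oplus>\<^bsub>R\<^esub>j\<in>{..<n}. u j \<otimes>\<^bsub>R\<^esub> v j)"

definition is_mat :: "('a, 'm) ring_scheme \<Rightarrow> nat \<Rightarrow> nat \<Rightarrow> (nat \<Rightarrow> nat \<Rightarrow> 'a) \<Rightarrow> bool" where
  "is_mat R m n M \<longleftrightarrow> (\<forall>i<m. \<forall>j<n. M i j \<in> carrier R)"

definition mat_app ::
  "('a, 'm) ring_scheme \<Rightarrow> nat \<Rightarrow> nat \<Rightarrow> (nat \<Rightarrow> nat \<Rightarrow> 'a) \<Rightarrow> (nat \<Rightarrow> 'a) \<Rightarrow> (nat \<Rightarrow> 'a)" where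
  "mat_app R m n M v = (\<lambda>i\<in>{..<m}. row_app R n (M i) v)"

section \<open>Resolutions\<close>

text \<open>
  \<open>cyclic_resolution R I n P d \<epsilon>\<close>: the sequence
  \<open>\<dots> \<rightarrow> P 2 \<rightarrow> P 1 \<rightarrow> P 0 \<rightarrow> R/I \<rightarrow> 0\<close> is exact, where \<open>P i\<close> is a submodule of \<open>R^(n i)\<close>,
  the map \<open>P (i+1) \<rightarrow> P i\<close> is given by the matrix \<open>d i\<close>, and the map \<open>P 0 \<rightarrow> R/I\<close> by the
  row \<open>\<epsilon>\<close> followed by the quotient map.
\<close>

definition cyclic_resolution ::
  "('a, 'm) ring_scheme \<Rightarrow> 'a set \<Rightarrow> (nat \<Rightarrow> nat) \<Rightarrow> (nat \<Rightarrow> (nat \<Rightarrow> 'a) set) \<Rightarrow>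
     (nat \<Rightarrow> nat \<Rightarrow> nat \<Rightarrow> 'a) \<Rightarrow> (nat \<Rightarrow> 'a) \<Rightarrow> bool" where
  "cyclic_resolution R I n P d \<epsilon> \<longleftrightarrow>
     (\<forall>i. is_mat R (n i) (n (Suc i)) (d i)) \<and> (\<forall>j<n 0. \<epsilon> j \<in> carrier R) \<and>
     (\<forall>x\<in>carrier R. \<exists>v\<in>P 0. x \<ominus>\<^bsub>R\<^esub> row_app R (n 0) \<epsilon> v \<in> I) \<and>
     {v \<in> P 0. row_app R (n 0) \<epsilon> v \<in> I} = mat_app R (n 0) (n 1) (d 0) ` P 1 \<and>
     (\<forall>i. {v \<in> P (Suc i). mat_app R (n i) (n (Suc i)) (d i) v = zero_vec R (n i)}
            = mat_app R (n (Suc i)) (n (Suc (Suc i))) (d (Suc i)) ` P (Suc (Suc i)))"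

definition idempotent_mat :: "('a, 'm) ring_scheme \<Rightarrow> nat \<Rightarrow> (nat \<Rightarrow> nat \<Rightarrow> 'a) \<Rightarrow> bool" where
  "idempotent_mat R n e \<longleftrightarrow>
     is_mat R n n e \<and> (\<forall>v\<in>vecs R n. mat_app R n n e (mat_app R n n e v) = mat_app R n n e v)"

text \<open>
  Finitely generated projective modules are, up to isomorphism, the direct summands of the
  \<open>R^n\<close>, i.e. the images of idempotent matrices.  For Noetherian \<open>R\<close>, projective
  resolutions by finitely generated modules compute the projective dimension of \<open>R/I\<close>.
\<close>

definition proj_dim_quotient :: "('a, 'm) ring_scheme \<Rightarrow> 'a set \<Rightarrow> enat" where
  "proj_dim_quotient R I =
     Inf {enat l | l. \<exists>n e d \<epsilon>. (\<forall>i. idempotent_mat R (n i) (e i)) \<and>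
       cyclic_resolution R I n (\<lambda>i. mat_app R (n i) (n i) (e i) ` vecs R (n i)) d \<epsilon> \<and>
       (\<forall>i>l. n i = 0)}"

section \<open>Perfect ideals\<close>

definition regular_sequence :: "('a, 'm) ring_scheme \<Rightarrow> 'a list \<Rightarrow> bool" where
  "regular_sequence R xs \<longleftrightarrow> set xs \<subseteq> carrier R \<and> Idl\<^bsub>R\<^esub> (set xs) \<noteq> carrier R \<and>
     (\<forall>i<length xs. \<forall>y\<in>carrier R.
        xs ! i \<otimes>\<^bsub>R\<^esub> y \<in> Idl\<^bsub>R\<^esub> (set (take i xs)) \<longrightarrow> y \<in> Idl\<^bsub>R\<^esub> (set (take i xs)))"

definition grade :: "('a, 'm) ring_scheme \<Rightarrow> 'a set \<Rightarrow> enat" where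
  "grade R I = Sup {enat (length xs) | xs. regular_sequence R xs \<and> set xs \<subseteq> I}"

definition perfect_ideal :: "('a, 'm) ring_scheme \<Rightarrow> 'a set \<Rightarrow> bool" where
  "perfect_ideal R I \<longleftrightarrow> ideal I R \<and> I \<noteq> carrier R \<and>
     proj_dim_quotient R I = grade R I \<and> proj_dim_quotient R I < \<infinity>"

section \<open>Gorenstein rings\<close>

definition fraction :: "('a, 'm) ring_scheme \<Rightarrow> 'a set \<Rightarrow> 'a \<Rightarrow> 'a \<Rightarrow> ('a \<times> 'a) set" where
  "fraction R S r s = {(r', s'). r' \<in> carrier R \<and> s' \<in> S \<and>
     (\<exists>t\<in>S. t \<otimes>\<^bsub>R\<^esub> (s \<otimes>\<^bsub>R\<^esub> r') = t \<otimes>\<^bsub>R\<^esub> (s' \<otimes>\<^bsub>R\<^esub> r))}"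

definition localization :: "('a, 'm) ring_scheme \<Rightarrow> 'a set \<Rightarrow> ('a \<times> 'a) set ring" where
  "localization R S = \<lparr>
     carrier = {fraction R S r s | r s. r \<in> carrier R \<and> s \<in> S},
     monoid.mult = (\<lambda>A B. \<Union>p\<in>A. \<Union>q\<in>B. fraction R S (fst p \<otimes>\<^bsub>R\<^esub> fst q) (snd p \<otimes>\<^bsub>R\<^esub> snd q)),
     monoid.one = fraction R S \<one>\<^bsub>R\<^esub> \<one>\<^bsub>R\<^esub>,
     ring.zero = fraction R S \<zero>\<^bsub>R\<^esub> \<one>\<^bsub>R\<^esub>,
     ring.add = (\<lambda>A B. \<Union>p\<in>A. \<Union>q\<in>B.
       fraction R S ((snd q \<otimes>\<^bsub>R\<^esub> fst p) \<oplus>\<^bsub>R\<^esub> (snd p \<otimes>\<^bsub>R\<^esub> fst q)) (snd p \<otimes>\<^bsub>R\<^esub> snd q))\<rparr>"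

text \<open>
  \<open>\<dots> \<rightarrow> R^(n 2) \<rightarrow> R^(n 1) \<rightarrow> R^(n 0)\<close> is exact, i.e. a resolution, by free modules of finite
  rank, of the cokernel of \<open>d 0\<close>.  Over a Noetherian ring every finitely generated module
  arises as such a cokernel.
\<close>

definition free_resolution ::
  "('a, 'm) ring_scheme \<Rightarrow> (nat \<Rightarrow> nat) \<Rightarrow> (nat \<Rightarrow> nat \<Rightarrow> nat \<Rightarrow> 'a) \<Rightarrow> bool" where
  "free_resolution R n d \<longleftrightarrow>
     (\<forall>i. is_mat R (n i) (n (Suc i)) (d i)) \<and>
     (\<forall>i. {v \<in> vecs R (n (Suc i)). mat_app R (n i) (n (Suc i)) (d i) v = zero_vec R (n i)}
            = mat_app R (n (Suc i)) (n (Suc (Suc i))) (d (Suc i)) ` vecs R (n (Suc (Suc i))))"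

text \<open>
  The cohomology of the dual (transposed) complex in degree \<open>i + 1\<close>, that is
  \<open>Ext^(i+1) (N, R)\<close> for \<open>N\<close> the cokernel of \<open>d 0\<close>, is zero.
\<close>

definition Ext_Suc_vanishes ::
  "('a, 'm) ring_scheme \<Rightarrow> (nat \<Rightarrow> nat) \<Rightarrow> (nat \<Rightarrow> nat \<Rightarrow> nat \<Rightarrow> 'a) \<Rightarrow> nat \<Rightarrow> bool" where
  "Ext_Suc_vanishes R n d i \<longleftrightarrow>
     {v \<in> vecs R (n (Suc i)). mat_app R (n (Suc (Suc i))) (n (Suc i)) (\<lambda>r c. d (Suc i) c r) v
          = zero_vec R (n (Suc (Suc i)))}
       = mat_app R (n (Suc i)) (n i) (\<lambda>r c. d i c r) ` vecs R (n i)"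

text \<open>
  For Noetherian \<open>R\<close>: the \<open>R\<close>-module \<open>R\<close> has injective dimension at most \<open>l\<close>, i.e.
  \<open>Ext^i (N, R) = 0\<close> for all \<open>i > l\<close> and all finitely generated \<open>N\<close>.
\<close>

definition self_inj_dim_le :: "('a, 'm) ring_scheme \<Rightarrow> nat \<Rightarrow> bool" where
  "self_inj_dim_le R l \<longleftrightarrow> (\<forall>n d. free_resolution R n d \<longrightarrow> (\<forall>i\<ge>l. Ext_Suc_vanishes R n d i))"

definition gorenstein_ring :: "('a, 'm) ring_scheme \<Rightarrow> bool" where
  "gorenstein_ring R \<longleftrightarrow> cring R \<and> noetherian_ring R \<and>
     (\<forall>\<mm>. maximalideal \<mm> R \<longrightarrow> (\<exists>l. self_inj_dim_le (localization R (carrier R - \<mm>)) l))"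

definition gorenstein_ideal :: "('a, 'm) ring_scheme \<Rightarrow> 'a set \<Rightarrow> bool" where
  "gorenstein_ideal R I \<longleftrightarrow> perfect_ideal R I \<and> gorenstein_ring (R Quot I)"

section \<open>The standard graded polynomial ring with variables indexed by \<open>'v\<close>\<close>

type_synonym ('v, 'k) mpoly = "('v \<Rightarrow>\<^sub>0 nat) \<Rightarrow>\<^sub>0 'k"

abbreviation mpoly_ring :: "('v, 'k::comm_ring_1) mpoly ring" where
  "mpoly_ring \<equiv> ring_of_type_algebra"

definition mon_deg :: "('v \<Rightarrow>\<^sub>0 nat) \<Rightarrow> nat" where
  "mon_deg m = (\<Sum>v\<in>Poly_Mapping.keys m. Poly_Mapping.lookup m v)"

definition variable :: "'v \<Rightarrow> ('v, 'k::comm_ring_1) mpoly" where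
  "variable v = Poly_Mapping.single (Poly_Mapping.single v 1) 1"

definition constants :: "('v, 'k::comm_ring_1) mpoly set" where
  "constants = range (Poly_Mapping.single 0)"

text \<open>
  The zero polynomial is homogeneous of every degree, and the only one of negative degree.
\<close>

definition homogeneous :: "int \<Rightarrow> ('v, 'k::comm_ring_1) mpoly \<Rightarrow> bool" where
  "homogeneous e p \<longleftrightarrow> (\<forall>m\<in>Poly_Mapping.keys p. int (mon_deg m) = e)"

definition homogeneous_ideal :: "('v, 'k::comm_ring_1) mpoly set \<Rightarrow> bool" where
  "homogeneous_ideal I \<longleftrightarrow> (\<exists>S. (\<forall>p\<in>S. \<exists>e. homogeneous e p) \<and> I = Idl\<^bsub>mpoly_ring\<^esub> S)"

definition irrelevant_ideal :: "('v, 'k::comm_ring_1) mpoly set" where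
  "irrelevant_ideal = Idl\<^bsub>mpoly_ring\<^esub> (range variable)"

definition ideal_power :: "('a, 'm) ring_scheme \<Rightarrow> 'a set \<Rightarrow> nat \<Rightarrow> 'a set" where
  "ideal_power R I n = I [^]\<^bsub>ideals_set R\<^esub> n"

text \<open>
  The degree \<open>e\<close> component of \<open>Q/I\<close> has dimension \<open>h e\<close> over the copy of the coefficient field
  inside \<open>Q/I\<close>.
\<close>

definition has_hilbert_function :: "('v, 'k::field) mpoly set \<Rightarrow> (nat \<Rightarrow> nat) \<Rightarrow> bool" where
  "has_hilbert_function I h \<longleftrightarrow>
     (\<forall>e. ring.dimension (mpoly_ring Quot I) (h e)
            ((\<lambda>p. I +>\<^bsub>mpoly_ring\<^esub> p) ` constants)
            ((\<lambda>p. I +>\<^bsub>mpoly_ring\<^esub> p) ` {p. homogeneous (int e) p}))"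

text \<open>
  Here \<open>F\<^sub>i\<close> is the direct sum of the \<open>Q(-a)\<close>, for \<open>a\<close> in the list \<open>a i\<close>.
  The maps have degree 0, and the resolution is minimal: the differentials have
  entries in the irrelevant ideal.
\<close>

definition minimal_graded_free_resolution ::
  "('v, 'k::field) mpoly set \<Rightarrow> (nat \<Rightarrow> int list) \<Rightarrow>
     (nat \<Rightarrow> nat \<Rightarrow> nat \<Rightarrow> ('v, 'k) mpoly) \<Rightarrow> (nat \<Rightarrow> ('v, 'k) mpoly) \<Rightarrow> bool" where
  "minimal_graded_free_resolution I a d \<epsilon> \<longleftrightarrow>
     cyclic_resolution mpoly_ring I (\<lambda>i. length (a i)) (\<lambda>i. vecs mpoly_ring (length (a i))) d \<epsilon> \<and>
     (\<forall>j<length (a 0). homogeneous (a 0 ! j) (\<epsilon> j)) \<and>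
     (\<forall>i. \<forall>r<length (a i). \<forall>c<length (a (Suc i)).
        homogeneous (a (Suc i) ! c - a i ! r) (d i r c) \<and> d i r c \<in> irrelevant_ideal)"

text \<open>
  A Betti table is recorded as the multisets of twists: the multiplicity of \<open>j\<close> in \<open>B i\<close>
  is the graded Betti number \<open>\<beta>\<^sub>i\<^sub>j\<close>, i.e. the number of summands \<open>Q(-j)\<close> of \<open>F\<^sub>i\<close>.
\<close>

definition is_betti_table :: "('v, 'k::field) mpoly set \<Rightarrow> (nat \<Rightarrow> int multiset) \<Rightarrow> bool" where
  "is_betti_table I B \<longleftrightarrow>
     (\<exists>a d \<epsilon>. minimal_graded_free_resolution I a d \<epsilon> \<and> B = (\<lambda>i. mset (a i)))"

text \<open>
  \<open>twists [N\<^sub>0, \<dots>, N\<^sub>l]\<close> is the table of a resolution \<open>0 \<rightarrow> F\<^sub>l \<rightarrow> \<dots> \<rightarrow> F\<^sub>0\<close> of length \<open>l\<close>, where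
  a pair \<open>(m, j)\<close> in \<open>N\<^sub>i\<close> stands for a summand \<open>Q(-j)^m\<close> of \<open>F\<^sub>i\<close>.
\<close>

definition twists :: "(nat \<times> int) list list \<Rightarrow> nat \<Rightarrow> int multiset" where
  "twists Ns i = (\<Sum>(m, j)\<leftarrow>nth_default [] Ns i. replicate_mset m j)"

end

theory Submission
  imports Defs "HOL-Library.Function_Algebras" "HOL-Analysis.Analysis" "HOL-Computational_Algebra.Polynomial"
begin

text \<open>
  The Betti numbers are the dimensions of the Koszul homology of \<open>A = Q/I\<close>.  Since \<open>A\<close> is
  Gorenstein, its socle is \<open>A\<^sub>3\<close>, so the multiplication of \<open>A\<close> is governed by the nondegenerate
  cubic form \<open>T(u, v, w) = \<tau>(uvw)\<close> on linear forms, where \<open>\<tau>\<close> is the coordinate on \<open>A\<^sub>3\<close>.  Duality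
  with respect to \<open>\<tau>\<close> and the Hilbert function determine all Koszul homology up to the dimension \<open>z\<close>
  of the space of \<open>u \<in> (Q\<^sub>1)\<^sup>4\<close> with \<open>x\<^sub>i u\<^sub>j - x\<^sub>j u\<^sub>i \<in> I\<close>; for instance \<open>I\<close> has \<open>z - 1\<close> cubic generators.
  This space is the centroid of \<open>T\<close>, the algebra of matrices \<open>M\<close> with
  \<open>T(Mu, v, w) = T(u, Mv, w)\<close>.  By the theorem of Gordan and Noether some \<open>T(v, _, _)\<close> is nondegenerate,
  so the centroid is a commutative algebra embedded in \<open>k\<^sup>4\<close>, and nondegeneracy of \<open>T\<close> leaves only the
  dimensions 1, 2 and 4.

  That the socle is simple follows from the vanishing of \<open>Ext\<^sup>i\<^sup>+\<^sup>1(k, A)\<close> for one \<open>i\<close>: it says that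
  \<open>Tor\<^sub>i\<^sub>+\<^sub>1(k, E) = 0\<close> for the dual module \<open>E = Hom\<^sub>k(A, k)\<close>.  Passing to syzygies, which in a minimal presentation
  cannot have a minimal generator because \<open>A\<close> has depth 0, shows that \<open>E\<close> is free, hence \<open>E \<cong> A\<close>.
\<close>

section \<open>Centroids of quaternary cubic forms\<close>

text \<open>Why a single number remains: grade the Koszul chains of \<open>Q\<close> whose
  differential has coefficients in \<open>I\<close> by the degree \<open>e\<close> of their own
  coefficients. For \<open>e\<close> at most 0 only zero qualifies, for \<open>e\<close> at least 3
  the condition is void, and for \<open>e = 2\<close> the pairing by \<open>tau\<close> compares
  them with dual cycles with constant coefficients, which vanish because \<open>I\<close> contains
  no linear form. The degree \<open>e = 1\<close> is dual to itself; there, complementing index sets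
  turns chains of exterior degree 3 into dual cycles of exterior degree 1, and the dimension of the
  latter stays free. Dimension 3 of the centroid is the delicate exclusion: if its values at a point
  form a hyperplane, any further vector turns out to be a value too. Characteristic 0 provides
  polarization and enough scalars for generic choices on lines. Being Gorenstein is a condition on
  localizations, but \<open>Q/I\<close> is local, so inverting the complement of its maximal ideal
  inverts only units and the condition can be read in \<open>Q/I\<close> itself.\<close>

lemma poly_fun_det:
  fixes A B :: "'k::field^'n^'n"
  shows "\<exists>p. \<forall>t. det (A + (\<chi> i j. t * B$i$j)) = poly p t"
proof -
  let ?q = "\<Sum>\<pi> | \<pi> permutes (UNIV :: 'n set). [:of_int (sign \<pi>):] * (\<Prod>i\<in>UNIV. [:A$i$(\<pi> i), B$i$(\<pi> i):])"
  have "det (A + (\<chi> i j. t * B$i$j)) = poly ?q t" for t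
    by (simp add: det_def poly_sum poly_prod)
  then show ?thesis by blast
qed

lemma inj_on_subspace_mult:
  fixes A :: "'k::field^'n^'m"
  assumes "vec.subspace S" and "\<And>x. x \<in> S \<Longrightarrow> A *v x = 0 \<Longrightarrow> x = 0"
  shows "inj_on ((*v) A) S"
  by (rule inj_onI) (metis assms eq_iff_diff_eq_0 matrix_vector_mult_diff_distrib vec.subspace_diff)

text \<open>A left inverse \<open>G\<close> of \<open>A\<close> on \<open>S\<close> turns a kernel
  vector of \<open>A + t B\<close> in \<open>S\<close> into one of \<open>1 + t G B\<close>. The
  determinant of that matrix is a polynomial in \<open>t\<close> with value 1 at 0.\<close>

lemma finite_kernel_pencil:
  fixes A B :: "'k::field^'n^'n"
  assumes S: "vec.subspace S" and inj: "\<And>x. x \<in> S \<Longrightarrow> A *v x = 0 \<Longrightarrow> x = 0"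
  shows "finite {t. \<exists>x\<in>S. x \<noteq> 0 \<and> (A + (\<chi> i j. t * B$i$j)) *v x = 0}"
proof -
  have lin: "Vector_Spaces.linear (*s) (*s) ((*v) A)" by (rule matrix_vector_mul_linear_gen)
  have "inj_on ((*v) A) S"
    using S inj by (rule inj_on_subspace_mult)
  then obtain g where g: "Vector_Spaces.linear (*s) (*s) g" "\<And>x. x \<in> S \<Longrightarrow> g (A *v x) = x"
    using vec.linear_exists_left_inverse_on[OF lin S] by blast
  define G where "G = matrix g"
  have G: "G *v x = g x" for x unfolding G_def by (rule matrix_works[OF g(1)])
  define N where "N = G ** B"
  obtain p where p: "\<And>t. det (mat 1 + (\<chi> i j. t * N$i$j)) = poly p t"
    using poly_fun_det[of "mat 1" N] by blast
  have "mat 1 + (\<chi> i j. 0 * N$i$j) = mat 1" by (simp add: vec_eq_iff)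
  then have "poly p 0 = 1" using p[of 0] by simp
  then have "p \<noteq> 0" by auto
  moreover have "{t. \<exists>x\<in>S. x \<noteq> 0 \<and> (A + (\<chi> i j. t * B$i$j)) *v x = 0} \<subseteq> {t. poly p t = 0}"
  proof safe
    fix t x assume x: "x \<in> S" "x \<noteq> 0" "(A + (\<chi> i j. t * B$i$j)) *v x = 0"
    have sc: "(\<chi> i j. t * C$i$j) *v y = t *s (C *v y)" for C :: "'k^'n^'n" and y
      by (simp add: vec_eq_iff matrix_vector_mult_def sum_distrib_left mult.assoc)
    have "A *v x + t *s (B *v x) = 0"
      using x(3) by (simp add: matrix_vector_mult_add_rdistrib sc)
    then have "G *v (A *v x) + t *s (G *v (B *v x)) = 0"
      by (metis matrix_vector_mult_0_right matrix_vector_right_distrib vector_scalar_commute)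
    then have "(mat 1 + (\<chi> i j. t * N$i$j)) *v x = 0"
      using g(2)[OF x(1)] by (simp add: matrix_vector_mult_add_rdistrib sc N_def G matrix_vector_mul_assoc[symmetric])
    then have "\<not> invertible (mat 1 + (\<chi> i j. t * N$i$j))"
      using x(2) by (metis invertible_def matrix_left_invertible_ker)
    then show "poly p t = 0" by (simp add: invertible_det_nz p)
  qed
  ultimately show ?thesis using poly_roots_finite[of p] finite_subset by blast
qed

section \<open>Ranks along a line of matrices\<close>

definition rk :: "'k::field^'n^'n \<Rightarrow> nat" where "rk A = vec.dim (range ((*v) A))"

text \<open>\<open>P\<close> consists of one preimage for each element of a basis of the image, so
  its span is a complement of the kernel.\<close>

lemma rk_complement:
  fixes A :: "'k::field^'n^'n"
  obtains P where "finite P" "card P = rk A" "vec.independent P"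
    "\<And>x. x \<in> vec.span P \<Longrightarrow> A *v x = 0 \<Longrightarrow> x = 0" "range ((*v) A) = (*v) A ` vec.span P"
proof -
  have lin: "Vector_Spaces.linear (*s) (*s) ((*v) A)" by (rule matrix_vector_mul_linear_gen)
  obtain C where C: "C \<subseteq> range ((*v) A)" "vec.independent C" "range ((*v) A) \<subseteq> vec.span C" "card C = rk A"
    unfolding rk_def using vec.basis_exists by blast
  have fC: "finite C" using C(2) by (rule vec.finiteI_independent)
  obtain g where g: "\<And>c. c \<in> C \<Longrightarrow> A *v (g c) = c" using C(1) by (metis (no_types, lifting) image_iff subsetD)
  let ?P = "g ` C"
  have im: "(*v) A ` ?P = C" using g by (force simp: image_image)
  have injP: "inj_on ((*v) A) ?P" using g by (auto simp: inj_on_def)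
  have injg: "inj_on g C" by (metis g inj_onI)
  have ind: "vec.independent ?P"
  proof
    assume "vec.dependent ?P"
    then obtain a where a: "a \<in> ?P" "a \<in> vec.span (?P - {a})" unfolding vec.dependent_def by blast
    have "A *v a \<in> vec.span ((*v) A ` (?P - {a}))" using a(2) vec.linear_span_image[OF lin, of "?P - {a}"] by blast
    also have "(*v) A ` (?P - {a}) = C - {A *v a}"
      using im injP a(1) inj_on_image_set_diff[OF injP, of ?P "{a}"] by auto
    finally show False using C(2) a(1) im unfolding vec.dependent_def by blast
  qed
  have "x = 0" if "x \<in> vec.span ?P" "A *v x = 0" for x
    using vec.linear_indep_image_lemma[OF lin _ _ injP that] fC C(2) im by simp
  moreover have "range ((*v) A) = (*v) A ` vec.span ?P"
    using C(3) im vec.linear_span_image[OF lin, of ?P]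
      vec.linear_subspace_image[OF lin vec.subspace_UNIV] C(1) vec.span_minimal by (metis subset_antisym)
  ultimately show ?thesis using that[of ?P] fC C(4) card_image[OF injg] ind by auto
qed

text \<open>\<open>A\<close> is injective on a space of dimension \<open>rk A\<close>, and by
  \<open>finite_kernel_pencil\<close> so is \<open>A + t B\<close> for almost every
  \<open>t\<close>.\<close>

lemma finite_rk_drop:
  fixes A B :: "'k::field^'n^'n"
  shows "finite {t. rk (A + (\<chi> i j. t * B$i$j)) < rk A}"
proof -
  obtain P where P: "finite P" "card P = rk A" "vec.independent P"
    "\<And>x. x \<in> vec.span P \<Longrightarrow> A *v x = 0 \<Longrightarrow> x = 0" by (rule rk_complement) blast
  have "finite {t. \<exists>x\<in>vec.span P. x \<noteq> 0 \<and> (A + (\<chi> i j. t * B$i$j)) *v x = 0}"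
    by (rule finite_kernel_pencil[OF vec.subspace_span P(4)])
  moreover have "\<exists>x\<in>vec.span P. x \<noteq> 0 \<and> C *v x = 0" if "rk C < rk A" for C :: "'k^'n^'n"
  proof (rule ccontr)
    assume neg: "\<not> ?thesis"
    have lin: "Vector_Spaces.linear (*s) (*s) ((*v) C)" by (rule matrix_vector_mul_linear_gen)
    have "inj_on ((*v) C) (vec.span P)"
      using vec.subspace_span by (rule inj_on_subspace_mult) (use neg in blast)
    then have "vec.dim ((*v) C ` vec.span P) = vec.dim (vec.span P)"
      using vec.dim_image_eq[OF lin, of "vec.span P"] by (metis vec.span_span)
    moreover have "vec.dim ((*v) C ` vec.span P) \<le> rk C" unfolding rk_def by (rule vec.dim_subset) auto
    ultimately show False
      using that P(2) vec.dim_span_eq_card_independent[OF P(3)] by (simp del: vec.dim_span)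
  qed
  ultimately show ?thesis by (auto elim!: rev_finite_subset)
qed

text \<open>The tangent condition for matrices of bounded rank. If \<open>B k\<close> lay outside
  the image of \<open>A\<close>, then \<open>A + t B\<close> would be injective on the span of
  \<open>P\<close> and \<open>k\<close> for almost every \<open>t\<close>, and that space has
  dimension \<open>rk A + 1\<close>. That \<open>A + t B\<close> is nearly zero on \<open>k\<close>
  for small \<open>t\<close> is compensated by rescaling \<open>k\<close>.\<close>

lemma rk_max_kernel_image:
  fixes A B :: "'k::field_char_0^'n^'n"
  assumes mx: "\<And>t. rk (A + (\<chi> i j. t * B$i$j)) \<le> rk A" and k: "A *v k = 0"
  shows "B *v k \<in> range ((*v) A)"
proof (rule ccontr)
  assume nk: "B *v k \<notin> range ((*v) A)"
  obtain P where P: "finite P" "card P = rk A" "vec.independent P"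
    "\<And>x. x \<in> vec.span P \<Longrightarrow> A *v x = 0 \<Longrightarrow> x = 0" "range ((*v) A) = (*v) A ` vec.span P"
    by (rule rk_complement) blast
  have k0: "k \<noteq> 0" using nk by (metis matrix_vector_mult_0_right rangeI)
  have kP: "k \<notin> vec.span P" using P(4) k k0 by blast
  let ?Q = "insert k P"
  have Qi: "vec.independent ?Q" using vec.independent_insertI[OF kP P(3)] .
  obtain l where l: "Vector_Spaces.linear (*s) (*s) l" "\<And>x. x \<in> ?Q \<Longrightarrow> l x = (if x = k then B *v k else A *v x)"
    using vec.linear_independent_extend[OF Qi, of "\<lambda>x. if x = k then B *v k else A *v x"] by blast
  obtain m where m: "Vector_Spaces.linear (*s) (*s) m" "\<And>x. x \<in> ?Q \<Longrightarrow> m x = (if x = k then 0 else B *v x)"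
    using vec.linear_independent_extend[OF Qi, of "\<lambda>x. if x = k then 0 else B *v x"] by blast
  \<comment> \<open>\<open>L + t M\<close> is \<open>A + t B\<close> on \<open>vec.span ?Q\<close>
    with \<open>k\<close> replaced by \<open>k / t\<close>: \<open>L\<close> takes \<open>k\<close>
    to \<open>B k\<close>, which makes it injective there, and \<open>M\<close> takes
    \<open>k\<close> to 0.\<close>
  define L where "L = matrix l"
  define M where "M = matrix m"
  have L: "L *v x = l x" and M: "M *v x = m x" for x
    unfolding L_def M_def by (rule matrix_works[OF l(1)], rule matrix_works[OF m(1)])
  have LP: "l x = A *v x" if "x \<in> vec.span P" for x
    by (rule vec.linear_eq_on_span[OF l(1) matrix_vector_mul_linear_gen _ that]) (use l(2) kP vec.span_base in auto)
  have MP: "m x = B *v x" if "x \<in> vec.span P" for x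
    by (rule vec.linear_eq_on_span[OF m(1) matrix_vector_mul_linear_gen _ that]) (use m(2) kP vec.span_base in auto)
  have Lk: "l k = B *v k" and Mk: "m k = 0" using l(2) m(2) by auto
  have dec: "\<exists>c y. y \<in> vec.span P \<and> x = y + c *s k" if "x \<in> vec.span ?Q" for x
    using that unfolding vec.span_insert by (auto intro!: exI[of _ "x - _ *s k"])
  have val: "(L + (\<chi> i j. t * M$i$j)) *v (y + c *s k) = (A + (\<chi> i j. t * B$i$j)) *v (y + (c / t) *s k)"
    if "y \<in> vec.span P" "t \<noteq> 0" for y c t
  proof -
    have sc: "(\<chi> i j. t * C$i$j) *v y = t *s (C *v y)" for C :: "'k^'n^'n" and y
      by (simp add: vec_eq_iff matrix_vector_mult_def sum_distrib_left mult.assoc)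
    show ?thesis using that k
      by (simp add: matrix_vector_mult_add_rdistrib matrix_vector_right_distrib sc L M LP MP Lk Mk
          vector_scalar_commute vec.linear_add[OF l(1)] vec.linear_add[OF m(1)]
          vec.linear_scale[OF l(1)] vec.linear_scale[OF m(1)] vector_smult_assoc vector_add_ldistrib)
  qed
  have inj: "x = 0" if xQ: "x \<in> vec.span ?Q" and "L *v x = 0" for x
  proof -
    obtain c y where y: "y \<in> vec.span P" "x = y + c *s k" using dec[OF xQ] by blast
    have e: "A *v y + c *s (B *v k) = 0"
      using that(2) y by (simp add: L vec.linear_add[OF l(1)] vec.linear_scale[OF l(1)] LP Lk)
    have "c = 0"
    proof (rule ccontr)
      assume c: "c \<noteq> 0"
      have "B *v k = (1/c) *s (c *s (B *v k))" using c by (simp add: vector_smult_assoc)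
      also have "c *s (B *v k) = - (A *v y)" using e by (simp add: add_eq_0_iff2)
      also have "(1/c) *s (- (A *v y)) = A *v ((1/c) *s (-y))"
        by (metis vector_scalar_commute vec.linear_neg matrix_vector_mul_linear_gen)
      finally show False using nk by blast
    qed
    then show ?thesis using e y P(4) by simp
  qed
  define Bad where "Bad = {t. \<exists>x\<in>vec.span ?Q. x \<noteq> 0 \<and> (L + (\<chi> i j. t * M$i$j)) *v x = 0}"
  have "finite (insert 0 Bad)"
    unfolding Bad_def using finite_kernel_pencil[OF vec.subspace_span inj] by (rule finite.insertI)
  from ex_new_if_finite[OF infinite_UNIV_char_0 this]
  obtain t where t0: "t \<notin> insert 0 Bad" by (rule exE)
  have t: "t \<noteq> 0" "t \<notin> Bad" using t0 by (meson insertCI insertI1)+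
  let ?N = "L + (\<chi> i j. t * M$i$j)"
  have "x = 0" if "x \<in> vec.span ?Q" "?N *v x = 0" for x
  proof (rule ccontr)
    assume "x \<noteq> 0"
    with that have "t \<in> Bad" unfolding Bad_def by (intro CollectI bexI conjI)
    with t(2) show False by contradiction
  qed
  then have "inj_on ((*v) ?N) (vec.span ?Q)"
    by (rule inj_on_subspace_mult[OF vec.subspace_span])
  then have "vec.dim ((*v) ?N ` vec.span ?Q) = vec.dim (vec.span ?Q)"
    using vec.dim_image_eq[OF matrix_vector_mul_linear_gen[of ?N], of "vec.span ?Q"] by (metis vec.span_span)
  moreover have "vec.dim (vec.span ?Q) = Suc (rk A)"
  proof -
    have "k \<notin> P" using kP vec.span_base by blast
    then show ?thesis using vec.dim_span_eq_card_independent[OF Qi] P(1,2) by (simp del: vec.dim_span)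
  qed
  moreover have "vec.dim ((*v) ?N ` vec.span ?Q) \<le> rk (A + (\<chi> i j. t * B$i$j))"
    unfolding rk_def
  proof (rule vec.dim_subset, rule image_subsetI)
    fix x assume "x \<in> vec.span ?Q"
    then obtain c y where y: "y \<in> vec.span P" and x: "x = y + c *s k" using dec by blast
    show "?N *v x \<in> range ((*v) (A + (\<chi> i j. t * B$i$j)))"
      unfolding x val[OF y t(1)] by (rule rangeI)
  qed
  ultimately show False using mx[of t] by simp
qed

lemma dim_le_4: "vec.dim (S :: ('k::field^4) set) \<le> 4"
  using vec.dim_subset[of S UNIV] vec_dim_card[where ?'a='k and ?'n=4] by simp

section \<open>Symmetric trilinear forms on a space of dimension 4\<close>

locale cubic_form =
  fixes T :: "'k::field_char_0^4 \<Rightarrow> 'k^4 \<Rightarrow> 'k^4 \<Rightarrow> 'k"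
  assumes add1: "T (x + y) v w = T x v w + T y v w"
    and scale1: "T (c *s x) v w = c * T x v w"
    and sym12: "T x y z = T y x z"
    and sym23: "T x y z = T x z y"
    and nondeg: "(\<And>v w. T u v w = 0) \<Longrightarrow> u = 0"
begin

lemma add2: "T v (x + y) w = T v x w + T v y w"
  by (metis add1 sym12)

lemma add3: "T v w (x + y) = T v w x + T v w y"
  by (metis add2 sym23)

lemma scale2: "T v (c *s x) w = c * T v x w"
  by (metis scale1 sym12)

lemma scale3: "T v w (c *s x) = c * T v w x"
  by (metis scale2 sym23)

lemma zero1: "T 0 v w = 0" using scale1[of 0 0] by simp
lemma zero2: "T v 0 w = 0" using scale2[of v 0 0] by simp
lemma zero3: "T v w 0 = 0" using scale3[of v w 0 0] by simp

lemma diff1: "T (x - y) v w = T x v w - T y v w" using add1[of "x - y" y v w] by simp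
lemma diff2: "T v (x - y) w = T v x w - T v y w" using add2[of v "x - y" y w] by simp
lemma diff3: "T v w (x - y) = T v w x - T v w y" using add3[of v w "x - y" y] by simp

lemmas lin = diff1 diff2 diff3 add1 add2 add3 scale1 scale2 scale3 zero1 zero2 zero3

lemma sym: "T x z y = T x y z" "T y x z = T x y z" "T y z x = T x y z" "T z x y = T x y z" "T z y x = T x y z"
  using sym12[of x y z] sym12[of x z y] sym12[of y z x] sym23[of x y z] sym23[of y x z] sym23[of z x y] by simp_all

lemma cub: "T x y x = T x x y" "T y x x = T x x y"
  using sym12[of y x x] sym23[of x y x] by simp_all

lemma polar2: assumes "\<And>q. T k q q = 0" shows "k = 0"
proof (rule nondeg)
  fix x y
  have "T k (x + y) (x + y) = T k x x + 2 * T k x y + T k y y" by (simp add: lin sym(1)[of k x y])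
  then show "T k x y = 0" using assms by simp
qed

text \<open>The difference of the values at \<open>x + y\<close> and \<open>x - y\<close> isolates
  \<open>T x x y\<close> up to the factor 6.\<close>

lemma polar3: assumes "\<And>q. T q q q = 0" shows False
proof -
  have "T x x y = 0" for x y
  proof -
    have 1: "T (x + y) (x + y) (x + y) = T x x x + 3 * T x x y + 3 * T y y x + T y y y"
      by (simp add: lin cub[of x y] cub[of y x])
    have 2: "T (x + (-1) *s y) (x + (-1) *s y) (x + (-1) *s y) = T x x x - 3 * T x x y + 3 * T y y x - T y y y"
      by (simp add: lin cub[of x y] cub[of y x])
    show ?thesis using 1 2 assms by (simp add: algebra_simps)
  qed
  then have "T k q q = 0" for k q using cub(2)[where x=q and y=k] by simp
  then have "(axis 1 1 :: 'k^4) = 0" by (intro polar2)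
  then show False by (simp add: axis_eq_0_iff)
qed

text \<open>Up to the factor 6, the Hessian matrix of the cubic \<open>T x x x\<close> at
  \<open>v\<close>.\<close>

definition hess :: "'k^4 \<Rightarrow> 'k^4^4" where "hess v = (\<chi> i j. T v (axis i 1) (axis j 1))"

lemma sum2: "T v (sum f S) w = (\<Sum>i\<in>S. T v (f i) w)" by (induct S rule: infinite_finite_induct) (auto simp: lin)
lemma sum3: "T v w (sum f S) = (\<Sum>i\<in>S. T v w (f i))" by (induct S rule: infinite_finite_induct) (auto simp: lin)

lemma hess_axis: "(hess v *v p) $ i = T v (axis i 1) p"
proof -
  have "T v (axis i 1) p = T v (axis i 1) (\<Sum>j\<in>UNIV. p$j *s axis j 1)" by (simp add: basis_expansion)
  also have "\<dots> = (\<Sum>j\<in>UNIV. p$j * T v (axis i 1) (axis j 1))" by (simp add: sum3 lin)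
  finally show ?thesis by (simp add: hess_def matrix_vector_mult_def mult.commute)
qed

lemma hess_eq_iff: "hess v *v p = hess u *v q \<longleftrightarrow> (\<forall>w. T v p w = T u q w)"
proof
  assume e: "hess v *v p = hess u *v q"
  show "\<forall>w. T v p w = T u q w"
  proof
    fix w
    have x: "T v p w = (\<Sum>i\<in>UNIV. w$i * T v (axis i 1) p)" for v p
    proof -
      have "T v p w = T v (\<Sum>i\<in>UNIV. w$i *s axis i 1) p" by (simp add: basis_expansion sym(1)[of v w p])
      then show ?thesis by (simp add: sum2 lin)
    qed
    show "T v p w = T u q w" using e unfolding x by (simp add: hess_axis[symmetric])
  qed
next
  assume "\<forall>w. T v p w = T u q w"
  then show "hess v *v p = hess u *v q" by (simp add: vec_eq_iff hess_axis) (metis sym(1))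
qed

lemma hess_eq_0_iff: "hess v *v p = 0 \<longleftrightarrow> (\<forall>w. T v p w = 0)"
  using hess_eq_iff[of v p 0 0] by (simp add: lin)

lemma hess_add: "hess (v + t *s u) = hess v + (\<chi> i j. t * hess u $ i $ j)"
  by (simp add: hess_def vec_eq_iff lin)

text \<open>On a line the quadric is a polynomial in \<open>t\<close> with leading coefficient
  \<open>T k q q\<close>. This is how a point is later moved into general position.\<close>

lemma quadratic_zeros: assumes "T k q q \<noteq> 0" shows "finite {t. T k (v + t *s q) (v + t *s q) = 0}"
proof -
  have "T k (v + t *s q) (v + t *s q) = poly [:T k v v, 2 * T k v q, T k q q:] t" for t
    by (simp add: lin sym(1)[of k v q] algebra_simps)
  moreover have "[:T k v v, 2 * T k v q, T k q q:] \<noteq> 0" using assms by simp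
  ultimately show ?thesis using poly_roots_finite[of "[:T k v v, 2 * T k v q, T k q q:]"] by simp
qed

lemma cubic_zeros: assumes "T q q q \<noteq> 0 \<or> T v v v \<noteq> 0"
  shows "finite {t. T (v + t *s q) (v + t *s q) (v + t *s q) = 0}"
proof -
  have "T (v + t *s q) (v + t *s q) (v + t *s q) = poly [:T v v v, 3 * T v v q, 3 * T q q v, T q q q:] t" for t
    by (simp add: lin cub[of v q] cub[of q v] algebra_simps)
  moreover have "[:T v v v, 3 * T v v q, 3 * T q q v, T q q q:] \<noteq> 0" using assms by auto
  ultimately show ?thesis using poly_roots_finite[of "[:T v v v, 3 * T v v q, 3 * T q q v, T q q q:]"] by simp
qed

text \<open>Here \<open>k\<close> and \<open>l\<close> are kernel vectors of \<open>hess v\<close>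
  and \<open>hess w\<close> whose squares vanish in \<open>T\<close>, and \<open>w\<close> lies off
  the quadric of \<open>k\<close>. Pairing a relation with \<open>k\<close> and \<open>w\<close>
  leaves only \<open>b\<close>. A relation that involves \<open>l\<close> would put \<open>l\<close>
  into the span of \<open>v\<close> and \<open>k\<close>; then \<open>T l l v\<close> and
  \<open>T w l w\<close> force both coefficients to vanish.\<close>

lemma kernel_pair_independent:
  assumes v: "T v v v \<noteq> 0" and k: "\<And>x. T v k x = 0" "\<And>x. T k k x = 0" "T k w w \<noteq> 0"
    and l: "l \<noteq> 0" "\<And>x. T w l x = 0" "\<And>x. T l l x = 0"
    and rel: "a *s v + b *s w + c *s k + d *s l = 0"
  shows "a = 0 \<and> b = 0 \<and> c = 0 \<and> d = 0"
proof -
  note k' = k(1)[unfolded sym(1)[of v k]]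
  have kl: "T k l w = 0" using l(2)[of k] by (metis sym)
  have z: "T x (a *s v + b *s w + c *s k + d *s l) y = 0" for x y using rel by (simp add: lin)
  have kv: "T k v x = 0" for x using k(1) by (metis sym)
  have b: "b = 0" using z[of k w] k(2,3) kl kv by (simp add: lin)
  have d: "d = 0"
  proof (rule ccontr)
    assume d: "d \<noteq> 0"
    define a' where "a' = - a / d" define c' where "c' = - c / d"
    have "l = (1 / d) *s (d *s l)" using d by (simp add: vector_smult_assoc)
    also have "d *s l = - (a *s v + c *s k)" using rel b by (simp add: add_eq_0_iff2 add.commute)
    finally have l': "l = a' *s v + c' *s k"
      by (simp add: a'_def c'_def vec_eq_iff field_simps)
    have "T l l v = a' * a' * T v v v" unfolding l' using k(1,2) kv by (simp add: lin)
    then have "a' = 0" using l(3) v by simp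
    then have "T w l w = c' * T k w w" unfolding l' by (simp add: lin sym(2)[of k w w])
    then have "c' = 0" using l(2) k(3) by simp
    then show False using l' \<open>a' = 0\<close> l(1) by simp
  qed
  have a: "a = 0" using z[of v v] b d v k(1) by (simp add: lin)
  have "k \<noteq> 0" using k(3) by (auto simp: lin)
  then have "c = 0" using rel a b d by simp
  with a b d show ?thesis by simp
qed

text \<open>Four independent vectors in dimension 4: the matrix with these rows is
  invertible.\<close>

lemma kernel_pair_span:
  assumes v: "T v v v \<noteq> 0" and k: "\<And>x. T v k x = 0" "\<And>x. T k k x = 0" "T k w w \<noteq> 0"
    and l: "l \<noteq> 0" "\<And>x. T w l x = 0" "\<And>x. T l l x = 0"
  shows "\<exists>a b c d. x = a *s v + b *s w + c *s k + d *s l"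
proof -
  define M :: "'k^4^4" where "M = (\<chi> i. if i = 1 then v else if i = 2 then w else if i = 3 then k else l)"
  have e: "(\<Sum>i\<in>UNIV. c i *s (M$i)) = c 1 *s v + c 2 *s w + c 3 *s k + c 4 *s l" for c :: "4 \<Rightarrow> 'k"
    unfolding sum_4 by (simp add: M_def)
  have "invertible M"
  proof (rule ccontr)
    assume "\<not> invertible M"
    then have "\<not> (\<exists>B. M ** B = mat 1)" using invertible_right_inverse by blast
    then obtain c i where c: "(\<Sum>i\<in>UNIV. c i *s (M$i)) = 0" "c i \<noteq> 0"
      unfolding matrix_right_invertible_independent_rows row_def by (auto simp: vec_lambda_eta)
    have "c 1 = 0 \<and> c 2 = 0 \<and> c 3 = 0 \<and> c 4 = 0"
      by (rule kernel_pair_independent[OF v k l c(1)[unfolded e]])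
    then show False using c(2) exhaust_4[of i] by auto
  qed
  then obtain N where N: "N ** M = mat 1" unfolding invertible_def by blast
  have "x = x v* (N ** M)" by (simp add: N)
  also have "\<dots> = (x v* N) v* M" by (simp add: vector_matrix_mul_assoc)
  also have "\<dots> = (\<Sum>i\<in>UNIV. (x v* N)$i *s (M$i))"
    by (simp add: vec_eq_iff vector_matrix_mult_def mult.commute)
  finally show ?thesis unfolding e by blast
qed

text \<open>It suffices to test on the basis \<open>v\<close>, \<open>w\<close>, \<open>k\<close>,
  \<open>l\<close>, and each of the four values contains a pair of arguments on which
  \<open>T\<close> vanishes.\<close>

lemma kernel_pair_orth:
  assumes v: "T v v v \<noteq> 0" and k: "\<And>x. T v k x = 0" "\<And>x. T k k x = 0" "T k w w \<noteq> 0"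
    and l: "l \<noteq> 0" "\<And>x. T w l x = 0" "\<And>x. T l l x = 0"
  shows "T k l x = 0"
proof -
  obtain a b c d where x: "x = a *s v + b *s w + c *s k + d *s l"
    using kernel_pair_span[OF assms] by blast
  have "T k l v = 0" "T k l w = 0" "T k l k = 0" "T k l l = 0"
    using k(1)[of l] l(2)[of k] k(2)[of l] l(3)[of k] by (metis sym)+
  then show ?thesis by (simp add: x lin)
qed

text \<open>The quaternary case of a theorem of Gordan and Noether.\<close>

theorem ex_nondegenerate: "\<exists>v. \<forall>p. (\<forall>w. T v p w = 0) \<longrightarrow> p = 0"
proof (rule ccontr)
  assume "\<not> ?thesis"
  then have deg: "\<exists>k. k \<noteq> 0 \<and> (\<forall>x. T v k x = 0)" for v by blast
  \<comment> \<open>Now every \<open>hess v\<close> is assumed singular. All choices are made in the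
    set \<open>G\<close> of points of maximal rank, which on any line through one of its points
    misses only finitely many others.\<close>
  define R where "R = range (\<lambda>v. rk (hess v))"
  have "finite R"
    by (rule finite_subset[of _ "{..4}"]) (auto simp: R_def rk_def dim_le_4)
  moreover have "R \<noteq> {}" by (simp add: R_def)
  ultimately have "Max R \<in> R" and mx: "\<And>r. r \<in> R \<Longrightarrow> r \<le> Max R" by auto
  then obtain v0 where "Max R = rk (hess v0)" unfolding R_def by blast
  with mx have v0: "rk (hess u) \<le> rk (hess v0)" for u unfolding R_def by auto
  define G where "G = {v. rk (hess v) = rk (hess v0)}"
  \<comment> \<open>Maximality of the rank puts \<open>hess u\<close> applied to \<open>k\<close>
    into the image of \<open>hess v\<close>. So \<open>T u k k\<close> has the form
    \<open>T v p k\<close>, which is 0.\<close>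
  have iso: "T k k u = 0" if vG: "v \<in> G" and vk: "\<And>x. T v k x = 0" for v k u
  proof -
    have "hess u *v k \<in> range ((*v) (hess v))"
      by (rule rk_max_kernel_image) (use v0 vG vk in \<open>auto simp: G_def hess_add[symmetric] hess_eq_0_iff\<close>)
    then obtain p where "hess u *v k = hess v *v p" by blast
    then have "T u k k = T v p k" unfolding hess_eq_iff by blast
    then show ?thesis using vk[of p] by (metis sym)
  qed
  have gen: "finite {t. v + t *s u \<notin> G}" if "v \<in> G" for v u
  proof (rule finite_subset[OF _ finite_rk_drop[of "hess v" "hess u"]])
    show "{t. v + t *s u \<notin> G} \<subseteq> {t. rk (hess v + (\<chi> i j. t * hess u $ i $ j)) < rk (hess v)}"
      using that v0 by (auto simp: G_def hess_add[symmetric] le_neq_implies_less)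
  qed
  have pick: "\<exists>t::'k. \<not> P t \<and> \<not> Q t \<and> \<not> R t" if "finite {t. P t}" "finite {t. Q t}" "finite {t. R t}" for P Q R
    using ex_new_if_finite[OF infinite_UNIV_char_0, of "{t. P t} \<union> {t. Q t} \<union> {t. R t}"] that by auto
  have v0G: "v0 \<in> G" by (simp add: G_def)
  obtain p where p: "T p p p \<noteq> 0" using polar3 by blast
  obtain t where "v0 + t *s p \<in> G" "T (v0 + t *s p) (v0 + t *s p) (v0 + t *s p) \<noteq> 0"
    using pick[OF gen[OF v0G, of p] cubic_zeros[of p v0] cubic_zeros[of p v0]] p by blast
  then obtain v where v: "v \<in> G" "T v v v \<noteq> 0" by blast
  obtain k where k: "k \<noteq> 0" "\<And>x. T v k x = 0" using deg by blast
  note kk = iso[OF v(1) k(2)]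
  obtain q where q: "T k q q \<noteq> 0" using polar2 k(1) by blast
  obtain t where "v + t *s q \<in> G" "T (v + t *s q) (v + t *s q) (v + t *s q) \<noteq> 0" "T k (v + t *s q) (v + t *s q) \<noteq> 0"
    using pick[OF gen[OF v(1), of q] cubic_zeros[of q v] quadratic_zeros[OF q, of v]] v(2) by blast
  then obtain w where w: "w \<in> G" "T w w w \<noteq> 0" "T k w w \<noteq> 0" by blast
  obtain l where l: "l \<noteq> 0" "\<And>x. T w l x = 0" using deg by blast
  note ll = iso[OF w(1) l(2)]
  note kl = kernel_pair_orth[OF v(2) k(2) kk w(3) l ll]
  note sp = kernel_pair_span[OF v(2) k(2) kk w(3) l ll]
  \<comment> \<open>On the basis \<open>v\<close>, \<open>w\<close>, \<open>k\<close>,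
    \<open>l\<close> the only entry of the form \<open>T l\<close> that can be nonzero is the one at
    \<open>v\<close>, \<open>v\<close>.\<close>
  have lv: "T l v v \<noteq> 0"
  proof
    assume 0: "T l v v = 0"
    have "T l y y = 0" for y
    proof -
      obtain a b c d where y: "y = a *s v + b *s w + c *s k + d *s l" using sp by blast
      have "T l w x = 0" "T l x w = 0" "T l k x = 0" "T l x k = 0" "T l x l = 0" for x
        using l(2) kl ll by (metis sym)+
      then show ?thesis using 0 ll by (simp add: y lin)
    qed
    then show False using polar2 l(1) by blast
  qed
  have kv: "T k v x = 0" "T k x v = 0" and lw: "T l w x = 0" "T l x w = 0" for x
    using k(2) l(2) by (metis sym)+
  have kq: "T k (v + w) (v + w) \<noteq> 0" using w(3) by (simp add: lin kv)
  have lq: "T l (v + w) (v + w) \<noteq> 0" using lv by (simp add: lin lw)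
  \<comment> \<open>A third point \<open>u\<close>, off the quadrics of both \<open>k\<close> and
    \<open>l\<close>. Its kernel vector \<open>m\<close> is then orthogonal to \<open>k\<close> and
    to \<open>l\<close>, which confines \<open>m\<close> to the span of \<open>k\<close> and
    \<open>l\<close>, and there \<open>hess u\<close> is injective.\<close>
  obtain t where "v + t *s (v + w) \<in> G" "T k (v + t *s (v + w)) (v + t *s (v + w)) \<noteq> 0" "T l (v + t *s (v + w)) (v + t *s (v + w)) \<noteq> 0"
    using pick[OF gen[OF v(1), of "v + w"] quadratic_zeros[OF kq, of v] quadratic_zeros[OF lq, of v]] by blast
  then obtain u where u: "u \<in> G" "T k u u \<noteq> 0" "T l u u \<noteq> 0" by blast
  obtain m where m: "m \<noteq> 0" "\<And>x. T u m x = 0" using deg by blast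
  note mm = iso[OF u(1) m(2)]
  note km = kernel_pair_orth[OF v(2) k(2) kk u(2) m mm]
  note lm = kernel_pair_orth[OF w(2) l(2) ll u(3) m mm]
  obtain a b c d where u': "u = a *s v + b *s w + c *s k + d *s l" using sp by blast
  obtain a1 b1 c1 d1 where m': "m = a1 *s v + b1 *s w + c1 *s k + d1 *s l" using sp by blast
  have kx: "T k k x = 0" "T k x k = 0" "T k l x = 0" "T k x l = 0" "T l l x = 0" "T l x l = 0" "T l k x = 0" "T l x k = 0" for x
    using kk ll kl by (metis sym)+
  have "T k u u = b * b * T k w w" by (simp add: u' lin kv kx)
  then have b: "b \<noteq> 0" using u(2) by auto
  have "T l u u = a * a * T l v v" by (simp add: u' lin lw kx)
  then have a: "a \<noteq> 0" using u(3) by auto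
  have "T k m w = b1 * T k w w" by (simp add: m' lin kv kx)
  then have b1: "b1 = 0" using km w(3) by simp
  have "T l m v = a1 * T l v v" by (simp add: m' lin lw kx)
  then have a1: "a1 = 0" using lm lv by simp
  have "T m u w = c1 * b * T k w w" by (simp add: m' u' a1 b1 lin kv lw kx)
  then have c1: "c1 = 0" using m(2)[of w] sym(2)[of u m w] b w(3) by simp
  have "T m u v = d1 * a * T l v v" by (simp add: m' u' a1 b1 lin kv lw kx)
  then have "d1 = 0" using m(2)[of v] sym(2)[of u m v] a lv by simp
  then show False using m(1) by (simp add: m' a1 b1 c1)
qed

section \<open>The centroid of a cubic form\<close>

definition centroid :: "('k^4^4) set" where
  "centroid = {M. \<forall>u v w. T (M *v u) v w = T u (M *v v) w}"

text \<open>Since \<open>T v (M x) w = T (M v) x w\<close>, an element \<open>M\<close> of the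
  centroid is determined by \<open>M v\<close> once \<open>hess v\<close> is nondegenerate. The
  identity excludes dimension 0. If the values \<open>M v\<close> formed a hyperplane, any
  \<open>n\<close> outside it would itself be such a value.\<close>

lemma centroid_codim:
  obtains v where "inj_on (\<lambda>M. M *v v) centroid"
    "vec.dim ((\<lambda>M. M *v v) ` centroid) \<in> {1, 2, 4}"
proof -
  obtain v where v: "\<And>p. (\<And>w. T v p w = 0) \<Longrightarrow> p = 0" using ex_nondegenerate by blast
  have veq: "p = q" if "\<And>w. T v p w = T v q w" for p q
  proof -
    have "p + (-1) *s q = 0" by (rule v) (simp add: lin that)
    then show ?thesis by (simp add: vec_eq_iff)
  qed
  let ?E = "(\<lambda>M. M *v v) ` centroid"
  have cen: "T (M *v x) y z = T x (M *v y) z" "T x (M *v y) z = T x y (M *v z)" if "M \<in> centroid" for M x y z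
  proof -
    show *: "T (M *v x) y z = T x (M *v y) z" for x y z using that unfolding centroid_def by blast
    show "T x (M *v y) z = T x y (M *v z)" using *[of y z x] by (metis sym)
  qed
  have inj: "inj_on (\<lambda>M. M *v v) centroid"
  proof (rule inj_onI)
    fix M N assume MN: "M \<in> centroid" "N \<in> centroid" "M *v v = N *v v"
    have "M *v x = N *v x" for x by (rule veq) (metis MN cen(1))
    then show "M = N" by (simp add: matrix_eq)
  qed
  have sub: "vec.subspace ?E"
  proof (rule vec.subspaceI)
    show "0 \<in> ?E" by (rule image_eqI[of _ _ 0]) (auto simp: centroid_def lin)
    fix x y assume "x \<in> ?E" "y \<in> ?E"
    then obtain M N where "M \<in> centroid" "N \<in> centroid" "x = M *v v" "y = N *v v" by blast
    then show "x + y \<in> ?E" by (intro image_eqI[of _ _ "M + N"])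
        (auto simp: centroid_def lin matrix_vector_mult_add_rdistrib)
  next
    fix c x assume "x \<in> ?E"
    then obtain M where "M \<in> centroid" "x = M *v v" by blast
    moreover have "(\<chi> i j. c * M$i$j) *v y = c *s (M *v y)" for y
      by (simp add: vec_eq_iff matrix_vector_mult_def sum_distrib_left mult.assoc)
    ultimately show "c *s x \<in> ?E" by (intro image_eqI[of _ _ "\<chi> i j. c * M$i$j"])
        (auto simp: centroid_def lin)
  qed
  have vE: "v \<in> ?E" by (rule image_eqI[of _ _ "mat 1"]) (auto simp: centroid_def)
  have v0: "v \<noteq> 0"
  proof
    assume "v = 0"
    then have "(axis 1 1 :: 'k^4) = 0" by (intro v) (simp add: lin)
    then show False by (simp add: axis_eq_0_iff)
  qed
  have "vec.dim ?E \<le> 4" by (rule dim_le_4)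
  moreover have "vec.dim ?E \<noteq> 0" using vE v0 by (auto simp: vec.dim_eq_0)
  moreover have "vec.dim ?E \<noteq> 3"
  proof
    assume d3: "vec.dim ?E = 3"
    have "?E \<noteq> UNIV" using d3 vec_dim_card[where ?'a='k and ?'n=4] by auto
    then obtain n where n: "n \<notin> ?E" by blast
    have spE: "vec.span ?E = ?E" using sub by (rule vec.span_eq_iff[THEN iffD2])
    have "vec.dim (insert n ?E) = 4" using vec.dim_insert[of n ?E] n d3 spE by simp
    then have "vec.span (insert n ?E) = UNIV" using vec.dim_eq_full[of "insert n ?E"] vec_dim_card[where ?'a='k and ?'n=4] by (simp add: vec.dim_UNIV vec.dimension_def)
    then have dec: "\<exists>N c. N \<in> centroid \<and> x = N *v v + c *s n" for x
      using vec.span_insert[of n ?E] spE by (force simp: algebra_simps)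
    have "inj ((*v) (hess v))"
      by (rule injI, rule veq) (simp add: hess_eq_iff)
    then have "\<exists>B. B ** hess v = mat 1" using matrix_left_invertible_injective by blast
    then obtain B where B: "hess v ** B = mat 1" using matrix_left_right_inverse by blast
    \<comment> \<open>The only candidate for an element of the centroid that takes \<open>v\<close>
      to \<open>n\<close>, as it must satisfy \<open>T v (M x) y = T n x y\<close>. It commutes with
      the centroid, and with the symmetry of \<open>T\<close> this gives the centroid identity on
      all vectors \<open>N v + c n\<close>, that is, everywhere.\<close>
    define M where "M = B ** hess n"
    have "hess v *v (M *v x) = hess n *v x" for x
      by (simp add: M_def matrix_vector_mul_assoc matrix_mul_assoc B)
    then have M: "T v (M *v x) y = T n x y" for x y unfolding hess_eq_iff by blast
    have comm: "M *v (N *v x) = N *v (M *v x)" if "N \<in> centroid" for N x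
      by (rule veq) (metis M cen that)
    have Mv: "M *v v = n" by (rule veq) (simp add: M sym(2)[of v n])
    have e1: "T (M *v (N *v v)) y z = T (N *v v) (M *v y) z" if "N \<in> centroid" for N y z
    proof -
      have "T (M *v (N *v v)) y z = T (N *v n) y z" by (simp add: comm that Mv)
      also have "\<dots> = T n y (N *v z)" by (metis cen that)
      also have "\<dots> = T v (M *v y) (N *v z)" by (simp add: M)
      also have "\<dots> = T (N *v v) (M *v y) z" by (metis cen that)
      finally show ?thesis .
    qed
    have "T (M *v x) y z = T x (M *v y) z" for x y z
    proof -
      obtain N c where x: "N \<in> centroid" "x = N *v v + c *s n" using dec by blast
      obtain N' c' where y: "N' \<in> centroid" "y = N' *v v + c' *s n" using dec by blast
      have "T (M *v n) (N' *v v) z = T n (M *v (N' *v v)) z"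
        using e1[OF y(1), of n z] by (metis sym(2))
      moreover have "T (M *v n) n z = T n (M *v n) z" by (rule sym(2))
      ultimately show ?thesis
        by (simp add: x(2) y(2) lin matrix_vector_right_distrib vector_scalar_commute e1[OF x(1)])
    qed
    then have "M \<in> centroid" by (simp add: centroid_def)
    then show False using n Mv by blast
  qed
  ultimately have "vec.dim ?E = 1 \<or> vec.dim ?E = 2 \<or> vec.dim ?E = 4" by linarith
  then have "vec.dim ?E \<in> {1, 2, 4}" by blast
  with inj show ?thesis using that by blast
qed

end

section \<open>Polynomials and homogeneous components\<close>

abbreviation lkp where "lkp \<equiv> Poly_Mapping.lookup"

abbreviation keys where "keys \<equiv> Poly_Mapping.keys"

definition kc :: "'k \<Rightarrow> ('v, 'k::comm_ring_1) mpoly" where "kc c = Poly_Mapping.single 0 c"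

lemma kc_add: "kc (a + b) = kc a + kc b" by (simp add: kc_def single_add)
lemma kc_mult: "kc (a * b) = kc a * kc b" by (simp add: kc_def mult_single)
lemma kc_0 [simp]: "kc 0 = 0" by (simp add: kc_def)
lemma kc_1 [simp]: "kc 1 = 1" by (simp add: kc_def)
lemma kc_minus: "kc (- a) = - kc a" by (simp add: kc_def single_uminus)
lemma kc_diff: "kc (a - b) = kc a - kc b" by (simp add: kc_def single_diff)
lemma kc_eq_iff [simp]: "kc a = kc b \<longleftrightarrow> a = b" unfolding kc_def by (metis lookup_single_eq)
lemma kc_eq_0_iff [simp]: "kc a = 0 \<longleftrightarrow> a = 0" using kc_eq_iff[of a 0] by (simp del: kc_eq_iff)
lemma lkp_single_mult: "lkp (Poly_Mapping.single e c * p) (e + m) = c * lkp p m"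
  for p :: "('v, 'k::comm_ring_1) mpoly"
proof -
  have "lkp (Poly_Mapping.single e c * p) (e + m)
    = (\<Sum>l. (c * (\<Sum>q. lkp p q when e + m = l + q)) when e = l)"
    by (simp add: lookup_mult lookup_single when_mult)
  also have "\<dots> = c * (\<Sum>q. lkp p q when m = q)" by (simp add: Sum_any_when_equal')
  also have "\<dots> = c * lkp p m" by (simp add: Sum_any_when_equal')
  finally show ?thesis .
qed

lemma lkp_kc_mult [simp]: "lkp (kc c * p) m = c * lkp p m"
  using lkp_single_mult[of 0 c p m] by (simp add: kc_def)

lemma lkp_kc: "lkp (kc c) m = (if m = 0 then c else 0)"
  by (simp add: kc_def lookup_single when_def)

lemma keys_mult_shift: "keys (Poly_Mapping.single e 1 * p) = (+) e ` keys p"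
  for p :: "('v, 'k::comm_ring_1) mpoly"
proof
  show "keys (Poly_Mapping.single e 1 * p) \<subseteq> (+) e ` keys p"
    using keys_mult[of "Poly_Mapping.single e 1" p] by (auto split: if_splits)
  show "(+) e ` keys p \<subseteq> keys (Poly_Mapping.single e 1 * p)"
    by (auto simp: in_keys_iff lkp_single_mult)
qed

lemma poly_expand: "p = (\<Sum>m\<in>keys p. Poly_Mapping.single m (lkp p m))" for p :: "('v, 'k::comm_ring_1) mpoly"
proof (rule poly_mapping_eqI)
  fix m
  have "lkp (\<Sum>m\<in>keys p. Poly_Mapping.single m (lkp p m)) m = (\<Sum>n\<in>keys p. if n = m then lkp p n else 0)"
    by (simp add: lookup_sum lookup_single when_def)
  then show "lkp p m = lkp (\<Sum>m\<in>keys p. Poly_Mapping.single m (lkp p m)) m"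
    by (simp add: in_keys_iff)
qed

lemma mon_deg_alt: "mon_deg m = (\<Sum>v\<in>UNIV. lkp m v)" for m :: "'v::finite \<Rightarrow>\<^sub>0 nat"
  unfolding mon_deg_def by (rule sum.mono_neutral_left) (auto simp: in_keys_iff)

lemma mon_deg_add [simp]: "mon_deg (m + n) = mon_deg m + mon_deg n" for m :: "'v::finite \<Rightarrow>\<^sub>0 nat"
  by (simp add: mon_deg_alt lookup_add sum.distrib)

lemma mon_deg_0 [simp]: "mon_deg 0 = 0" by (simp add: mon_deg_def)

lemma mon_deg_single [simp]: "mon_deg (Poly_Mapping.single v n) = n" by (simp add: mon_deg_def)

lemma mon_deg_eq_0_iff [simp]: "mon_deg m = 0 \<longleftrightarrow> m = 0" for m :: "'v::finite \<Rightarrow>\<^sub>0 nat"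
  by (auto simp: mon_deg_alt intro: poly_mapping_eqI)

lemma homogeneous_0 [simp]: "homogeneous e 0" by (simp add: homogeneous_def)

lemma homogeneous_add: "homogeneous e p \<Longrightarrow> homogeneous e q \<Longrightarrow> homogeneous e (p + q)"
  using Poly_Mapping.keys_add[of p q] by (auto simp: homogeneous_def)

lemma homogeneous_sum: "(\<And>i. i \<in> A \<Longrightarrow> homogeneous e (f i)) \<Longrightarrow> homogeneous e (sum f A)"
  by (induct A rule: infinite_finite_induct) (auto intro: homogeneous_add)

lemma homogeneous_mult: "homogeneous d p \<Longrightarrow> homogeneous e q \<Longrightarrow> homogeneous (d + e) (p * q)"
  for p q :: "('v::finite, 'k::comm_ring_1) mpoly"
  using keys_mult[of p q] by (fastforce simp: homogeneous_def)

lemma homogeneous_kc [simp]: "homogeneous 0 (kc c)" by (simp add: homogeneous_def kc_def)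

lemma homogeneous_kc_mult: "homogeneous e p \<Longrightarrow> homogeneous e (kc c * p)"
  for p :: "('v::finite, 'k::comm_ring_1) mpoly"
  using homogeneous_mult[OF homogeneous_kc, of e p c] by simp

lemma homogeneous_uminus: "homogeneous e p \<Longrightarrow> homogeneous e (- p)"
  by (simp add: homogeneous_def in_keys_iff)

lemma homogeneous_diff: "homogeneous e p \<Longrightarrow> homogeneous e q \<Longrightarrow> homogeneous e (p - q)"
  using homogeneous_add[of e p "- q"] by (simp add: homogeneous_uminus)

lemma homogeneous_neg: "homogeneous e p \<Longrightarrow> e < 0 \<Longrightarrow> p = 0"
  by (rule poly_mapping_eqI) (fastforce simp: homogeneous_def in_keys_iff)

lemma homogeneous_variable [simp]: "homogeneous 1 (variable v)"
  by (simp add: homogeneous_def variable_def)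

lemma homogeneous_degree_0: "homogeneous 0 p \<Longrightarrow> p = kc (lkp p 0)" for p :: "('v::finite, 'k::comm_ring_1) mpoly"
  by (rule poly_mapping_eqI) (auto simp: homogeneous_def lkp_kc in_keys_iff)

text \<open>Degrees are integers, as in \<open>homogeneous\<close>; the components of negative
  degree are 0, so the shift \<open>e - d\<close> in \<open>hc_mult\<close> needs no side
  condition.\<close>

definition hc :: "int \<Rightarrow> ('v, 'k::comm_ring_1) mpoly \<Rightarrow> ('v, 'k) mpoly" where
  "hc e p = Abs_poly_mapping (\<lambda>m. if int (mon_deg m) = e then lkp p m else 0)"

lemma lkp_hc: "lkp (hc e p) m = (if int (mon_deg m) = e then lkp p m else 0)"
proof -
  have "finite {m. (if int (mon_deg m) = e then lkp p m else 0) \<noteq> 0}"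
    by (rule finite_subset[OF _ finite_lookup[of p]]) auto
  then show ?thesis by (simp add: hc_def)
qed

lemma homogeneous_hc [simp]: "homogeneous e (hc e p)"
  by (auto simp: homogeneous_def in_keys_iff lkp_hc split: if_splits)

lemma hc_add: "hc e (p + q) = hc e p + hc e q"
  by (rule poly_mapping_eqI) (simp add: lkp_hc lookup_add)

lemma hc_0 [simp]: "hc e 0 = 0" by (rule poly_mapping_eqI) (simp add: lkp_hc)

lemma hc_sum: "hc e (sum f A) = (\<Sum>i\<in>A. hc e (f i))"
  by (induct A rule: infinite_finite_induct) (simp_all add: hc_add)

lemma hc_id: "homogeneous e p \<Longrightarrow> hc e p = p"
  by (rule poly_mapping_eqI) (auto simp: lkp_hc homogeneous_def in_keys_iff)

lemma hc_other: "homogeneous d p \<Longrightarrow> d \<noteq> e \<Longrightarrow> hc e p = 0"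
  by (rule poly_mapping_eqI) (auto simp: lkp_hc homogeneous_def in_keys_iff)

lemma poly_hc_expand: "p = (\<Sum>e\<in>(\<lambda>m. int (mon_deg m)) ` keys p. hc e p)"
proof (rule poly_mapping_eqI)
  fix m
  have "lkp (\<Sum>e\<in>(\<lambda>m. int (mon_deg m)) ` keys p. hc e p) m
     = (\<Sum>e\<in>(\<lambda>m. int (mon_deg m)) ` keys p. if e = int (mon_deg m) then lkp p m else 0)"
    by (simp add: lookup_sum lkp_hc eq_commute)
  then show "lkp p m = lkp (\<Sum>e\<in>(\<lambda>m. int (mon_deg m)) ` keys p. hc e p) m"
    by (auto simp: in_keys_iff)
qed

lemma hc_mult:
  fixes p q :: "('v::finite, 'k::comm_ring_1) mpoly"
  assumes "homogeneous d q"
  shows "hc e (q * p) = q * hc (e - d) p"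
proof -
  let ?E = "(\<lambda>m. int (mon_deg m)) ` keys p"
  have t: "hc e (q * hc f p) = (if f = e - d then q * hc (e - d) p else 0)" for f
    using homogeneous_mult[OF assms homogeneous_hc[of f p]]
    by (auto intro: hc_id hc_other[of "d + f"])
  have "hc e (q * p) = (\<Sum>f\<in>?E. hc e (q * hc f p))"
    by (subst poly_hc_expand[of p]) (simp add: sum_distrib_left hc_sum)
  also have "\<dots> = (if e - d \<in> ?E then q * hc (e - d) p else 0)" by (simp add: t)
  also have "\<dots> = q * hc (e - d) p"
  proof -
    have "hc (e - d) p = 0" if "e - d \<notin> ?E"
    proof (rule poly_mapping_eqI)
      fix m
      have "m \<notin> keys p" if "int (mon_deg m) = e - d"
        using that \<open>e - d \<notin> ?E\<close> by force
      then show "lkp (hc (e - d) p) m = lkp 0 m" by (auto simp: lkp_hc in_keys_iff)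
    qed
    then show ?thesis by auto
  qed
  finally show ?thesis .
qed

lemma hc_variable_mult: "hc e (variable v * p) = variable v * hc (e - 1) p" for v :: "'v::finite"
  by (rule hc_mult) simp

lemma hc_kc_mult: "hc e (kc c * p) = kc c * hc e p" for p :: "('v::finite, 'k::comm_ring_1) mpoly"
  using hc_mult[OF homogeneous_kc[of c], of e p] by simp

section \<open>Ideals of the polynomial ring\<close>

text \<open>Ideals of \<open>ring_of_type_algebra\<close> in terms of the type class operations;
  \<open>ideal_iff_qideal\<close> is the translation.\<close>

definition qideal :: "'q::comm_ring_1 set \<Rightarrow> bool" where
  "qideal J \<longleftrightarrow> 0 \<in> J \<and> (\<forall>a\<in>J. \<forall>b\<in>J. a + b \<in> J) \<and> (\<forall>a\<in>J. \<forall>p. p * a \<in> J)"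

lemma qidealD: assumes "qideal J"
  shows "0 \<in> J" "a \<in> J \<Longrightarrow> b \<in> J \<Longrightarrow> a + b \<in> J" "a \<in> J \<Longrightarrow> p * a \<in> J" "a \<in> J \<Longrightarrow> a * p \<in> J"
    "a \<in> J \<Longrightarrow> - a \<in> J" "a \<in> J \<Longrightarrow> b \<in> J \<Longrightarrow> a - b \<in> J"
proof -
  show "0 \<in> J" "a \<in> J \<Longrightarrow> b \<in> J \<Longrightarrow> a + b \<in> J" "a \<in> J \<Longrightarrow> p * a \<in> J"
    using assms unfolding qideal_def by auto
  show "a \<in> J \<Longrightarrow> a * p \<in> J" using assms unfolding qideal_def by (auto simp: mult.commute)
  have n: "- x \<in> J" if "x \<in> J" for x
  proof -
    have "(-1) * x \<in> J" using assms that unfolding qideal_def by blast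
    then show ?thesis by simp
  qed
  then show "a \<in> J \<Longrightarrow> - a \<in> J" .
  assume "a \<in> J" "b \<in> J"
  then have "a + - b \<in> J" using assms n unfolding qideal_def by blast
  then show "a - b \<in> J" by simp
qed

lemma qideal_sum: "qideal J \<Longrightarrow> (\<And>i. i \<in> A \<Longrightarrow> f i \<in> J) \<Longrightarrow> sum f A \<in> J"
  by (induct A rule: infinite_finite_induct) (auto intro: qidealD)

lemma rta_simps [simp]:
  "carrier ring_of_type_algebra = UNIV" "x \<otimes>\<^bsub>ring_of_type_algebra\<^esub> y = x * y"
  "\<one>\<^bsub>ring_of_type_algebra\<^esub> = 1" "\<zero>\<^bsub>ring_of_type_algebra\<^esub> = 0"
  "x \<oplus>\<^bsub>ring_of_type_algebra\<^esub> y = x + y"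
  by (simp_all add: ring_of_type_algebra_def)

lemma cring_rta: "cring (ring_of_type_algebra :: 'a::comm_ring_1 ring)" by (rule cring_from_type_algebra)

lemma ideal_iff_qideal: "ideal J ring_of_type_algebra \<longleftrightarrow> qideal (J :: 'a::comm_ring_1 set)"
proof
  assume "ideal J ring_of_type_algebra"
  then interpret J: ideal J "ring_of_type_algebra" .
  have "0 \<in> J" using additive_subgroup.zero_closed[OF J.is_additive_subgroup] by simp
  moreover have "a + b \<in> J" if "a \<in> J" "b \<in> J" for a b
    using additive_subgroup.a_closed[OF J.is_additive_subgroup that] by simp
  moreover have "p * a \<in> J" if "a \<in> J" for a p
    using J.I_l_closed[OF that, of p] by simp
  ultimately show "qideal J" unfolding qideal_def by blast
next
  assume J: "qideal J"
  interpret R: cring "ring_of_type_algebra :: 'a ring" by (rule cring_rta)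
  show "ideal J ring_of_type_algebra"
  proof (rule idealI)
    show "subgroup J (add_monoid ring_of_type_algebra)"
    proof (rule R.add.subgroupI)
      fix a assume a: "a \<in> J"
      have "\<ominus>\<^bsub>ring_of_type_algebra\<^esub> a = - a"
        by (rule R.minus_equality) auto
      then show "\<ominus>\<^bsub>ring_of_type_algebra\<^esub> a \<in> J" using J a by (auto intro: qidealD)
    qed (use J in \<open>auto intro: qidealD\<close>)
  qed (use J in \<open>auto intro: qidealD R.ring_axioms\<close>)
qed

lemma rta_minus [simp]: "\<ominus>\<^bsub>ring_of_type_algebra\<^esub> (a::'a::comm_ring_1) = - a"
proof -
  interpret R: cring "ring_of_type_algebra :: 'a ring" by (rule cring_rta)
  show ?thesis by (rule R.minus_equality) auto
qed

lemma rta_diff [simp]: "a \<ominus>\<^bsub>ring_of_type_algebra\<^esub> (b::'a::comm_ring_1) = a - b"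
  by (simp add: a_minus_def)

lemma genideal_qideal: "qideal (Idl\<^bsub>ring_of_type_algebra\<^esub> (S :: 'a::comm_ring_1 set))"
proof -
  interpret R: cring "ring_of_type_algebra :: 'a ring" by (rule cring_rta)
  show ?thesis using R.genideal_ideal[of S] by (simp add: ideal_iff_qideal)
qed

lemma genideal_least: "qideal J \<Longrightarrow> S \<subseteq> J \<Longrightarrow> Idl\<^bsub>ring_of_type_algebra\<^esub> (S :: 'a::comm_ring_1 set) \<subseteq> J"
  by (auto simp: genideal_def ideal_iff_qideal)

lemma genideal_incl: "S \<subseteq> Idl\<^bsub>ring_of_type_algebra\<^esub> (S :: 'a::comm_ring_1 set)"
  by (auto simp: genideal_def)

lemma single_variable: "lkp m v \<noteq> 0 \<Longrightarrow>
    Poly_Mapping.single m c = variable v * Poly_Mapping.single (m - Poly_Mapping.single v 1) c"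
  for c :: "'k::comm_ring_1"
  by (simp add: variable_def mult_single) (rule arg_cong[where f="\<lambda>m. Poly_Mapping.single m c"],
    rule poly_mapping_eqI, auto simp: lookup_add lookup_minus lookup_single when_def)

lemma mem_qideal_keys: assumes "qideal J" "\<And>m c. m \<in> keys p \<Longrightarrow> Poly_Mapping.single m c \<in> J"
  shows "p \<in> (J :: ('v, 'k::comm_ring_1) mpoly set)"
  by (subst poly_expand) (rule qideal_sum[OF assms(1)], rule assms(2))

lemma lkp_nonzero: assumes "m \<noteq> 0" obtains v where "lkp m v \<noteq> 0"
  by (rule ccontr) (metis assms that lookup_zero poly_mapping_eqI)

text \<open>The constant coefficient is multiplicative, so its kernel is an ideal that contains the
  variables. Conversely, every monomial other than 1 has a variable as a factor.\<close>

lemma irrelevant_iff: "p \<in> irrelevant_ideal \<longleftrightarrow> lkp p 0 = 0" for p :: "('v::finite, 'k::comm_ring_1) mpoly"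
proof
  have c0: "lkp (a * b) 0 = lkp a 0 * lkp b 0" for a b :: "('v, 'k) mpoly"
  proof -
    have "lkp (Poly_Mapping.single m c * b) 0 = 0" if "m \<noteq> 0" for m c
    proof (rule ccontr)
      assume "lkp (Poly_Mapping.single m c * b) 0 \<noteq> 0"
      then have "0 \<in> keys (Poly_Mapping.single m c * b)" by (simp add: in_keys_iff)
      then obtain x y where "0 = x + y" "x \<in> keys (Poly_Mapping.single m c)" using keys_mult by blast
      then have "0 = m + y" by (auto split: if_splits)
      then have "mon_deg m + mon_deg y = 0" by (metis mon_deg_0 mon_deg_add)
      with that show False by simp
    qed
    then have *: "lkp (Poly_Mapping.single m c * b) 0 = (if m = 0 then c * lkp b 0 else 0)" for m c
      using lkp_single_mult[of 0 c b 0] by auto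
    have "lkp (a * b) 0 = (\<Sum>m\<in>keys a. lkp (Poly_Mapping.single m (lkp a m) * b) 0)"
      by (subst poly_expand[of a]) (simp add: sum_distrib_right lookup_sum)
    then show ?thesis by (simp add: * in_keys_iff)
  qed
  have "qideal {p :: ('v, 'k) mpoly. lkp p 0 = 0}"
    by (simp add: qideal_def lookup_add c0)
  moreover have "range variable \<subseteq> {p :: ('v, 'k) mpoly. lkp p 0 = 0}"
  proof safe
    fix v :: 'v
    have "Poly_Mapping.single v (1::nat) \<noteq> 0" using mon_deg_single[of v 1] by (metis mon_deg_0 zero_neq_one)
    then show "lkp (variable v :: ('v, 'k) mpoly) 0 = 0" by (simp add: variable_def lookup_single when_def)
  qed
  ultimately have "irrelevant_ideal \<subseteq> {p :: ('v, 'k) mpoly. lkp p 0 = 0}"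
    unfolding irrelevant_ideal_def by (rule genideal_least)
  then show "p \<in> irrelevant_ideal \<Longrightarrow> lkp p 0 = 0" by blast
next
  assume p: "lkp p 0 = 0"
  show "p \<in> irrelevant_ideal" unfolding irrelevant_ideal_def
  proof (rule mem_qideal_keys[OF genideal_qideal])
    fix m and c :: 'k assume "m \<in> keys p"
    then have "m \<noteq> 0" using p by (auto simp: in_keys_iff)
    then obtain v where v: "lkp m v \<noteq> 0" by (rule lkp_nonzero)
    show "Poly_Mapping.single m c \<in> Idl\<^bsub>mpoly_ring\<^esub> range variable"
      by (subst single_variable[OF v], rule qidealD(4)[OF genideal_qideal], rule subsetD[OF genideal_incl], rule rangeI)
  qed
qed

text \<open>Together these describe the power as the span of the monomials of degree at least
  \<open>n\<close>. A factor without constant term raises the degree of every monomial by at least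
  one, and a monomial of degree at least \<open>n + 1\<close> splits off a variable.\<close>

lemma
  fixes p :: "('v::finite, 'k::comm_ring_1) mpoly" and c :: 'k
  shows ideal_power_qideal: "qideal (ideal_power mpoly_ring irrelevant_ideal n :: ('v, 'k) mpoly set)"
    and ideal_power_deg: "p \<in> ideal_power mpoly_ring irrelevant_ideal n \<Longrightarrow> m \<in> keys p \<Longrightarrow> mon_deg m \<ge> n"
    and ideal_power_mem: "mon_deg m \<ge> n \<Longrightarrow> Poly_Mapping.single m c \<in> (ideal_power mpoly_ring irrelevant_ideal n :: ('v, 'k) mpoly set)"
proof (induct n arbitrary: p m c)
  case 0
  { case 1 show ?case by (simp add: ideal_power_def ideals_set_def qideal_def)
  next case 2 show ?case by simp
  next case 3 show ?case by (simp add: ideal_power_def ideals_set_def) }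
next
  case (Suc n)
  interpret R: cring "mpoly_ring :: ('v, 'k) mpoly ring" by (rule cring_rta)
  have S: "ideal_power mpoly_ring irrelevant_ideal (Suc n) =
     ideal_prod mpoly_ring (ideal_power mpoly_ring irrelevant_ideal n) (irrelevant_ideal :: ('v, 'k) mpoly set)"
    by (simp add: ideal_power_def ideals_set_def nat_pow_def)
  have irr: "qideal (irrelevant_ideal :: ('v, 'k) mpoly set)" unfolding irrelevant_ideal_def by (rule genideal_qideal)
  { case 1 show ?case unfolding S using R.ideal_prod_is_ideal Suc(1) irr by (simp add: ideal_iff_qideal)
  next case 2
    from 2(1)[unfolded S] 2(2) show ?case
    proof (induct arbitrary: m rule: ideal_prod.induct)
      case (prod i j)
      from prod(3) obtain a b where ab: "a \<in> keys i" "b \<in> keys j" "m = a + b" using keys_mult[of i j] by auto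
      have "b \<noteq> 0" using prod(2) ab(2) by (auto simp: irrelevant_iff in_keys_iff)
      then have "0 < mon_deg b" using mon_deg_eq_0_iff[of b] by (intro gr0I) simp
      moreover have "n \<le> mon_deg a" using Suc(2) prod(1) ab(1) by blast
      ultimately show ?case unfolding ab(3) mon_deg_add by linarith
    next
      case (sum s1 s2)
      then show ?case using Poly_Mapping.keys_add[of s1 s2] by auto
    qed
  next case 3
    then have "m \<noteq> 0" by auto
    then obtain v where v: "lkp m v \<noteq> 0" by (rule lkp_nonzero)
    have m: "m = Poly_Mapping.single v 1 + (m - Poly_Mapping.single v 1)"
      by (rule poly_mapping_eqI) (use v in \<open>auto simp: lookup_add lookup_minus lookup_single when_def\<close>)
    have "mon_deg m = 1 + mon_deg (m - Poly_Mapping.single v 1)"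
      by (subst m) (simp only: mon_deg_add mon_deg_single)
    then have "Poly_Mapping.single (m - Poly_Mapping.single v 1) c \<in> ideal_power mpoly_ring irrelevant_ideal n"
      using 3 by - (rule Suc(3), linarith)
    moreover have "variable v \<in> (irrelevant_ideal :: ('v, 'k) mpoly set)"
      unfolding irrelevant_ideal_def by (rule subsetD[OF genideal_incl], rule rangeI)
    ultimately have "Poly_Mapping.single (m - Poly_Mapping.single v 1) c \<otimes>\<^bsub>mpoly_ring\<^esub> variable v
       \<in> ideal_prod mpoly_ring (ideal_power mpoly_ring irrelevant_ideal n) irrelevant_ideal"
      by (rule ideal_prod.prod)
    then show ?case unfolding S by (subst single_variable[OF v]) (simp add: mult.commute) }
qed

text \<open>The polynomials all of whose components lie in \<open>I\<close> form an ideal, and it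
  contains the homogeneous generators.\<close>

lemma homogeneous_ideal_hc:
  fixes I :: "('v::finite, 'k::comm_ring_1) mpoly set"
  assumes "homogeneous_ideal I" "p \<in> I"
  shows "hc e p \<in> I"
proof -
  obtain S where S: "\<And>p. p \<in> S \<Longrightarrow> \<exists>e. homogeneous e p" "I = Idl\<^bsub>mpoly_ring\<^esub> S"
    using assms(1) unfolding homogeneous_ideal_def by blast
  have I: "qideal I" unfolding S(2) by (rule genideal_qideal)
  have sm: "hc e (Poly_Mapping.single m c * a) = Poly_Mapping.single m c * hc (e - int (mon_deg m)) a" for e m c and a :: "('v, 'k) mpoly"
    by (rule hc_mult) (simp add: homogeneous_def)
  have "qideal {p. \<forall>e. hc e p \<in> I}"
    unfolding qideal_def
  proof (intro conjI ballI allI CollectI; (elim CollectE)?)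
    fix a p e assume a: "\<forall>e. hc e a \<in> I"
    have "hc e (p * a) = (\<Sum>m\<in>keys p. Poly_Mapping.single m (lkp p m) * hc (e - int (mon_deg m)) a)"
      by (subst poly_expand[of p]) (simp add: sum_distrib_right hc_sum sm)
    also have "\<dots> \<in> I" by (rule qideal_sum[OF I], rule qidealD(3)[OF I]) (use a in blast)
    finally show "hc e (p * a) \<in> I" .
  qed (use I in \<open>auto simp: hc_add intro: qidealD\<close>)
  moreover have "S \<subseteq> {p. \<forall>e. hc e p \<in> I}"
  proof safe
    fix p e assume p: "p \<in> S"
    then obtain d where d: "homogeneous d p" using S(1) by blast
    have "p \<in> I" using p S(2) genideal_incl by blast
    then show "hc e p \<in> I"
    proof (cases "d = e")
      case True
      with d have "hc e p = p" by (intro hc_id) simp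
      with \<open>p \<in> I\<close> show ?thesis by (simp only:)
    next
      case False
      with d have "hc e p = 0" by (rule hc_other)
      with qidealD(1)[OF I] show ?thesis by (simp only:)
    qed
  qed
  ultimately have "I \<subseteq> {p. \<forall>e. hc e p \<in> I}" unfolding S(2) by (rule genideal_least)
  then show ?thesis using assms(2) by blast
qed

section \<open>Dimensions of finite-dimensional subspaces\<close>

locale kvs = vector_space scale for scale :: "'a::field \<Rightarrow> 'b::ab_group_add \<Rightarrow> 'b"
begin

text \<open>The ambient spaces of polynomials are infinite-dimensional, so finiteness is recorded
  for their subsets.\<close>

definition fd :: "'b set \<Rightarrow> bool" where "fd S \<longleftrightarrow> (\<exists>B. finite B \<and> S \<subseteq> span B)"

lemma fd_subset: "fd T \<Longrightarrow> S \<subseteq> T \<Longrightarrow> fd S" unfolding fd_def by fast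

lemma fd_span: "finite B \<Longrightarrow> fd (span B)" unfolding fd_def by fast

lemma fd_extend:
  assumes "fd V" "A \<subseteq> V" "independent A"
  obtains B where "finite B" "A \<subseteq> B" "B \<subseteq> V" "independent B" "V \<subseteq> span B" "card B = dim V"
proof -
  obtain B where B: "A \<subseteq> B" "B \<subseteq> V" "independent B" "V \<subseteq> span B"
    using maximal_independent_subset_extend[OF assms(2,3)] by blast
  obtain F where F: "finite F" "V \<subseteq> span F" using assms(1) unfolding fd_def by blast
  have "finite B" using independent_span_bound[OF F(1) B(3)] B(2) F(2) by blast
  moreover have "card B = dim V" by (rule basis_card_eq_dim[OF B(2,4,3)])
  ultimately show ?thesis using that B by blast
qed

lemma fd_basis:
  assumes "fd V"
  obtains B where "finite B" "B \<subseteq> V" "independent B" "V \<subseteq> span B" "card B = dim V"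
  by (rule fd_extend[OF assms empty_subsetI independent_empty])

lemma fd_sum: assumes "fd S" "fd T" shows "fd {x + y |x y. x \<in> S \<and> y \<in> T}"
proof -
  obtain A B where AB: "finite A" "S \<subseteq> span A" "finite B" "T \<subseteq> span B" using assms unfolding fd_def by blast
  have "x + y \<in> span (A \<union> B)" if "x \<in> S" "y \<in> T" for x y
    using that AB span_mono[of A "A \<union> B"] span_mono[of B "A \<union> B"] by (intro span_add) auto
  then have "{x + y |x y. x \<in> S \<and> y \<in> T} \<subseteq> span (A \<union> B)" by blast
  then show ?thesis unfolding fd_def using AB(1,3) by blast
qed

lemma dim_mono_fd: assumes "fd T" "S \<subseteq> T" shows "dim S \<le> dim T"
proof -
  obtain B where B: "finite B" "B \<subseteq> T" "independent B" "T \<subseteq> span B" "card B = dim T"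
    by (rule fd_basis[OF assms(1)])
  then show ?thesis using dim_le_card[of S B] assms(2) by auto
qed

lemma dim_zero: "dim {0} = 0"
  using dim_le_card[of "{0}" "{}"] by simp

lemma independent_span_disjoint:
  assumes "independent B" "A \<subseteq> B" "C \<subseteq> B" "A \<inter> C = {}" "x \<in> span A" "x \<in> span C"
  shows "x = 0"
proof -
  have r: "representation B x = representation A x" "representation B x = representation C x"
    using representation_extend[OF assms(1,5,2)] representation_extend[OF assms(1,6,3)] by auto
  have "representation B x b = 0" for b
    using representation_ne_zero[of A x b] representation_ne_zero[of C x b] r assms(4) by (metis disjoint_iff)
  moreover have "x \<in> span B" using assms(2,5) span_mono by blast
  ultimately show "x = 0" using sum_nonzero_representation_eq[OF assms(1), of x] by simp
qed

text \<open>\<open>B\<close> lifts a basis of \<open>L / D\<close>: extend a basis of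
  \<open>D\<close> to one of \<open>L\<close> and keep the new vectors.\<close>

lemma complement_basis:
  assumes "fd L" "subspace L" "subspace D" "D \<subseteq> L"
  obtains B where "finite B" "B \<subseteq> L" "card B + dim D = dim L"
    "\<And>x. x \<in> L \<Longrightarrow> \<exists>c. x - (\<Sum>b\<in>B. scale (c b) b) \<in> D"
    "\<And>c b. (\<Sum>b\<in>B. scale (c b) b) \<in> D \<Longrightarrow> b \<in> B \<Longrightarrow> c b = 0"
proof -
  obtain A where A: "finite A" "A \<subseteq> D" "independent A" "D \<subseteq> span A" "card A = dim D"
    by (rule fd_basis[OF fd_subset[OF assms(1,4)]])
  have "A \<subseteq> L" using A(2) assms(4) by blast
  then obtain B where B: "finite B" "A \<subseteq> B" "B \<subseteq> L" "independent B" "L \<subseteq> span B" "card B = dim L"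
    by (rule fd_extend[OF assms(1) _ A(3)])
  have sA: "span A = D" using A(2,4) assms(3) by (metis span_minimal subset_antisym)
  show ?thesis
  proof (rule that[of "B - A"])
    show "finite (B - A)" "B - A \<subseteq> L" using B by auto
    show "card (B - A) + dim D = dim L" using card_Diff_subset[OF A(1) B(2)] card_mono[OF B(1,2)] A(5) B(6) by simp
    fix x assume "x \<in> L"
    then have "x \<in> span B" using B(5) by blast
    then obtain c where c: "x = (\<Sum>b\<in>B. scale (c b) b)" using span_finite[OF B(1)] by auto
    have "x = (\<Sum>b\<in>B - A. scale (c b) b) + (\<Sum>b\<in>A. scale (c b) b)"
      unfolding c by (rule sum.subset_diff[OF B(2,1)])
    then have "x - (\<Sum>b\<in>B - A. scale (c b) b) = (\<Sum>b\<in>A. scale (c b) b)" by simp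
    also have "\<dots> \<in> D" using A(2) assms(3) by (intro subspace_sum subspace_scale) auto
    finally show "\<exists>c. x - (\<Sum>b\<in>B - A. scale (c b) b) \<in> D" by blast
  next
    fix c b assume c: "(\<Sum>b\<in>B - A. scale (c b) b) \<in> D" and b: "b \<in> B - A"
    have "(\<Sum>b\<in>B - A. scale (c b) b) = 0"
    proof (rule independent_span_disjoint[OF B(4), of "B - A" A])
      show "(\<Sum>b\<in>B - A. scale (c b) b) \<in> span (B - A)" by (intro span_sum span_scale span_base) auto
      show "(\<Sum>b\<in>B - A. scale (c b) b) \<in> span A" using c sA by simp
    qed (use B(2) in auto)
    then show "c b = 0" using independentD[OF B(4), of "B - A" c b] b B(1) by auto
  qed
qed

text \<open>The same as a formula of the object logic, to which \<open>choice\<close> can be applied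
  for a whole family of subspaces.\<close>

lemma complement_basis_ex:
  assumes "fd L" "subspace L" "subspace D" "D \<subseteq> L"
  shows "\<exists>B. finite B \<and> B \<subseteq> L \<and> card B + dim D = dim L \<and>
    (\<forall>x\<in>L. \<exists>c. x - (\<Sum>b\<in>B. scale (c b) b) \<in> D) \<and>
    (\<forall>c. (\<Sum>b\<in>B. scale (c b) b) \<in> D \<longrightarrow> (\<forall>b\<in>B. c b = 0))"
proof (rule complement_basis[OF assms])
  fix B
  assume B: "finite B" "B \<subseteq> L" "card B + dim D = dim L"
    "\<And>x. x \<in> L \<Longrightarrow> \<exists>c. x - (\<Sum>b\<in>B. scale (c b) b) \<in> D"
    "\<And>c b. (\<Sum>b\<in>B. scale (c b) b) \<in> D \<Longrightarrow> b \<in> B \<Longrightarrow> c b = 0"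
  show ?thesis by (intro exI[of _ B] conjI ballI allI impI; (rule B)?) (assumption | rule B)+
qed

end

section \<open>Rank formulas for linear maps and pairings\<close>

locale kvs_pair = vs1: kvs s1 + vs2: kvs s2
  for s1 :: "'a::field \<Rightarrow> 'b::ab_group_add \<Rightarrow> 'b" and s2 :: "'a \<Rightarrow> 'c::ab_group_add \<Rightarrow> 'c"
begin

sublocale vector_space_pair s1 s2 ..


lemma fd_image: assumes "Vector_Spaces.linear s1 s2 f" "vs1.fd V" shows "vs2.fd (f ` V)"
proof -
  obtain B where "finite B" "V \<subseteq> vs1.span B" using assms(2) unfolding vs1.fd_def by blast
  then have "finite (f ` B)" "f ` V \<subseteq> vs2.span (f ` B)" using linear_span_image[OF assms(1), of B] by auto
  then show ?thesis unfolding vs2.fd_def by blast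
qed

lemma rank_nullity:
  assumes f: "Vector_Spaces.linear s1 s2 f" and V: "vs1.subspace V" "vs1.fd V"
  shows "vs1.dim V = vs2.dim (f ` V) + vs1.dim {v \<in> V. f v = 0}"
proof -
  let ?K = "{v \<in> V. f v = 0}"
  have K: "vs1.subspace ?K"
    using V(1) by (auto intro!: vs1.subspaceI simp: linear_0[OF f] linear_add[OF f] linear_scale[OF f]
        vs1.subspace_0 vs1.subspace_add vs1.subspace_scale)
  obtain A where A: "finite A" "A \<subseteq> ?K" "vs1.independent A" "?K \<subseteq> vs1.span A" "card A = vs1.dim ?K"
    by (rule vs1.fd_basis[OF vs1.fd_subset[OF V(2), of ?K]]) auto
  have "A \<subseteq> V" using A(2) by blast
  then obtain B where B: "finite B" "A \<subseteq> B" "B \<subseteq> V" "vs1.independent B" "V \<subseteq> vs1.span B" "card B = vs1.dim V"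
    by (rule vs1.fd_extend[OF V(2) _ A(3)])
  let ?C = "B - A"
  have Ci: "vs1.independent ?C" using vs1.independent_mono[OF B(4)] by blast
  have spCV: "vs1.span ?C \<subseteq> V" by (rule vs1.span_minimal[OF _ V(1)]) (use B(3) in blast)
  have inj: "inj_on f (vs1.span ?C)"
  proof (subst linear_inj_on_iff_eq_0[OF f vs1.subspace_span], intro ballI impI)
    fix x assume x: "x \<in> vs1.span ?C" "f x = 0"
    then have "x \<in> ?K" using spCV by blast
    then have "x \<in> vs1.span A" using A(4) by blast
    then show "x = 0" using x(1) by (intro vs1.independent_span_disjoint[OF B(4), of ?C A]) (use B(2) in auto)
  qed
  have fC: "vs2.independent (f ` ?C)" by (rule linear_independent_injective_image[OF f Ci inj])
  have cC: "card (f ` ?C) = card ?C"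
    by (rule card_image, rule inj_on_subset[OF inj]) (auto intro: vs1.span_base)
  have "f ` V \<subseteq> vs2.span (f ` ?C)"
  proof safe
    fix x assume "x \<in> V"
    then have "x \<in> vs1.span B" using B(5) by blast
    then have "f x \<in> vs2.span (f ` B)" using linear_span_image[OF f, of B] by blast
    also have "vs2.span (f ` B) \<subseteq> vs2.span (f ` ?C)"
    proof (rule vs2.span_minimal[OF _ vs2.subspace_span], safe)
      fix b assume b: "b \<in> B"
      show "f b \<in> vs2.span (f ` ?C)"
      proof (cases "b \<in> A")
        case True
        then have "f b = 0" using A(2) by blast
        then show ?thesis by (simp add: vs2.span_zero)
      next
        case False
        then show ?thesis using b by (intro vs2.span_base) simp
      qed
    qed
    finally show "f x \<in> vs2.span (f ` ?C)" .
  qed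
  then have "vs2.dim (f ` V) = card (f ` ?C)"
    by (intro vs2.dim_unique[OF _ _ fC refl]) (use B(3) in auto)
  then show ?thesis using cC card_Diff_subset[OF A(1) B(2)] card_mono[OF B(1,2)] A(5) B(6) by simp
qed

text \<open>\<open>D\<close> contains the kernel of \<open>f\<close> on \<open>L\<close>, so
  \<open>f\<close> induces an isomorphism of \<open>L / D\<close> with the quotient of the images.
  The equation avoids subtraction; all comparisons of homology rest on it.\<close>

lemma dim_quotient_transfer:
  assumes f: "Vector_Spaces.linear s1 s2 f" and L: "vs1.subspace L" "vs1.fd L" and D: "vs1.subspace D" "D \<subseteq> L"
    and K: "\<And>x. x \<in> L \<Longrightarrow> f x = 0 \<Longrightarrow> x \<in> D"
  shows "vs1.dim L + vs2.dim (f ` D) = vs1.dim D + vs2.dim (f ` L)"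
proof -
  have "{v \<in> L. f v = 0} = {v \<in> D. f v = 0}" using K D(2) by blast
  then show ?thesis using rank_nullity[OF f L] rank_nullity[OF f D(1) vs1.fd_subset[OF L(2) D(2)]] by simp
qed

lemma linear_inj_dim:
  assumes f: "Vector_Spaces.linear s1 s2 f" and L: "vs1.subspace L" "vs1.fd L" and "\<And>x. x \<in> L \<Longrightarrow> f x = 0 \<Longrightarrow> x = 0"
  shows "vs2.dim (f ` L) = vs1.dim L"
proof -
  have "{v \<in> L. f v = 0} = {0}" using assms(4) vs1.subspace_0[OF L(1)] linear_0[OF f] by auto
  then show ?thesis using rank_nullity[OF f L] by (simp add: vs1.dim_zero)
qed

definition sprod :: "'a \<Rightarrow> 'b \<times> 'c \<Rightarrow> 'b \<times> 'c" where "sprod c p = (s1 c (fst p), s2 c (snd p))"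

lemma kvs_sprod: "kvs sprod"
  by unfold_locales (simp_all add: sprod_def vs1.scale_right_distrib vs2.scale_right_distrib
      vs1.scale_left_distrib vs2.scale_left_distrib)

text \<open>Rank and nullity for \<open>(x, y) \<mapsto> y + f x\<close> on
  \<open>P \<times> N\<close>: the kernel is the graph of \<open>- f\<close> over the vectors that
  \<open>f\<close> takes into \<open>N\<close>.\<close>

lemma dim_sum_preimage:
  assumes f: "Vector_Spaces.linear s1 s2 f" and P: "vs1.subspace P" "vs1.fd P" and N: "vs2.subspace N" "vs2.fd N"
  shows "vs2.dim {y + f x |x y. x \<in> P \<and> y \<in> N} + vs1.dim {x \<in> P. f x \<in> N} = vs1.dim P + vs2.dim N"
proof -
  interpret p: kvs sprod by (rule kvs_sprod)
  interpret p1: kvs_pair sprod s1 ..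
  interpret p2: kvs_pair sprod s2 ..
  let ?W = "P \<times> N"
  have lin: "Vector_Spaces.linear sprod s1 fst" "Vector_Spaces.linear sprod s2 (\<lambda>q. snd q + f (fst q))"
    by (unfold_locales; simp add: sprod_def linear_add[OF f] linear_scale[OF f] vs2.scale_right_distrib)+
  have W: "p.subspace ?W" by (rule p.subspaceI)
      (use P(1) N(1) in \<open>auto simp: sprod_def zero_prod_def vs1.subspace_0 vs1.subspace_add vs1.subspace_scale
         vs2.subspace_0 vs2.subspace_add vs2.subspace_scale\<close>)
  have Wfd: "p.fd ?W"
  proof -
    obtain A B where AB: "finite A" "P \<subseteq> vs1.span A" "finite B" "N \<subseteq> vs2.span B"
      using P(2) N(2) unfolding vs1.fd_def vs2.fd_def by blast
    let ?C = "(\<lambda>a. (a, 0)) ` A \<union> Pair 0 ` B"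
    have l: "Vector_Spaces.linear s1 sprod (\<lambda>a. (a, 0))" "Vector_Spaces.linear s2 sprod (Pair 0)"
      by (unfold_locales; simp add: sprod_def)+
    interpret q1: kvs_pair s1 sprod ..
    interpret q2: kvs_pair s2 sprod ..
    have "(a, b) \<in> p.span ?C" if "a \<in> P" "b \<in> N" for a b
    proof -
      have "(a, 0) \<in> p.span ((\<lambda>a. (a, 0)) ` A)" "(0, b) \<in> p.span (Pair 0 ` B)"
        using q1.linear_span_image[OF l(1), of A] q2.linear_span_image[OF l(2), of B] that AB(2,4) by auto
      then have "(a, 0) + (0, b) \<in> p.span ?C"
        using p.span_mono[of "(\<lambda>a. (a, 0)) ` A" ?C] p.span_mono[of "Pair 0 ` B" ?C] by (intro p.span_add) auto
      then show ?thesis by simp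
    qed
    then have "?W \<subseteq> p.span ?C" by auto
    then show ?thesis unfolding p.fd_def using AB(1,3) by (intro exI[of _ ?C]) auto
  qed
  have n0: "0 \<in> N" "0 \<in> P" using vs2.subspace_0[OF N(1)] vs1.subspace_0[OF P(1)] by auto
  have "fst ` ?W = P" using n0 by force
  moreover have "p.dim {v \<in> ?W. fst v = 0} = vs2.dim N"
  proof -
    interpret q2: kvs_pair s2 sprod ..
    have "Vector_Spaces.linear s2 sprod (Pair 0)" by (unfold_locales; simp add: sprod_def)
    from q2.linear_inj_dim[OF this N] have "p.dim (Pair 0 ` N) = vs2.dim N" by (simp add: zero_prod_def)
    moreover have "{v \<in> ?W. fst v = 0} = Pair 0 ` N" using n0 by force
    ultimately show ?thesis by simp
  qed
  ultimately have 1: "p.dim ?W = vs1.dim P + vs2.dim N" using p1.rank_nullity[OF lin(1) W Wfd] by simp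
  have "(\<lambda>q. snd q + f (fst q)) ` ?W = {y + f x |x y. x \<in> P \<and> y \<in> N}" by force
  moreover have "p.dim {v \<in> ?W. snd v + f (fst v) = 0} = vs1.dim {x \<in> P. f x \<in> N}"
  proof -
    interpret q1: kvs_pair s1 sprod ..
    have l: "Vector_Spaces.linear s1 sprod (\<lambda>x. (x, - f x))"
      by (unfold_locales; simp add: sprod_def linear_add[OF f] linear_scale[OF f])
    have sub: "vs1.subspace {x \<in> P. f x \<in> N}"
      using P(1) N(1) by (auto intro!: vs1.subspaceI simp: linear_0[OF f] linear_add[OF f] linear_scale[OF f]
        vs1.subspace_0 vs1.subspace_add vs1.subspace_scale vs2.subspace_0 vs2.subspace_add vs2.subspace_scale)
    have "p.dim ((\<lambda>x. (x, - f x)) ` {x \<in> P. f x \<in> N}) = vs1.dim {x \<in> P. f x \<in> N}"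
      by (rule q1.linear_inj_dim[OF l sub vs1.fd_subset[OF P(2)]]) (auto simp: zero_prod_def)
    moreover have "{v \<in> ?W. snd v + f (fst v) = 0} = (\<lambda>x. (x, - f x)) ` {x \<in> P. f x \<in> N}"
    proof safe
      fix a b assume ab: "a \<in> P" "b \<in> N" "snd (a, b) + f (fst (a, b)) = 0"
      then have b: "b = - f a" by (simp add: eq_neg_iff_add_eq_0)
      have "f a \<in> N" using vs2.subspace_neg[OF N(1) ab(2)] b by simp
      then show "(a, b) \<in> (\<lambda>x. (x, - f x)) ` {x \<in> P. f x \<in> N}" using ab(1) b by blast
    next
      fix x assume x: "x \<in> P" "f x \<in> N"
      show "- f x \<in> N" using vs2.subspace_neg[OF N(1) x(2)] .
    qed auto
    ultimately show ?thesis by simp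
  qed
  ultimately show ?thesis using p2.rank_nullity[OF lin(2) W Wfd] 1 by simp
qed

end

subsection \<open>Vectors of polynomials over the coefficient field\<close>

definition qs :: "'k::field \<Rightarrow> ('v, 'k) mpoly \<Rightarrow> ('v, 'k) mpoly" where "qs c p = kc c * p"

definition fs :: "'k::field \<Rightarrow> ('i \<Rightarrow> ('v, 'k) mpoly) \<Rightarrow> ('i \<Rightarrow> ('v, 'k) mpoly)" where
  "fs c f = (\<lambda>i. kc c * f i)"

global_interpretation Qv: kvs qs
  by unfold_locales (simp_all add: qs_def kc_add kc_mult algebra_simps)

global_interpretation Fv: kvs fs
  by unfold_locales (simp_all add: fs_def kc_add kc_mult algebra_simps fun_eq_iff)

global_interpretation FF: kvs_pair fs fs ..

global_interpretation FQ: kvs_pair fs qs ..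

global_interpretation QF: kvs_pair qs fs ..

lemma linear_FF_I: "(\<And>f g. T (f + g) = T f + T g) \<Longrightarrow> (\<And>c f. T (fs c f) = fs c (T f)) \<Longrightarrow> Vector_Spaces.linear fs fs T"
  by unfold_locales auto

lemma linear_FQ_I: "(\<And>f g. T (f + g) = T f + T g) \<Longrightarrow> (\<And>c f. T (fs c f) = qs c (T f)) \<Longrightarrow> Vector_Spaces.linear fs qs T"
  by unfold_locales auto

definition fun_space :: "'i set \<Rightarrow> ('i \<Rightarrow> ('v, 'k::field) mpoly set) \<Rightarrow> ('i \<Rightarrow> ('v, 'k) mpoly) set" where
  "fun_space J U = {f. (\<forall>i\<in>J. f i \<in> U i) \<and> (\<forall>i. i \<notin> J \<longrightarrow> f i = 0)}"

lemma Qv_subspace_kc: "Qv.subspace S \<Longrightarrow> p \<in> S \<Longrightarrow> kc c * p \<in> S"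
  by (drule (1) Qv.subspace_scale[of _ _ c]) (simp add: qs_def)

lemma fun_space_subspace: "(\<And>i. i \<in> J \<Longrightarrow> Qv.subspace (U i)) \<Longrightarrow> Fv.subspace (fun_space J U)"
  by (rule Fv.subspaceI) (auto simp: fun_space_def fs_def Qv.subspace_0 Qv.subspace_add
     intro: Qv_subspace_kc)

lemma fun_space_dim:
  fixes U :: "'i \<Rightarrow> ('v, 'k::field) mpoly set"
  assumes "finite J" "\<And>i. i \<in> J \<Longrightarrow> Qv.subspace (U i)" "\<And>i. i \<in> J \<Longrightarrow> Qv.fd (U i)"
  shows "Fv.fd (fun_space J U) \<and> Fv.dim (fun_space J U) = (\<Sum>i\<in>J. Qv.dim (U i))"
  using assms
proof (induct J rule: finite_induct)
  case empty
  have e: "fun_space {} U = {0}"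
  proof (rule Set.set_eqI)
    fix f :: "'i \<Rightarrow> ('v, 'k) mpoly"
    have "f = 0 \<longleftrightarrow> (\<forall>i. f i = 0)" by (simp only: fun_eq_iff zero_fun_apply)
    then show "f \<in> fun_space {} U \<longleftrightarrow> f \<in> {0}" unfolding fun_space_def by blast
  qed
  have "Fv.fd {0 :: 'i \<Rightarrow> ('v, 'k) mpoly}" unfolding Fv.fd_def by (rule exI[of _ "{}"]) simp
  then show ?case unfolding e by (simp only: Fv.dim_zero sum.empty)
next
  case (insert j J)
  let ?F = "fun_space (insert j J) U"
  have IH: "Fv.fd (fun_space J U)" "Fv.dim (fun_space J U) = (\<Sum>i\<in>J. Qv.dim (U i))"
    using insert by auto
  have lin: "Vector_Spaces.linear fs qs (\<lambda>f. f j)" by (rule linear_FQ_I) (auto simp: fs_def qs_def)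
  have lin2: "Vector_Spaces.linear qs fs (\<lambda>p i. if i = j then p else 0)"
    by unfold_locales (auto simp: fs_def qs_def fun_eq_iff)
  have sub: "Fv.subspace ?F" using insert(4) by (rule fun_space_subspace)
  have fd1: "Fv.fd ((\<lambda>p i. if i = j then p else 0) ` U j)" using QF.fd_image[OF lin2] insert(5) by blast
  have fd: "Fv.fd ?F"
  proof (rule Fv.fd_subset[OF Fv.fd_sum[OF fd1 IH(1)]], rule subsetI)
    fix f assume f: "f \<in> ?F"
    have "f = (\<lambda>i. if i = j then f j else 0) + (\<lambda>i. if i = j then 0 else f i)" by (auto simp: fun_eq_iff)
    moreover have "(\<lambda>i. if i = j then 0 else f i) \<in> fun_space J U" using f insert(2) by (auto simp: fun_space_def)
    moreover have "(\<lambda>i. if i = j then f j else 0) \<in> (\<lambda>p i. if i = j then p else 0) ` U j" using f by (auto simp: fun_space_def)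
    ultimately show "f \<in> {x + y |x y. x \<in> (\<lambda>p i. if i = j then p else 0) ` U j \<and> y \<in> fun_space J U}" by blast
  qed
  have "(\<lambda>f. f j) ` ?F = U j"
  proof safe
    fix p assume "p \<in> U j"
    then have "(\<lambda>i. if i = j then p else 0) \<in> ?F"
      using insert(4) by (auto simp: fun_space_def Qv.subspace_0)
    then show "p \<in> (\<lambda>f. f j) ` ?F" by (rule image_eqI[rotated]) simp
  qed (auto simp: fun_space_def)
  moreover have "{f \<in> ?F. f j = 0} = fun_space J U" using insert(2) insert(4)[of j]
    by (auto simp: fun_space_def Qv.subspace_0)
  ultimately show ?case using FQ.rank_nullity[OF lin sub fd] IH(2) insert(1,2) fd by simp
qed

lemma fd_constants: "Qv.subspace (range kc :: ('v, 'k) mpoly set)" "Qv.fd (range kc :: ('v, 'k) mpoly set)"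
  "Qv.dim (range kc :: ('v, 'k::field) mpoly set) = 1"
proof -
  have sp: "range kc = Qv.span {1 :: ('v, 'k) mpoly}"
    by (auto simp: Qv.span_singleton qs_def image_def)
  show "Qv.subspace (range kc :: ('v, 'k) mpoly set)" unfolding sp by (rule Qv.subspace_span)
  show "Qv.fd (range kc :: ('v, 'k) mpoly set)" unfolding sp by (rule Qv.fd_span) simp
  show "Qv.dim (range kc :: ('v, 'k) mpoly set) = 1" unfolding sp
    by (subst Qv.dim_span_eq_card_independent) simp_all
qed

text \<open>Let \<open>B\<close> lift a basis of \<open>U\<close> modulo the vectors orthogonal to
  \<open>Y\<close>. Pairing with \<open>B\<close> maps \<open>Y\<close> to the functions on
  \<open>B\<close>, and the kernel is the part of \<open>Y\<close> orthogonal to \<open>U\<close>.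
  The values are stored as constant polynomials so that the target is again a vector space under
  \<open>fs\<close>.\<close>

lemma bilinear_rank_le:
  fixes b :: "('i \<Rightarrow> ('v, 'k::field) mpoly) \<Rightarrow> ('j \<Rightarrow> ('v, 'k) mpoly) \<Rightarrow> 'k"
  assumes b: "\<And>x y z. b (x + y) z = b x z + b y z" "\<And>c x z. b (fs c x) z = c * b x z"
     "\<And>x y z. b z (x + y) = b z x + b z y" "\<And>c x z. b z (fs c x) = c * b z x"
    and U: "Fv.subspace U" "Fv.fd U" and Y: "Fv.subspace Y" "Fv.fd Y"
  shows "Fv.dim Y + Fv.dim {u \<in> U. \<forall>x\<in>Y. b u x = 0} \<le> Fv.dim U + Fv.dim {x \<in> Y. \<forall>u\<in>U. b u x = 0}"
proof -
  let ?D = "{u \<in> U. \<forall>x\<in>Y. b u x = 0}"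
  have b0: "b 0 x = 0" for x using b(2)[of 0 0 x] by (simp add: fs_def zero_fun_def)
  have bs: "b (sum f A) x = (\<Sum>i\<in>A. b (f i) x)" for f A x
    by (induct A rule: infinite_finite_induct)
      (simp_all only: sum.infinite sum.empty sum.insert b0 b(1) not_False_eq_True)
  have D: "Fv.subspace ?D"
  proof (rule Fv.subspaceI)
    show "0 \<in> ?D" using Fv.subspace_0[OF U(1)] b0 by blast
    show "x + y \<in> ?D" if "x \<in> ?D" "y \<in> ?D" for x y
    proof -
      have "b (x + y) z = 0" if "z \<in> Y" for z using \<open>x \<in> ?D\<close> \<open>y \<in> ?D\<close> that b(1)[of x y z] by simp
      then show ?thesis using that Fv.subspace_add[OF U(1), of x y] by blast
    qed
    show "fs c x \<in> ?D" if "x \<in> ?D" for c x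
    proof -
      have "b (fs c x) z = 0" if "z \<in> Y" for z using \<open>x \<in> ?D\<close> that b(2)[of c x z] by simp
      then show ?thesis using that Fv.subspace_scale[OF U(1), of x c] by blast
    qed
  qed
  from Fv.complement_basis_ex[OF U(2,1) D Collect_restrict]
  obtain B where B': "finite B \<and> B \<subseteq> U \<and> card B + Fv.dim ?D = Fv.dim U \<and>
    (\<forall>x\<in>U. \<exists>c. x - (\<Sum>b\<in>B. fs (c b) b) \<in> ?D) \<and>
    (\<forall>c. (\<Sum>b\<in>B. fs (c b) b) \<in> ?D \<longrightarrow> (\<forall>b\<in>B. c b = 0))" by (rule exE)
  then have B: "finite B" "B \<subseteq> U" "card B + Fv.dim ?D = Fv.dim U" by simp_all
  note B4 = B'[THEN conjunct2, THEN conjunct2, THEN conjunct2, THEN conjunct1]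
  define T where "T x = (\<lambda>u. if u \<in> B then kc (b u x) :: ('v, 'k) mpoly else 0)" for x
  have lin: "Vector_Spaces.linear fs fs T"
    by (rule linear_FF_I) (auto simp: T_def fun_eq_iff fs_def b kc_add b(4)[unfolded fs_def] kc_mult)
  have "T ` Y \<subseteq> fun_space B (\<lambda>_. range kc)" by (auto simp: T_def fun_space_def)
  moreover have "Fv.fd (fun_space B (\<lambda>_. range kc :: ('v, 'k) mpoly set)) \<and>
      Fv.dim (fun_space B (\<lambda>_. range kc :: ('v, 'k) mpoly set)) = card B"
    using fun_space_dim[OF B(1), of "\<lambda>_. range kc :: ('v, 'k) mpoly set"] fd_constants[where ?'v='v and ?'k='k] by simp
  ultimately have "Fv.dim (T ` Y) \<le> card B" using Fv.dim_mono_fd by metis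
  moreover have "{x \<in> Y. T x = 0} = {x \<in> Y. \<forall>u\<in>U. b u x = 0}"
  proof (intro Collect_cong conj_cong refl iffI ballI)
    fix x u assume x: "x \<in> Y" "T x = 0" and u: "u \<in> U"
    have z: "b w x = 0" if "w \<in> B" for w
      using fun_cong[OF x(2), of w] that by (simp add: T_def)
    obtain c where c: "u - (\<Sum>b\<in>B. fs (c b) b) \<in> ?D" using bspec[OF B4 u] by (rule exE)
    have "b u x = b (u - (\<Sum>b\<in>B. fs (c b) b) + (\<Sum>b\<in>B. fs (c b) b)) x" by simp
    also have "\<dots> = 0" using c x(1) z by (subst b(1)) (simp add: bs b)
    finally show "b u x = 0" .
  next
    fix x assume "\<forall>u\<in>U. b u x = 0"
    then show "T x = 0" using B(2) by (auto simp: T_def fun_eq_iff)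
  qed
  ultimately show ?thesis using FF.rank_nullity[OF lin Y] B(3) by simp
qed

text \<open>The inequality for the pairing and for its transpose.\<close>

lemma bilinear_rank:
  fixes b :: "('i \<Rightarrow> ('v, 'k::field) mpoly) \<Rightarrow> ('j \<Rightarrow> ('v, 'k) mpoly) \<Rightarrow> 'k"
  assumes b: "\<And>x y z. b (x + y) z = b x z + b y z" "\<And>c x z. b (fs c x) z = c * b x z"
     "\<And>x y z. b z (x + y) = b z x + b z y" "\<And>c x z. b z (fs c x) = c * b z x"
    and U: "Fv.subspace U" "Fv.fd U" and Y: "Fv.subspace Y" "Fv.fd Y"
  shows "Fv.dim Y + Fv.dim {u \<in> U. \<forall>x\<in>Y. b u x = 0} = Fv.dim U + Fv.dim {x \<in> Y. \<forall>u\<in>U. b u x = 0}"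
proof (rule antisym)
  show "Fv.dim Y + Fv.dim {u \<in> U. \<forall>x\<in>Y. b u x = 0} \<le> Fv.dim U + Fv.dim {x \<in> Y. \<forall>u\<in>U. b u x = 0}"
    by (rule bilinear_rank_le) fact+
  show "Fv.dim U + Fv.dim {x \<in> Y. \<forall>u\<in>U. b u x = 0} \<le> Fv.dim Y + Fv.dim {u \<in> U. \<forall>x\<in>Y. b u x = 0}"
    by (rule bilinear_rank_le[of "\<lambda>x u. b u x"]) fact+
qed

section \<open>The Koszul complex\<close>

text \<open>Numbering the variables by naturals gives them an order, for the signs of the Koszul
  complex, and initial segments, for inductions on the number of variables.\<close>

definition xv :: "nat \<Rightarrow> (4, 'k::comm_ring_1) mpoly" where "xv i = variable (of_nat i)"

lemma of_nat_4_inj: "i < 4 \<Longrightarrow> j < 4 \<Longrightarrow> (of_nat i :: 4) = of_nat j \<longleftrightarrow> i = j"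
proof -
  assume "i < 4" "j < 4"
  then have "i = 0 \<or> i = 1 \<or> i = 2 \<or> i = 3" "j = 0 \<or> j = 1 \<or> j = 2 \<or> j = 3" by linarith+
  then show ?thesis by (elim disjE) simp_all
qed

lemma of_nat_4_surj: "\<exists>i<4. (v :: 4) = of_nat i"
proof -
  have "v = of_nat 1 \<or> v = of_nat 2 \<or> v = of_nat 3 \<or> v = of_nat 0" using exhaust_4[of v] by auto
  then show ?thesis by (metis zero_less_numeral one_less_numeral_iff numeral_less_iff semiring_norm(76,77,78,79,80,81))
qed

lemma homogeneous_xv [simp]: "homogeneous 1 (xv i)" by (simp add: xv_def)

lemma hc_xv_mult: "hc e (xv v * p) = xv v * hc (e - 1) p"
  by (simp add: xv_def hc_variable_mult)

definition varid :: "nat \<Rightarrow> (4, 'k::comm_ring_1) mpoly set" where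
  "varid r = {p. \<exists>q. p = (\<Sum>i<r. xv i * q i)}"

lemma qideal_varid: "qideal (varid r :: (4, 'k::comm_ring_1) mpoly set)"
  unfolding qideal_def
proof (intro conjI ballI allI)
  show "0 \<in> varid r" unfolding varid_def by (intro CollectI exI[of _ "\<lambda>_. 0"]) simp
next
  fix a b :: "(4, 'k) mpoly" assume "a \<in> varid r" "b \<in> varid r"
  then obtain q q' where "a = (\<Sum>i<r. xv i * q i)" "b = (\<Sum>i<r. xv i * q' i)" unfolding varid_def by blast
  then show "a + b \<in> varid r" unfolding varid_def
    by (intro CollectI exI[of _ "\<lambda>i. q i + q' i"]) (simp add: distrib_left sum.distrib)
next
  fix a p :: "(4, 'k) mpoly" assume "a \<in> varid r"
  then obtain q where "a = (\<Sum>i<r. xv i * q i)" unfolding varid_def by blast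
  then show "p * a \<in> varid r" unfolding varid_def
    by (intro CollectI exI[of _ "\<lambda>i. p * q i"]) (simp add: sum_distrib_left mult.left_commute)
qed

lemma varid_iff: "p \<in> varid r \<longleftrightarrow> (\<forall>m\<in>keys p. \<exists>i<r. lkp m (of_nat i) \<noteq> 0)"
proof
  assume "p \<in> varid r"
  then obtain q where p: "p = (\<Sum>i<r. xv i * q i)" unfolding varid_def by blast
  show "\<forall>m\<in>keys p. \<exists>i<r. lkp m (of_nat i) \<noteq> 0"
  proof
    fix m assume m: "m \<in> keys p"
    have "\<exists>i<r. m \<in> keys (xv i * q i)"
    proof (rule ccontr)
      assume "\<not> ?thesis"
      then have "lkp p m = 0" unfolding p lookup_sum by (intro sum.neutral) (simp add: in_keys_iff)
      then show False using m by (simp add: in_keys_iff)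
    qed
    then obtain i where i: "i < r" "m \<in> keys (xv i * q i)" by blast
    then obtain m' where "m = Poly_Mapping.single (of_nat i) 1 + m'"
      unfolding xv_def variable_def keys_mult_shift by blast
    then show "\<exists>i<r. lkp m (of_nat i) \<noteq> 0" using i(1) by (intro exI[of _ i]) (simp add: lookup_add)
  qed
next
  assume h: "\<forall>m\<in>keys p. \<exists>i<r. lkp m (of_nat i) \<noteq> 0"
  show "p \<in> varid r"
  proof (rule mem_qideal_keys[OF qideal_varid])
    fix m and c :: 'a assume "m \<in> keys p"
    then obtain i where i: "i < r" "lkp m (of_nat i) \<noteq> 0" using h by blast
    have "xv i \<in> (varid r :: (4, 'a) mpoly set)" unfolding varid_def
      by (intro CollectI exI[of _ "\<lambda>k. if k = i then 1 else 0"]) (use i(1) in \<open>simp add: if_distrib cong: if_cong\<close>)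
    then show "Poly_Mapping.single m c \<in> varid r"
      unfolding single_variable[OF i(2), of c] xv_def[symmetric] by (rule qidealD(4)[OF qideal_varid])
  qed
qed

text \<open>Multiplication by \<open>xv r\<close> does not change the exponents of the earlier
  variables. This is the regularity of the sequence of variables on which \<open>kd_exact\<close>
  depends.\<close>

lemma varid_regular: "r < 4 \<Longrightarrow> xv r * p \<in> varid r \<Longrightarrow> p \<in> varid r"
  unfolding varid_iff
proof
  fix m assume r: "r < 4" and h: "\<forall>m\<in>keys (xv r * p). \<exists>i<r. lkp m (of_nat i) \<noteq> 0" and m: "m \<in> keys p"
  have "Poly_Mapping.single (of_nat r) 1 + m \<in> keys (xv r * p)"
    unfolding xv_def variable_def keys_mult_shift using m by blast
  then obtain i where i: "i < r" "lkp (Poly_Mapping.single (of_nat r) 1 + m) (of_nat i) \<noteq> 0" using h by blast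
  have "(of_nat r :: 4) \<noteq> of_nat i" using of_nat_4_inj[of r i] r i(1) by simp
  then have "lkp m (of_nat i) \<noteq> 0" using i(2) by (simp add: lookup_add lookup_single when_def)
  then show "\<exists>i<r. lkp m (of_nat i) \<noteq> 0" using i(1) by blast
qed

lemma varid_4: "p \<in> varid 4 \<longleftrightarrow> lkp p 0 = 0"
proof -
  have "(\<exists>i<4. lkp m (of_nat i :: 4) \<noteq> 0) \<longleftrightarrow> m \<noteq> 0" for m :: "4 \<Rightarrow>\<^sub>0 nat"
  proof
    show "m \<noteq> 0" if "\<exists>i<4. lkp m (of_nat i :: 4) \<noteq> 0" using that by auto
    assume "m \<noteq> 0"
    then obtain v where "lkp m v \<noteq> 0" by (rule lkp_nonzero)
    then show "\<exists>i<4. lkp m (of_nat i :: 4) \<noteq> 0" using of_nat_4_surj[of v] by auto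
  qed
  then have "p \<in> varid 4 \<longleftrightarrow> (\<forall>m\<in>keys p. m \<noteq> 0)" unfolding varid_iff by simp
  then show ?thesis by (auto simp: in_keys_iff)
qed

type_synonym 'k kchain = "nat set \<times> nat \<Rightarrow> (4, 'k) mpoly"

text \<open>
  A chain maps \<open>(S, c)\<close> to the coefficient of the exterior monomial with index set \<open>S\<close> in the
  \<open>c\<close>-th coordinate of a free module; \<open>kd r\<close> is the differential for the first \<open>r\<close> variables.
\<close>

primrec kd :: "nat \<Rightarrow> 'k::comm_ring_1 kchain \<Rightarrow> 'k kchain" where
  "kd 0 f = (\<lambda>_. 0)"
| "kd (Suc r) f = (\<lambda>(S, c). kd r f (S, c) +
     (if r \<in> S then 0 else (-1) ^ card (S \<inter> {..<r}) * xv r * f (insert r S, c)))"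

declare kd.simps [simp del]

lemma kd_0: "kd 0 f s = 0" by (simp add: kd.simps)

lemma kd_Suc_in: "r \<in> S \<Longrightarrow> kd (Suc r) f (S, c) = kd r f (S, c)" by (simp add: kd.simps)

lemma kd_Suc_notin: "r \<notin> S \<Longrightarrow>
  kd (Suc r) f (S, c) = kd r f (S, c) + (-1) ^ card (S \<inter> {..<r}) * xv r * f (insert r S, c)"
  by (simp add: kd.simps)

lemma kd_cong: "(\<And>v. v < r \<Longrightarrow> v \<notin> S \<Longrightarrow> f (insert v S, c) = g (insert v S, d)) \<Longrightarrow> kd r f (S, c) = kd r g (S, d)"
proof (induct r)
  case (Suc r)
  then have "kd r f (S, c) = kd r g (S, d)" by simp
  then show ?case using Suc(2)[of r] by (cases "r \<in> S") (simp_all add: kd_Suc_in kd_Suc_notin)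
qed (simp add: kd_0)

lemma kd_lin: "kd r (\<lambda>s. f s + q * g s) s = kd r f s + q * kd r g s"
proof (induct r)
  case (Suc r)
  obtain S c where s: "s = (S, c)" by fastforce
  show ?case using Suc unfolding s
    by (cases "r \<in> S") (simp_all add: kd_Suc_in kd_Suc_notin algebra_simps)
qed (simp add: kd_0)

lemma kd_zero: "kd r (\<lambda>s. 0) s = 0"
proof -
  obtain S c where s: "s = (S, c)" by fastforce
  show ?thesis unfolding s by (induct r) (simp_all add: kd.simps)
qed

lemma kd_add: "kd r (f + g) = kd r f + kd r g"
proof
  fix s show "kd r (f + g) s = (kd r f + kd r g) s"
    using kd_lin[of r f 1 g s] by (simp add: plus_fun_def)
qed

lemma kd_qmult: "kd r (\<lambda>s. q * f s) s = q * kd r f s"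
  using kd_lin[of r "\<lambda>s. 0" q f s] by (simp add: kd_zero)

lemma kd_diff: "kd r (f - g) = kd r f - kd r g"
proof
  fix s show "kd r (f - g) s = (kd r f - kd r g) s"
    using kd_lin[of r f "-1" g s] by (simp add: fun_diff_def)
qed

lemma kd_fs: "kd r (fs c f) = fs c (kd r f)"
  by (rule ext) (simp add: fs_def kd_qmult)

lemma kd_0_fun: "kd r 0 = 0"
  by (rule ext) (simp add: kd_zero zero_fun_def)

lemma linear_kd: "Vector_Spaces.linear fs fs (kd r)"
  by (rule linear_FF_I) (simp_all add: kd_add kd_fs)

lemma kd_zeroI: "(\<And>v. v < r \<Longrightarrow> v \<notin> S \<Longrightarrow> f (insert v S, c) = 0) \<Longrightarrow> kd r f (S, c) = 0"
  using kd_cong[of r S f c "\<lambda>s. 0" c] by (simp add: kd_zero)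

lemma kd_insert: "s \<le> r \<Longrightarrow> kd s f (insert r S, c) = kd s (\<lambda>(T, c). f (insert r T, c)) (S, c)"
proof (induct s)
  case (Suc s)
  have "insert r S \<inter> {..<s} = S \<inter> {..<s}" "s \<in> insert r S \<longleftrightarrow> s \<in> S" using Suc(2) by auto
  moreover have "kd s f (insert r S, c) = kd s (\<lambda>(T, c). f (insert r T, c)) (S, c)" using Suc by simp
  ultimately show ?case by (cases "s \<in> S") (simp_all add: kd_Suc_in kd_Suc_notin insert_commute)
qed (simp add: kd_0)

text \<open>Induction on the number of variables: for \<open>r\<close> outside \<open>S\<close> the
  two new terms cancel, because adjoining an index below \<open>r\<close> to \<open>S\<close> flips
  the sign attached to \<open>r\<close>.\<close>

lemma kd_kd: "kd r (kd r f) s = 0"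
proof (induct r arbitrary: f s)
  case (Suc r)
  obtain S c where s: "s = (S, c)" by fastforce
  let ?w = "\<lambda>(T, c). f (insert r T, c)"
  show ?case
  proof (cases "r \<in> S")
    case True
    have "kd r (kd (Suc r) f) (S, c) = kd r (kd r f) (S, c)"
      by (rule kd_cong) (simp add: kd_Suc_in True)
    then show ?thesis by (simp add: s kd_Suc_in True Suc)
  next
    case False
    let ?q = "(-1) ^ Suc (card (S \<inter> {..<r})) * xv r :: (4, 'a) mpoly"
    have "kd r (kd (Suc r) f) (S, c) = kd r (\<lambda>s. kd r f s + ?q * ?w s) (S, c)"
    proof (rule kd_cong)
      fix v assume v: "v < r" "v \<notin> S"
      have "insert v S \<inter> {..<r} = insert v (S \<inter> {..<r})" using v by auto
      then have "card (insert v S \<inter> {..<r}) = Suc (card (S \<inter> {..<r}))" using v by simp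
      then show "kd (Suc r) f (insert v S, c) = kd r f (insert v S, c) + ?q * ?w (insert v S, c)"
        using False v by (simp add: kd_Suc_notin)
    qed
    also have "\<dots> = ?q * kd r ?w (S, c)" by (simp only: kd_lin Suc) simp
    finally show ?thesis using False kd_insert[of r r f S c]
      by (simp add: s kd_Suc_notin kd_Suc_in)
  qed
qed (simp add: kd_0)

definition ksupp :: "nat \<Rightarrow> nat \<Rightarrow> 'k::comm_ring_1 kchain \<Rightarrow> bool" where
  "ksupp r p f \<longleftrightarrow> (\<forall>S c. f (S, c) \<noteq> 0 \<longrightarrow> S \<subseteq> {..<r} \<and> card S = p)"

lemma ksuppD: "ksupp r p f \<Longrightarrow> f (S, c) \<noteq> 0 \<Longrightarrow> S \<subseteq> {..<r}" "ksupp r p f \<Longrightarrow> f (S, c) \<noteq> 0 \<Longrightarrow> card S = p"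
  unfolding ksupp_def by blast+

lemma ksuppD_finite: "ksupp r p f \<Longrightarrow> f (S, c) \<noteq> 0 \<Longrightarrow> finite S"
  by (drule (1) ksuppD(1)) (rule finite_subset, assumption, simp)

lemma kd_nonzero: assumes "kd r f (S, c) \<noteq> 0" shows "\<exists>v<r. v \<notin> S \<and> f (insert v S, c) \<noteq> 0"
  using kd_zeroI[of r S f c] assms by blast

lemma ksupp_kd: assumes "ksupp t (Suc p) f" shows "ksupp t p (kd r f)"
  unfolding ksupp_def
proof (intro allI impI)
  fix S c assume "kd r f (S, c) \<noteq> 0"
  then obtain v where v: "v \<notin> S" "f (insert v S, c) \<noteq> 0" using kd_nonzero by blast
  then have "insert v S \<subseteq> {..<t}" "card (insert v S) = Suc p" "finite (insert v S)"
    using ksuppD[OF assms v(2)] ksuppD_finite[OF assms v(2)] by simp_all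
  then show "S \<subseteq> {..<t} \<and> card S = p" using v(1) by simp
qed

lemma kd_ksupp_0: assumes "ksupp t 0 f" shows "kd r f = 0"
proof
  fix s :: "nat set \<times> nat"
  obtain S c where s: "s = (S, c)" by fastforce
  have "f (insert v S, c) = 0" for v
  proof (rule ccontr)
    assume "f (insert v S, c) \<noteq> 0"
    then have "card (insert v S) = 0" "finite (insert v S)"
      using ksuppD(2)[OF assms, of "insert v S" c] ksuppD_finite[OF assms, of "insert v S" c] by simp_all
    then show False by simp
  qed
  then show "kd r f s = 0 s" unfolding s using kd_zeroI[of r S f c] by simp
qed

lemma kd_empty: "kd r f ({}, c) = (\<Sum>i<r. xv i * f ({i}, c))"
  by (induct r) (simp_all add: kd_0 kd_Suc_notin)

text \<open>Induction on the number of variables. The coefficient \<open>w\<close> of the last index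
  is a cycle for the earlier variables. Once it is a boundary, subtracting the boundary of a
  suitable \<open>W\<close> removes all terms that involve the last index, and what is left is a
  cycle in fewer variables.\<close>

lemma kd_exact:
  assumes "r \<le> 4" "ksupp r p f" "0 < p" "kd r f = 0"
  shows "\<exists>g. ksupp r (Suc p) g \<and> kd r g = f"
  using assms
proof (induct r arbitrary: p f)
  case 0
  have "f (S, c) = 0" for S c using 0(2,3) unfolding ksupp_def by fastforce
  then have "f = (\<lambda>s. 0)" by (simp add: fun_eq_iff)
  then show ?case by (intro exI[of _ "\<lambda>s. 0"]) (simp add: ksupp_def fun_eq_iff kd_zero)
next
  case (Suc r)
  define w where "w = (\<lambda>(S, c). if r \<in> S then 0 else f (insert r S, c))"
  have w_eq: "w (S, c) = (if r \<in> S then 0 else f (insert r S, c))" for S c by (simp add: w_def)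
  have sw: "ksupp r (p - 1) w" unfolding ksupp_def
  proof (intro allI impI)
    fix S c assume "w (S, c) \<noteq> 0"
    then have S: "r \<notin> S" "f (insert r S, c) \<noteq> 0" by (auto simp: w_eq split: if_splits)
    then have "insert r S \<subseteq> {..<Suc r}" "card (insert r S) = p" "finite (insert r S)"
      using ksuppD[OF Suc(3) S(2)] ksuppD_finite[OF Suc(3) S(2)] by simp_all
    then show "S \<subseteq> {..<r} \<and> card S = p - 1" using S(1) by (auto simp: less_Suc_eq)
  qed
  have f0: "kd (Suc r) f s = 0" for s using Suc(5) by simp
  have kw: "kd r w = 0"
  proof
    fix s :: "nat set \<times> nat"
    obtain S c where s: "s = (S, c)" by fastforce
    show "kd r w s = 0 s"
    proof (cases "r \<in> S")
      case True
      then show ?thesis unfolding s by (simp add: kd_zeroI w_eq)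
    next
      case False
      have "kd r w (S, c) = kd r (\<lambda>(T, c). f (insert r T, c)) (S, c)"
        by (rule kd_cong) (use False in \<open>simp add: w_eq\<close>)
      also have "\<dots> = kd (Suc r) f (insert r S, c)" by (simp add: kd_insert kd_Suc_in)
      finally show ?thesis by (simp add: s f0)
    qed
  qed
  have "\<exists>w'. ksupp r p w' \<and> kd r w' = w"
  proof (cases "p = 1")
    case False
    then have "\<exists>w'. ksupp r (Suc (p - 1)) w' \<and> kd r w' = w"
      using Suc(1)[of "p - 1" w] Suc(2,4) sw kw by simp
    then show ?thesis using Suc(4) by simp
  next
    \<comment> \<open>Now \<open>w\<close> has exterior degree 0 and the induction hypothesis does
      not apply. Instead the cycle condition puts \<open>xv r\<close> times \<open>w\<close> into
      the ideal of the earlier variables, and regularity puts \<open>w\<close> there.\<close>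
    case True
    have "w ({}, c) \<in> varid r" for c
    proof (rule varid_regular)
      show "r < 4" using Suc(2) by simp
      have "kd r f ({}, c) + xv r * w ({}, c) = 0"
        using f0[of "({}, c)"] by (simp add: kd_Suc_notin w_eq)
      then have "xv r * w ({}, c) = - kd r f ({}, c)" by (simp add: eq_neg_iff_add_eq_0 add.commute)
      also have "\<dots> \<in> varid r" unfolding kd_empty
        by (rule qidealD(5)[OF qideal_varid]) (auto simp: varid_def)
      finally show "xv r * w ({}, c) \<in> varid r" .
    qed
    then obtain q where q: "\<And>c. w ({}, c) = (\<Sum>i<r. xv i * q c i)" unfolding varid_def by (auto simp: ) metis
    define w' where "w' = (\<lambda>(S, c). \<Sum>i<r. if S = {i} then q c i else 0)"
    have sw': "ksupp r 1 w'" unfolding ksupp_def w'_def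
    proof (intro allI impI)
      fix S c assume "(case (S, c) of (S, c) \<Rightarrow> \<Sum>i<r. if S = {i} then q c i else 0) \<noteq> 0"
      then have "\<exists>i<r. S = {i}" by (auto elim!: sum.not_neutral_contains_not_neutral split: if_splits)
      then show "S \<subseteq> {..<r} \<and> card S = 1" by auto
    qed
    have "kd r w' = w"
    proof
      fix s :: "nat set \<times> nat"
      obtain S c where s: "s = (S, c)" by fastforce
      show "kd r w' s = w s"
      proof (cases "S = {}")
        case True
        have "w' ({i}, c) = q c i" if "i < r" for i
          using that by (simp add: w'_def eq_commute)
        then show ?thesis by (simp add: s True kd_empty q)
      next
        case False
        have "ksupp r 0 (kd r w')" using ksupp_kd[of r 0 w' r] sw' by simp
        then have "kd r w' (S, c) = 0"
          using False ksuppD(2) ksuppD_finite card_0_eq by blast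
        moreover have "w (S, c) = 0"
          using False ksuppD(2)[OF sw, of S c] ksuppD_finite[OF sw, of S c] True by auto
        ultimately show ?thesis by (simp add: s)
      qed
    qed
    then show ?thesis using sw' True by auto
  qed
  then obtain w' where w': "ksupp r p w'" "kd r w' = w" by blast
  define W where "W = (\<lambda>(S, c). if r \<in> S then w' (S - {r}, c) else 0)"
  have W_eq: "W (S, c) = (if r \<in> S then w' (S - {r}, c) else 0)" for S c by (simp add: W_def)
  have sW: "ksupp (Suc r) (Suc p) W" unfolding ksupp_def
  proof (intro allI impI)
    fix S c assume "W (S, c) \<noteq> 0"
    then have S: "r \<in> S" "w' (S - {r}, c) \<noteq> 0" by (auto simp: W_eq split: if_splits)
    then have *: "S - {r} \<subseteq> {..<r}" "card (S - {r}) = p" "finite (S - {r})"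
      using ksuppD[OF w'(1) S(2)] ksuppD_finite[OF w'(1) S(2)] by simp_all
    then have "finite S" by simp
    then have "card S = Suc p" using *(2) S(1) card_Suc_Diff1[of S r] by simp
    moreover have "S \<subseteq> {..<Suc r}" using *(1) by auto
    ultimately show "S \<subseteq> {..<Suc r} \<and> card S = Suc p" by blast
  qed
  have kW: "kd (Suc r) W (S, c) = f (S, c)" if "r \<in> S" for S c
  proof -
    have S: "S = insert r (S - {r})" using that by blast
    have "kd (Suc r) W (S, c) = kd r W (insert r (S - {r}), c)" using that S by (simp add: kd_Suc_in)
    also have "\<dots> = kd r (\<lambda>(T, c). W (insert r T, c)) (S - {r}, c)" by (rule kd_insert) simp
    also have "\<dots> = kd r w' (S - {r}, c)"
    proof (rule kd_cong)
      fix v assume "v < r"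
      then have "insert r (insert v (S - {r})) - {r} = insert v (S - {r})" by auto
      then show "(case (insert v (S - {r}), c) of (T, c) \<Rightarrow> W (insert r T, c)) = w' (insert v (S - {r}), c)"
        by (simp add: W_eq)
    qed
    also have "\<dots> = f (S, c)" using S by (simp add: w'(2) w_eq)
    finally show ?thesis .
  qed
  define f' where "f' = f - kd (Suc r) W"
  have f'0: "f' (S, c) = 0" if "r \<in> S" for S c using kW[OF that] by (simp add: f'_def)
  have "ksupp (Suc r) p (kd (Suc r) W)" by (rule ksupp_kd[OF sW])
  then have sf1: "S \<subseteq> {..<Suc r} \<and> card S = p" if "f' (S, c) \<noteq> 0" for S c
    using that ksuppD[OF Suc(3), of S c] ksuppD[of "Suc r" p "kd (Suc r) W" S c]
    by (cases "f (S, c) = 0") (simp_all add: f'_def)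
  have sf': "ksupp r p f'" unfolding ksupp_def
  proof (intro allI impI)
    fix S c assume f: "f' (S, c) \<noteq> 0"
    then have "r \<notin> S" using f'0 by blast
    then show "S \<subseteq> {..<r} \<and> card S = p" using sf1[OF f] by (auto simp: less_Suc_eq)
  qed
  have "kd (Suc r) f' = 0" unfolding f'_def kd_diff Suc(5) by (rule ext) (simp add: kd_kd)
  then have k': "kd (Suc r) f' s = 0" for s by simp
  have "kd r f' = 0"
  proof
    fix s :: "nat set \<times> nat"
    obtain S c where s: "s = (S, c)" by fastforce
    show "kd r f' s = 0 s"
      using k'[of "(S, c)"] f'0[of "insert r S" c] by (cases "r \<in> S") (simp_all add: s kd_Suc_in kd_Suc_notin)
  qed
  then obtain u where u: "ksupp r (Suc p) u" "kd r u = f'" using Suc(1)[of p f'] Suc(2,4) sf' by auto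
  have "kd (Suc r) u = kd r u"
  proof
    fix s :: "nat set \<times> nat"
    obtain S c where s: "s = (S, c)" by fastforce
    have "u (insert r S, c) = 0" using ksuppD(1)[OF u(1), of "insert r S" c] by (rule_tac ccontr) auto
    then show "kd (Suc r) u s = kd r u s" by (cases "r \<in> S") (simp_all add: s kd_Suc_in kd_Suc_notin)
  qed
  then have "kd (Suc r) (W + u) = f" using u(2) by (simp add: kd_add f'_def)
  moreover have "ksupp (Suc r) (Suc p) (W + u)" unfolding ksupp_def
  proof (intro allI impI)
    fix S c assume "(W + u) (S, c) \<noteq> 0"
    then have "W (S, c) \<noteq> 0 \<or> u (S, c) \<noteq> 0" by auto
    then show "S \<subseteq> {..<Suc r} \<and> card S = Suc p"
    proof
      assume "W (S, c) \<noteq> 0"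
      then show ?thesis using ksuppD[OF sW] by simp
    next
      assume "u (S, c) \<noteq> 0"
      then have "S \<subseteq> {..<r}" "card S = Suc p" using ksuppD[OF u(1)] by simp_all
      then show ?thesis by auto
    qed
  qed
  ultimately show ?case by blast
qed

section \<open>Koszul homology of graded submodules of free modules\<close>

definition Hom :: "int \<Rightarrow> ('v, 'k::comm_ring_1) mpoly set" where "Hom e = {p. homogeneous e p}"

lemma Qv_subspace_Hom: "Qv.subspace (Hom e :: ('v::finite, 'k::field) mpoly set)"
  by (rule Qv.subspaceI) (auto simp: Hom_def qs_def intro: homogeneous_add homogeneous_kc_mult)

lemma finite_monomials: "finite {m :: 'v::finite \<Rightarrow>\<^sub>0 nat. mon_deg m = n}"
proof -
  have "lkp ` {m :: 'v \<Rightarrow>\<^sub>0 nat. mon_deg m = n} \<subseteq> PiE UNIV (\<lambda>_. {..n})"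
  proof safe
    fix m :: "'v \<Rightarrow>\<^sub>0 nat" and v assume "n = mon_deg m"
    then show "lkp m v \<le> mon_deg m" unfolding mon_deg_alt by (intro member_le_sum) auto
  qed auto
  moreover have "finite (PiE (UNIV :: 'v set) (\<lambda>_. {..n}))" by (rule finite_PiE) auto
  ultimately have "finite (lkp ` {m :: 'v \<Rightarrow>\<^sub>0 nat. mon_deg m = n})" by (rule finite_subset)
  then show ?thesis by (rule finite_imageD) (auto simp: inj_on_def intro: poly_mapping_eqI)
qed

lemma Qv_fd_Hom: "Qv.fd (Hom e :: ('v::finite, 'k::field) mpoly set)"
proof -
  let ?B = "(\<lambda>m. Poly_Mapping.single m 1 :: ('v, 'k) mpoly) ` {m. mon_deg m = nat e}"
  have "p \<in> Qv.span ?B" if p: "homogeneous e p" for p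
  proof -
    have "Poly_Mapping.single m (lkp p m) \<in> Qv.span ?B" if m: "m \<in> keys p" for m
    proof -
      have "mon_deg m = nat e" using p m unfolding homogeneous_def by (metis nat_int)
      then have "qs (lkp p m) (Poly_Mapping.single m 1) \<in> Qv.span ?B"
        by (intro Qv.span_scale Qv.span_base) blast
      then show ?thesis by (simp add: qs_def kc_def mult_single)
    qed
    then have "(\<Sum>m\<in>keys p. Poly_Mapping.single m (lkp p m)) \<in> Qv.span ?B" by (rule Qv.span_sum)
    then show ?thesis using poly_expand[of p] by simp
  qed
  then show ?thesis unfolding Qv.fd_def Hom_def using finite_monomials by (intro exI[of _ ?B]) auto
qed

section \<open>Graded submodules of free modules and their Koszul complexes\<close>

type_synonym 'k pvec = "nat \<Rightarrow> (4, 'k) mpoly"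

definition Fn :: "nat \<Rightarrow> 'k::comm_ring_1 pvec set" where "Fn n = {v. \<forall>c\<ge>n. v c = 0}"

text \<open>The basis vector with index \<open>c\<close> has degree \<open>a c\<close>, so the
  vectors of degree \<open>j\<close> have coordinates of degree \<open>j - a c\<close>.\<close>

definition hv :: "(nat \<Rightarrow> int) \<Rightarrow> int \<Rightarrow> 'k::comm_ring_1 pvec \<Rightarrow> 'k pvec" where
  "hv a j v = (\<lambda>c. hc (j - a c) (v c))"

definition gsub :: "(nat \<Rightarrow> int) \<Rightarrow> 'k::comm_ring_1 pvec set \<Rightarrow> bool" where
  "gsub a Z \<longleftrightarrow> (\<lambda>c. 0) \<in> Z \<and> (\<forall>u\<in>Z. \<forall>v\<in>Z. (\<lambda>c. u c + v c) \<in> Z) \<and> (\<forall>v\<in>Z. \<forall>q. (\<lambda>c. q * v c) \<in> Z) \<and>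
     (\<forall>v\<in>Z. \<forall>j. hv a j v \<in> Z)"

lemma gsubD: assumes "gsub a Z"
  shows "(\<lambda>c. 0) \<in> Z" "u \<in> Z \<Longrightarrow> v \<in> Z \<Longrightarrow> (\<lambda>c. u c + v c) \<in> Z" "v \<in> Z \<Longrightarrow> (\<lambda>c. q * v c) \<in> Z"
    "v \<in> Z \<Longrightarrow> hv a j v \<in> Z"
  using assms unfolding gsub_def by blast+

lemma gsub_Fn: "gsub a (Fn n)" unfolding gsub_def Fn_def hv_def by auto

text \<open>
  The degree \<open>j\<close> part of the \<open>p\<close>-th term of the Koszul complex of a submodule \<open>Z\<close> of a free module
  whose generators have the degrees \<open>a\<close>.
\<close>

definition KK :: "(nat \<Rightarrow> int) \<Rightarrow> nat \<Rightarrow> int \<Rightarrow> 'k::comm_ring_1 pvec set \<Rightarrow> 'k kchain set" where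
  "KK a p j Z = {f. ksupp 4 p f \<and> (\<forall>S c. homogeneous (j - int p - a c) (f (S, c))) \<and> (\<forall>S. (\<lambda>c. f (S, c)) \<in> Z)}"

lemma KK_I: "ksupp 4 p f \<Longrightarrow> (\<And>S c. homogeneous (j - int p - a c) (f (S, c))) \<Longrightarrow> (\<And>S. (\<lambda>c. f (S, c)) \<in> Z) \<Longrightarrow> f \<in> KK a p j Z"
  unfolding KK_def by simp

lemma KK_D: assumes "f \<in> KK a p j Z"
  shows "ksupp 4 p f" "homogeneous (j - int p - a c) (f (S, c))" "(\<lambda>c. f (S, c)) \<in> Z"
  using assms unfolding KK_def by simp_all

lemma KK_mono: "Z \<subseteq> Y \<Longrightarrow> KK a p j Z \<subseteq> KK a p j Y" unfolding KK_def by blast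

lemma ksupp_add: "ksupp r p f \<Longrightarrow> ksupp r p g \<Longrightarrow> ksupp r p (\<lambda>s. f s + g s)"
  unfolding ksupp_def by (metis add.right_neutral add.left_neutral)

lemma ksupp_mono: "ksupp r p f \<Longrightarrow> (\<And>S c. g (S, c) \<noteq> 0 \<Longrightarrow> \<exists>d. f (S, d) \<noteq> 0) \<Longrightarrow> ksupp r p g"
  unfolding ksupp_def by blast

lemma KK_subspace: fixes Z :: "'k::field pvec set" assumes "gsub a Z" shows "Fv.subspace (KK a p j Z)"
proof (rule Fv.subspaceI)
  show "0 \<in> KK a p j Z" by (rule KK_I) (use gsubD(1)[OF assms] in \<open>simp_all add: ksupp_def\<close>)
next
  fix f g assume f: "f \<in> KK a p j Z" and g: "g \<in> KK a p j Z"
  have "(\<lambda>s. f s + g s) \<in> KK a p j Z"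
    by (rule KK_I) (use ksupp_add[OF KK_D(1)[OF f] KK_D(1)[OF g]] KK_D(2)[OF f] KK_D(2)[OF g]
      gsubD(2)[OF assms KK_D(3)[OF f] KK_D(3)[OF g]] in \<open>simp_all add: homogeneous_add\<close>)
  then show "f + g \<in> KK a p j Z" by (simp add: plus_fun_def)
next
  fix c f assume f: "f \<in> KK a p j Z"
  show "fs c f \<in> KK a p j Z"
  proof (rule KK_I)
    show "ksupp 4 p (fs c f)" by (rule ksupp_mono[OF KK_D(1)[OF f]]) (auto simp: fs_def)
    show "homogeneous (j - int p - a d) (fs c f (S, d))" for S d
      unfolding fs_def by (rule homogeneous_kc_mult[OF KK_D(2)[OF f]])
    show "(\<lambda>d. fs c f (S, d)) \<in> Z" for S unfolding fs_def by (rule gsubD(3)[OF assms KK_D(3)[OF f]])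
  qed
qed

lemma KK_Fn_eq: "KK a p j (Fn n) =
   fun_space ({S. S \<subseteq> {..<4} \<and> card S = p} \<times> {..<n}) (\<lambda>s. Hom (j - int p - a (snd s)) :: (4, 'k::field) mpoly set)"
proof (rule Set.set_eqI, rule iffI)
  fix f :: "'k kchain"
  assume f: "f \<in> KK a p j (Fn n)"
  have "f (S, c) \<noteq> 0 \<Longrightarrow> S \<subseteq> {..<4} \<and> card S = p \<and> c < n" for S c
    using ksuppD[OF KK_D(1)[OF f], of S c] KK_D(3)[OF f, of S] by (auto simp: Fn_def) (meson not_le)
  then show "f \<in> fun_space ({S. S \<subseteq> {..<4} \<and> card S = p} \<times> {..<n}) (\<lambda>s. Hom (j - int p - a (snd s)))"
    using KK_D(2)[OF f] unfolding fun_space_def Hom_def by fastforce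
next
  fix f :: "'k kchain"
  assume f: "f \<in> fun_space ({S. S \<subseteq> {..<4} \<and> card S = p} \<times> {..<n}) (\<lambda>s. Hom (j - int p - a (snd s)))"
  have z: "f (S, c) = 0" if "\<not> (S \<subseteq> {..<4} \<and> card S = p \<and> c < n)" for S c
    using f that unfolding fun_space_def by auto
  have h: "homogeneous (j - int p - a c) (f (S, c))" for S c
  proof (cases "S \<subseteq> {..<4} \<and> card S = p \<and> c < n")
    case True
    then show ?thesis using f unfolding fun_space_def Hom_def by auto
  next
    case False
    show ?thesis unfolding z[OF False] by simp
  qed
  show "f \<in> KK a p j (Fn n)"
  proof (rule KK_I)
    show "ksupp 4 p f" unfolding ksupp_def using z by blast
    show "homogeneous (j - int p - a c) (f (S, c))" for S c by (rule h)
    show "(\<lambda>c. f (S, c)) \<in> Fn n" for S using z by (auto simp: Fn_def)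
  qed
qed

lemma finite_kindex: "finite ({S. S \<subseteq> {..<4::nat} \<and> card S = p} \<times> {..<n::nat})"
  by (rule finite_cartesian_product) (auto intro: finite_subset[of _ "Pow {..<4}"])

lemma KK_fd: fixes Z :: "'k::field pvec set" assumes "Z \<subseteq> Fn n" shows "Fv.fd (KK a p j Z)"
proof -
  have "Fv.fd (KK a p j (Fn n) :: 'k kchain set)" unfolding KK_Fn_eq
    using fun_space_dim[OF finite_kindex, of p n "\<lambda>s. Hom (j - int p - a (snd s)) :: (4, 'k) mpoly set"]
      Qv_subspace_Hom Qv_fd_Hom by blast
  then show ?thesis by (rule Fv.fd_subset[OF _ KK_mono[OF assms]])
qed

lemma kd_closed_vec: fixes Z :: "'k::comm_ring_1 pvec set" assumes "gsub a Z" "\<And>v. v < r \<Longrightarrow> v \<notin> S \<Longrightarrow> (\<lambda>c. f (insert v S, c)) \<in> Z"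
  shows "(\<lambda>c. kd r f (S, c)) \<in> Z"
  using assms(2)
proof (induct r)
  case 0 show ?case using gsubD(1)[OF assms(1)] by (simp add: kd_0)
next
  case (Suc r)
  then have *: "(\<lambda>c. kd r f (S, c)) \<in> Z" by simp
  show ?case
  proof (cases "r \<in> S")
    case True then show ?thesis using * by (simp add: kd_Suc_in)
  next
    case False
    then have "(\<lambda>c. f (insert r S, c)) \<in> Z" using Suc(2) by simp
    from gsubD(2)[OF assms(1) * gsubD(3)[OF assms(1) this, of "(-1) ^ card (S \<inter> {..<r}) * xv r"]]
    show ?thesis using False by (simp add: kd_Suc_notin)
  qed
qed

lemma hom_sign: "homogeneous 0 ((-1) ^ n :: ('v::finite, 'k::comm_ring_1) mpoly)"
proof -
  have "(-1) ^ n = (kc ((-1) ^ n) :: ('v, 'k) mpoly)" by (induct n) (simp_all add: kc_mult kc_minus)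
  then show ?thesis by simp
qed

lemma kd_homogeneous: "(\<And>v. v < r \<Longrightarrow> v \<notin> S \<Longrightarrow> homogeneous (e - 1) (f (insert v S, c))) \<Longrightarrow> homogeneous e (kd r f (S, c))"
proof (induct r)
  case (Suc r)
  then have *: "homogeneous e (kd r f (S, c))" by simp
  show ?case
  proof (cases "r \<in> S")
    case True then show ?thesis using * by (simp add: kd_Suc_in)
  next
    case False
    have "homogeneous (0 + 1 + (e - 1)) ((-1) ^ card (S \<inter> {..<r}) * xv r * f (insert r S, c))"
      by (intro homogeneous_mult hom_sign homogeneous_xv) (use Suc(2) False in simp)
    then show ?thesis using * False by (simp add: kd_Suc_notin homogeneous_add)
  qed
qed (simp add: kd_0)

lemma KK_kd: assumes Z: "gsub a Z" and f: "f \<in> KK a (Suc p) j Z" shows "kd r f \<in> KK a p j Z"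
proof (rule KK_I)
  show "ksupp 4 p (kd r f)" by (rule ksupp_kd[OF KK_D(1)[OF f]])
  show "homogeneous (j - int p - a c) (kd r f (S, c))" for S c
    by (rule kd_homogeneous) (use KK_D(2)[OF f, of c] in \<open>simp add: algebra_simps\<close>)
  show "(\<lambda>c. kd r f (S, c)) \<in> Z" for S by (rule kd_closed_vec[OF Z KK_D(3)[OF f]])
qed

text \<open>Projection to internal degree \<open>j\<close>, where an exterior monomial has the size
  of its index set as degree. The guard keeps \<open>card\<close> away from infinite sets.\<close>

definition hK :: "(nat \<Rightarrow> int) \<Rightarrow> int \<Rightarrow> 'k::comm_ring_1 kchain \<Rightarrow> 'k kchain" where
  "hK a j f = (\<lambda>(S, c). if S \<subseteq> {..<4} then hc (j - int (card S) - a c) (f (S, c)) else 0)"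

lemma hK_eq: "hK a j f (S, c) = (if S \<subseteq> {..<4} then hc (j - int (card S) - a c) (f (S, c)) else 0)"
  by (simp add: hK_def)

lemma hc_sign_mult: "hc e ((-1) ^ n * p) = (-1) ^ n * hc e p" for p :: "('v::finite, 'k::comm_ring_1) mpoly"
  using hc_mult[OF hom_sign, of e n p] by simp

lemma kd_hK: assumes "r \<le> 4" "ksupp 4 p f" shows "kd r (hK a j f) = hK a j (kd r f)"
proof
  fix s :: "nat set \<times> nat"
  obtain S c where s: "s = (S, c)" by fastforce
  show "kd r (hK a j f) s = hK a j (kd r f) s"
  proof (cases "S \<subseteq> {..<4}")
    case False
    have "kd r (hK a j f) (S, c) = 0" by (rule kd_zeroI) (use False in \<open>auto simp: hK_eq\<close>)
    then show ?thesis using False by (simp add: s hK_eq)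
  next
    case True
    then have fin: "finite S" using finite_subset by blast
    have "kd r (hK a j f) (S, c) = hc (j - int (card S) - a c) (kd r f (S, c))" using assms(1)
    proof (induct r)
      case (Suc r)
      have "hK a j f (insert r S, c) = hc (j - int (card S) - a c - 1) (f (insert r S, c))" if "r \<notin> S"
        using True Suc(2) that fin by (simp add: hK_eq algebra_simps)
      then show ?case using Suc
        by (cases "r \<in> S") (simp_all add: kd_Suc_in kd_Suc_notin hc_add mult.assoc hc_sign_mult hc_xv_mult)
    qed (simp add: kd_0)
    then show ?thesis using True by (simp add: s hK_eq)
  qed
qed

lemma hK_KK: assumes Z: "gsub a Z" and f: "ksupp 4 p f" "\<And>S. (\<lambda>c. f (S, c)) \<in> Z" shows "hK a j f \<in> KK a p j Z"
proof (rule KK_I)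
  show "ksupp 4 p (hK a j f)" by (rule ksupp_mono[OF f(1)]) (metis hK_eq hc_0)
  show "homogeneous (j - int p - a c) (hK a j f (S, c))" for S c
    using ksuppD[OF f(1), of S c] by (cases "f (S, c) = 0") (auto simp: hK_eq)
  show "(\<lambda>c. hK a j f (S, c)) \<in> Z" for S
    using gsubD(1)[OF Z] gsubD(4)[OF Z f(2)[of S], of "j - int (card S)"]
    by (cases "S \<subseteq> {..<4}") (simp_all add: hK_eq hv_def)
qed

lemma hK_id: assumes "f \<in> KK a p j Z" shows "hK a j f = f"
proof
  fix s :: "nat set \<times> nat"
  obtain S c where s: "s = (S, c)" by fastforce
  show "hK a j f s = f s"
    using ksuppD[OF KK_D(1)[OF assms], of S c] hc_id[OF KK_D(2)[OF assms, of c S]]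
    by (cases "f (S, c) = 0") (auto simp: hK_eq s)
qed

text \<open>A preimage given by \<open>kd_exact\<close> is cut down to the first \<open>n\<close>
  coordinates and then projected to degree \<open>j\<close>; both operations commute with the
  differential.\<close>

lemma KK_exact:
  assumes f: "f \<in> KK a p j (Fn n)" "kd 4 f = 0" "0 < p"
  shows "f \<in> kd 4 ` KK a (Suc p) j (Fn n)"
proof -
  obtain g where g: "ksupp 4 (Suc p) g" "kd 4 g = f" using kd_exact[OF _ KK_D(1)[OF f(1)] f(3,2)] by auto
  define g1 where "g1 = (\<lambda>(S, c). if c < n then g (S, c) else 0)"
  have s1: "ksupp 4 (Suc p) g1" by (rule ksupp_mono[OF g(1)]) (auto simp: g1_def split: if_splits)
  have "kd 4 g1 = f"
  proof
    fix s :: "nat set \<times> nat"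
    obtain S c where s: "s = (S, c)" by fastforce
    show "kd 4 g1 s = f s"
    proof (cases "c < n")
      case True
      have "kd 4 g1 (S, c) = kd 4 g (S, c)" by (rule kd_cong) (use True in \<open>simp add: g1_def\<close>)
      then show ?thesis using g(2) s by simp
    next
      case False
      have "kd 4 g1 (S, c) = 0" by (rule kd_zeroI) (use False in \<open>simp add: g1_def\<close>)
      moreover have "f (S, c) = 0" using KK_D(3)[OF f(1), of S] False by (simp add: Fn_def)
      ultimately show ?thesis using s by simp
    qed
  qed
  then have "f = kd 4 (hK a j g1)" using kd_hK[OF order_refl s1, of a j] hK_id[OF f(1)] by simp
  moreover have "hK a j g1 \<in> KK a (Suc p) j (Fn n)"
    by (rule hK_KK[OF gsub_Fn s1]) (auto simp: g1_def Fn_def)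
  ultimately show ?thesis by blast
qed

definition cyc where "cyc a p j Z = {f \<in> KK a p j Z. kd 4 f = 0}"
definition bd where "bd a p j Z = kd 4 ` KK a (Suc p) j Z"

text \<open>The degree \<open>j\<close> part of Koszul homology; the subtraction does not truncate, as boundaries are cycles.\<close>

definition kh :: "(nat \<Rightarrow> int) \<Rightarrow> nat \<Rightarrow> int \<Rightarrow> 'k::field pvec set \<Rightarrow> nat" where
  "kh a p j Z = Fv.dim (cyc a p j Z) - Fv.dim (bd a p j Z)"

lemma bd_cyc: "gsub a Z \<Longrightarrow> bd a p j Z \<subseteq> cyc a p j Z"
  unfolding bd_def cyc_def using KK_kd[of a Z _ p j 4] by (auto simp: fun_eq_iff kd_kd)

lemma cyc_0: "cyc a 0 j Z = KK a 0 j Z"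
  unfolding cyc_def using kd_ksupp_0[OF KK_D(1)] by auto

lemma cyc_subspace: fixes Z :: "'k::field pvec set" assumes "gsub a Z" shows "Fv.subspace (cyc a p j Z)"
  using FF.linear_subspace_kernel[OF linear_kd, of 4] Fv.subspace_inter[OF KK_subspace[OF assms, of p j]]
  unfolding cyc_def Collect_conj_eq[of "\<lambda>f. f \<in> KK a p j Z"] by (simp add: Collect_conj_eq)

lemma kh_eq: fixes Z :: "'k::field pvec set" assumes "gsub a Z" "Z \<subseteq> Fn n"
  shows "kh a p j Z + Fv.dim (bd a p j Z) = Fv.dim (cyc a p j Z)"
proof -
  have "cyc a p j Z \<subseteq> KK a p j Z" unfolding cyc_def by blast
  then have "Fv.fd (cyc a p j Z)" using Fv.fd_subset[OF KK_fd[OF assms(2)]] by blast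
  from Fv.dim_mono_fd[OF this bd_cyc[OF assms(1)]] show ?thesis unfolding kh_def by simp
qed

text \<open>With \<open>F = Fn n\<close>, \<open>Lsp\<close> and \<open>Dsp\<close> consist of the
  chains of \<open>F\<close> that become cycles and boundaries in the Koszul complex of
  \<open>F / Z\<close>, in exterior degree \<open>p + 1\<close>. Their quotient is the homology of
  \<open>F / Z\<close>, without a quotient module being formed.\<close>

definition Lsp where "Lsp a p j n Z = {f \<in> KK a (Suc p) j (Fn n). kd 4 f \<in> KK a p j Z}"
definition Dsp where "Dsp a p j n Z = {x + kd 4 y |x y. x \<in> KK a (Suc p) j Z \<and> y \<in> KK a (Suc (Suc p)) j (Fn n)}"

lemma Lsp_subspace: fixes Z :: "'k::field pvec set" assumes "gsub a Z" shows "Fv.subspace (Lsp a p j n Z)"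
proof -
  have "Fv.subspace (kd 4 -` KK a p j Z)"
    using FF.linear_subspace_vimage[OF linear_kd KK_subspace[OF assms]] .
  from Fv.subspace_inter[OF KK_subspace[OF gsub_Fn[of a n], of "Suc p" j] this]
  show ?thesis unfolding Lsp_def by (simp add: Int_def vimage_def)
qed

lemma Dsp_subspace: fixes Z :: "'k::field pvec set" assumes "gsub a Z" shows "Fv.subspace (Dsp a p j n Z)"
proof -
  have "Dsp a p j n Z = {x + y |x y. x \<in> KK a (Suc p) j Z \<and> y \<in> kd 4 ` KK a (Suc (Suc p)) j (Fn n)}"
    unfolding Dsp_def by blast
  then show ?thesis
    using Fv.subspace_sums[OF KK_subspace[OF assms] FF.linear_subspace_image[OF linear_kd KK_subspace[OF gsub_Fn]]]
    by simp
qed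

lemma Lsp_fd: fixes Z :: "'k::field pvec set" shows "Fv.fd (Lsp a p j n Z)"
  by (rule Fv.fd_subset[OF KK_fd[OF order_refl, of a "Suc p" j n]]) (auto simp: Lsp_def)

lemma Dsp_Lsp: fixes Z :: "'k::field pvec set" assumes "gsub a Z" "Z \<subseteq> Fn n" shows "Dsp a p j n Z \<subseteq> Lsp a p j n Z"
proof
  fix f assume "f \<in> Dsp a p j n Z"
  then obtain x y where f: "f = x + kd 4 y" "x \<in> KK a (Suc p) j Z" "y \<in> KK a (Suc (Suc p)) j (Fn n)"
    unfolding Dsp_def by blast
  have "kd 4 f = kd 4 x" unfolding f(1) kd_add by (rule ext) (simp add: kd_kd)
  moreover have "kd 4 x \<in> KK a p j Z" by (rule KK_kd[OF assms(1) f(2)])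
  moreover have "x \<in> KK a (Suc p) j (Fn n)" using f(2) KK_mono[OF assms(2)] by blast
  moreover have "kd 4 y \<in> KK a (Suc p) j (Fn n)" by (rule KK_kd[OF gsub_Fn f(3)])
  ultimately show "f \<in> Lsp a p j n Z" unfolding Lsp_def
    using Fv.subspace_add[OF KK_subspace[OF gsub_Fn[of a n], of "Suc p" j], of x "kd 4 y"] f(1) by simp
qed

text \<open>The connecting map of the long exact sequence: the differential takes \<open>Lsp\<close>
  onto the cycles of \<open>Z\<close>, by \<open>H\<close>, and \<open>Dsp\<close> onto its
  boundaries. Its kernel on \<open>Lsp\<close> lies in \<open>Dsp\<close> because the Koszul complex
  of the free module is exact.\<close>

lemma kh_subspace_step:
  fixes Z :: "'k::field pvec set"
  assumes Z: "gsub a Z" "Z \<subseteq> Fn n" and H: "cyc a p j Z \<subseteq> bd a p j (Fn n)"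
  shows "Fv.dim (Lsp a p j n Z) = Fv.dim (Dsp a p j n Z) + kh a p j Z"
proof -
  have 1: "kd 4 ` Lsp a p j n Z = cyc a p j Z"
  proof (rule equalityI; rule subsetI)
    fix z assume "z \<in> kd 4 ` Lsp a p j n Z"
    then show "z \<in> cyc a p j Z" unfolding Lsp_def cyc_def by (auto simp: fun_eq_iff kd_kd)
  next
    fix z assume z: "z \<in> cyc a p j Z"
    then obtain g where "g \<in> KK a (Suc p) j (Fn n)" "z = kd 4 g" using H unfolding bd_def by blast
    then show "z \<in> kd 4 ` Lsp a p j n Z" using z unfolding Lsp_def cyc_def by blast
  qed
  have 2: "kd 4 ` Dsp a p j n Z = bd a p j Z"
  proof (rule equalityI; rule subsetI)
    fix z assume "z \<in> kd 4 ` Dsp a p j n Z"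
    then obtain x y where xy: "x \<in> KK a (Suc p) j Z" "z = kd 4 (x + kd 4 y)" unfolding Dsp_def by blast
    have "z = kd 4 x" unfolding xy(2) kd_add by (rule ext) (simp add: kd_kd)
    then show "z \<in> bd a p j Z" unfolding bd_def using xy(1) by blast
  next
    fix z assume "z \<in> bd a p j Z"
    then obtain x where x: "x \<in> KK a (Suc p) j Z" "z = kd 4 x" unfolding bd_def by blast
    have "x + kd 4 0 \<in> Dsp a p j n Z" unfolding Dsp_def
      using x(1) Fv.subspace_0[OF KK_subspace[OF gsub_Fn[of a n], of "Suc (Suc p)" j]] by blast
    then show "z \<in> kd 4 ` Dsp a p j n Z" unfolding x(2) kd_0_fun by simp
  qed
  have K: "x \<in> Dsp a p j n Z" if "x \<in> Lsp a p j n Z" "kd 4 x = 0" for x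
  proof -
    have "x \<in> kd 4 ` KK a (Suc (Suc p)) j (Fn n)"
      by (rule KK_exact) (use that in \<open>simp_all add: Lsp_def\<close>)
    then obtain y where y: "y \<in> KK a (Suc (Suc p)) j (Fn n)" "x = kd 4 y" by blast
    have "0 + kd 4 y \<in> Dsp a p j n Z" unfolding Dsp_def
      using y(1) Fv.subspace_0[OF KK_subspace[OF Z(1), of "Suc p" j]] by blast
    then show ?thesis using y(2) by simp
  qed
  from FF.dim_quotient_transfer[OF linear_kd[of 4] Lsp_subspace[OF Z(1)] Lsp_fd Dsp_subspace[OF Z(1)] Dsp_Lsp[OF Z] K]
  show ?thesis using kh_eq[OF Z, of p j] unfolding 1 2 by simp
qed

section \<open>Graded matrices acting on Koszul complexes\<close>

definition mapp :: "nat \<Rightarrow> nat \<Rightarrow> (nat \<Rightarrow> nat \<Rightarrow> (4, 'k::comm_ring_1) mpoly) \<Rightarrow> 'k pvec \<Rightarrow> 'k pvec" where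
  "mapp n n' M v = (\<lambda>r. if r < n' then \<Sum>c<n. M r c * v c else 0)"

definition mapK :: "nat \<Rightarrow> nat \<Rightarrow> (nat \<Rightarrow> nat \<Rightarrow> (4, 'k::comm_ring_1) mpoly) \<Rightarrow> 'k kchain \<Rightarrow> 'k kchain" where
  "mapK n n' M f = (\<lambda>(S, r). mapp n n' M (\<lambda>c. f (S, c)) r)"

definition gradedM :: "(nat \<Rightarrow> int) \<Rightarrow> (nat \<Rightarrow> int) \<Rightarrow> nat \<Rightarrow> nat \<Rightarrow> (nat \<Rightarrow> nat \<Rightarrow> (4, 'k::comm_ring_1) mpoly) \<Rightarrow> bool" where
  "gradedM a a' n n' M \<longleftrightarrow> (\<forall>r<n'. \<forall>c<n. homogeneous (a c - a' r) (M r c))"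

definition kerp :: "nat \<Rightarrow> nat \<Rightarrow> (nat \<Rightarrow> nat \<Rightarrow> (4, 'k::comm_ring_1) mpoly) \<Rightarrow> 'k pvec set" where
  "kerp n n' M = {v \<in> Fn n. mapp n n' M v = (\<lambda>r. 0)}"

lemma mapK_eq: "mapK n n' M f (S, r) = mapp n n' M (\<lambda>c. f (S, c)) r" by (simp add: mapK_def)

lemma mapp_add: "mapp n n' M (\<lambda>c. u c + v c) = (\<lambda>r. mapp n n' M u r + mapp n n' M v r)"
  by (simp add: mapp_def fun_eq_iff distrib_left sum.distrib)

lemma mapp_qmult: "mapp n n' M (\<lambda>c. q * v c) = (\<lambda>r. q * mapp n n' M v r)"
  by (simp add: mapp_def fun_eq_iff sum_distrib_left mult.left_commute)

lemma mapp_zero: "mapp n n' M (\<lambda>c. 0) = (\<lambda>r. 0)" by (simp add: mapp_def fun_eq_iff)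

lemma mapp_hv: assumes "gradedM a a' n n' M" shows "hv a' j (mapp n n' M v) = mapp n n' M (hv a j v)"
proof
  fix r
  have "hc (j - a' r) (M r c * v c) = M r c * hc (j - a c) (v c)" if "r < n'" "c < n" for c
    using hc_mult[of "a c - a' r" "M r c" "j - a' r" "v c"] assms that unfolding gradedM_def by simp
  then show "hv a' j (mapp n n' M v) r = mapp n n' M (hv a j v) r"
    by (simp add: hv_def mapp_def hc_sum)
qed

lemma mapp_Fn: "mapp n n' M v \<in> Fn n'" by (simp add: mapp_def Fn_def)

lemma gsub_image: assumes "gradedM a a' n n' M" "gsub a Y" shows "gsub a' (mapp n n' M ` Y)"
  unfolding gsub_def
proof (intro conjI ballI allI)
  show "(\<lambda>c. 0) \<in> mapp n n' M ` Y"
    by (rule image_eqI, rule mapp_zero[symmetric], rule gsubD(1)[OF assms(2)])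
next
  fix u v assume "u \<in> mapp n n' M ` Y" "v \<in> mapp n n' M ` Y"
  then obtain x y where xy: "u = mapp n n' M x" "x \<in> Y" "v = mapp n n' M y" "y \<in> Y" by blast
  show "(\<lambda>c. u c + v c) \<in> mapp n n' M ` Y" unfolding xy(1,3)
    by (rule image_eqI, rule mapp_add[symmetric], rule gsubD(2)[OF assms(2) xy(2,4)])
next
  fix v q assume "v \<in> mapp n n' M ` Y"
  then obtain x where x: "v = mapp n n' M x" "x \<in> Y" by blast
  show "(\<lambda>c. q * v c) \<in> mapp n n' M ` Y" unfolding x(1)
    by (rule image_eqI, rule mapp_qmult[symmetric], rule gsubD(3)[OF assms(2) x(2)])
next
  fix v j assume "v \<in> mapp n n' M ` Y"
  then obtain x where x: "v = mapp n n' M x" "x \<in> Y" by blast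
  show "hv a' j v \<in> mapp n n' M ` Y" unfolding x(1)
    by (rule image_eqI, rule mapp_hv[OF assms(1)], rule gsubD(4)[OF assms(2) x(2)])
qed

lemma gsub_kerp: assumes "gradedM a a' n n' M" shows "gsub a (kerp n n' M)"
  unfolding gsub_def
proof (intro conjI ballI allI)
  show "(\<lambda>c. 0) \<in> kerp n n' M" by (simp add: kerp_def mapp_zero Fn_def)
next
  fix u v assume "u \<in> kerp n n' M" "v \<in> kerp n n' M"
  then show "(\<lambda>c. u c + v c) \<in> kerp n n' M" by (simp add: kerp_def mapp_add Fn_def)
next
  fix v q assume "v \<in> kerp n n' M"
  then show "(\<lambda>c. q * v c) \<in> kerp n n' M" by (simp add: kerp_def mapp_qmult Fn_def)
next
  fix v j assume "v \<in> kerp n n' M"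
  then show "hv a j v \<in> kerp n n' M"
    using gsubD(4)[OF gsub_Fn[of a n], of v j] mapp_hv[OF assms, of j v] by (simp add: kerp_def) (simp add: hv_def)
qed

lemma kerp_Fn: "kerp n n' M \<subseteq> Fn n" unfolding kerp_def by blast

lemma mapK_lin: "mapK n n' M (f + g) = mapK n n' M f + mapK n n' M g" "mapK n n' M (fs c f) = fs c (mapK n n' M f)"
proof -
  show "mapK n n' M (f + g) = mapK n n' M f + mapK n n' M g"
    by (rule ext) (simp add: mapK_def mapp_add split: prod.split)
  show "mapK n n' M (fs c f) = fs c (mapK n n' M f)"
    by (rule ext) (simp add: mapK_def mapp_qmult fs_def split: prod.split)
qed

lemma linear_mapK: "Vector_Spaces.linear fs fs (mapK n n' M)"
  by (rule linear_FF_I) (simp_all only: mapK_lin)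

lemma mapK_kd: "kd r (mapK n n' M f) = mapK n n' M (kd r f)"
proof
  fix s :: "nat set \<times> nat"
  obtain S c where s: "s = (S, c)" by fastforce
  have "kd r (mapK n n' M f) (S, c) = mapK n n' M (kd r f) (S, c)"
  proof (induct r)
    case 0 show ?case by (simp add: kd_0 mapK_eq mapp_def)
  next
    case (Suc r)
    show ?case
    proof (cases "r \<in> S")
      case True
      then show ?thesis using Suc by (simp add: kd_Suc_in mapK_eq)
    next
      case False
      have "mapK n n' M (kd (Suc r) f) (S, c) = mapp n n' M (\<lambda>c. kd r f (S, c) + ((-1) ^ card (S \<inter> {..<r}) * xv r) * f (insert r S, c)) c"
        by (simp add: mapK_eq kd_Suc_notin[OF False])
      also have "\<dots> = mapp n n' M (\<lambda>c. kd r f (S, c)) c + ((-1) ^ card (S \<inter> {..<r}) * xv r) * mapp n n' M (\<lambda>c. f (insert r S, c)) c"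
        unfolding mapp_add mapp_qmult ..
      finally show ?thesis using Suc False by (simp add: kd_Suc_notin mapK_eq)
    qed
  qed
  then show "kd r (mapK n n' M f) s = mapK n n' M (kd r f) s" unfolding s .
qed

lemma mapK_KK: assumes M: "gradedM a a' n n' M" and f: "f \<in> KK a p j Y"
  shows "mapK n n' M f \<in> KK a' p j (mapp n n' M ` Y)"
proof (rule KK_I)
  show "ksupp 4 p (mapK n n' M f)"
  proof (rule ksupp_mono[OF KK_D(1)[OF f]])
    fix S c assume nz: "mapK n n' M f (S, c) \<noteq> 0"
    show "\<exists>d. f (S, d) \<noteq> 0"
    proof (rule ccontr)
      assume "\<not> ?thesis"
      then have "(\<lambda>c. f (S, c)) = (\<lambda>c. 0)" by (simp add: fun_eq_iff)
      then have "mapK n n' M f (S, c) = 0" by (simp only: mapK_eq mapp_zero)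
      with nz show False by contradiction
    qed
  qed
  show "homogeneous (j - int p - a' r) (mapK n n' M f (S, r))" for S r
  proof (cases "r < n'")
    case True
    have "homogeneous (j - int p - a' r) (M r c * f (S, c))" if "c < n" for c
    proof -
      have "homogeneous (a c - a' r) (M r c)" using M that True unfolding gradedM_def by blast
      from homogeneous_mult[OF this KK_D(2)[OF f, of c S]] show ?thesis by (simp add: algebra_simps)
    qed
    then show ?thesis using True by (auto simp: mapK_eq mapp_def intro!: homogeneous_sum)
  next
    case False then show ?thesis by (simp add: mapK_eq mapp_def)
  qed
  show "(\<lambda>c. mapK n n' M f (S, c)) \<in> mapp n n' M ` Y" for S
    unfolding mapK_eq using KK_D(3)[OF f, of S] by (intro image_eqI[of _ _ "\<lambda>c. f (S, c)"]) simp_all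
qed

lemma mapK_hK: assumes "gradedM a a' n n' M" shows "mapK n n' M (hK a j f) = hK a' j (mapK n n' M f)"
proof
  fix s :: "nat set \<times> nat"
  obtain S c where s: "s = (S, c)" by fastforce
  show "mapK n n' M (hK a j f) s = hK a' j (mapK n n' M f) s"
  proof (cases "S \<subseteq> {..<4}")
    case True
    show ?thesis using fun_cong[OF mapp_hv[OF assms, of "j - int (card S)" "\<lambda>c. f (S, c)"], of c] True
      by (simp add: s mapK_eq hK_eq hv_def)
  next
    case False
    then show ?thesis by (simp add: s mapK_eq hK_eq mapp_def)
  qed
qed

text \<open>Each coefficient vector is lifted separately, by 0 wherever the chain vanishes so that
  the exterior degree is kept; the projection \<open>hK\<close> then makes the lift
  homogeneous.\<close>

lemma mapK_surj: assumes M: "gradedM a a' n n' M" and Y: "gsub a Y" and g: "g \<in> KK a' p j (mapp n n' M ` Y)"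
  shows "\<exists>f\<in>KK a p j Y. mapK n n' M f = g"
proof -
  have "\<forall>S. \<exists>v. v \<in> Y \<and> mapp n n' M v = (\<lambda>c. g (S, c))" using KK_D(3)[OF g] by (metis (no_types, lifting) imageE)
  then obtain h where h: "\<And>S. h S \<in> Y" "\<And>S. mapp n n' M (h S) = (\<lambda>c. g (S, c))" by metis
  define f where "f = (\<lambda>(S, c). if \<exists>d. g (S, d) \<noteq> 0 then h S c else 0)"
  have fe: "f (S, c) = (if \<exists>d. g (S, d) \<noteq> 0 then h S c else 0)" for S c by (simp add: f_def)
  have sf: "ksupp 4 p f" by (rule ksupp_mono[OF KK_D(1)[OF g]]) (auto simp: fe split: if_splits)
  have fY: "(\<lambda>c. f (S, c)) \<in> Y" for S using h(1)[of S] gsubD(1)[OF Y] by (cases "\<exists>d. g (S, d) \<noteq> 0") (simp_all add: fe)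
  have "mapK n n' M f = g"
  proof
    fix s :: "nat set \<times> nat"
    obtain S c where s: "s = (S, c)" by fastforce
    show "mapK n n' M f s = g s"
    proof (cases "\<exists>d. g (S, d) \<noteq> 0")
      case True
      then show ?thesis using fun_cong[OF h(2)[of S], of c] by (simp add: s mapK_eq fe)
    next
      case False
      then show ?thesis by (simp add: s mapK_eq fe mapp_zero)
    qed
  qed
  then have "mapK n n' M (hK a j f) = g" using mapK_hK[OF M, of j f] hK_id[OF g] by simp
  then show ?thesis using hK_KK[OF Y sf fY, of j] by blast
qed

lemma mapK_kernel: assumes "f \<in> KK a p j (Fn n)" shows "mapK n n' M f = 0 \<longleftrightarrow> f \<in> KK a p j (kerp n n' M)"
proof
  assume 0: "mapK n n' M f = 0"
  have "mapp n n' M (\<lambda>c. f (S, c)) = (\<lambda>r. 0)" for S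
  proof
    fix r show "mapp n n' M (\<lambda>c. f (S, c)) r = 0" using fun_cong[OF 0, of "(S, r)"] by (simp add: mapK_eq)
  qed
  then show "f \<in> KK a p j (kerp n n' M)"
    using KK_D[OF assms] by (intro KK_I) (simp_all add: kerp_def)
next
  assume f: "f \<in> KK a p j (kerp n n' M)"
  show "mapK n n' M f = 0"
  proof
    fix s :: "nat set \<times> nat"
    obtain S c where s: "s = (S, c)" by fastforce
    show "mapK n n' M f s = 0 s" using KK_D(3)[OF f, of S] by (simp add: s mapK_eq kerp_def)
  qed
qed

text \<open>The image of \<open>M\<close> is the free module modulo \<open>kerp\<close>. So
  \<open>mapK\<close> takes \<open>Lsp\<close> onto the cycles and \<open>Dsp\<close> onto the
  boundaries of the image, with kernel inside \<open>Dsp\<close>.\<close>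

lemma kh_quotient_step:
  fixes M :: "nat \<Rightarrow> nat \<Rightarrow> (4, 'k::field) mpoly"
  assumes M: "gradedM a a' n n' M"
  shows "Fv.dim (Lsp a p j n (kerp n n' M)) = Fv.dim (Dsp a p j n (kerp n n' M)) + kh a' (Suc p) j (mapp n n' M ` Fn n)"
proof -
  let ?Z = "kerp n n' M" and ?M = "mapp n n' M ` Fn n" and ?\<phi> = "mapK n n' M"
  note Z = gsub_kerp[OF M] kerp_Fn[of n n' M]
  have gM: "gsub a' ?M" by (rule gsub_image[OF M gsub_Fn])
  have MF: "?M \<subseteq> Fn n'" using mapp_Fn by blast
  have kdz: "kd r 0 = 0" for r by (rule kd_0_fun)
  have 1: "?\<phi> ` Lsp a p j n ?Z = cyc a' (Suc p) j ?M"
  proof (rule equalityI; rule subsetI)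
    fix z assume "z \<in> ?\<phi> ` Lsp a p j n ?Z"
    then obtain f where f: "f \<in> KK a (Suc p) j (Fn n)" "kd 4 f \<in> KK a p j ?Z" "z = ?\<phi> f" unfolding Lsp_def by blast
    have "kd 4 z = ?\<phi> (kd 4 f)" unfolding f(3) by (rule mapK_kd)
    also have "\<dots> = 0" using mapK_kernel[OF KK_kd[OF gsub_Fn f(1)]] f(2) by blast
    finally show "z \<in> cyc a' (Suc p) j ?M" unfolding cyc_def using mapK_KK[OF M f(1)] f(3) by blast
  next
    fix z assume "z \<in> cyc a' (Suc p) j ?M"
    then have z: "z \<in> KK a' (Suc p) j ?M" "kd 4 z = 0" unfolding cyc_def by blast+
    obtain f where f: "f \<in> KK a (Suc p) j (Fn n)" "?\<phi> f = z" using mapK_surj[OF M gsub_Fn z(1)] by blast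
    have "?\<phi> (kd 4 f) = 0" using mapK_kd[of 4 n n' M f] f(2) z(2) by simp
    then have "kd 4 f \<in> KK a p j ?Z" using mapK_kernel[OF KK_kd[OF gsub_Fn f(1)]] by blast
    then show "z \<in> ?\<phi> ` Lsp a p j n ?Z" unfolding Lsp_def using f by blast
  qed
  have 2: "?\<phi> ` Dsp a p j n ?Z = bd a' (Suc p) j ?M"
  proof (rule equalityI; rule subsetI)
    fix z assume "z \<in> ?\<phi> ` Dsp a p j n ?Z"
    then obtain x y where xy: "x \<in> KK a (Suc p) j ?Z" "y \<in> KK a (Suc (Suc p)) j (Fn n)" "z = ?\<phi> (x + kd 4 y)"
      unfolding Dsp_def by blast
    have "x \<in> KK a (Suc p) j (Fn n)" using xy(1) KK_mono[OF Z(2)] by blast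
    then have "?\<phi> x = 0" using mapK_kernel xy(1) by blast
    then have "z = kd 4 (?\<phi> y)" unfolding xy(3) mapK_lin mapK_kd by simp
    then show "z \<in> bd a' (Suc p) j ?M" unfolding bd_def using mapK_KK[OF M xy(2)] by blast
  next
    fix z assume "z \<in> bd a' (Suc p) j ?M"
    then obtain h where h: "h \<in> KK a' (Suc (Suc p)) j ?M" "z = kd 4 h" unfolding bd_def by blast
    obtain y where y: "y \<in> KK a (Suc (Suc p)) j (Fn n)" "?\<phi> y = h" using mapK_surj[OF M gsub_Fn h(1)] by blast
    have "z = ?\<phi> (0 + kd 4 y)" using h(2) y(2) mapK_kd[of 4 n n' M y] by simp
    moreover have "0 + kd 4 y \<in> Dsp a p j n ?Z" unfolding Dsp_def
      using y(1) Fv.subspace_0[OF KK_subspace[OF Z(1), of "Suc p" j]] by blast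
    ultimately show "z \<in> ?\<phi> ` Dsp a p j n ?Z" by blast
  qed
  have K: "x \<in> Dsp a p j n ?Z" if "x \<in> Lsp a p j n ?Z" "?\<phi> x = 0" for x
  proof -
    have "x \<in> KK a (Suc p) j ?Z" using that mapK_kernel unfolding Lsp_def by blast
    then have "x + kd 4 0 \<in> Dsp a p j n ?Z" unfolding Dsp_def
      using Fv.subspace_0[OF KK_subspace[OF gsub_Fn[of a n], of "Suc (Suc p)" j]] by blast
    then show ?thesis unfolding kdz by simp
  qed
  from FF.dim_quotient_transfer[OF linear_mapK[of n n' M] Lsp_subspace[OF Z(1)] Lsp_fd Dsp_subspace[OF Z(1)] Dsp_Lsp[OF Z] K]
  show ?thesis using kh_eq[OF gM MF, of "Suc p" j] unfolding 1 2 by simp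
qed

section \<open>Minimal covers by free modules\<close>

definition irrv :: "'k::comm_ring_1 pvec set" where "irrv = {v. \<forall>c. lkp (v c) 0 = 0}"

text \<open>The differential from exterior degree 1 to 0 forms the linear combinations of the
  variables, and by \<open>varid_4\<close> these are the polynomials without constant term.\<close>

lemma bd_0_free: "bd a 0 j (Fn n) = KK a 0 j (Fn n \<inter> irrv)"
proof (rule equalityI; rule subsetI)
  fix f :: "'k::comm_ring_1 kchain" assume "f \<in> bd a 0 j (Fn n)"
  then obtain g where g: "g \<in> KK a (Suc 0) j (Fn n)" "f = kd 4 g" unfolding bd_def by blast
  have f: "f \<in> KK a 0 j (Fn n)" unfolding g(2) by (rule KK_kd[OF gsub_Fn g(1)])
  have "lkp (f (S, c)) 0 = 0" for S c
  proof (cases "S = {}")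
    case True
    have "f (S, c) \<in> varid 4" unfolding g(2) True kd_empty varid_def by (intro CollectI exI[of _ "\<lambda>i. g ({i}, c)"]) (rule refl)
    then show ?thesis by (simp add: varid_4)
  next
    case False
    then have "f (S, c) = 0" using ksuppD(2)[OF KK_D(1)[OF f], of S c] ksuppD_finite[OF KK_D(1)[OF f], of S c] by auto
    then show ?thesis by simp
  qed
  then show "f \<in> KK a 0 j (Fn n \<inter> irrv)" using KK_D[OF f] by (intro KK_I) (simp_all add: irrv_def)
next
  fix f :: "'k::comm_ring_1 kchain" assume f: "f \<in> KK a 0 j (Fn n \<inter> irrv)"
  have f': "f \<in> KK a 0 j (Fn n)" using f KK_mono[of "Fn n \<inter> irrv" "Fn n"] by blast
  have "\<forall>c. \<exists>q. f ({}, c) = (\<Sum>i<4. xv i * q i)"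
    using KK_D(3)[OF f, of "{}"] varid_4 unfolding irrv_def varid_def by blast
  then obtain q where q: "\<And>c. f ({}, c) = (\<Sum>i<4. xv i * q c i)" by metis
  define g where "g = (\<lambda>(S, c). if c < n then \<Sum>i<4. if S = {i} then q c i else 0 else 0)"
  have ge: "g (S, c) = (if c < n then \<Sum>i<4. if S = {i} then q c i else 0 else 0)" for S c by (simp add: g_def)
  have sg: "ksupp 4 (Suc 0) g" unfolding ksupp_def
  proof (intro allI impI)
    fix S c assume nz: "g (S, c) \<noteq> 0"
    have "\<exists>i<4. S = {i}"
    proof (rule ccontr)
      assume "\<not> ?thesis"
      then have "(\<Sum>i<4. if S = {i} then q c i else 0) = 0" by (intro sum.neutral) auto
      then have "g (S, c) = 0" by (cases "c < n") (simp_all only: ge if_True if_False)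
      with nz show False by contradiction
    qed
    then show "S \<subseteq> {..<4} \<and> card S = Suc 0" by auto
  qed
  have "kd 4 g = f"
  proof
    fix s :: "nat set \<times> nat"
    obtain S c where s: "s = (S, c)" by fastforce
    show "kd 4 g s = f s"
    proof (cases "S = {}")
      case True
      have "g ({i}, c) = (if c < n then q c i else 0)" if "i < 4" for i
        using that by (simp add: ge eq_commute)
      moreover have "f ({}, c) = 0" if "\<not> c < n" using KK_D(3)[OF f', of "{}"] that by (simp add: Fn_def)
      ultimately show ?thesis using q[of c] by (cases "c < n") (simp_all add: s True kd_empty)
    next
      case False
      have "kd 4 g (S, c) = 0" using False ksuppD(2)[OF ksupp_kd[OF sg], of 4 S c] ksuppD_finite[OF ksupp_kd[OF sg], of 4 S c] by auto
      moreover have "f (S, c) = 0" using False ksuppD(2)[OF KK_D(1)[OF f], of S c] ksuppD_finite[OF KK_D(1)[OF f], of S c] by auto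
      ultimately show ?thesis by (simp add: s)
    qed
  qed
  then have "f = kd 4 (hK a j g)" using kd_hK[OF order_refl sg, of a j] hK_id[OF f'] by simp
  moreover have "hK a j g \<in> KK a (Suc 0) j (Fn n)" by (rule hK_KK[OF gsub_Fn sg]) (simp add: ge Fn_def)
  ultimately show "f \<in> bd a 0 j (Fn n)" unfolding bd_def by blast
qed

lemma cyc_bd_free: assumes "Z \<subseteq> Fn n" "p = 0 \<Longrightarrow> Z \<subseteq> irrv" shows "cyc a p j Z \<subseteq> bd a p j (Fn n)"
proof (cases "p = 0")
  case True
  then have "Z \<subseteq> Fn n \<inter> irrv" using assms by blast
  then show ?thesis unfolding True cyc_0 bd_0_free by (rule KK_mono)
next
  case False
  show ?thesis
  proof
    fix f assume "f \<in> cyc a p j Z"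
    then have "f \<in> KK a p j (Fn n)" "kd 4 f = 0" unfolding cyc_def using KK_mono[OF assms(1)] by blast+
    then show "f \<in> bd a p j (Fn n)" unfolding bd_def using KK_exact False by blast
  qed
qed

text \<open>Both sides are the dimension of \<open>Lsp\<close> modulo \<open>Dsp\<close>. This is
  dimension shifting for Tor along a free cover; minimality makes the inclusion of the kernel zero
  on homology in exterior degree 0.\<close>

theorem kh_shift:
  fixes M :: "nat \<Rightarrow> nat \<Rightarrow> (4, 'k::field) mpoly"
  assumes M: "gradedM a a' n n' M" and m: "kerp n n' M \<subseteq> irrv"
  shows "kh a' (Suc p) j (mapp n n' M ` Fn n) = kh a p j (kerp n n' M)"
  using kh_quotient_step[OF M, of p j]
    kh_subspace_step[OF gsub_kerp[OF M] kerp_Fn cyc_bd_free[OF kerp_Fn m], of p j] by simp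

lemma dim_Hom_irr: "Qv.dim (Hom e :: ('v::finite, 'k::field) mpoly set) =
   Qv.dim (Hom e \<inter> {p. lkp p 0 = 0} :: ('v, 'k) mpoly set) + (if e = 0 then 1 else 0)"
proof (cases "e = 0")
  case False
  then have "Hom e \<inter> {p. lkp p 0 = 0} = (Hom e :: ('v, 'k) mpoly set)"
    by (auto simp: Hom_def homogeneous_def in_keys_iff)
  then show ?thesis using False by simp
next
  case True
  have 1: "(Hom 0 :: ('v, 'k) mpoly set) = range kc"
  proof (rule equalityI; rule subsetI)
    fix p :: "('v, 'k) mpoly" assume "p \<in> Hom 0"
    then have "p = kc (lkp p 0)" unfolding Hom_def by (intro homogeneous_degree_0) simp
    then show "p \<in> range kc" by (rule image_eqI) simp
  qed (auto simp: Hom_def)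
  have 2: "Hom 0 \<inter> {p. lkp p 0 = 0} = {0 :: ('v, 'k) mpoly}" unfolding 1 by (auto simp: lkp_kc)
  show ?thesis unfolding True 2 by (simp add: 1 fd_constants Qv.dim_zero)
qed

text \<open>Homology in exterior degree 0 is the free module modulo the irrelevant ideal. By
  \<open>dim_Hom_irr\<close> a coordinate contributes 1 exactly if its degree part consists of
  constants.\<close>

lemma kh_free: "kh a 0 j (Fn n :: 'k::field pvec set) = card {c. c < n \<and> a c = j}"
proof -
  let ?J = "{S. S \<subseteq> {..<4::nat} \<and> card S = 0} \<times> {..<n}"
  let ?U = "\<lambda>s. Hom (j - a (snd s)) :: (4, 'k) mpoly set"
  let ?V = "\<lambda>s. ?U s \<inter> {p. lkp p 0 = 0}"
  have J: "?J = {{}} \<times> {..<n}" using finite_subset[of _ "{..<4::nat}"] by auto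
  have fJ: "finite ?J" by (rule finite_kindex)
  have sV: "Qv.subspace {p :: (4, 'k) mpoly. lkp p 0 = 0}"
    by (rule Qv.subspaceI) (auto simp: lookup_add qs_def)
  have c: "cyc a 0 j (Fn n) = fun_space ?J ?U" unfolding cyc_0 KK_Fn_eq by simp
  have b: "bd a 0 j (Fn n) = fun_space ?J ?V"
  proof -
    have "KK a 0 j (Fn n \<inter> irrv) = {f \<in> KK a 0 j (Fn n). \<forall>s. lkp (f s) 0 = 0}"
      unfolding KK_def irrv_def by auto
    also have "\<dots> = {f \<in> fun_space ?J ?U. \<forall>s. lkp (f s) 0 = 0}" unfolding KK_Fn_eq by simp
    also have "\<dots> = fun_space ?J ?V"
    proof (rule equalityI; rule subsetI)
      fix f assume "f \<in> {f \<in> fun_space ?J ?U. \<forall>s. lkp (f s) 0 = 0}"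
      then show "f \<in> fun_space ?J ?V" unfolding fun_space_def by blast
    next
      fix f assume f: "f \<in> fun_space ?J ?V"
      have "lkp (f s) 0 = 0" for s
      proof (cases "s \<in> ?J")
        case True then show ?thesis using f unfolding fun_space_def by blast
      next
        case False
        then have "f s = 0" using f unfolding fun_space_def by blast
        then show ?thesis by simp
      qed
      moreover have "f \<in> fun_space ?J ?U" using f unfolding fun_space_def by blast
      ultimately show "f \<in> {f \<in> fun_space ?J ?U. \<forall>s. lkp (f s) 0 = 0}" by blast
    qed
    finally show ?thesis unfolding bd_0_free .
  qed
  have dU: "Fv.dim (fun_space ?J ?U) = (\<Sum>s\<in>?J. Qv.dim (?U s))"
    using fun_space_dim[OF fJ, of ?U] Qv_subspace_Hom Qv_fd_Hom by blast
  have dV: "Fv.dim (fun_space ?J ?V) = (\<Sum>s\<in>?J. Qv.dim (?V s))"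
    using fun_space_dim[OF fJ, of ?V] Qv.subspace_inter[OF Qv_subspace_Hom sV] Qv.fd_subset[OF Qv_fd_Hom Int_lower1] by blast
  have "(\<Sum>s\<in>?J. Qv.dim (?U s)) = (\<Sum>s\<in>?J. Qv.dim (?V s)) + (\<Sum>s\<in>?J. if j - a (snd s) = 0 then 1 else 0)"
    unfolding sum.distrib[symmetric] by (rule sum.cong[OF refl]) (rule dim_Hom_irr)
  moreover have "(\<Sum>s\<in>?J. if j - a (snd s) = 0 then 1 else 0) = card {c. c < n \<and> a c = j}"
  proof -
    have "(\<Sum>s\<in>?J. if j - a (snd s) = 0 then 1 else 0) = (\<Sum>c<n. if j - a c = 0 then 1 else (0::nat))"
    proof -
      have J': "?J = Pair {} ` {..<n}" unfolding J by auto
      show ?thesis unfolding J' by (subst sum.reindex) (simp_all add: inj_on_def)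
    qed
    also have "\<dots> = card {c \<in> {..<n}. j - a c = 0}" by (simp add: sum.If_cases Int_def)
    also have "{c \<in> {..<n}. j - a c = 0} = {c. c < n \<and> a c = j}" by auto
    finally show ?thesis .
  qed
  ultimately show ?thesis unfolding kh_def c b dU dV by simp
qed

text \<open>By minimality the kernel consists of boundaries, so the free module and its image have
  the same homology in exterior degree 0.\<close>

theorem kh_generators:
  fixes M :: "nat \<Rightarrow> nat \<Rightarrow> (4, 'k::field) mpoly"
  assumes M: "gradedM a a' n n' M" and m: "kerp n n' M \<subseteq> irrv"
  shows "kh a' 0 j (mapp n n' M ` Fn n) = card {c. c < n \<and> a c = j}"
proof -
  let ?M = "mapp n n' M ` Fn n" and ?\<phi> = "mapK n n' M"
  have gM: "gsub a' ?M" by (rule gsub_image[OF M gsub_Fn])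
  have MF: "?M \<subseteq> Fn n'" using mapp_Fn by blast
  have 1: "?\<phi> ` cyc a 0 j (Fn n) = cyc a' 0 j ?M" unfolding cyc_0
    using mapK_KK[OF M] mapK_surj[OF M gsub_Fn] by blast
  have 2: "?\<phi> ` bd a 0 j (Fn n) = bd a' 0 j ?M"
  proof -
    have "?\<phi> ` KK a (Suc 0) j (Fn n) = KK a' (Suc 0) j ?M"
      using mapK_KK[OF M] mapK_surj[OF M gsub_Fn] by blast
    then have "kd 4 ` ?\<phi> ` KK a (Suc 0) j (Fn n) = bd a' 0 j ?M" unfolding bd_def by simp
    then show ?thesis unfolding bd_def image_image mapK_kd .
  qed
  have K: "x \<in> bd a 0 j (Fn n)" if "x \<in> cyc a 0 j (Fn n)" "?\<phi> x = 0" for x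
  proof -
    have "x \<in> KK a 0 j (kerp n n' M)" using that mapK_kernel unfolding cyc_0 by blast
    then show ?thesis unfolding bd_0_free using KK_mono[of "kerp n n' M" "Fn n \<inter> irrv"] m kerp_Fn by blast
  qed
  have fdc: "Fv.fd (cyc a 0 j (Fn n :: 'k pvec set))" unfolding cyc_0 by (rule KK_fd[OF order_refl])
  have sb: "Fv.subspace (bd a 0 j (Fn n :: 'k pvec set))" unfolding bd_def
    by (rule FF.linear_subspace_image[OF linear_kd KK_subspace[OF gsub_Fn]])
  from FF.dim_quotient_transfer[OF linear_mapK[of n n' M] cyc_subspace[OF gsub_Fn] fdc sb bd_cyc[OF gsub_Fn] K]
  show ?thesis using kh_eq[OF gM MF, of 0 j] kh_eq[OF gsub_Fn order_refl, of a 0 j n, where ?'k='k] kh_free[of a j n, where ?'k='k]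
    unfolding 1 2 by simp
qed

section \<open>Finite self-injective dimension forces a simple socle\<close>

text \<open>\<open>Q/I\<close> is local and finite-dimensional: \<open>I4\<close> makes the maximal
  ideal nilpotent, and \<open>I0\<close> keeps \<open>I\<close> inside it.\<close>

locale artin =
  fixes I :: "(4, 'k::field) mpoly set"
  assumes qI: "qideal I"
    and I4: "(\<And>m. m \<in> keys p \<Longrightarrow> 4 \<le> mon_deg m) \<Longrightarrow> p \<in> I"
    and I0: "p \<in> I \<Longrightarrow> lkp p 0 = 0"
begin

definition cg :: "(4, 'k) mpoly \<Rightarrow> (4, 'k) mpoly \<Rightarrow> bool" where "cg p q \<longleftrightarrow> p - q \<in> I"

lemma cg_0: "cg p 0 \<longleftrightarrow> p \<in> I" by (simp add: cg_def)

lemma cg_refl [simp]: "cg p p" using qidealD(1)[OF qI] by (simp add: cg_def)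

lemma cg_sym: "cg p q \<Longrightarrow> cg q p" using qidealD(5)[OF qI, of "p - q"] by (simp add: cg_def)

lemma cg_trans: "cg p q \<Longrightarrow> cg q r \<Longrightarrow> cg p r"
  using qidealD(2)[OF qI, of "p - q" "q - r"] by (simp add: cg_def)

lemma cg_add: "cg p q \<Longrightarrow> cg p' q' \<Longrightarrow> cg (p + p') (q + q')"
  using qidealD(2)[OF qI, of "p - q" "p' - q'"] by (simp add: cg_def algebra_simps)

lemma cg_diff: "cg p q \<Longrightarrow> cg p' q' \<Longrightarrow> cg (p - p') (q - q')"
  using qidealD(6)[OF qI, of "p - q" "p' - q'"] by (simp add: cg_def algebra_simps)

lemma cg_mult: "cg p q \<Longrightarrow> cg (r * p) (r * q)"
  using qidealD(3)[OF qI, of "p - q" r] by (simp add: cg_def algebra_simps)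

lemma cg_sum: "(\<And>i. i \<in> A \<Longrightarrow> cg (f i) (g i)) \<Longrightarrow> cg (sum f A) (sum g A)"
  by (induct A rule: infinite_finite_induct) (auto intro: cg_add)

lemma cg_I: "cg p q \<Longrightarrow> q \<in> I \<Longrightarrow> p \<in> I"
  using qidealD(2)[OF qI, of "p - q" q] by (simp add: cg_def)

text \<open>Write \<open>a = c + n\<close> with \<open>n\<close> free of a constant term. Since
  \<open>n ^ 4\<close> lies in \<open>I\<close>, the geometric series for the inverse stops after
  four terms.\<close>

lemma cg_unit: assumes "lkp a 0 \<noteq> 0" shows "\<exists>u. cg (u * a) 1"
proof -
  define c where "c = lkp a 0"
  define n where "n = a - kc c"
  have n0: "lkp n 0 = 0" by (simp add: n_def c_def lookup_minus lkp_kc)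
  have a: "a = kc c + n" by (simp add: n_def)
  have nk: "1 \<le> mon_deg m" if "m \<in> keys n" for m
  proof -
    have "m \<noteq> 0" using that n0 by (auto simp: in_keys_iff)
    then have "mon_deg m \<noteq> 0" by simp
    then show ?thesis by linarith
  qed
  have pw: "k \<le> mon_deg m" if "m \<in> keys (n ^ k)" for m k
    using that
  proof (induct k arbitrary: m)
    case (Suc k)
    then have "m \<in> keys (n * n ^ k)" by simp
    then obtain x y where xy: "x \<in> keys n" "y \<in> keys (n ^ k)" "m = x + y" using keys_mult[of n "n ^ k"] by auto
    then show ?case using nk[OF xy(1)] Suc(1)[OF xy(2)] unfolding xy(3) mon_deg_add by linarith
  qed simp
  have n4: "n ^ 4 \<in> I" by (rule I4) (rule pw)
  let ?C = "kc c" and ?D = "kc (inverse (c ^ 4))"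
  have CD: "?D * ?C ^ 4 = 1"
  proof -
    have h4: "?C ^ 4 = kc (c ^ 4)" by (simp add: kc_mult power_def numeral_eq_Suc)
    then have "?D * ?C ^ 4 = kc (inverse (c ^ 4) * c ^ 4)" by (simp only: kc_mult h4)
    also have "inverse (c ^ 4) * c ^ 4 = 1" using assms by (simp add: c_def)
    finally show ?thesis by simp
  qed
  have "(?D * (?C ^ 3 - ?C ^ 2 * n + ?C * n ^ 2 - n ^ 3)) * a = ?D * ?C ^ 4 - ?D * n ^ 4"
    unfolding a by (simp add: algebra_simps power2_eq_square power3_eq_cube power4_eq_xxxx)
  also have "\<dots> = 1 - ?D * n ^ 4" by (simp only: CD)
  finally have "cg ((?D * (?C ^ 3 - ?C ^ 2 * n + ?C * n ^ 2 - n ^ 3)) * a) 1"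
    using qidealD(5)[OF qI qidealD(3)[OF qI n4, of ?D]] by (simp add: cg_def)
  then show ?thesis by blast
qed

text \<open>Submodules of \<open>(Q/I)^J\<close>, as sets of representatives.\<close>

definition sm :: "nat set \<Rightarrow> 'k pvec set \<Rightarrow> bool" where
  "sm J Y \<longleftrightarrow> (\<forall>v. (\<forall>r\<in>J. v r \<in> I) \<longrightarrow> v \<in> Y) \<and> (\<forall>u\<in>Y. \<forall>v\<in>Y. (\<lambda>r. u r + v r) \<in> Y) \<and>
     (\<forall>v\<in>Y. \<forall>q. (\<lambda>r. q * v r) \<in> Y)"

lemma smD: assumes "sm J Y"
  shows "(\<And>r. r \<in> J \<Longrightarrow> v r \<in> I) \<Longrightarrow> v \<in> Y" "u \<in> Y \<Longrightarrow> v \<in> Y \<Longrightarrow> (\<lambda>r. u r + v r) \<in> Y"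
    "v \<in> Y \<Longrightarrow> (\<lambda>r. q * v r) \<in> Y"
  using assms unfolding sm_def by blast+

lemma sm_cong: assumes "sm J Y" "u \<in> Y" "\<And>r. r \<in> J \<Longrightarrow> cg (v r) (u r)" shows "v \<in> Y"
proof -
  have "(\<lambda>r. v r - u r) \<in> Y" by (rule smD(1)[OF assms(1)]) (use assms(3) in \<open>simp add: cg_def\<close>)
  from smD(2)[OF assms(1,2) this] show ?thesis by simp
qed

lemma sm_sum: assumes "sm J Y" "\<And>i. i \<in> A \<Longrightarrow> f i \<in> Y" shows "(\<lambda>r. \<Sum>i\<in>A. f i r) \<in> Y"
  using assms(2)
proof (induct A rule: infinite_finite_induct)
  case (insert x F)
  then show ?case using smD(2)[OF assms(1), of "f x" "\<lambda>r. \<Sum>i\<in>F. f i r"] by simp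
qed (use smD(1)[OF assms(1)] qidealD(1)[OF qI] in auto)

definition gen :: "nat set \<Rightarrow> 'k pvec set \<Rightarrow> nat set \<Rightarrow> (nat \<Rightarrow> nat \<Rightarrow> (4, 'k) mpoly) \<Rightarrow> bool" where
  "gen J Y B G \<longleftrightarrow> finite B \<and> (\<forall>v. v \<in> Y \<longleftrightarrow> (\<exists>w. \<forall>r\<in>J. cg (v r) (\<Sum>c\<in>B. G r c * w c)))"

lemma gen_mem:
  assumes "gen J Y B G" "\<And>r. r \<in> J \<Longrightarrow> cg (v r) (\<Sum>c\<in>B. G r c * w c)"
  shows "v \<in> Y"
proof -
  have "\<exists>w. \<forall>r\<in>J. cg (v r) (\<Sum>c\<in>B. G r c * w c)" by (rule exI, rule ballI, rule assms(2))
  moreover have "\<forall>v. v \<in> Y \<longleftrightarrow> (\<exists>w. \<forall>r\<in>J. cg (v r) (\<Sum>c\<in>B. G r c * w c))"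
    using assms(1) unfolding gen_def by (rule conjunct2)
  ultimately show ?thesis by (simp only:)
qed

text \<open>A finite-dimensional space that contains a representative of every class modulo
  \<open>I\<close>, namely the truncation \<open>tr\<close>.\<close>

definition Qlt :: "(4, 'k) mpoly set" where "Qlt = {p. \<forall>m\<in>keys p. mon_deg m < 4}"

lemma finite_mon_lt: "finite {m :: 4 \<Rightarrow>\<^sub>0 nat. mon_deg m < 4}"
proof -
  have "{m :: 4 \<Rightarrow>\<^sub>0 nat. mon_deg m < 4} = (\<Union>n<4. {m. mon_deg m = n})" by auto
  then show ?thesis by (simp add: finite_monomials)
qed

lemma Qlt_subspace: "Qv.subspace Qlt"
proof (rule Qv.subspaceI)
  show "x + y \<in> Qlt" if "x \<in> Qlt" "y \<in> Qlt" for x y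
    using that Poly_Mapping.keys_add[of x y] unfolding Qlt_def by blast
  show "qs c x \<in> Qlt" if "x \<in> Qlt" for c x
    using that unfolding Qlt_def qs_def by (auto simp: in_keys_iff)
qed (simp add: Qlt_def)

lemma Qlt_fd: "Qv.fd Qlt"
proof -
  let ?B = "(\<lambda>m. Poly_Mapping.single m 1 :: (4, 'k) mpoly) ` {m. mon_deg m < 4}"
  have "p \<in> Qv.span ?B" if p: "p \<in> Qlt" for p
  proof -
    have "Poly_Mapping.single m (lkp p m) \<in> Qv.span ?B" if m: "m \<in> keys p" for m
    proof -
      have "mon_deg m < 4" using p m unfolding Qlt_def by blast
      then have "qs (lkp p m) (Poly_Mapping.single m 1) \<in> Qv.span ?B"
        by (intro Qv.span_scale Qv.span_base) blast
      then show ?thesis by (simp add: qs_def kc_def mult_single)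
    qed
    then have "(\<Sum>m\<in>keys p. Poly_Mapping.single m (lkp p m)) \<in> Qv.span ?B" by (rule Qv.span_sum)
    then show ?thesis using poly_expand[of p] by simp
  qed
  then show ?thesis unfolding Qv.fd_def using finite_mon_lt by (intro exI[of _ ?B]) auto
qed

definition tr :: "(4, 'k) mpoly \<Rightarrow> (4, 'k) mpoly" where
  "tr p = (\<Sum>m\<in>{m. mon_deg m < 4}. Poly_Mapping.single m (lkp p m))"

lemma lkp_tr: "lkp (tr p) m = (if mon_deg m < 4 then lkp p m else 0)"
proof -
  have "lkp (tr p) m = (\<Sum>n\<in>{m. mon_deg m < 4}. if n = m then lkp p n else 0)"
    by (simp add: tr_def lookup_sum lookup_single when_def)
  then show ?thesis using finite_mon_lt by simp
qed

lemma tr_Qlt: "tr p \<in> Qlt"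
  unfolding Qlt_def by (auto simp: in_keys_iff lkp_tr split: if_splits)

lemma cg_tr: "cg p (tr p)"
  unfolding cg_def by (rule I4) (auto simp: in_keys_iff lookup_minus lkp_tr split: if_splits)

text \<open>A basis over the field of the truncated vectors in \<open>Y\<close> generates
  \<open>Y\<close> modulo \<open>I\<close>.\<close>

lemma gen_exists: assumes J: "finite J" and Y: "sm J Y" shows "\<exists>B G. gen J Y B G"
proof -
  let ?F = "fun_space J (\<lambda>_. Qlt)"
  have fd: "Fv.fd ?F" using fun_space_dim[OF J, of "\<lambda>_. Qlt"] Qlt_subspace Qlt_fd by blast
  then obtain T where T: "finite T" "T \<subseteq> ?F \<inter> Y" "?F \<inter> Y \<subseteq> Fv.span T"
    using Fv.fd_basis[OF Fv.fd_subset[OF fd, of "?F \<inter> Y"]] by (metis Int_lower1)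
  obtain g where g: "bij_betw g {..<card T} T" using T(1) by (metis bij_betw_from_nat_into_finite)
  define G where "G = (\<lambda>r c. g c r)"
  have gY: "g c \<in> Y" if "c < card T" for c using g that T(2) unfolding bij_betw_def by blast
  have "gen J Y {..<card T} G" unfolding gen_def
  proof (intro conjI allI iffI)
    fix v assume v: "v \<in> Y"
    define t where "t = (\<lambda>r. if r \<in> J then tr (v r) else 0)"
    have "t \<in> Y" by (rule sm_cong[OF Y v]) (simp add: t_def cg_sym[OF cg_tr])
    moreover have "t \<in> ?F" unfolding fun_space_def t_def by (simp add: tr_Qlt)
    ultimately have "t \<in> Fv.span T" using T(3) by blast
    then obtain u where u: "t = (\<Sum>f\<in>T. fs (u f) f)" unfolding Fv.span_finite[OF T(1)] by blast
    have "cg (v r) (\<Sum>c<card T. G r c * kc (u (g c)))" if "r \<in> J" for r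
    proof -
      have "tr (v r) = t r" using that by (simp add: t_def)
      also have "\<dots> = (\<Sum>f\<in>T. kc (u f) * f r)" unfolding u using T(1) by (induct T) (auto simp: fs_def)
      also have "\<dots> = (\<Sum>c<card T. kc (u (g c)) * g c r)" by (rule sum.reindex_bij_betw[OF g, symmetric])
      finally show ?thesis using cg_tr[of "v r"] by (simp add: G_def mult.commute)
    qed
    then show "\<exists>w. \<forall>r\<in>J. cg (v r) (\<Sum>c<card T. G r c * w c)" by (intro exI[of _ "\<lambda>c. kc (u (g c))"]) blast
  next
    fix v assume "\<exists>w. \<forall>r\<in>J. cg (v r) (\<Sum>c<card T. G r c * w c)"
    then obtain w where w: "\<And>r. r \<in> J \<Longrightarrow> cg (v r) (\<Sum>c<card T. G r c * w c)" by blast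
    have "(\<lambda>r. \<Sum>c<card T. w c * g c r) \<in> Y"
      by (rule sm_sum[OF Y]) (simp add: smD(3)[OF Y gY])
    then show "v \<in> Y" by (rule sm_cong[OF Y]) (use w in \<open>simp add: G_def mult.commute\<close>)
  qed simp
  then show ?thesis by blast
qed

text \<open>Take the least possible number of generators. A relation in which one coefficient is a
  unit would express a generator through the others.\<close>

lemma min_gen_exists: assumes J: "finite J" and Y: "sm J Y"
  shows "\<exists>B G. gen J Y B G \<and> (\<forall>w. (\<forall>r\<in>J. (\<Sum>c\<in>B. G r c * w c) \<in> I) \<longrightarrow> (\<forall>c\<in>B. lkp (w c) 0 = 0))"
proof -
  define P where "P n \<longleftrightarrow> (\<exists>B G. gen J Y B G \<and> card B = n)" for n
  have "\<exists>n. P n" using gen_exists[OF assms] unfolding P_def by blast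
  then have "P (LEAST n. P n)" by (rule LeastI_ex)
  then obtain B G where BG: "gen J Y B G" "card B = (LEAST n. P n)" unfolding P_def by blast
  have fB: "finite B" using BG(1) unfolding gen_def by blast
  have "lkp (w c) 0 = 0" if w: "\<And>r. r \<in> J \<Longrightarrow> (\<Sum>c\<in>B. G r c * w c) \<in> I" and c: "c \<in> B" for w c
  proof (rule ccontr)
    assume "lkp (w c) 0 \<noteq> 0"
    then obtain u where u: "cg (u * w c) 1" using cg_unit by blast
    have col: "cg (G r c) (\<Sum>b\<in>B - {c}. G r b * (- u * w b))" if r: "r \<in> J" for r
    proof -
      have "cg (u * (\<Sum>b\<in>B. G r b * w b)) 0" using qidealD(3)[OF qI w[OF r], of u] by (simp add: cg_0)
      moreover have "u * (\<Sum>b\<in>B. G r b * w b) = G r c * (u * w c) - (\<Sum>b\<in>B - {c}. G r b * (- u * w b))"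
        unfolding sum.remove[OF fB c] by (simp add: algebra_simps sum_distrib_left sum_negf)
      ultimately have 1: "cg (G r c * (u * w c)) (\<Sum>b\<in>B - {c}. G r b * (- u * w b))" by (simp add: cg_def)
      have "cg (G r c) (G r c * (u * w c))" using cg_mult[OF cg_sym[OF u], of "G r c"] by simp
      then show ?thesis by (rule cg_trans[OF _ 1])
    qed
    have "gen J Y (B - {c}) G" unfolding gen_def
    proof (intro conjI allI iffI)
      fix v assume "v \<in> Y"
      then obtain x where x: "\<And>r. r \<in> J \<Longrightarrow> cg (v r) (\<Sum>b\<in>B. G r b * x b)" using BG(1) unfolding gen_def by blast
      show "\<exists>w. \<forall>r\<in>J. cg (v r) (\<Sum>b\<in>B - {c}. G r b * w b)"
      proof (intro exI ballI)
        fix r assume r: "r \<in> J"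
        have "cg (v r) (x c * G r c + (\<Sum>b\<in>B - {c}. G r b * x b))"
          using x[OF r] unfolding sum.remove[OF fB c] by (simp add: mult.commute)
        also have "cg (x c * G r c + (\<Sum>b\<in>B - {c}. G r b * x b))
           (x c * (\<Sum>b\<in>B - {c}. G r b * (- u * w b)) + (\<Sum>b\<in>B - {c}. G r b * x b))"
          by (rule cg_add[OF cg_mult[OF col[OF r]] cg_refl])
        also (cg_trans) have "x c * (\<Sum>b\<in>B - {c}. G r b * (- u * w b)) + (\<Sum>b\<in>B - {c}. G r b * x b)
          = (\<Sum>b\<in>B - {c}. G r b * (x c * (- u * w b) + x b))"
          by (simp add: sum_distrib_left sum.distrib[symmetric] algebra_simps)
        finally show "cg (v r) (\<Sum>b\<in>B - {c}. G r b * (x c * (- u * w b) + x b))" .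
      qed
    next
      fix v assume "\<exists>w. \<forall>r\<in>J. cg (v r) (\<Sum>b\<in>B - {c}. G r b * w b)"
      then obtain x where x: "\<And>r. r \<in> J \<Longrightarrow> cg (v r) (\<Sum>b\<in>B - {c}. G r b * x b)" by blast
      have "cg (v r) (\<Sum>b\<in>B. G r b * (if b = c then 0 else x b))" if "r \<in> J" for r
      proof -
        have "(\<Sum>b\<in>B - {c}. G r b * (if b = c then 0 else x b)) = (\<Sum>b\<in>B - {c}. G r b * x b)"
          by (rule sum.cong[OF refl]) simp
        then have "(\<Sum>b\<in>B. G r b * (if b = c then 0 else x b)) = (\<Sum>b\<in>B - {c}. G r b * x b)"
          by (simp only: sum.remove[OF fB c] simp_thms if_True mult_zero_right add_0_left)
        with x[OF that] show ?thesis by (simp only:)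
      qed
      then show "v \<in> Y" by (rule gen_mem[OF BG(1)])
    qed (use fB in simp)
    then have "P (card (B - {c}))" unfolding P_def by blast
    then have "(LEAST n. P n) \<le> card (B - {c})" by (rule Least_le)
    then show False using BG(2) card_Diff1_less[OF fB c] by simp
  qed
  then show ?thesis using BG(1) by (intro exI[of _ B] exI[of _ G]) blast
qed

section \<open>Resolutions over the quotient and vanishing of Ext\<close>

definition resI :: "(nat \<Rightarrow> nat) \<Rightarrow> (nat \<Rightarrow> nat \<Rightarrow> nat \<Rightarrow> (4, 'k) mpoly) \<Rightarrow> bool" where
  "resI n d \<longleftrightarrow> (\<forall>i v. (\<forall>r<n i. (\<Sum>c<n (Suc i). d i r c * v c) \<in> I) \<longleftrightarrow>
     (\<exists>w. \<forall>r<n (Suc i). cg (v r) (\<Sum>c<n (Suc (Suc i)). d (Suc i) r c * w c)))"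

text \<open>Ext in degree \<open>i + 1\<close> of the cokernel of \<open>d 0\<close> with values in
  \<open>Q/I\<close>: cocycles of the transposed complex are coboundaries.\<close>

definition extI :: "(nat \<Rightarrow> nat) \<Rightarrow> (nat \<Rightarrow> nat \<Rightarrow> nat \<Rightarrow> (4, 'k) mpoly) \<Rightarrow> nat \<Rightarrow> bool" where
  "extI n d i \<longleftrightarrow> (\<forall>v. (\<forall>r<n (Suc (Suc i)). (\<Sum>c<n (Suc i). d (Suc i) c r * v c) \<in> I) \<longrightarrow>
     (\<exists>w. \<forall>r<n (Suc i). cg (v r) (\<Sum>c<n i. d i c r * w c)))"

lemma kernel_sm: "sm {..<b} {v. \<forall>r<m. (\<Sum>c<b. D r c * v c) \<in> I}" for b m :: nat
  unfolding sm_def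
proof (intro conjI allI ballI impI CollectI; (elim CollectE)?)
  fix v r assume "\<forall>r\<in>{..<b}. v r \<in> I"
  then show "(\<Sum>c<b. D r c * v c) \<in> I" by (intro qideal_sum[OF qI] qidealD(3)[OF qI]) simp
next
  fix u v r assume "\<forall>r<m. (\<Sum>c<b. D r c * u c) \<in> I" "\<forall>r<m. (\<Sum>c<b. D r c * v c) \<in> I" "r < m"
  then show "(\<Sum>c<b. D r c * (u c + v c)) \<in> I" using qidealD(2)[OF qI] by (simp add: distrib_left sum.distrib)
next
  fix v q r assume "\<forall>r<m. (\<Sum>c<b. D r c * v c) \<in> I" "r < m"
  then have "q * (\<Sum>c<b. D r c * v c) \<in> I" using qidealD(3)[OF qI] by blast
  then show "(\<Sum>c<b. D r c * (q * v c)) \<in> I" by (simp add: sum_distrib_left mult.left_commute)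
qed

text \<open>The kernel is a submodule, hence finitely generated; its generators are renumbered by an
  initial segment to become the columns of a matrix.\<close>

lemma next_syzygy: fixes b m :: nat and D :: "nat \<Rightarrow> nat \<Rightarrow> (4, 'k) mpoly"
  shows "\<exists>(n'::nat) D'. \<forall>v. (\<forall>r<m. (\<Sum>c<b. D r c * v c) \<in> I) \<longleftrightarrow> (\<exists>w. \<forall>r<b. cg (v r) (\<Sum>c<n'. D' r c * w c))"
proof -
  obtain B G where BG: "gen {..<b} {v. \<forall>r<m. (\<Sum>c<b. D r c * v c) \<in> I} B G"
    using gen_exists[OF finite_lessThan kernel_sm] by blast
  have fB: "finite B" using BG unfolding gen_def by blast
  obtain g where g: "bij_betw g {..<card B} B" using fB by (metis bij_betw_from_nat_into_finite)
  have e: "(\<exists>w. \<forall>r<b. cg (v r) (\<Sum>c\<in>B. G r c * w c)) \<longleftrightarrow> (\<exists>w. \<forall>r<b. cg (v r) (\<Sum>c<card B. G r (g c) * w c))" for v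
  proof
    assume "\<exists>w. \<forall>r<b. cg (v r) (\<Sum>c\<in>B. G r c * w c)"
    then obtain w where "\<forall>r<b. cg (v r) (\<Sum>c\<in>B. G r c * w c)" by blast
    then show "\<exists>w. \<forall>r<b. cg (v r) (\<Sum>c<card B. G r (g c) * w c)"
      by (intro exI[of _ "\<lambda>c. w (g c)"]) (simp add: sum.reindex_bij_betw[OF g, of "\<lambda>c. G _ c * w c"])
  next
    assume "\<exists>w. \<forall>r<b. cg (v r) (\<Sum>c<card B. G r (g c) * w c)"
    then obtain w where w: "\<forall>r<b. cg (v r) (\<Sum>c<card B. G r (g c) * w c)" by blast
    have "(\<Sum>c<card B. G r (g c) * w c) = (\<Sum>c\<in>B. G r c * w (the_inv_into {..<card B} g c))" for r
    proof -
      have "(\<Sum>c<card B. G r (g c) * w c) = (\<Sum>c<card B. G r (g c) * w (the_inv_into {..<card B} g (g c)))"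
        by (rule sum.cong[OF refl]) (use g in \<open>simp add: bij_betw_def the_inv_into_f_f\<close>)
      then show ?thesis using sum.reindex_bij_betw[OF g, of "\<lambda>c. G r c * w (the_inv_into {..<card B} g c)"] by simp
    qed
    then show "\<exists>w. \<forall>r<b. cg (v r) (\<Sum>c\<in>B. G r c * w c)"
      using w by (intro exI[of _ "\<lambda>c. w (the_inv_into {..<card B} g c)"]) simp
  qed
  have "\<forall>v. (\<forall>r<m. (\<Sum>c<b. D r c * v c) \<in> I) \<longleftrightarrow> (\<exists>w. \<forall>r<b. cg (v r) (\<Sum>c\<in>B. G r c * w c))"
    using BG unfolding gen_def by (simp add: Ball_def)
  then have "\<forall>v. (\<forall>r<m. (\<Sum>c<b. D r c * v c) \<in> I) \<longleftrightarrow> (\<exists>w. \<forall>r<b. cg (v r) (\<Sum>c<card B. (\<lambda>r c. G r (g c)) r c * w c))"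
    unfolding e .
  from exI[where P="\<lambda>D'. \<forall>v. (\<forall>r<m. (\<Sum>c<b. D r c * v c) \<in> I) \<longleftrightarrow> (\<exists>w. \<forall>r<b. cg (v r) (\<Sum>c<card B. D' r c * w c))", OF this]
  show ?thesis by (rule exI)
qed

text \<open>The row of variables comes first, so that the module resolved is the residue field. The
  states of the dependent choice are two ranks and a matrix.\<close>

lemma resI_exists: "\<exists>n d. n 0 = 1 \<and> n (Suc 0) = 4 \<and> d 0 0 = xv \<and> resI n d"
proof -
  define R where "R s s' \<longleftrightarrow> fst (snd s) = fst s' \<and>
     (\<forall>v. (\<forall>r<fst s. (\<Sum>c<fst (snd s). snd (snd s) r c * v c) \<in> I) \<longleftrightarrow>
       (\<exists>w. \<forall>r<fst s'. cg (v r) (\<Sum>c<fst (snd s'). snd (snd s') r c * w c)))"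
    for s s' :: "nat \<times> nat \<times> (nat \<Rightarrow> nat \<Rightarrow> (4, 'k) mpoly)"
  have "\<exists>s'. R s s'" for s
  proof -
    obtain m b D where s: "s = (m, b, D)" by (metis prod_cases3)
    obtain n' :: nat and D' where "\<forall>v. (\<forall>r<m. (\<Sum>c<b. D r c * v c) \<in> I) \<longleftrightarrow> (\<exists>w. \<forall>r<b. cg (v r) (\<Sum>c<n'. D' r c * w c))"
      using next_syzygy[where m=m and b=b and D=D] by blast
    then have "R s (b, n', D')" unfolding R_def s by simp
    then show ?thesis by (rule exI)
  qed
  then have "\<exists>f. f 0 = (1, 4, \<lambda>_. xv) \<and> (\<forall>i. R (f i) (f (Suc i)))"
    using dependent_nat_choice[of "\<lambda>i s. i = 0 \<longrightarrow> s = (1, 4, \<lambda>_. xv)" "\<lambda>_. R"] by auto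
  then obtain f where f: "f 0 = (1, 4, \<lambda>_. xv)" "\<And>i. R (f i) (f (Suc i))" by blast
  define n where "n i = fst (f i)" for i
  define d where "d i = snd (snd (f i))" for i
  have n1: "fst (snd (f i)) = n (Suc i)" for i using f(2)[of i] unfolding R_def n_def by simp
  have "resI n d" unfolding resI_def
  proof (intro allI)
    fix i v
    show "(\<forall>r<n i. (\<Sum>c<n (Suc i). d i r c * v c) \<in> I) \<longleftrightarrow>
     (\<exists>w. \<forall>r<n (Suc i). cg (v r) (\<Sum>c<n (Suc (Suc i)). d (Suc i) r c * w c))"
      using f(2)[of i] unfolding R_def n1 d_def[symmetric] n_def[symmetric] by blast
  qed
  moreover have "n 0 = 1" "n (Suc 0) = 4" "d 0 0 = xv" using f(1) n1[of 0] by (simp_all add: n_def d_def)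
  ultimately show ?thesis by blast
qed

end

text \<open>\<open>L\<close> is well defined on the image of \<open>T\<close> modulo
  \<open>N\<close>, and a functional on a subspace extends. This injectivity of the field is what
  permits passing from Ext to the dual module.\<close>

lemma functional_factor:
  fixes T :: "('i \<Rightarrow> ('v, 'k::field) mpoly) \<Rightarrow> ('j \<Rightarrow> ('v, 'k) mpoly)"
  assumes T: "Vector_Spaces.linear fs fs T" and N: "Fv.subspace N"
    and L: "Vector_Spaces.linear fs (*) L" and z: "\<And>v. T v \<in> N \<Longrightarrow> L v = 0"
  shows "\<exists>L'. Vector_Spaces.linear fs (*) L' \<and> (\<forall>v. L' (T v) = L v) \<and> (\<forall>x\<in>N. L' x = 0)"
proof -
  interpret FK: vector_space_pair "fs :: 'k \<Rightarrow> ('j \<Rightarrow> ('v, 'k) mpoly) \<Rightarrow> _" "(*) :: 'k \<Rightarrow> 'k \<Rightarrow> 'k" ..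
  interpret FK1: vector_space_pair "fs :: 'k \<Rightarrow> ('i \<Rightarrow> ('v, 'k) mpoly) \<Rightarrow> _" "(*) :: 'k \<Rightarrow> 'k \<Rightarrow> 'k" ..
  obtain A where A: "A \<subseteq> N" "Fv.independent A" "N \<subseteq> Fv.span A"
    by (rule Fv.basis_exists[of N]) blast
  have "A \<subseteq> N \<union> range T" using A(1) by blast
  then obtain B where B: "A \<subseteq> B" "B \<subseteq> N \<union> range T" "Fv.independent B" "N \<union> range T \<subseteq> Fv.span B"
    by (rule Fv.maximal_independent_subset_extend[OF _ A(2)])
  define w where "w b = (SOME v. T v = b)" for b
  have w: "T (w b) = b" if "b \<in> B" "b \<notin> N" for b
  proof -
    have "\<exists>v. T v = b" using B(2) that by auto
    then show ?thesis unfolding w_def by (rule someI_ex)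
  qed
  obtain L' where L': "Vector_Spaces.linear fs (*) L'" "\<And>b. b \<in> B \<Longrightarrow> L' b = (if b \<in> N then 0 else L (w b))"
    using FK.linear_independent_extend[OF B(3), of "\<lambda>b. if b \<in> N then 0 else L (w b)"] by blast
  have N0: "L' x = 0" if "x \<in> N" for x
  proof (rule FK.linear_eq_0_on_span[OF L'(1), of A])
    show "L' b = 0" if "b \<in> A" for b using L'(2)[of b] that A(1) B(1) by (simp add: subsetD)
    show "x \<in> Fv.span A" using A(3) that by blast
  qed
  have "L' (T v) = L v" for v
  proof -
    have "T v \<in> Fv.span B" using B(4) by blast
    then obtain F r where F: "finite F" "F \<subseteq> B" "T v = (\<Sum>b\<in>F. fs (r b) b)"
      unfolding Fv.span_explicit by blast
    define v' where "v' = (\<Sum>b\<in>F - N. fs (r b) (w b))"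
    have Tv': "T v' = (\<Sum>b\<in>F - N. fs (r b) b)"
      unfolding v'_def FF.linear_sum[OF T] by (rule sum.cong[OF refl]) (use F(2) w in \<open>auto simp: FF.linear_scale[OF T]\<close>)
    have "T v - T v' = (\<Sum>b\<in>F \<inter> N. fs (r b) b)"
      unfolding F(3) Tv' using sum.Int_Diff[OF F(1), of "\<lambda>b. fs (r b) b" N] by simp
    also have "\<dots> \<in> N" by (intro Fv.subspace_sum[OF N] Fv.subspace_scale[OF N]) blast
    finally have n: "T v - T v' \<in> N" .
    then have "L (v - v') = 0" by (intro z) (simp add: FF.linear_diff[OF T])
    then have "L v = L v'" by (simp add: FK1.linear_diff[OF L])
    also have "\<dots> = (\<Sum>b\<in>F - N. r b * L (w b))"
      unfolding v'_def by (simp add: FK1.linear_sum[OF L] FK1.linear_scale[OF L])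
    also have "\<dots> = L' (T v')"
      unfolding Tv' FK.linear_sum[OF L'(1)]
      by (rule sum.cong[OF refl]) (use F(2) L'(2) in \<open>auto simp: FK.linear_scale[OF L'(1)]\<close>)
    also have "\<dots> = L' (T v)" using N0[OF n] by (simp add: FK.linear_diff[OF L'(1)])
    finally show ?thesis by simp
  qed
  then show ?thesis using L'(1) N0 by blast
qed

section \<open>Vanishing of Tor against the residue field\<close>

locale artin_res = artin +
  fixes n :: "nat \<Rightarrow> nat" and d :: "nat \<Rightarrow> nat \<Rightarrow> nat \<Rightarrow> (4, 'a) mpoly"
  assumes n0: "n 0 = 1" and n1: "n (Suc 0) = 4" and d0: "d 0 0 = xv" and res: "resI n d"
begin

lemma dd: assumes "r < n i" shows "(\<Sum>b<n (Suc i). d i r b * (\<Sum>c<n (Suc (Suc i)). d (Suc i) b c * w c)) \<in> I"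
proof -
  have "\<exists>w'. \<forall>b<n (Suc i). cg (\<Sum>c<n (Suc (Suc i)). d (Suc i) b c * w c) (\<Sum>c<n (Suc (Suc i)). d (Suc i) b c * w' c)"
    by (intro exI[of _ w]) simp
  with res[unfolded resI_def, THEN spec[of _ i], THEN spec[of _ "\<lambda>b. \<Sum>c<n (Suc (Suc i)). d (Suc i) b c * w c"]]
  have "\<forall>r<n i. (\<Sum>b<n (Suc i). d i r b * (\<Sum>c<n (Suc (Suc i)). d (Suc i) b c * w c)) \<in> I" by (simp only:)
  then show ?thesis using assms by simp
qed

text \<open>\<open>Tor\<^sub>i\<^sub>+\<^sub>1(k, (Q/I)\<^sup>J/Y) = 0\<close>.\<close>

definition TV :: "'a pvec set \<Rightarrow> nat \<Rightarrow> bool" where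
  "TV Y i \<longleftrightarrow> (\<forall>g. (\<forall>r<n i. (\<lambda>s. \<Sum>c<n (Suc i). d i r c * g c s) \<in> Y) \<longrightarrow>
     (\<exists>h. \<forall>r<n (Suc i). (\<lambda>s. g r s - (\<Sum>c<n (Suc (Suc i)). d (Suc i) r c * h c s)) \<in> Y))"

text \<open>Nakayama. Write an element of \<open>Y\<close> as a combination of the variables;
  vanishing of Tor in degree 1 allows the coefficient vectors to be changed by a syzygy of the
  variables until they lie in \<open>Y\<close>. So modulo \<open>I\<close> the module equals its
  product with the maximal ideal, and four iterations end in \<open>I\<close>.\<close>

lemma TV_base:
  assumes Y: "sm J Y" and m: "\<And>v r. v \<in> Y \<Longrightarrow> r \<in> J \<Longrightarrow> lkp (v r) 0 = 0" and T: "TV Y 0"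
  assumes v: "v \<in> Y" and r: "r \<in> J"
  shows "v r \<in> I"
proof -
  have step: "\<exists>y. (\<forall>i<4. y i \<in> Y) \<and> (\<forall>s\<in>J. cg (v s) (\<Sum>i<4. xv i * y i s))" if v: "v \<in> Y" for v
  proof -
    have "\<forall>s. \<exists>q. s \<in> J \<longrightarrow> v s = (\<Sum>i<4. xv i * q i)" using m[OF v] varid_4 unfolding varid_def by blast
    then obtain q where q: "\<And>s. s \<in> J \<Longrightarrow> v s = (\<Sum>i<4. xv i * q s i)" by metis
    have "(\<lambda>s. \<Sum>c<4. xv c * q s c) \<in> Y" by (rule sm_cong[OF Y v]) (simp add: q)
    then have "\<forall>r<n 0. (\<lambda>s. \<Sum>c<n (Suc 0). d 0 r c * q s c) \<in> Y" by (simp add: n0 n1 d0)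
    then obtain h where h: "\<And>r. r < 4 \<Longrightarrow> (\<lambda>s. q s r - (\<Sum>c<n (Suc (Suc 0)). d (Suc 0) r c * h c s)) \<in> Y"
      using T[unfolded TV_def, rule_format, of "\<lambda>c s. q s c"] unfolding n1 by blast
    have "cg (v s) (\<Sum>i<4. xv i * (q s i - (\<Sum>c<n (Suc (Suc 0)). d (Suc 0) i c * h c s)))" if "s \<in> J" for s
    proof -
      have "v s - (\<Sum>i<4. xv i * (q s i - (\<Sum>c<n (Suc (Suc 0)). d (Suc 0) i c * h c s)))
        = (\<Sum>i<4. xv i * (\<Sum>c<n (Suc (Suc 0)). d (Suc 0) i c * h c s))"
        by (simp add: q[OF that] algebra_simps sum_subtractf)
      also have "\<dots> \<in> I" using dd[of 0 0 "\<lambda>c. h c s"] by (simp add: n0 n1 d0)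
      finally show ?thesis unfolding cg_def .
    qed
    then show ?thesis using h
      by (intro exI[of _ "\<lambda>i s. q s i - (\<Sum>c<n (Suc (Suc 0)). d (Suc 0) i c * h c s)"]) blast
  qed
  have ind: "\<exists>q. cg (v s) q \<and> (\<forall>m\<in>keys q. k \<le> mon_deg m)" if vY: "v \<in> Y" and sJ: "s \<in> J" for v s k
    using vY
  proof (induct k arbitrary: v)
    case 0 then show ?case by (intro exI[of _ "v s"]) simp
  next
    case (Suc k)
    obtain y where y: "\<And>i. i < 4 \<Longrightarrow> y i \<in> Y" "cg (v s) (\<Sum>i<4. xv i * y i s)"
      using step[OF Suc(2)] sJ by blast
    have "\<forall>i. \<exists>q. i < 4 \<longrightarrow> cg (y i s) q \<and> (\<forall>m\<in>keys q. k \<le> mon_deg m)" using Suc(1) y(1) by blast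
    then obtain q where q: "\<And>i. i < 4 \<Longrightarrow> cg (y i s) (q i)" "\<And>i m. i < 4 \<Longrightarrow> m \<in> keys (q i) \<Longrightarrow> k \<le> mon_deg m"
      by metis
    have "cg (v s) (\<Sum>i<4. xv i * q i)"
      by (rule cg_trans[OF y(2)]) (auto intro!: cg_sum cg_mult q(1))
    moreover have "Suc k \<le> mon_deg m" if "m \<in> keys (\<Sum>i<4. xv i * q i)" for m
    proof -
      have "\<exists>i<4. m \<in> keys (xv i * q i)"
      proof (rule ccontr)
        assume "\<not> ?thesis"
        then have "lkp (\<Sum>i<4. xv i * q i) m = 0" unfolding lookup_sum by (intro sum.neutral) (simp add: in_keys_iff)
        then show False using that by (simp add: in_keys_iff)
      qed
      then obtain i where i: "i < 4" "m \<in> keys (xv i * q i)" by blast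
      then obtain m' where "m = Poly_Mapping.single (of_nat i) 1 + m'" "m' \<in> keys (q i)"
        unfolding xv_def variable_def keys_mult_shift by blast
      then show ?thesis using q(2)[OF i(1)] by simp
    qed
    ultimately show ?case by blast
  qed
  obtain q where "cg (v r) q" "\<forall>m\<in>keys q. 4 \<le> mon_deg m" using ind[OF v r] by blast
  then show ?thesis using cg_I I4 by blast
qed

text \<open>Dimension shifting along the cover of \<open>Y\<close> by its generators: the kernel of
  this cover takes the place of \<open>Y\<close>, and the degree of Tor drops by one.\<close>

lemma TV_shift:
  assumes Y: "sm J Y" and T: "TV Y (Suc i)" and G: "gen J Y B G"
  shows "TV {w. \<forall>r\<in>J. (\<Sum>c\<in>B. G r c * w c) \<in> I} i"
  unfolding TV_def
proof (intro allI impI)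
  let ?Y' = "{w. \<forall>r\<in>J. (\<Sum>c\<in>B. G r c * w c) \<in> I}"
  let ?a = "n i" and ?b = "n (Suc i)" and ?c = "n (Suc (Suc i))" and ?e = "n (Suc (Suc (Suc i)))"
  fix g assume g: "\<forall>r<?a. (\<lambda>s. \<Sum>c<?b. d i r c * g c s) \<in> ?Y'"
  define Gg where "Gg c s = (\<Sum>b\<in>B. G s b * g c b)" for c s
  have k: "(\<Sum>c<?b. d i r c * Gg c s) \<in> I" if "r < ?a" "s \<in> J" for r s
  proof -
    have "(\<Sum>b\<in>B. G s b * (\<Sum>c<?b. d i r c * g c b)) \<in> I" using g that by blast
    also have "(\<Sum>b\<in>B. G s b * (\<Sum>c<?b. d i r c * g c b)) = (\<Sum>c<?b. d i r c * Gg c s)"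
      unfolding Gg_def sum_distrib_left by (subst sum.swap) (simp add: mult.left_commute)
    finally show ?thesis .
  qed
  have "\<forall>s. \<exists>w. s \<in> J \<longrightarrow> (\<forall>r<?b. cg (Gg r s) (\<Sum>c<?c. d (Suc i) r c * w c))"
  proof
    fix s show "\<exists>w. s \<in> J \<longrightarrow> (\<forall>r<?b. cg (Gg r s) (\<Sum>c<?c. d (Suc i) r c * w c))"
      using res[unfolded resI_def, rule_format, of i "\<lambda>c. Gg c s"] k[of _ s] by blast
  qed
  then obtain h where h: "\<And>s r. s \<in> J \<Longrightarrow> r < ?b \<Longrightarrow> cg (Gg r s) (\<Sum>c<?c. d (Suc i) r c * h s c)" by metis
  have GY: "Gg r \<in> Y" for r by (rule gen_mem[OF G, of _ "g r"]) (simp add: Gg_def)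
  have "\<forall>r<?b. (\<lambda>s. \<Sum>c<?c. d (Suc i) r c * h s c) \<in> Y"
    by (intro allI impI sm_cong[OF Y GY]) (rule cg_sym, rule h)
  from T[unfolded TV_def, THEN spec[where x="\<lambda>c s. h s c"], THEN mp, OF this]
  obtain k where k0: "\<forall>r<?c. (\<lambda>s. h s r - (\<Sum>c<?e. d (Suc (Suc i)) r c * k c s)) \<in> Y" ..
  note k = k0[rule_format]
  have "\<forall>r. \<exists>u. r < ?c \<longrightarrow> (\<forall>s\<in>J. cg (h s r - (\<Sum>c<?e. d (Suc (Suc i)) r c * k c s)) (\<Sum>b\<in>B. G s b * u b))"
  proof
    fix r
    have Gv: "\<forall>v\<in>Y. \<exists>w. \<forall>r\<in>J. cg (v r) (\<Sum>c\<in>B. G r c * w c)" using G unfolding gen_def by simp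
    show "\<exists>u. r < ?c \<longrightarrow> (\<forall>s\<in>J. cg (h s r - (\<Sum>c<?e. d (Suc (Suc i)) r c * k c s)) (\<Sum>b\<in>B. G s b * u b))"
    proof (cases "r < ?c")
      case True
      from bspec[OF Gv k[OF True]] obtain u where
        "\<forall>s\<in>J. cg (h s r - (\<Sum>c<?e. d (Suc (Suc i)) r c * k c s)) (\<Sum>b\<in>B. G s b * u b)" ..
      then show ?thesis by (intro exI[of _ u]) simp
    qed simp
  qed
  from choice[OF this] obtain u where u0: "\<forall>r. r < ?c \<longrightarrow> (\<forall>s\<in>J.
      cg (h s r - (\<Sum>c<?e. d (Suc (Suc i)) r c * k c s)) (\<Sum>b\<in>B. G s b * u r b))" ..
  note u = u0[rule_format]
  have "(\<Sum>b\<in>B. G s b * (g r b - (\<Sum>c<?c. d (Suc i) r c * u c b))) \<in> I" if r: "r < ?b" and s: "s \<in> J" for r s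
  proof -
    have 1: "(\<Sum>b\<in>B. G s b * (g r b - (\<Sum>c<?c. d (Suc i) r c * u c b)))
       = Gg r s - (\<Sum>c<?c. d (Suc i) r c * (\<Sum>b\<in>B. G s b * u c b))"
      unfolding Gg_def right_diff_distrib sum_subtractf sum_distrib_left
      by (subst (2) sum.swap) (simp add: mult.left_commute)
    have "cg (\<Sum>c<?c. d (Suc i) r c * (\<Sum>b\<in>B. G s b * u c b))
       (\<Sum>c<?c. d (Suc i) r c * (h s c - (\<Sum>c'<?e. d (Suc (Suc i)) c c' * k c' s)))"
      by (rule cg_sum, rule cg_mult, rule cg_sym, rule u) (use s in auto)
    also have "(\<Sum>c<?c. d (Suc i) r c * (h s c - (\<Sum>c'<?e. d (Suc (Suc i)) c c' * k c' s)))
      = (\<Sum>c<?c. d (Suc i) r c * h s c) - (\<Sum>c<?c. d (Suc i) r c * (\<Sum>c'<?e. d (Suc (Suc i)) c c' * k c' s))"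
      by (simp add: right_diff_distrib sum_subtractf)
    finally have "cg (\<Sum>c<?c. d (Suc i) r c * (\<Sum>b\<in>B. G s b * u c b))
      ((\<Sum>c<?c. d (Suc i) r c * h s c) - (\<Sum>c<?c. d (Suc i) r c * (\<Sum>c'<?e. d (Suc (Suc i)) c c' * k c' s)))" .
    from cg_diff[OF h[OF s r] this] have "cg (\<Sum>b\<in>B. G s b * (g r b - (\<Sum>c<?c. d (Suc i) r c * u c b)))
       (\<Sum>c<?c. d (Suc i) r c * (\<Sum>c'<?e. d (Suc (Suc i)) c c' * k c' s))" unfolding 1 by simp
    then show ?thesis using cg_I dd[OF r, of "\<lambda>c'. k c' s"] by blast
  qed
  then show "\<exists>h. \<forall>r<?b. (\<lambda>s. g r s - (\<Sum>c<?c. d (Suc i) r c * h c s)) \<in> ?Y'"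
    by (intro exI[of _ u]) blast
qed

text \<open>By induction the syzygies of minimal generators of \<open>Y\<close> vanish. But the
  socle element \<open>s\<close>, placed at any single generator, is a syzygy, because the entries
  of the generators have no constant term. So there are no generators.\<close>

lemma TV_zero:
  assumes s: "s \<notin> I" "\<And>i. i < 4 \<Longrightarrow> xv i * s \<in> I"
  assumes "finite J" "sm J Y" "\<And>v r. v \<in> Y \<Longrightarrow> r \<in> J \<Longrightarrow> lkp (v r) 0 = 0" "TV Y i" "v \<in> Y" "r \<in> J"
  shows "v r \<in> I"
  using assms(3-8)
proof (induct i arbitrary: J Y v r)
  case 0
  then show ?case using TV_base[of J Y v r] by blast
next
  case (Suc i)
  obtain B G where BG: "gen J Y B G"
    "\<And>w. (\<And>r. r \<in> J \<Longrightarrow> (\<Sum>c\<in>B. G r c * w c) \<in> I) \<Longrightarrow> \<forall>c\<in>B. lkp (w c) 0 = 0"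
    using min_gen_exists[OF Suc(2,3)] by blast
  have fB: "finite B" using BG(1) unfolding gen_def by blast
  let ?Y' = "{w. \<forall>r\<in>J. (\<Sum>c\<in>B. G r c * w c) \<in> I}"
  have sY': "sm B ?Y'" unfolding sm_def
  proof (intro conjI allI ballI impI CollectI; (elim CollectE)?)
    fix v r assume "\<forall>r\<in>B. v r \<in> I"
    then show "(\<Sum>c\<in>B. G r c * v c) \<in> I" by (intro qideal_sum[OF qI] qidealD(3)[OF qI]) simp
  next
    fix u v r assume "\<forall>r\<in>J. (\<Sum>c\<in>B. G r c * u c) \<in> I" "\<forall>r\<in>J. (\<Sum>c\<in>B. G r c * v c) \<in> I" "r \<in> J"
    then show "(\<Sum>c\<in>B. G r c * (u c + v c)) \<in> I" using qidealD(2)[OF qI] by (simp add: distrib_left sum.distrib)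
  next
    fix v q r assume "\<forall>r\<in>J. (\<Sum>c\<in>B. G r c * v c) \<in> I" "r \<in> J"
    then have "q * (\<Sum>c\<in>B. G r c * v c) \<in> I" using qidealD(3)[OF qI] by blast
    then show "(\<Sum>c\<in>B. G r c * (q * v c)) \<in> I" by (simp add: sum_distrib_left mult.left_commute)
  qed
  have z: "w c \<in> I" if "w \<in> ?Y'" "c \<in> B" for w c
    using Suc(1)[OF fB sY' _ TV_shift[OF Suc(3,5) BG(1)] that] BG(2) by blast
  have "B = {}"
  proof (rule ccontr)
    assume "B \<noteq> {}"
    then obtain c where c: "c \<in> B" by blast
    define w where "w = (\<lambda>b. if b = c then s else 0)"
    have sm0: "s * p \<in> I" if p0: "lkp p 0 = 0" for p
    proof -
      obtain q where q: "p = (\<Sum>i<4. xv i * q i)" using p0 varid_4 unfolding varid_def by blast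
      have "s * p = (\<Sum>i<4. q i * (xv i * s))" unfolding q by (simp add: sum_distrib_left ac_simps)
      also have "\<dots> \<in> I" by (rule qideal_sum[OF qI], rule qidealD(3)[OF qI], rule s(2), simp)
      finally show ?thesis .
    qed
    have colY: "(\<lambda>r. G r c) \<in> Y"
    proof -
      have "\<forall>r\<in>J. cg (G r c) (\<Sum>b\<in>B. G r b * (if b = c then 1 else 0))"
        using fB c by (simp add: if_distrib cong: if_cong)
      then show ?thesis by (intro gen_mem[OF BG(1), where v="\<lambda>r. G r c" and w="\<lambda>b. if b = c then 1 else 0"]) blast
    qed
    have "w \<in> ?Y'"
    proof (intro CollectI ballI)
      fix r assume r: "r \<in> J"
      have "(\<Sum>b\<in>B. G r b * w b) = s * G r c"
        using fB c by (simp add: w_def if_distrib mult.commute cong: if_cong)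
      then show "(\<Sum>b\<in>B. G r b * w b) \<in> I" using sm0[OF Suc(4)[OF colY r]] by simp
    qed
    from z[OF this c] show False using s(1) by (simp add: w_def)
  qed
  then have "\<exists>w. \<forall>r\<in>J. cg (v r) 0" using BG(1) Suc(6) unfolding gen_def by auto
  then show ?case using Suc(7) by (simp add: cg_0)
qed

end

section \<open>Generators of the dual module\<close>

context artin
begin

text \<open>The dual module \<open>Hom\<^sub>k(Q/I, k)\<close>.\<close>

definition fnl :: "((4, 'k) mpoly \<Rightarrow> 'k) \<Rightarrow> bool" where
  "fnl \<phi> \<longleftrightarrow> (\<forall>p q. \<phi> (p + q) = \<phi> p + \<phi> q) \<and> (\<forall>c p. \<phi> (kc c * p) = c * \<phi> p) \<and> (\<forall>p\<in>I. \<phi> p = 0)"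

lemma fnlD: assumes "fnl \<phi>"
  shows "\<phi> (p + q) = \<phi> p + \<phi> q" "\<phi> (kc c * p) = c * \<phi> p" "p \<in> I \<Longrightarrow> \<phi> p = 0" "\<phi> 0 = 0"
    "\<phi> (p - q) = \<phi> p - \<phi> q" "\<phi> (- p) = - \<phi> p"
proof -
  show *: "\<phi> (p + q) = \<phi> p + \<phi> q" "\<phi> (kc c * p) = c * \<phi> p" "p \<in> I \<Longrightarrow> \<phi> p = 0" for p q c
    using assms unfolding fnl_def by blast+
  show "\<phi> 0 = 0" using *(2)[of 0 0] by simp
  have m: "\<phi> (- q) = - \<phi> q" for q using *(2)[of "-1" q] by (simp add: kc_minus)
  then show "\<phi> (- p) = - \<phi> p" .
  show "\<phi> (p - q) = \<phi> p - \<phi> q" using *(1)[of p "- q"] m by simp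
qed

lemma fnl_sum: "fnl \<phi> \<Longrightarrow> \<phi> (sum f A) = (\<Sum>i\<in>A. \<phi> (f i))"
  by (induct A rule: infinite_finite_induct) (simp_all add: fnlD)

lemma fnl_cg: "fnl \<phi> \<Longrightarrow> cg p q \<Longrightarrow> \<phi> p = \<phi> q"
  using fnlD(3)[of \<phi> "p - q"] fnlD(5)[of \<phi> p q] unfolding cg_def by simp

text \<open>A ring element \<open>a\<close> acts on a functional by precomposition with
  multiplication by \<open>a\<close>.\<close>

definition genE :: "nat set \<Rightarrow> (nat \<Rightarrow> (4, 'k) mpoly \<Rightarrow> 'k) \<Rightarrow> bool" where
  "genE B \<phi> \<longleftrightarrow> finite B \<and> (\<forall>t\<in>B. fnl (\<phi> t)) \<and> (\<forall>\<psi>. fnl \<psi> \<longrightarrow> (\<exists>a. \<forall>p. \<psi> p = (\<Sum>t\<in>B. \<phi> t (a t * p))))"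

text \<open>The monomials of degree below 4 are orthonormal. They suffice to represent a functional
  that vanishes on \<open>I\<close>, since all other monomials lie in \<open>I\<close>.\<close>

definition pr :: "(4, 'k) mpoly \<Rightarrow> (4, 'k) mpoly \<Rightarrow> 'k" where
  "pr e p = (\<Sum>m\<in>{m. mon_deg m < 4}. lkp e m * lkp p m)"

lemma pr_simps: "pr e (p + q) = pr e p + pr e q" "pr e (kc c * p) = c * pr e p" "pr (e + f) p = pr e p + pr f p"
   "pr (kc c * e) p = c * pr e p" "pr 0 p = 0"
  unfolding pr_def by (simp_all add: lookup_add distrib_left distrib_right sum.distrib sum_distrib_left mult.assoc mult.left_commute)

lemma genE_exists: "\<exists>B \<phi>. genE B \<phi>"
proof -
  define E where "E = {e \<in> Qlt. \<forall>p\<in>I. pr e p = 0}"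
  have "Qv.fd E" by (rule Qv.fd_subset[OF Qlt_fd]) (auto simp: E_def)
  then obtain T where T: "finite T" "T \<subseteq> E" "E \<subseteq> Qv.span T" using Qv.fd_basis by metis
  obtain g where g: "bij_betw g {..<card T} T" using T(1) by (metis bij_betw_from_nat_into_finite)
  have "genE {..<card T} (\<lambda>t. pr (g t))" unfolding genE_def
  proof (intro conjI ballI allI impI)
    fix t assume "t \<in> {..<card T}"
    then have "g t \<in> E" using g T(2) unfolding bij_betw_def by blast
    then show "fnl (pr (g t))" unfolding fnl_def E_def by (simp add: pr_simps)
  next
    fix \<psi> assume psi: "fnl \<psi>"
    define e where "e = (\<Sum>m\<in>{m. mon_deg m < 4}. Poly_Mapping.single m (\<psi> (Poly_Mapping.single m 1)))"
    have le: "lkp e m = (if mon_deg m < 4 then \<psi> (Poly_Mapping.single m 1) else 0)" for m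
    proof -
      have "lkp e m = (\<Sum>n\<in>{m. mon_deg m < 4}. if n = m then \<psi> (Poly_Mapping.single n 1) else 0)"
        by (simp add: e_def lookup_sum lookup_single when_def)
      then show ?thesis using finite_mon_lt by simp
    qed
    have pe: "pr e p = \<psi> p" for p
    proof -
      have "\<psi> p = \<psi> (tr p)" by (rule fnl_cg[OF psi cg_tr])
      also have "\<dots> = (\<Sum>m\<in>{m. mon_deg m < 4}. \<psi> (kc (lkp p m) * Poly_Mapping.single m 1))"
        unfolding tr_def fnl_sum[OF psi] by (simp add: kc_def mult_single)
      also have "\<dots> = pr e p" unfolding pr_def
      proof (rule sum.cong[OF refl])
        fix m :: "4 \<Rightarrow>\<^sub>0 nat" assume "m \<in> {m. mon_deg m < 4}"
        then show "\<psi> (kc (lkp p m) * Poly_Mapping.single m 1) = lkp e m * lkp p m"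
          unfolding fnlD(2)[OF psi] le by simp
      qed
      finally show ?thesis by simp
    qed
    have "e \<in> E" unfolding E_def Qlt_def using pe fnlD(3)[OF psi] by (auto simp: in_keys_iff le split: if_splits)
    then have "e \<in> Qv.span T" using T(3) by blast
    then obtain u where u: "e = (\<Sum>f\<in>T. qs (u f) f)" unfolding Qv.span_finite[OF T(1)] by blast
    have "\<psi> p = (\<Sum>t<card T. pr (g t) (kc (u (g t)) * p))" for p
    proof -
      have ps: "pr (\<Sum>f\<in>A. qs (u f) f) p = (\<Sum>f\<in>A. u f * pr f p)" for A
        by (induct A rule: infinite_finite_induct) (simp_all add: pr_simps qs_def)
      have "\<psi> p = (\<Sum>f\<in>T. u f * pr f p)" unfolding pe[symmetric] u by (rule ps)
      also have "\<dots> = (\<Sum>t<card T. u (g t) * pr (g t) p)" by (rule sum.reindex_bij_betw[OF g, symmetric])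
      finally show ?thesis by (simp add: pr_simps)
    qed
    then show "\<exists>a. \<forall>p. \<psi> p = (\<Sum>t\<in>{..<card T}. pr (g t) (a t * p))" by (intro exI[of _ "\<lambda>t. kc (u (g t))"]) blast
  qed simp
  then show ?thesis by blast
qed

text \<open>The argument of \<open>min_gen_exists\<close>, for functionals.\<close>

lemma min_genE_exists: "\<exists>B \<phi>. genE B \<phi> \<and> (\<forall>a. (\<forall>p. (\<Sum>t\<in>B. \<phi> t (a t * p)) = 0) \<longrightarrow> (\<forall>t\<in>B. lkp (a t) 0 = 0))"
proof -
  define P where "P m \<longleftrightarrow> (\<exists>B \<phi>. genE B \<phi> \<and> card B = m)" for m
  have "\<exists>m. P m" using genE_exists unfolding P_def by blast
  then have "P (LEAST m. P m)" by (rule LeastI_ex)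
  then obtain B \<phi> where B: "genE B \<phi>" "card B = (LEAST m. P m)" unfolding P_def by blast
  have fB: "finite B" and fn: "\<And>t. t \<in> B \<Longrightarrow> fnl (\<phi> t)" using B(1) unfolding genE_def by blast+
  have "lkp (a c) 0 = 0" if a: "\<And>p. (\<Sum>t\<in>B. \<phi> t (a t * p)) = 0" and c: "c \<in> B" for a c
  proof (rule ccontr)
    assume "lkp (a c) 0 \<noteq> 0"
    then obtain u where u: "cg (u * a c) 1" using cg_unit by blast
    have col: "\<phi> c p = (\<Sum>t\<in>B - {c}. \<phi> t (- (a t * u) * p))" for p
    proof -
      have "cg (p * 1) (p * (u * a c))" by (rule cg_mult[OF cg_sym[OF u]])
      then have "\<phi> c p = \<phi> c (a c * (u * p))" using fnl_cg[OF fn[OF c], of p "a c * (u * p)"] by (simp add: ac_simps)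
      also have "\<dots> = - (\<Sum>t\<in>B - {c}. \<phi> t (a t * (u * p)))"
        using a[of "u * p"] unfolding sum.remove[OF fB c] by (simp add: eq_neg_iff_add_eq_0)
      also have "\<dots> = (\<Sum>t\<in>B - {c}. \<phi> t (- (a t * u) * p))"
        unfolding sum_negf[symmetric] by (rule sum.cong[OF refl]) (use fn fnlD(6) in \<open>simp add: mult.assoc\<close>)
      finally show ?thesis .
    qed
    have "genE (B - {c}) \<phi>" unfolding genE_def
    proof (intro conjI ballI allI impI)
      fix \<psi> assume "fnl \<psi>"
      then obtain x where x: "\<And>p. \<psi> p = (\<Sum>t\<in>B. \<phi> t (x t * p))" using B(1) unfolding genE_def by blast
      have "\<psi> p = (\<Sum>t\<in>B - {c}. \<phi> t ((- (a t * u) * x c + x t) * p))" for p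
      proof -
        have "\<psi> p = (\<Sum>t\<in>B - {c}. \<phi> t (- (a t * u) * (x c * p))) + (\<Sum>t\<in>B - {c}. \<phi> t (x t * p))"
          unfolding x sum.remove[OF fB c] col[of "x c * p"] ..
        also have "\<dots> = (\<Sum>t\<in>B - {c}. \<phi> t ((- (a t * u) * x c + x t) * p))"
          unfolding sum.distrib[symmetric]
          by (rule sum.cong[OF refl]) (use fn in \<open>simp only: fnlD(1)[symmetric] DiffD1 distrib_right mult.assoc\<close>)
        finally show ?thesis .
      qed
      then show "\<exists>a. \<forall>p. \<psi> p = (\<Sum>t\<in>B - {c}. \<phi> t (a t * p))"
        by (intro exI[of _ "\<lambda>t. - (a t * u) * x c + x t"]) blast
    qed (use fB fn in auto)
    then have "P (card (B - {c}))" unfolding P_def by blast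
    then have "(LEAST m. P m) \<le> card (B - {c})" by (rule Least_le)
    then show False using B(2) card_Diff1_less[OF fB c] by simp
  qed
  then show ?thesis using B(1) by (intro exI[of _ B] exI[of _ \<phi>]) blast
qed

end

section \<open>Freeness of the dual module and the socle\<close>

context artin_res
begin

text \<open>Dualizing over the field turns the transposed complex into the resolution tensored with
  the dual module. A cycle there is a functional that kills the image of one transposed matrix.
  Vanishing of Ext makes it factor through the next transposed matrix, and the components of the
  factor, expressed by the generators, are the chain sought.\<close>

lemma TV_dual:
  assumes E: "genE B \<phi>" and ext: "extI n d i"
  shows "TV {a. \<forall>p. (\<Sum>t\<in>B. \<phi> t (a t * p)) = 0} i"
  unfolding TV_def
proof (intro allI impI)
  let ?Y = "{a. \<forall>p. (\<Sum>t\<in>B. \<phi> t (a t * p)) = 0}"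
  let ?a = "n i" and ?b = "n (Suc i)" and ?c = "n (Suc (Suc i))"
  fix g assume "\<forall>r<?a. (\<lambda>s. \<Sum>c<?b. d i r c * g c s) \<in> ?Y"
  then have g: "(\<Sum>t\<in>B. \<phi> t ((\<Sum>c<?b. d i r c * g c t) * p)) = 0" if "r < ?a" for r p using that by blast
  have fB: "finite B" and fn: "\<And>t. t \<in> B \<Longrightarrow> fnl (\<phi> t)" using E unfolding genE_def by blast+
  define e where "e c p = (\<Sum>t\<in>B. \<phi> t (g c t * p))" for c p
  have fe: "fnl (e c)" for c unfolding fnl_def
  proof (intro conjI allI ballI)
    fix p q show "e c (p + q) = e c p + e c q" unfolding e_def sum.distrib[symmetric]
      by (rule sum.cong[OF refl]) (simp add: distrib_left fnlD(1)[OF fn])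
  next
    fix x p show "e c (kc x * p) = x * e c p" unfolding e_def sum_distrib_left
      by (rule sum.cong[OF refl]) (simp add: fnlD(2)[OF fn] mult.left_commute[of _ "kc x"])
  next
    fix p assume "p \<in> I"
    then show "e c p = 0" unfolding e_def by (intro sum.neutral ballI fnlD(3)[OF fn] qidealD(3)[OF qI])
  qed
  have ez: "(\<Sum>c<?b. e c (d i r c * p)) = 0" if "r < ?a" for r p
  proof -
    have "(\<Sum>c<?b. e c (d i r c * p)) = (\<Sum>t\<in>B. \<Sum>c<?b. \<phi> t (g c t * (d i r c * p)))"
      unfolding e_def by (rule sum.swap)
    also have "\<dots> = (\<Sum>t\<in>B. \<phi> t ((\<Sum>c<?b. d i r c * g c t) * p))"
    proof (rule sum.cong[OF refl])
      fix t assume t: "t \<in> B"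
      have "(\<Sum>c<?b. d i r c * g c t) * p = (\<Sum>c<?b. g c t * (d i r c * p))"
        by (simp add: sum_distrib_right sum_distrib_left ac_simps)
      then show "(\<Sum>c<?b. \<phi> t (g c t * (d i r c * p))) = \<phi> t ((\<Sum>c<?b. d i r c * g c t) * p)"
        by (simp only: fnl_sum[OF fn[OF t]])
    qed
    finally show ?thesis using g[OF that] by simp
  qed
  \<comment> \<open>\<open>L\<close> is the cycle \<open>g\<close> read as one functional on
    vectors; \<open>T\<close> below is the transpose of \<open>d (Suc i)\<close>, set to 0 beyond
    its rank.\<close>
  define L where "L v = (\<Sum>c<?b. e c (v c))" for v :: "'a pvec"
  define T where "T v = (\<lambda>r. if r < ?c then \<Sum>c<?b. d (Suc i) c r * v c else 0)" for v :: "'a pvec"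
  have linL: "Vector_Spaces.linear fs (*) L"
    by unfold_locales (simp_all add: L_def fs_def fnlD(1,2)[OF fe] sum.distrib sum_distrib_left distrib_left distrib_right mult.assoc)
  have linT: "Vector_Spaces.linear fs fs T"
    by (rule linear_FF_I) (auto simp: T_def fs_def fun_eq_iff distrib_left sum.distrib sum_distrib_left mult.left_commute)
  have subN: "Fv.subspace {v :: 'a pvec. \<forall>r<?c. v r \<in> I}"
    by (rule Fv.subspaceI) (auto simp: fs_def intro: qidealD[OF qI])
  have zz: "L v = 0" if "T v \<in> {v. \<forall>r<?c. v r \<in> I}" for v
  proof -
    have "\<forall>r<?c. (\<Sum>c<?b. d (Suc i) c r * v c) \<in> I" using that by (simp add: T_def)
    then obtain w where w: "\<And>r. r < ?b \<Longrightarrow> cg (v r) (\<Sum>c<?a. d i c r * w c)" using ext unfolding extI_def by blast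
    have "L v = (\<Sum>r<?b. e r (\<Sum>c<?a. d i c r * w c))"
      unfolding L_def by (rule sum.cong[OF refl]) (use w fnl_cg[OF fe] in simp)
    also have "\<dots> = (\<Sum>c<?a. \<Sum>r<?b. e r (d i c r * w c))" unfolding fnl_sum[OF fe] by (rule sum.swap)
    also have "\<dots> = 0" by (rule sum.neutral) (simp add: ez)
    finally show ?thesis .
  qed
  obtain L' where L': "Vector_Spaces.linear fs (*) L'" "\<And>v. L' (T v) = L v" "\<And>x. \<forall>r<?c. x r \<in> I \<Longrightarrow> L' x = 0"
    using functional_factor[OF linT subN linL zz] by blast
  interpret FK: vector_space_pair "fs :: 'a \<Rightarrow> 'a pvec \<Rightarrow> _" "(*) :: 'a \<Rightarrow> 'a \<Rightarrow> 'a" ..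
  define \<delta> where "\<delta> k p = (\<lambda>r. if r = k then p else 0)" for k :: nat and p :: "(4, 'a) mpoly"
  have dadd: "\<delta> k (p + q) = \<delta> k p + \<delta> k q" and dsc: "\<delta> k (kc x * p) = fs x (\<delta> k p)" for k p q x
    by (auto simp: \<delta>_def fs_def fun_eq_iff)
  define e' where "e' k p = L' (\<delta> k p)" for k p
  have fe': "fnl (e' k)" for k unfolding fnl_def e'_def
  proof (intro conjI allI ballI)
    show "L' (\<delta> k (p + q)) = L' (\<delta> k p) + L' (\<delta> k q)" for p q
      unfolding dadd by (rule FK.linear_add[OF L'(1)])
    show "L' (\<delta> k (kc x * p)) = x * L' (\<delta> k p)" for x p
      unfolding dsc by (rule FK.linear_scale[OF L'(1)])
    show "L' (\<delta> k p) = 0" if "p \<in> I" for p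
      by (rule L'(3)) (use that qidealD(1)[OF qI] in \<open>simp add: \<delta>_def\<close>)
  qed
  have key: "e r p = (\<Sum>k<?c. e' k (d (Suc i) r k * p))" if r: "r < ?b" for r p
  proof -
    have "L (\<delta> r p) = (\<Sum>c<?b. if c = r then e r p else 0)"
      unfolding L_def by (rule sum.cong[OF refl]) (simp add: \<delta>_def fnlD(4)[OF fe])
    then have "e r p = L (\<delta> r p)" using r by simp
    also have "\<dots> = L' (T (\<delta> r p))" by (simp add: L'(2))
    also have "T (\<delta> r p) = (\<Sum>k<?c. \<delta> k (d (Suc i) r k * p))"
    proof
      fix k
      have s: "(\<Sum>k\<in>A. f k) x = (\<Sum>k\<in>A. f k x)" for A and f :: "nat \<Rightarrow> 'a pvec" and x
        by (induct A rule: infinite_finite_induct) simp_all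
      have "T (\<delta> r p) k = (if k < ?c then \<Sum>c<?b. if c = r then d (Suc i) r k * p else 0 else 0)"
        using r by (simp add: T_def \<delta>_def if_distrib cong: if_cong)
      also have "\<dots> = (if k < ?c then d (Suc i) r k * p else 0)" using r by simp
      also have "\<dots> = (\<Sum>j<?c. \<delta> j (d (Suc i) r j * p) k)" unfolding \<delta>_def by simp
      finally show "T (\<delta> r p) k = (\<Sum>k<?c. \<delta> k (d (Suc i) r k * p)) k" by (simp only: s)
    qed
    also have "L' (\<Sum>k<?c. \<delta> k (d (Suc i) r k * p)) = (\<Sum>k<?c. e' k (d (Suc i) r k * p))"
      unfolding e'_def by (rule FK.linear_sum[OF L'(1)])
    finally show ?thesis .
  qed
  have "\<forall>k. \<exists>a. \<forall>p. e' k p = (\<Sum>t\<in>B. \<phi> t (a t * p))" using E fe' unfolding genE_def by blast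
  then obtain h where h: "\<And>k p. e' k p = (\<Sum>t\<in>B. \<phi> t (h k t * p))" by metis
  have "(\<Sum>t\<in>B. \<phi> t ((g r t - (\<Sum>c<?c. d (Suc i) r c * h c t)) * p)) = 0" if r: "r < ?b" for r p
  proof -
    have "(\<Sum>t\<in>B. \<phi> t ((g r t - (\<Sum>c<?c. d (Suc i) r c * h c t)) * p))
      = (\<Sum>t\<in>B. \<phi> t (g r t * p) - (\<Sum>c<?c. \<phi> t (h c t * (d (Suc i) r c * p))))"
    proof (rule sum.cong[OF refl])
      fix t assume t: "t \<in> B"
      have "(g r t - (\<Sum>c<?c. d (Suc i) r c * h c t)) * p = g r t * p - (\<Sum>c<?c. h c t * (d (Suc i) r c * p))"
        by (simp only: left_diff_distrib sum_distrib_right) (simp add: ac_simps)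
      then show "\<phi> t ((g r t - (\<Sum>c<?c. d (Suc i) r c * h c t)) * p) = \<phi> t (g r t * p) - (\<Sum>c<?c. \<phi> t (h c t * (d (Suc i) r c * p)))"
        by (simp only: fnlD(5)[OF fn[OF t]] fnl_sum[OF fn[OF t]])
    qed
    also have "\<dots> = e r p - (\<Sum>c<?c. e' c (d (Suc i) r c * p))"
      unfolding sum_subtractf e_def h by (subst sum.swap) simp
    also have "\<dots> = 0" using key[OF r] by simp
    finally show ?thesis .
  qed
  then show "\<exists>h. \<forall>r<?b. (\<lambda>s. g r s - (\<Sum>c<?c. d (Suc i) r c * h c s)) \<in> ?Y" by (intro exI[of _ h]) blast
qed

text \<open>By \<open>TV_dual\<close> and \<open>TV_zero\<close> the relations between minimal
  generators of the dual module are trivial. On multiples of a socle element a generator sees only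
  the constant coefficient of the factor. So the combination of \<open>s\<close> and
  \<open>t\<close> on which one generator vanishes is killed by all its multiples, and hence lies in
  \<open>I\<close>.\<close>

theorem simple_socle:
  assumes ext: "extI n d i"
    and s: "s \<notin> I" "\<And>i. i < 4 \<Longrightarrow> xv i * s \<in> I" and t: "\<And>i. i < 4 \<Longrightarrow> xv i * t \<in> I"
  shows "\<exists>c. t - kc c * s \<in> I"
proof -
  obtain B \<phi> where B: "genE B \<phi>" "\<And>a. (\<And>p. (\<Sum>t\<in>B. \<phi> t (a t * p)) = 0) \<Longrightarrow> \<forall>t\<in>B. lkp (a t) 0 = 0"
    using min_genE_exists by blast
  have fB: "finite B" and fn: "\<And>t. t \<in> B \<Longrightarrow> fnl (\<phi> t)" using B(1) unfolding genE_def by blast+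
  let ?Y = "{a. \<forall>p. (\<Sum>t\<in>B. \<phi> t (a t * p)) = 0}"
  have sY: "sm B ?Y" unfolding sm_def
  proof (intro conjI allI ballI impI CollectI; (elim CollectE)?)
    fix v p assume "\<forall>r\<in>B. v r \<in> I"
    then show "(\<Sum>t\<in>B. \<phi> t (v t * p)) = 0" by (intro sum.neutral ballI fnlD(3)[OF fn] qidealD(4)[OF qI]) auto
  next
    fix u v p assume "\<forall>p. (\<Sum>t\<in>B. \<phi> t (u t * p)) = 0" "\<forall>p. (\<Sum>t\<in>B. \<phi> t (v t * p)) = 0"
    then show "(\<Sum>t\<in>B. \<phi> t ((u t + v t) * p)) = 0" by (simp add: distrib_right fnlD(1)[OF fn] sum.distrib)
  next
    fix v q p assume "\<forall>p. (\<Sum>t\<in>B. \<phi> t (v t * p)) = 0"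
    then have "(\<Sum>t\<in>B. \<phi> t (v t * (q * p))) = 0" by blast
    then show "(\<Sum>t\<in>B. \<phi> t (q * v t * p)) = 0" by (simp add: ac_simps)
  qed
  have Y: "a r \<in> I" if "\<And>p. (\<Sum>t\<in>B. \<phi> t (a t * p)) = 0" "r \<in> B" for a r
    by (rule TV_zero[OF s fB sY _ TV_dual[OF B(1) ext], of a r]) (use B(2) that in auto)
  have sp: "\<phi> r ((kc x * u) * p) = x * lkp p 0 * \<phi> r u" if "r \<in> B" "\<And>i. i < 4 \<Longrightarrow> xv i * u \<in> I" for r x u p
  proof -
    define q where "q = p - kc (lkp p 0)"
    have "lkp q 0 = 0" by (simp add: q_def lookup_minus lkp_kc)
    then obtain w where w: "q = (\<Sum>i<4. xv i * w i)" using varid_4 unfolding varid_def by blast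
    have "u * q = (\<Sum>i<4. w i * (xv i * u))" unfolding w by (simp add: sum_distrib_left ac_simps)
    also have "\<dots> \<in> I" by (rule qideal_sum[OF qI], rule qidealD(3)[OF qI], rule that(2), simp)
    finally have uq: "\<phi> r (u * q) = 0" by (rule fnlD(3)[OF fn[OF that(1)]])
    have "(kc x * u) * p = kc x * (u * q) + kc (x * lkp p 0) * u" by (simp add: q_def kc_mult algebra_simps)
    then show ?thesis using uq by (simp add: fnlD[OF fn[OF that(1)]])
  qed
  \<comment> \<open>The constant coefficient is a nonzero functional, so there is at least one
    generator.\<close>
  have "fnl (\<lambda>p. lkp p 0)" unfolding fnl_def by (simp add: lookup_add I0)
  then obtain a where a: "\<And>p. lkp p 0 = (\<Sum>t\<in>B. \<phi> t (a t * p))" using B(1) unfolding genE_def by blast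
  have "B \<noteq> {}" using a[of 1] by (auto simp: lookup_one)
  then obtain b where b: "b \<in> B" by blast
  have one: "(\<Sum>t\<in>B. \<phi> t ((if t = b then y else 0) * p)) = \<phi> b (y * p)" for y p
  proof -
    have "(\<Sum>t\<in>B. \<phi> t ((if t = b then y else 0) * p)) = (\<Sum>t\<in>B. if t = b then \<phi> b (y * p) else 0)"
      by (rule sum.cong[OF refl]) (simp add: fnlD(4)[OF fn])
    then show ?thesis using fB b by simp
  qed
  have bs: "\<phi> b s \<noteq> 0"
  proof
    assume 0: "\<phi> b s = 0"
    have "(if b = b then s else 0) \<in> I"
      by (rule Y[of "\<lambda>t. if t = b then s else 0" b, OF _ b]) (use one[of s] sp[OF b s(2), of 1] 0 in simp)
    then show False using s(1) by simp
  qed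
  define y where "y = kc (\<phi> b s) * t - kc (\<phi> b t) * s"
  have "\<phi> b (y * p) = 0" for p
  proof -
    have "\<phi> b ((kc (\<phi> b t) * s) * p) = \<phi> b t * lkp p 0 * \<phi> b s" by (rule sp[OF b]) (rule s(2))
    moreover have "\<phi> b ((kc (\<phi> b s) * t) * p) = \<phi> b s * lkp p 0 * \<phi> b t" by (rule sp[OF b]) (rule t)
    ultimately show ?thesis unfolding y_def left_diff_distrib fnlD(5)[OF fn[OF b]] by simp
  qed
  then have "(if b = b then y else 0) \<in> I"
    by (intro Y[of "\<lambda>t. if t = b then y else 0" b, OF _ b]) (simp only: one)
  then have "kc (inverse (\<phi> b s)) * y \<in> I" using qidealD(3)[OF qI] by simp
  also have "kc (inverse (\<phi> b s)) * y = t - kc (inverse (\<phi> b s) * \<phi> b t) * s"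
  proof -
    have "kc (inverse (\<phi> b s)) * (kc (\<phi> b s) * t) = t" using bs by (simp flip: mult.assoc kc_mult)
    then show ?thesis by (simp add: y_def right_diff_distrib kc_mult mult.assoc)
  qed
  finally show ?thesis by blast
qed

end

section \<open>Localizing at a set of units\<close>

text \<open>The operations of \<open>localization\<close> are unions over representatives; here all
  members of the union agree.\<close>

lemma UN2_const:
  assumes "A \<noteq> {}" "B \<noteq> {}" "\<And>p q. p \<in> A \<Longrightarrow> q \<in> B \<Longrightarrow> f p q = C"
  shows "(\<Union>p\<in>A. \<Union>q\<in>B. f p q) = C"
proof (rule equalityI; rule subsetI)
  fix x assume "x \<in> (\<Union>p\<in>A. \<Union>q\<in>B. f p q)"
  then obtain p q where pq: "p \<in> A" "q \<in> B" "x \<in> f p q" by blast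
  then show "x \<in> C" using assms(3)[OF pq(1,2)] by simp
next
  fix x assume x: "x \<in> C"
  obtain p q where pq: "p \<in> A" "q \<in> B" using assms(1,2) by blast
  then have "x \<in> f p q" using assms(3)[OF pq] x by simp
  then show "x \<in> (\<Union>p\<in>A. \<Union>q\<in>B. f p q)" using pq by blast
qed

text \<open>To be applied to the complement of the maximal ideal in the local ring
  \<open>Q/I\<close>. As only units are inverted, \<open>lc\<close> below is an isomorphism onto the
  localization.\<close>

locale unit_loc = cring A for A (structure) +
  fixes S
  assumes SU: "S \<subseteq> Units A" and S1: "\<one> \<in> S" and SM: "s \<in> S \<Longrightarrow> t \<in> S \<Longrightarrow> s \<otimes> t \<in> S"
begin

text \<open>The class of \<open>r / 1\<close>: since all denominators are units, it contains exactly
  one pair for each denominator.\<close>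

definition lc where "lc r = {(s \<otimes> r, s) |s. s \<in> S}"

lemma lc_nonempty: "lc r \<noteq> {}" using S1 unfolding lc_def by blast

lemma Scarr: "s \<in> S \<Longrightarrow> s \<in> carrier A" using SU Units_closed by blast

lemma fraction_eq: assumes r: "r \<in> carrier A" and s: "s \<in> S" shows "fraction A S r s = lc (inv s \<otimes> r)"
proof -
  have sU: "s \<in> Units A" and sc: "s \<in> carrier A" and isc: "inv s \<in> carrier A" using s SU Scarr by auto
  have "(\<exists>t\<in>S. t \<otimes> (s \<otimes> r') = t \<otimes> (s' \<otimes> r)) \<longleftrightarrow> r' = s' \<otimes> (inv s \<otimes> r)"
    if r': "r' \<in> carrier A" and s': "s' \<in> S" for r' s'
  proof
    assume "\<exists>t\<in>S. t \<otimes> (s \<otimes> r') = t \<otimes> (s' \<otimes> r)"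
    then obtain t where t: "t \<in> S" "t \<otimes> (s \<otimes> r') = t \<otimes> (s' \<otimes> r)" by blast
    have "s \<otimes> r' = s' \<otimes> r" using t(2) Units_l_cancel[of t "s \<otimes> r'" "s' \<otimes> r"] t(1) SU sc r r' Scarr[OF s'] by blast
    then have "inv s \<otimes> (s \<otimes> r') = inv s \<otimes> (s' \<otimes> r)" by simp
    moreover have "inv s \<otimes> (s \<otimes> r') = r'" using sU sc isc r' by (simp add: m_assoc[symmetric])
    moreover have "inv s \<otimes> (s' \<otimes> r) = s' \<otimes> (inv s \<otimes> r)" using isc Scarr[OF s'] r by (rule m_lcomm)
    ultimately show "r' = s' \<otimes> (inv s \<otimes> r)" by simp
  next
    assume e: "r' = s' \<otimes> (inv s \<otimes> r)"
    have "s \<otimes> (s' \<otimes> (inv s \<otimes> r)) = s' \<otimes> (s \<otimes> (inv s \<otimes> r))" using sc Scarr[OF s'] isc r by (intro m_lcomm) auto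
    also have "s \<otimes> (inv s \<otimes> r) = r" using sU sc isc r by (simp add: m_assoc[symmetric])
    finally show "\<exists>t\<in>S. t \<otimes> (s \<otimes> r') = t \<otimes> (s' \<otimes> r)" using s unfolding e by (intro bexI[of _ s]) simp
  qed
  moreover have "s' \<otimes> (inv s \<otimes> r) \<in> carrier A" if "s' \<in> S" for s' using Scarr[OF that] isc r by simp
  ultimately show ?thesis unfolding fraction_def lc_def by fastforce
qed

lemma fraction_one: "r \<in> carrier A \<Longrightarrow> fraction A S r \<one> = lc r"
  using fraction_eq[of r \<one>] S1 by simp

abbreviation "Loc \<equiv> localization A S"

lemma carrier_Loc: "carrier Loc = lc ` carrier A"
proof (rule equalityI; rule subsetI)
  fix x assume "x \<in> carrier Loc"
  then obtain r s where "r \<in> carrier A" "s \<in> S" "x = fraction A S r s" unfolding localization_def by auto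
  then show "x \<in> lc ` carrier A" using fraction_eq SU Scarr by auto
next
  fix x assume "x \<in> lc ` carrier A"
  then obtain r where "r \<in> carrier A" "x = fraction A S r \<one>" using fraction_one by blast
  then show "x \<in> carrier Loc" unfolding localization_def using S1 by auto
qed

lemma lc_inj: assumes "a \<in> carrier A" "b \<in> carrier A" "lc a = lc b" shows "a = b"
proof -
  have "(\<one> \<otimes> a, \<one>) \<in> lc a" unfolding lc_def using S1 by blast
  then have "(\<one> \<otimes> a, \<one>) \<in> lc b" unfolding assms(3) .
  then show ?thesis using assms(1,2) unfolding lc_def by auto
qed

lemma unit_cancel: assumes "u \<in> S" "a \<in> carrier A" shows "inv u \<otimes> (u \<otimes> a) = a"
proof -
  have "u \<in> Units A" "u \<in> carrier A" "inv u \<in> carrier A" using assms(1) SU Scarr by auto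
  then show ?thesis using assms(2) by (simp add: m_assoc[symmetric])
qed

lemma lc_mult: assumes a: "a \<in> carrier A" and b: "b \<in> carrier A"
  shows "lc a \<otimes>\<^bsub>Loc\<^esub> lc b = lc (a \<otimes> b)"
proof -
  have "fraction A S ((s \<otimes> a) \<otimes> (t \<otimes> b)) (s \<otimes> t) = lc (a \<otimes> b)" if s: "s \<in> S" and t: "t \<in> S" for s t
  proof -
    have "(s \<otimes> a) \<otimes> (t \<otimes> b) = (s \<otimes> t) \<otimes> (a \<otimes> b)" using a b Scarr[OF s] Scarr[OF t] by (simp add: m_ac)
    then show ?thesis using fraction_eq[of "(s \<otimes> t) \<otimes> (a \<otimes> b)" "s \<otimes> t"] unit_cancel[of "s \<otimes> t" "a \<otimes> b"] SM[OF s t] a b Scarr by simp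
  qed
  then have "(\<Union>p\<in>lc a. \<Union>q\<in>lc b. fraction A S (fst p \<otimes> fst q) (snd p \<otimes> snd q)) = lc (a \<otimes> b)"
    by (intro UN2_const lc_nonempty) (auto simp: lc_def[of a] lc_def[of b])
  then show ?thesis by (simp add: localization_def)
qed

lemma lc_add: assumes a: "a \<in> carrier A" and b: "b \<in> carrier A"
  shows "lc a \<oplus>\<^bsub>Loc\<^esub> lc b = lc (a \<oplus> b)"
proof -
  have "fraction A S ((t \<otimes> (s \<otimes> a)) \<oplus> (s \<otimes> (t \<otimes> b))) (s \<otimes> t) = lc (a \<oplus> b)" if s: "s \<in> S" and t: "t \<in> S" for s t
  proof -
    have "(t \<otimes> (s \<otimes> a)) \<oplus> (s \<otimes> (t \<otimes> b)) = (s \<otimes> t) \<otimes> (a \<oplus> b)"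
      using a b Scarr[OF s] Scarr[OF t] by (simp add: r_distr m_ac)
    then show ?thesis using fraction_eq[of "(s \<otimes> t) \<otimes> (a \<oplus> b)" "s \<otimes> t"] unit_cancel[of "s \<otimes> t" "a \<oplus> b"] SM[OF s t] a b Scarr by simp
  qed
  then have "(\<Union>p\<in>lc a. \<Union>q\<in>lc b. fraction A S ((snd q \<otimes> fst p) \<oplus> (snd p \<otimes> fst q)) (snd p \<otimes> snd q)) = lc (a \<oplus> b)"
    by (intro UN2_const lc_nonempty) (auto simp: lc_def[of a] lc_def[of b])
  then show ?thesis by (simp add: localization_def)
qed

lemma one_Loc: "\<one>\<^bsub>Loc\<^esub> = lc \<one>" by (simp add: localization_def fraction_one)

lemma lc_ring_hom: "lc \<in> ring_hom A Loc"
  by (rule ring_hom_memI) (simp_all add: carrier_Loc lc_mult lc_add one_Loc)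

lemma zero_Loc: "\<zero>\<^bsub>Loc\<^esub> = lc \<zero>" by (simp add: localization_def fraction_one)

end

section \<open>Quotients presented by surjective homomorphisms\<close>

text \<open>That \<open>R\<close> is a ring is derived from the surjection. The zero is listed
  separately because membership in \<open>ring_hom\<close> does not mention it.\<close>

locale qhom = artin +
  fixes R :: "'r ring" and \<pi> :: "(4, 'a) mpoly \<Rightarrow> 'r"
  assumes hom: "\<pi> \<in> ring_hom mpoly_ring R" and surj: "carrier R = range \<pi>" and z: "\<zero>\<^bsub>R\<^esub> = \<pi> 0"
    and ker: "\<pi> p = \<pi> q \<longleftrightarrow> p - q \<in> I"
begin

lemma pi_mult: "\<pi> p \<otimes>\<^bsub>R\<^esub> \<pi> q = \<pi> (p * q)" using ring_hom_mult[OF hom, of p q] by simp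
lemma pi_add: "\<pi> p \<oplus>\<^bsub>R\<^esub> \<pi> q = \<pi> (p + q)" using ring_hom_add[OF hom, of p q] by simp
lemma pi_carr: "\<pi> p \<in> carrier R" using surj by blast

lemma ring_R: "ring R"
proof -
  interpret Q: cring "mpoly_ring :: (4, 'a) mpoly ring" by (rule cring_rta)
  have "R \<lparr>carrier := \<pi> ` carrier mpoly_ring, zero := \<pi> \<zero>\<^bsub>mpoly_ring\<^esub>\<rparr> = R"
    using surj z by (simp add: )
  then show ?thesis using Q.ring_hom_imp_img_ring[OF hom] by simp
qed

lemma pi_sum: "finsum R (\<lambda>j. \<pi> (f j)) {..<n} = \<pi> (\<Sum>j<n. f j)" for n :: nat
proof -
  interpret R: ring R by (rule ring_R)
  show ?thesis
  proof (induct n)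
    case 0 then show ?case by (simp add: z)
  next
    case (Suc n)
    have "finsum R (\<lambda>j. \<pi> (f j)) (insert n {..<n}) = \<pi> (f n) \<oplus>\<^bsub>R\<^esub> finsum R (\<lambda>j. \<pi> (f j)) {..<n}"
      by (rule R.finsum_insert) (auto simp: pi_carr)
    then show ?case using Suc by (simp add: lessThan_Suc pi_add add.commute)
  qed
qed

lemma row_pi: assumes "\<And>j. j < n \<Longrightarrow> u j = \<pi> (a j)" "\<And>j. j < n \<Longrightarrow> v j = \<pi> (b j)"
  shows "row_app R n u v = \<pi> (\<Sum>j<n. a j * b j)"
proof -
  interpret R: ring R by (rule ring_R)
  have "row_app R n u v = finsum R (\<lambda>j. \<pi> (a j * b j)) {..<n}" unfolding row_app_def
    by (rule R.finsum_cong') (auto simp: pi_carr assms pi_mult)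
  then show ?thesis by (simp add: pi_sum)
qed

definition vR :: "nat \<Rightarrow> (nat \<Rightarrow> (4, 'a) mpoly) \<Rightarrow> nat \<Rightarrow> 'r" where "vR n w = (\<lambda>i\<in>{..<n}. \<pi> (w i))"

lemma vecs_R: "vecs R n = range (vR n)"
proof (rule equalityI; rule subsetI)
  fix v assume v: "v \<in> vecs R n"
  have "\<forall>i. \<exists>p. i < n \<longrightarrow> v i = \<pi> p" using v unfolding vecs_def surj by (auto simp: PiE_iff)
  then obtain w where w: "\<And>i. i < n \<Longrightarrow> v i = \<pi> (w i)" by metis
  have "v = vR n w"
  proof
    fix i show "v i = vR n w i" using v w[of i] unfolding vecs_def vR_def by (cases "i < n") (auto simp: PiE_iff extensional_def)
  qed
  then show "v \<in> range (vR n)" by blast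
next
  fix v assume "v \<in> range (vR n)"
  then show "v \<in> vecs R n" unfolding vecs_def vR_def by (auto simp: pi_carr split: if_splits)
qed

lemma mat_R: "mat_app R m n (\<lambda>r c. \<pi> (M r c)) (vR n w) = vR m (\<lambda>r. \<Sum>c<n. M r c * w c)"
proof
  fix r
  have "row_app R n (\<lambda>c. \<pi> (M r c)) (vR n w) = \<pi> (\<Sum>c<n. M r c * w c)"
    by (rule row_pi) (simp_all add: vR_def)
  then show "mat_app R m n (\<lambda>r c. \<pi> (M r c)) (vR n w) r = vR m (\<lambda>r. \<Sum>c<n. M r c * w c) r"
    unfolding mat_app_def vR_def[of m] by simp
qed

lemma vR_eq: "vR n v = vR n w \<longleftrightarrow> (\<forall>r<n. cg (v r) (w r))"
proof
  assume e: "vR n v = vR n w"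
  show "\<forall>r<n. cg (v r) (w r)" using fun_cong[OF e] ker unfolding vR_def cg_def by (metis lessThan_iff restrict_apply')
next
  assume "\<forall>r<n. cg (v r) (w r)"
  then show "vR n v = vR n w" unfolding vR_def cg_def by (intro restrict_ext) (simp add: ker)
qed

lemma zero_vec_R: "zero_vec R n = vR n (\<lambda>_. 0)" unfolding Defs.zero_vec_def vR_def by (simp add: z)

lemma free_resolution_R: assumes "resI n d" shows "free_resolution R n (\<lambda>i r c. \<pi> (d i r c))"
  unfolding free_resolution_def
proof (intro conjI allI)
  fix i
  show "is_mat R (n i) (n (Suc i)) (\<lambda>r c. \<pi> (d i r c))" unfolding is_mat_def by (simp add: pi_carr)
  have r: "(\<forall>r<n i. cg (\<Sum>c<n (Suc i). d i r c * v c) 0) \<longleftrightarrow>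
     (\<exists>w. \<forall>r<n (Suc i). cg (v r) (\<Sum>c<n (Suc (Suc i)). d (Suc i) r c * w c))" for v
    using assms unfolding resI_def cg_0 by blast
  show "{v \<in> vecs R (n (Suc i)). mat_app R (n i) (n (Suc i)) (\<lambda>r c. \<pi> (d i r c)) v = zero_vec R (n i)} =
      mat_app R (n (Suc i)) (n (Suc (Suc i))) (\<lambda>r c. \<pi> (d (Suc i) r c)) ` vecs R (n (Suc (Suc i)))"
    unfolding vecs_R zero_vec_R
  proof (rule equalityI; rule subsetI)
    fix v assume "v \<in> {v \<in> range (vR (n (Suc i))). mat_app R (n i) (n (Suc i)) (\<lambda>r c. \<pi> (d i r c)) v = vR (n i) (\<lambda>_. 0)}"
    then obtain u where u: "v = vR (n (Suc i)) u" "mat_app R (n i) (n (Suc i)) (\<lambda>r c. \<pi> (d i r c)) (vR (n (Suc i)) u) = vR (n i) (\<lambda>_. 0)"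
      by blast
    have "\<forall>r<n i. cg (\<Sum>c<n (Suc i). d i r c * u c) 0" using u(2) unfolding mat_R vR_eq .
    then obtain w where "\<forall>r<n (Suc i). cg (u r) (\<Sum>c<n (Suc (Suc i)). d (Suc i) r c * w c)" unfolding r ..
    then have "v = mat_app R (n (Suc i)) (n (Suc (Suc i))) (\<lambda>r c. \<pi> (d (Suc i) r c)) (vR (n (Suc (Suc i))) w)"
      unfolding u(1) mat_R vR_eq .
    then show "v \<in> mat_app R (n (Suc i)) (n (Suc (Suc i))) (\<lambda>r c. \<pi> (d (Suc i) r c)) ` range (vR (n (Suc (Suc i))))" by blast
  next
    fix v assume "v \<in> mat_app R (n (Suc i)) (n (Suc (Suc i))) (\<lambda>r c. \<pi> (d (Suc i) r c)) ` range (vR (n (Suc (Suc i))))"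
    then obtain w where v: "v = vR (n (Suc i)) (\<lambda>r. \<Sum>c<n (Suc (Suc i)). d (Suc i) r c * w c)" by (auto simp: mat_R)
    have "\<forall>r<n i. cg (\<Sum>c<n (Suc i). d i r c * (\<Sum>c'<n (Suc (Suc i)). d (Suc i) c c' * w c')) 0"
      unfolding r by (intro exI[of _ w]) simp
    then have "mat_app R (n i) (n (Suc i)) (\<lambda>r c. \<pi> (d i r c)) v = vR (n i) (\<lambda>_. 0)" unfolding v mat_R vR_eq .
    then show "v \<in> {v \<in> range (vR (n (Suc i))). mat_app R (n i) (n (Suc i)) (\<lambda>r c. \<pi> (d i r c)) v = vR (n i) (\<lambda>_. 0)}"
      unfolding v by blast
  qed
qed

lemma extI_R: assumes "Ext_Suc_vanishes R n (\<lambda>i r c. \<pi> (d i r c)) i" shows "extI n d i"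
  unfolding extI_def
proof (intro allI impI)
  fix v assume v: "\<forall>r<n (Suc (Suc i)). (\<Sum>c<n (Suc i). d (Suc i) c r * v c) \<in> I"
  have "mat_app R (n (Suc (Suc i))) (n (Suc i)) (\<lambda>r c. \<pi> (d (Suc i) c r)) (vR (n (Suc i)) v) = zero_vec R (n (Suc (Suc i)))"
    unfolding mat_R[of _ _ "\<lambda>r c. d (Suc i) c r"] zero_vec_R vR_eq cg_0 using v .
  then have "vR (n (Suc i)) v \<in> mat_app R (n (Suc i)) (n i) (\<lambda>r c. \<pi> (d i c r)) ` vecs R (n i)"
    using assms unfolding Ext_Suc_vanishes_def vecs_R by blast
  then obtain w where "vR (n (Suc i)) v = vR (n (Suc i)) (\<lambda>r. \<Sum>c<n i. d i c r * w c)"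
    unfolding vecs_R using mat_R[of _ _ "\<lambda>r c. d i c r"] by auto
  then show "\<exists>w. \<forall>r<n (Suc i). cg (v r) (\<Sum>c<n i. d i c r * w c)" unfolding vR_eq by blast
qed

end

section \<open>The quotient as a local Gorenstein ring\<close>

context artin
begin

abbreviation "AQ \<equiv> (mpoly_ring :: (4, 'k) mpoly ring) Quot I"
abbreviation "cst \<equiv> \<lambda>p :: (4, 'k) mpoly. I +>\<^bsub>mpoly_ring\<^esub> p"

lemma ideal_I: "ideal I mpoly_ring" using qI by (simp add: ideal_iff_qideal)

lemma cst_eq: "cst p = cst q \<longleftrightarrow> p - q \<in> I"
proof -
  have c: "cst p = {h + p |h. h \<in> I}" for p by (auto simp: a_r_coset_def r_coset_def)
  show ?thesis
  proof
    assume "cst p = cst q"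
    moreover have "0 + p \<in> cst p" unfolding c using qidealD(1)[OF qI] by blast
    ultimately have "p \<in> cst q" by simp
    then obtain h where "h \<in> I" "p = h + q" unfolding c by blast
    then show "p - q \<in> I" by simp
  next
    assume d: "p - q \<in> I"
    have "h + p = (h + (p - q)) + q" "h + q = (h - (p - q)) + p" for h by simp_all
    then show "cst p = cst q" unfolding c using qidealD(2,6)[OF qI _ d] by blast
  qed
qed

lemma carrier_AQ: "carrier AQ = range cst"
  by (auto simp: FactRing_def A_RCOSETS_def RCOSETS_def a_r_coset_def)

lemma AQ_simps: "cst p \<otimes>\<^bsub>AQ\<^esub> cst q = cst (p * q)" "cst p \<oplus>\<^bsub>AQ\<^esub> cst q = cst (p + q)"
   "\<one>\<^bsub>AQ\<^esub> = cst 1" "\<zero>\<^bsub>AQ\<^esub> = cst 0"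
proof -
  note h = ideal.rcos_ring_hom[OF ideal_I]
  show "cst p \<otimes>\<^bsub>AQ\<^esub> cst q = cst (p * q)" "cst p \<oplus>\<^bsub>AQ\<^esub> cst q = cst (p + q)" "\<one>\<^bsub>AQ\<^esub> = cst 1"
    using ring_hom_mult[OF h, of p q] ring_hom_add[OF h, of p q] ring_hom_one[OF h] by simp_all
  have "cst 0 = I" by (auto simp: a_r_coset_def r_coset_def)
  then show "\<zero>\<^bsub>AQ\<^esub> = cst 0" by (simp add: FactRing_def)
qed

lemma cring_AQ: "cring AQ" by (rule ideal.quotient_is_cring[OF ideal_I cring_rta])

text \<open>By \<open>cg_unit\<close>, every class with nonzero constant coefficient is a
  unit.\<close>

lemma maximal_AQ: "maximalideal (cst ` {p. lkp p 0 = 0}) AQ" and unit_AQ: "unit_loc AQ (carrier AQ - cst ` {p. lkp p 0 = 0})"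
proof -
  interpret A: cring AQ by (rule cring_AQ)
  let ?m = "cst ` {p. lkp p 0 = 0}"
  have mem: "cst p \<in> ?m \<longleftrightarrow> lkp p 0 = 0" for p
  proof
    assume "cst p \<in> ?m"
    then obtain q where "cst p = cst q" "lkp q 0 = 0" by blast
    then show "lkp p 0 = 0" using I0[of "p - q"] by (simp add: cst_eq lookup_minus)
  qed blast
  have un: "cst p \<in> Units AQ" if p0: "lkp p 0 \<noteq> 0" for p
  proof -
    obtain u where u: "cg (u * p) 1" using cg_unit[OF p0] by blast
    have "cst u \<otimes>\<^bsub>AQ\<^esub> cst p = \<one>\<^bsub>AQ\<^esub>" "cst p \<otimes>\<^bsub>AQ\<^esub> cst u = \<one>\<^bsub>AQ\<^esub>"
      using u by (simp_all add: AQ_simps cst_eq cg_def mult.commute)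
    then show ?thesis unfolding Units_def carrier_AQ by blast
  qed
  have c0: "lkp (a * b) 0 = lkp a 0 * lkp b 0" for a b :: "(4, 'k) mpoly"
  proof -
    have "kc (lkp a 0) * b + (a - kc (lkp a 0)) * b = a * b" by (simp add: algebra_simps)
    moreover have "(a - kc (lkp a 0)) * b \<in> varid 4"
      by (rule qidealD(4)[OF qideal_varid]) (simp add: varid_4 lookup_minus lkp_kc)
    ultimately show ?thesis by (metis add.right_neutral lkp_kc_mult lookup_add varid_4)
  qed
  have idm: "ideal ?m AQ"
  proof (rule idealI[OF A.ring_axioms])
    show "subgroup ?m (add_monoid AQ)"
    proof (rule A.add.subgroupI)
      show "?m \<subseteq> carrier AQ" by (auto simp: carrier_AQ)
      have "cst 0 \<in> ?m" unfolding mem by simp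
      then show "?m \<noteq> {}" by blast
      fix a assume "a \<in> ?m"
      then obtain p where p: "a = cst p" "lkp p 0 = 0" by blast
      have "\<ominus>\<^bsub>AQ\<^esub> a = cst (- p)" unfolding p(1)
        by (rule A.minus_equality) (auto simp: AQ_simps carrier_AQ)
      then show "\<ominus>\<^bsub>AQ\<^esub> a \<in> ?m" using p(2) by (simp add: mem)
      fix b assume "b \<in> ?m"
      then obtain q where "b = cst q" "lkp q 0 = 0" by blast
      then show "a \<oplus>\<^bsub>AQ\<^esub> b \<in> ?m" using p by (simp add: AQ_simps mem lookup_add)
    qed
    fix a x assume "a \<in> ?m" "x \<in> carrier AQ"
    then obtain p q where "a = cst p" "lkp p 0 = 0" "x = cst q" unfolding carrier_AQ by blast
    then show "x \<otimes>\<^bsub>AQ\<^esub> a \<in> ?m" "a \<otimes>\<^bsub>AQ\<^esub> x \<in> ?m" by (simp_all add: AQ_simps mem c0)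
  qed
  have one: "cst 1 \<notin> ?m" using mem[of 1] by (simp add: lookup_one)
  show "maximalideal ?m AQ"
  proof (rule maximalidealI[OF idm])
    show "carrier AQ \<noteq> ?m" using one by (auto simp: carrier_AQ)
    fix J assume J: "ideal J AQ" "?m \<subseteq> J" "J \<subseteq> carrier AQ"
    show "J = ?m \<or> J = carrier AQ"
    proof (cases "J \<subseteq> ?m")
      case False
      then obtain x where x: "x \<in> J" "x \<notin> ?m" by blast
      then obtain p where p: "x = cst p" using J(3) unfolding carrier_AQ by blast
      have "cst p \<in> J" "lkp p 0 \<noteq> 0" using x mem[of p] unfolding p by blast+
      have u: "cst p \<in> Units AQ" by (rule un) fact
      have "inv\<^bsub>AQ\<^esub> (cst p) \<otimes>\<^bsub>AQ\<^esub> cst p \<in> J"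
        by (rule ideal.I_l_closed[OF J(1) \<open>cst p \<in> J\<close> A.Units_inv_closed[OF u]])
      then have "J = carrier AQ" using A.Units_l_inv[OF u] ideal.one_imp_carrier[OF J(1)] by simp
      then show ?thesis by blast
    qed (use J in blast)
  qed
  show "unit_loc AQ (carrier AQ - ?m)"
  proof (unfold_locales)
    show "carrier AQ - ?m \<subseteq> Units AQ" using un mem unfolding carrier_AQ by auto
    show "\<one>\<^bsub>AQ\<^esub> \<in> carrier AQ - ?m" using one A.one_closed by (simp add: AQ_simps)
    fix s t assume "s \<in> carrier AQ - ?m" "t \<in> carrier AQ - ?m"
    then obtain p q where "s = cst p" "t = cst q" "lkp p 0 \<noteq> 0" "lkp q 0 \<noteq> 0" using mem unfolding carrier_AQ by blast
    then show "s \<otimes>\<^bsub>AQ\<^esub> t \<in> carrier AQ - ?m" using mem[of "p * q"] by (simp add: AQ_simps c0 carrier_AQ)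
  qed
qed

text \<open>The bound on the injective dimension is given for a localization that is presented by a
  surjection from \<open>Q\<close> with kernel \<open>I\<close>; so resolutions over
  \<open>Q/I\<close> are resolutions there, and vanishing of Ext can be read back.\<close>

lemma gorenstein_extI:
  assumes "gorenstein_ring AQ"
  shows "\<exists>l. \<forall>n d. resI n d \<longrightarrow> (\<forall>i\<ge>l. extI n d i)"
proof -
  let ?S = "carrier AQ - cst ` {p. lkp p 0 = 0}"
  interpret L: unit_loc AQ ?S by (rule unit_AQ)
  obtain l where l: "self_inj_dim_le (localization AQ ?S) l"
    using assms maximal_AQ unfolding gorenstein_ring_def by blast
  interpret q: qhom I "localization AQ ?S" "\<lambda>p. L.lc (cst p)"
  proof unfold_locales
    show "(\<lambda>p. L.lc (cst p)) \<in> ring_hom mpoly_ring (localization AQ ?S)"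
      using ring_hom_trans[OF ideal.rcos_ring_hom[OF ideal_I] L.lc_ring_hom] by (simp add: comp_def)
    have "carrier (localization AQ ?S) = L.lc ` carrier AQ" by (rule L.carrier_Loc)
    also have "\<dots> = L.lc ` range cst" by (rule arg_cong[where f="\<lambda>C. L.lc ` C", OF carrier_AQ])
    also have "\<dots> = range (\<lambda>p. L.lc (cst p))" by (rule image_image)
    finally show "carrier (localization AQ ?S) = range (\<lambda>p. L.lc (cst p))" .
    show "\<zero>\<^bsub>localization AQ ?S\<^esub> = L.lc (cst 0)" unfolding L.zero_Loc by (simp only: AQ_simps(4))
    show "(L.lc (cst p) = L.lc (cst q)) = (p - q \<in> I)" for p q
      using L.lc_inj[of "cst p" "cst q"] cst_eq[of p q] carrier_AQ by auto
  qed
  show ?thesis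
    using l q.free_resolution_R q.extI_R unfolding self_inj_dim_le_def by blast
qed

theorem gorenstein_socle:
  assumes "gorenstein_ring AQ" and s: "s \<notin> I" "\<And>i. i < 4 \<Longrightarrow> xv i * s \<in> I" and t: "\<And>i. i < 4 \<Longrightarrow> xv i * t \<in> I"
  shows "\<exists>c. t - kc c * s \<in> I"
proof -
  obtain n d where nd: "n 0 = 1" "n (Suc 0) = 4" "d 0 0 = xv" "resI n d" using resI_exists by blast
  interpret artin_res I n d by unfold_locales (use nd in simp_all)
  obtain l where "\<forall>i\<ge>l. extI n d i" using gorenstein_extI[OF assms(1)] nd(4) by blast
  then have "extI n d l" by simp
  then show ?thesis using simple_socle s t by blast
qed

text \<open>Unfolds the inductive notion of dimension: dimension 1 is a line extension of the zero
  space by one vector, and this vector has a homogeneous representative.\<close>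

lemma hilbert_one:
  assumes "has_hilbert_function I h" "h e = 1"
  shows "\<exists>s. homogeneous (int e) s \<and> s \<notin> I \<and> (\<forall>p. homogeneous (int e) p \<longrightarrow> (\<exists>c. p - kc c * s \<in> I))"
proof -
  interpret A: cring AQ by (rule cring_AQ)
  let ?K = "cst ` constants" and ?E = "cst ` {p. homogeneous (int e) p}"
  have "ring.dimension AQ (h e) ?K ?E" using assms(1) unfolding has_hilbert_function_def by (rule spec)
  then have "ring.dimension AQ (Suc 0) ?K ?E" unfolding assms(2) One_nat_def .
  then obtain v E' where v: "v \<in> carrier AQ" "ring.dimension AQ 0 ?K E'" "v \<notin> E'" "?E = A.line_extension ?K v E'"
  proof (cases rule: A.dimension.cases)
    case (Suc_dim v E)
    show ?thesis by (rule that[of v E]) (use Suc_dim in simp_all)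
  qed
  have E': "E' = {\<zero>\<^bsub>AQ\<^esub>}" using v(2) by (cases rule: A.dimension.cases) simp_all
  have mem: "u \<in> ?E \<longleftrightarrow> (\<exists>k\<in>?K. u = k \<otimes>\<^bsub>AQ\<^esub> v \<oplus>\<^bsub>AQ\<^esub> \<zero>\<^bsub>AQ\<^esub>)" for u
    unfolding v(4) A.line_extension_mem_iff E' by simp
  obtain s' where s': "v = cst s'" using v(1) unfolding carrier_AQ by blast
  have "kc 1 \<in> constants" unfolding constants_def kc_def by (rule rangeI)
  then have "cst (kc 1) \<in> ?K" by (rule imageI)
  then have "cst 1 \<in> ?K" unfolding kc_1 .
  then have "v \<in> ?E" unfolding mem by (rule bexI[rotated]) (simp add: s' AQ_simps)
  then obtain s where s: "v = cst s" "homogeneous (int e) s" by blast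
  have "s \<notin> I" using v(3) cst_eq[of s 0] unfolding E' s(1) AQ_simps by simp
  moreover have "\<exists>c. p - kc c * s \<in> I" if "homogeneous (int e) p" for p
  proof -
    have "cst p \<in> ?E" by (rule imageI) (use that in simp)
    then obtain k where k: "k \<in> ?K" "cst p = k \<otimes>\<^bsub>AQ\<^esub> v \<oplus>\<^bsub>AQ\<^esub> \<zero>\<^bsub>AQ\<^esub>" unfolding mem by (rule bexE)
    then obtain q where q: "k = cst q" "q \<in> constants" by (elim imageE)
    then obtain c where "q = kc c" unfolding constants_def kc_def by (elim rangeE)
    then have "cst p = cst (kc c) \<otimes>\<^bsub>AQ\<^esub> cst s \<oplus>\<^bsub>AQ\<^esub> cst 0" using k(2) q(1) s(1) AQ_simps(4) by simp
    then have "cst p = cst (kc c * s)" by (simp add: AQ_simps)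
    then show ?thesis unfolding cst_eq by blast
  qed
  ultimately show ?thesis using s(2) by blast
qed

end

section \<open>Betti numbers of minimal graded free resolutions\<close>

lemma finsum_rta: "finsum (ring_of_type_algebra :: 'a::comm_ring_1 ring) f {..<n::nat} = (\<Sum>j<n. f j)"
proof -
  interpret R: cring "ring_of_type_algebra :: 'a ring" by (rule cring_rta)
  show ?thesis
  proof (induct n)
    case (Suc n)
    have "finsum ring_of_type_algebra f (insert n {..<n}) = f n \<oplus>\<^bsub>ring_of_type_algebra\<^esub> finsum ring_of_type_algebra f {..<n}"
      by (rule R.finsum_insert) auto
    then show ?case using Suc by (simp add: lessThan_Suc add.commute)
  qed simp
qed

lemma row_app_rta: "row_app (ring_of_type_algebra :: 'a::comm_ring_1 ring) n u v = (\<Sum>j<n. u j * v j)"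
  unfolding row_app_def by (simp add: finsum_rta)

text \<open>Members of \<open>vecs\<close> are \<open>undefined\<close> beyond their length, members
  of \<open>Fn\<close> are 0 there; \<open>vv\<close> converts the latter into the former.\<close>

definition vv :: "nat \<Rightarrow> 'k::comm_ring_1 pvec \<Rightarrow> 'k pvec" where "vv n v = (\<lambda>i\<in>{..<n}. v i)"

lemma vecs_rta: "vecs mpoly_ring n = vv n ` Fn n"
proof (rule equalityI; rule subsetI)
  fix v :: "'a pvec" assume v: "v \<in> vecs mpoly_ring n"
  have "v = vv n (\<lambda>i. if i < n then v i else 0)"
    using v by (auto simp: vecs_def vv_def fun_eq_iff PiE_iff extensional_def)
  moreover have "(\<lambda>i. if i < n then v i else 0) \<in> Fn n" by (simp add: Fn_def)
  ultimately show "v \<in> vv n ` Fn n" by blast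
next
  fix v :: "'a pvec" assume "v \<in> vv n ` Fn n"
  then show "v \<in> vecs mpoly_ring n" by (auto simp: vecs_def vv_def split: if_splits)
qed

lemma vv_inj: "inj_on (vv n) (Fn n)"
proof (rule inj_onI, rule ext)
  fix u v :: "'a pvec" and i assume uv: "u \<in> Fn n" "v \<in> Fn n" "vv n u = vv n v"
  show "u i = v i" using fun_cong[OF uv(3), of i] uv(1,2) by (cases "i < n") (auto simp: vv_def Fn_def)
qed

lemma row_vv: "row_app mpoly_ring n u (vv n v) = (\<Sum>j<n. u j * v j)"
  unfolding row_app_rta vv_def by (rule sum.cong) auto

lemma mat_vv: "mat_app mpoly_ring m n M (vv n v) = vv m (mapp n m M v)"
  unfolding mat_app_def row_vv by (simp add: vv_def mapp_def fun_eq_iff restrict_def)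

lemma zero_vv: "zero_vec mpoly_ring n = vv n (\<lambda>_. 0)"
  unfolding Defs.zero_vec_def vv_def by simp

definition cres :: "(4, 'k::comm_ring_1) mpoly set \<Rightarrow> (nat \<Rightarrow> nat) \<Rightarrow> (nat \<Rightarrow> nat \<Rightarrow> nat \<Rightarrow> (4, 'k) mpoly) \<Rightarrow> 'k pvec \<Rightarrow> bool" where
  "cres I n d \<epsilon> \<longleftrightarrow> (\<forall>x. \<exists>v\<in>Fn (n 0). x - (\<Sum>j<n 0. \<epsilon> j * v j) \<in> I) \<and>
     {v \<in> Fn (n 0). (\<Sum>j<n 0. \<epsilon> j * v j) \<in> I} = mapp (n 1) (n 0) (d 0) ` Fn (n 1) \<and>
     (\<forall>i. kerp (n (Suc i)) (n i) (d i) = mapp (n (Suc (Suc i))) (n (Suc i)) (d (Suc i)) ` Fn (n (Suc (Suc i))))"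

lemma vv_image_eq: "A \<subseteq> Fn n \<Longrightarrow> B \<subseteq> Fn n \<Longrightarrow> vv n ` A = vv n ` B \<longleftrightarrow> A = B"
  using inj_on_image_eq_iff[OF vv_inj] by blast

lemma cyclic_resolution_iff_cres:
  "cyclic_resolution mpoly_ring I n (\<lambda>i. vecs mpoly_ring (n i)) d \<epsilon> \<longleftrightarrow> cres I n d \<epsilon>"
proof -
  have F: "mapp b a M ` Y \<subseteq> Fn a" for a b M and Y :: "'a pvec set" using mapp_Fn by blast
  have 1: "(\<forall>x. \<exists>v\<in>vecs mpoly_ring (n 0). x - row_app mpoly_ring (n 0) \<epsilon> v \<in> I) \<longleftrightarrow>
    (\<forall>x. \<exists>v\<in>Fn (n 0). x - (\<Sum>j<n 0. \<epsilon> j * v j) \<in> I)" unfolding vecs_rta by (simp add: row_vv)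
  have 2: "{v \<in> vecs mpoly_ring (n 0). row_app mpoly_ring (n 0) \<epsilon> v \<in> I} = vv (n 0) ` {v \<in> Fn (n 0). (\<Sum>j<n 0. \<epsilon> j * v j) \<in> I}"
    unfolding vecs_rta using row_vv[of "n 0" \<epsilon>] by auto
  have im: "mat_app mpoly_ring a b M ` vecs mpoly_ring b = vv a ` mapp b a M ` Fn b" for a b and M :: "nat \<Rightarrow> nat \<Rightarrow> (4, 'a) mpoly"
    unfolding vecs_rta image_image mat_vv ..
  have 3: "{v \<in> vecs mpoly_ring b. mat_app mpoly_ring a b M v = zero_vec mpoly_ring a} = vv b ` kerp b a M"
    for a b and M :: "nat \<Rightarrow> nat \<Rightarrow> (4, 'a) mpoly"
  proof -
    have "vv a (mapp b a M v) = vv a (\<lambda>_. 0) \<longleftrightarrow> mapp b a M v = (\<lambda>_. 0)" for v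
      using inj_on_eq_iff[OF vv_inj, of "mapp b a M v" a "\<lambda>_. 0"] mapp_Fn[of b a M v] by (simp add: Fn_def)
    then show ?thesis unfolding vecs_rta kerp_def zero_vv by (auto simp: mat_vv)
  qed
  have e1: "vv (n 0) ` {v \<in> Fn (n 0). (\<Sum>j<n 0. \<epsilon> j * v j) \<in> I} = vv (n 0) ` mapp (n 1) (n 0) (d 0) ` Fn (n 1) \<longleftrightarrow>
     {v \<in> Fn (n 0). (\<Sum>j<n 0. \<epsilon> j * v j) \<in> I} = mapp (n 1) (n 0) (d 0) ` Fn (n 1)"
    by (rule vv_image_eq[OF _ F]) blast
  have e2: "vv (n (Suc i)) ` kerp (n (Suc i)) (n i) (d i) = vv (n (Suc i)) ` mapp (n (Suc (Suc i))) (n (Suc i)) (d (Suc i)) ` Fn (n (Suc (Suc i))) \<longleftrightarrow>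
     kerp (n (Suc i)) (n i) (d i) = mapp (n (Suc (Suc i))) (n (Suc i)) (d (Suc i)) ` Fn (n (Suc (Suc i)))" for i
    by (rule vv_image_eq[OF kerp_Fn F])
  show ?thesis unfolding cyclic_resolution_def cres_def
    using 1 2 3 im e1 e2 by (simp add: is_mat_def)
qed

definition nt :: "int list \<Rightarrow> nat \<Rightarrow> int" where "nt a c = a ! c"

definition I1 :: "(4, 'k::comm_ring_1) mpoly set \<Rightarrow> 'k pvec set" where "I1 I = {v \<in> Fn 1. v 0 \<in> I}"

text \<open>Needed because \<open>nt\<close> is unspecified beyond the length of its list.\<close>

lemma KK_cong: assumes "Z \<subseteq> Fn n" "\<And>c. c < n \<Longrightarrow> a c = b c" shows "KK a p j Z = KK b p j Z"
proof -
  have "KK a p j Z \<subseteq> KK b p j Z" if "\<And>c. c < n \<Longrightarrow> a c = b c" for a b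
  proof
    fix f assume f: "f \<in> KK a p j Z"
    have "homogeneous (j - int p - b c) (f (S, c))" for S c
    proof (cases "c < n")
      case True
      then show ?thesis using KK_D(2)[OF f, of c S] that by simp
    next
      case False
      then have "f (S, c) = 0" using KK_D(3)[OF f, of S] assms(1) unfolding Fn_def by auto
      then show ?thesis by simp
    qed
    then show "f \<in> KK b p j Z" using KK_D[OF f] by (intro KK_I) auto
  qed
  from this[of a b] this[of b a] show ?thesis using assms(2) by (simp add: subset_antisym)
qed

lemma kh_cong: assumes "Z \<subseteq> Fn n" "\<And>c. c < n \<Longrightarrow> a c = b c" shows "kh a p j Z = kh b p j Z"
  unfolding kh_def cyc_def bd_def using KK_cong[OF assms] by simp

lemma count_mset_nth: "count (mset xs) x = card {c. c < length xs \<and> xs ! c = x}"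
proof -
  have e: "(\<lambda>y. y = x) = ((=) x)" by (rule ext) (rule eq_commute)
  have "count (mset xs) x = length (filter (\<lambda>y. y = x) xs)" by (simp add: count_mset count_list_eq_length_filter e)
  then show ?thesis by (simp add: length_filter_conv_card)
qed

text \<open>Each differential is a minimal cover of its image, so the number of its columns of
  degree \<open>j\<close> is a Koszul homology dimension in exterior degree 0. Shifting back along
  the resolution turns it into exterior degree \<open>i\<close> for the ideal.\<close>

theorem betti_koszul:
  fixes I :: "(4, 'k::field) mpoly set"
  assumes I: "qideal I" "\<And>p. p \<in> I \<Longrightarrow> lkp p 0 = 0" and m: "minimal_graded_free_resolution I a d \<epsilon>"
  shows "a 0 = [0]" "count (mset (a (Suc i))) j = kh (\<lambda>_. 0) i j (I1 I)"
proof -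
  define n where "n i = length (a i)" for i
  have cr: "cres I n d \<epsilon>" using m unfolding minimal_graded_free_resolution_def n_def cyclic_resolution_iff_cres by blast
  have eh: "\<And>j. j < n 0 \<Longrightarrow> homogeneous (a 0 ! j) (\<epsilon> j)" using m unfolding minimal_graded_free_resolution_def n_def by blast
  have dh: "\<And>i r c. r < n i \<Longrightarrow> c < n (Suc i) \<Longrightarrow> homogeneous (a (Suc i) ! c - a i ! r) (d i r c) \<and> d i r c \<in> irrelevant_ideal"
    using m unfolding minimal_graded_free_resolution_def n_def by blast
  have c1: "\<And>x. \<exists>v\<in>Fn (n 0). x - (\<Sum>j<n 0. \<epsilon> j * v j) \<in> I"
    and c2: "{v \<in> Fn (n 0). (\<Sum>j<n 0. \<epsilon> j * v j) \<in> I} = mapp (n 1) (n 0) (d 0) ` Fn (n 1)"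
    and c3: "\<And>i. kerp (n (Suc i)) (n i) (d i) = mapp (n (Suc (Suc i))) (n (Suc i)) (d (Suc i)) ` Fn (n (Suc (Suc i)))"
    using cr unfolding cres_def by blast+
  have gr: "gradedM (nt (a (Suc i))) (nt (a i)) (n (Suc i)) (n i) (d i)" for i
    unfolding gradedM_def nt_def using dh by blast
  have c0: "lkp (p * q) 0 = 0" if "lkp p 0 = 0" for p q :: "(4, 'k) mpoly"
    using qidealD(4)[OF qideal_varid, of p 4 q] that by (simp add: varid_4)
  have irr: "mapp (n (Suc i)) (n i) (d i) v \<in> irrv" for i v
  proof -
    have "lkp (d i r c * v c) 0 = 0" if "r < n i" "c < n (Suc i)" for r c
      using dh[OF that] by (intro c0) (simp add: irrelevant_iff)
    then show ?thesis unfolding irrv_def mapp_def by (simp add: lookup_sum)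
  qed
  have kirr: "kerp (n (Suc i)) (n i) (d i) \<subseteq> irrv" for i unfolding c3 using irr by blast
  \<comment> \<open>\<open>\<epsilon>\<close> has a single entry, which is a nonzero constant\<close>
  obtain v where v: "1 - (\<Sum>j<n 0. \<epsilon> j * v j) \<in> I" using c1[of 1] by blast
  have "\<exists>k<n 0. lkp (\<epsilon> k) 0 \<noteq> 0"
  proof (rule ccontr)
    assume "\<not> ?thesis"
    then have "lkp (\<Sum>j<n 0. \<epsilon> j * v j) 0 = 0" unfolding lookup_sum using c0 by (intro sum.neutral) blast
    then show False using I(2)[OF v] by (simp add: lookup_minus lookup_one)
  qed
  then obtain k where k: "k < n 0" "lkp (\<epsilon> k) 0 \<noteq> 0" by blast
  have "0 \<in> keys (\<epsilon> k)" using k(2) by (simp add: in_keys_iff)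
  then have ak: "a 0 ! k = 0" using eh[OF k(1)] unfolding homogeneous_def by force
  define e where "e = lkp (\<epsilon> k) 0"
  have ek: "\<epsilon> k = kc e" using homogeneous_degree_0[of "\<epsilon> k"] eh[OF k(1)] ak e_def by simp
  have e0: "e \<noteq> 0" using k(2) by (simp add: e_def)
  have only: "l = k" if l: "l < n 0" for l
  proof (rule ccontr)
    assume lk: "l \<noteq> k"
    \<comment> \<open>A second generator of \<open>F\<^sub>0\<close> would give an element of the
      kernel with entry 1 at \<open>l\<close>, whereas the kernel is the image of a matrix with
      entries in the irrelevant ideal.\<close>
    define w where "w = (\<lambda>c. if c = l then 1 else if c = k then - (\<epsilon> l * kc (inverse e)) else 0)"
    have "(\<Sum>j<n 0. \<epsilon> j * w j) = (\<Sum>j\<in>{l, k}. \<epsilon> j * w j)"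
      by (rule sum.mono_neutral_right) (use l k in \<open>auto simp: w_def\<close>)
    also have "\<dots> = \<epsilon> l - \<epsilon> l * (kc (inverse e) * kc e)" using lk by (simp add: w_def ek ac_simps)
    also have "\<dots> = 0" using e0 by (simp flip: kc_mult)
    finally have "w \<in> {v \<in> Fn (n 0). (\<Sum>j<n 0. \<epsilon> j * v j) \<in> I}"
      using qidealD(1)[OF I(1)] l k(1) by (auto simp: Fn_def w_def)
    then have "w \<in> irrv" unfolding c2 using irr[of 0] by auto
    then have "lkp (w l) 0 = 0" unfolding irrv_def by blast
    then show False by (simp add: w_def lookup_one)
  qed
  have n0: "n 0 = 1"
  proof -
    have "k = 0" using only[of 0] k(1) by simp
    moreover have "\<not> 1 < n 0" using only[of 1] k(1) only[of 0] by auto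
    ultimately show ?thesis using k(1) by simp
  qed
  then have k0: "k = 0" using k(1) by simp
  show a0: "a 0 = [0]" using n0 ak unfolding n_def k0 by (cases "a 0") auto
  have M0: "mapp (n 1) (n 0) (d 0) ` Fn (n 1) = I1 I"
  proof -
    have "kc e * p \<in> I \<longleftrightarrow> p \<in> I" for p
    proof
      assume "kc e * p \<in> I"
      then have "kc (inverse e) * (kc e * p) \<in> I" by (rule qidealD(3)[OF I(1)])
      then show "p \<in> I" using e0 by (simp flip: mult.assoc kc_mult)
    qed (rule qidealD(3)[OF I(1)])
    then show ?thesis using c2 ek k0 by (simp add: I1_def n0)
  qed
  have sh: "kh (nt (a i)) (p) j (mapp (n (Suc i)) (n i) (d i) ` Fn (n (Suc i))) = kh (nt (a 0)) (i + p) j (I1 I)" for i p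
  proof (induct i arbitrary: p)
    case 0 then show ?case using M0 by simp
  next
    case (Suc i)
    have "kh (nt (a i)) (Suc p) j (mapp (n (Suc i)) (n i) (d i) ` Fn (n (Suc i))) = kh (nt (a (Suc i))) p j (kerp (n (Suc i)) (n i) (d i))"
      by (rule kh_shift[OF gr kirr])
    then show ?case using Suc[of "Suc p"] unfolding c3 by simp
  qed
  have "kh (nt (a i)) 0 j (mapp (n (Suc i)) (n i) (d i) ` Fn (n (Suc i))) = card {c. c < n (Suc i) \<and> nt (a (Suc i)) c = j}"
    by (rule kh_generators[OF gr kirr])
  then have "count (mset (a (Suc i))) j = kh (nt (a 0)) i j (I1 I)"
    using sh[of i 0] by (simp add: count_mset_nth n_def nt_def)
  also have "\<dots> = kh (\<lambda>_. 0) i j (I1 I)"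
    by (rule kh_cong[of _ 1]) (auto simp: I1_def a0 nt_def)
  finally show "count (mset (a (Suc i))) j = kh (\<lambda>_. 0) i j (I1 I)" .
qed

subsection \<open>Existence\<close>

text \<open>Write \<open>q\<close> as a combination of the variables; the coefficients, reduced to
  their components of degree \<open>j - i - 1\<close> and multiplied into \<open>f\<close>, form a
  chain of exterior degree 1.\<close>

lemma bd_mult:
  assumes Y: "gsub a Y" and f: "f \<in> KK a 0 i Y" and q: "homogeneous (j - i) q" "lkp q 0 = 0"
  shows "(\<lambda>s. q * f s) \<in> bd a 0 j Y"
proof -
  obtain u where u: "q = (\<Sum>v<4. xv v * u v)" using q(2) varid_4[of q] unfolding varid_def by blast
  have q': "q = (\<Sum>v<4. xv v * hc (j - i - 1) (u v))"
  proof -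
    have "q = hc (j - i) q" using q(1) by (simp add: hc_id)
    then show ?thesis by (subst (asm) u) (simp add: hc_sum hc_xv_mult)
  qed
  define g where "g = (\<lambda>(S, c). (\<Sum>v<4. if S = {v} then hc (j - i - 1) (u v) else 0) * f ({}, c))"
  have ge: "g (S, c) = (\<Sum>v<4. if S = {v} then hc (j - i - 1) (u v) else 0) * f ({}, c)" for S c by (simp add: g_def)
  have gv: "g ({v}, c) = hc (j - i - 1) (u v) * f ({}, c)" if "v < 4" for v c
    using that by (simp add: ge eq_commute)
  have gz: "g (S, c) = 0" if "\<not> (\<exists>v<4. S = {v})" for S c
  proof -
    have "(\<Sum>v<4. if S = {v} then hc (j - i - 1) (u v) else 0) = 0" by (rule sum.neutral) (use that in auto)
    then show ?thesis by (simp add: ge)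
  qed
  have g: "g \<in> KK a (Suc 0) j Y"
  proof (rule KK_I)
    show "ksupp 4 (Suc 0) g" unfolding ksupp_def
    proof (intro allI impI)
      fix S c assume "g (S, c) \<noteq> 0"
      then have "\<exists>v<4. S = {v}" using gz by blast
      then show "S \<subseteq> {..<4} \<and> card S = Suc 0" by auto
    qed
    fix S
    show "homogeneous (j - int (Suc 0) - a c) (g (S, c))" for c
    proof (cases "\<exists>v<4. S = {v}")
      case True
      then obtain v where v: "v < 4" "S = {v}" by blast
      have "homogeneous ((j - i - 1) + (i - int 0 - a c)) (hc (j - i - 1) (u v) * f ({}, c))"
        by (rule homogeneous_mult[OF homogeneous_hc KK_D(2)[OF f]])
      then show ?thesis using gv[OF v(1), of c] v(2) by (simp add: algebra_simps)
    next
      case False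
      then show ?thesis by (simp add: gz)
    qed
    show "(\<lambda>c. g (S, c)) \<in> Y" unfolding ge by (rule gsubD(3)[OF Y KK_D(3)[OF f]])
  qed
  have "kd 4 g = (\<lambda>s. q * f s)"
  proof
    fix s :: "nat set \<times> nat"
    obtain S c where s: "s = (S, c)" by fastforce
    show "kd 4 g s = q * f s"
    proof (cases "S = {}")
      case True
      have "kd 4 g ({}, c) = (\<Sum>v<4. xv v * (hc (j - i - 1) (u v) * f ({}, c)))"
        unfolding kd_empty by (rule sum.cong[OF refl]) (simp add: gv)
      also have "\<dots> = (\<Sum>v<4. xv v * hc (j - i - 1) (u v)) * f ({}, c)" by (simp add: sum_distrib_right mult.assoc)
      also have "\<dots> = q * f ({}, c)" by (simp only: q'[symmetric])
      finally show ?thesis unfolding s True .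
    next
      case False
      have "kd 4 g (S, c) = 0" using False ksuppD(2)[OF ksupp_kd[OF KK_D(1)[OF g]], of 4 S c] ksuppD_finite[OF ksupp_kd[OF KK_D(1)[OF g]], of 4 S c] by auto
      moreover have "f (S, c) = 0" using False ksuppD(2)[OF KK_D(1)[OF f], of S c] ksuppD_finite[OF KK_D(1)[OF f], of S c] by auto
      ultimately show ?thesis unfolding s by simp
    qed
  qed
  then show ?thesis unfolding bd_def using g by (metis image_eqI)
qed

definition ch :: "'k::comm_ring_1 pvec \<Rightarrow> 'k kchain" where "ch v = (\<lambda>(S, c). if S = {} then v c else 0)"

lemma ch_KK: assumes "gsub a Y" "v \<in> Y" "\<And>c. homogeneous (j - a c) (v c)" shows "ch v \<in> KK a 0 j Y"
proof (rule KK_I)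
  show "ksupp 4 0 (ch v)" by (auto simp: ksupp_def ch_def)
  show "homogeneous (j - int 0 - a c) (ch v (S, c))" for S c using assms(3) by (simp add: ch_def)
  show "(\<lambda>c. ch v (S, c)) \<in> Y" for S using assms(2) gsubD(1)[OF assms(1)] by (cases "S = {}") (simp_all add: ch_def)
qed

lemma gsub_mult_sum: assumes "gsub a Y" "\<And>i. i \<in> A \<Longrightarrow> f i \<in> Y" shows "(\<lambda>c. \<Sum>i\<in>A. q i * f i c) \<in> Y"
  using assms(2)
proof (induct A rule: infinite_finite_induct)
  case (insert x F)
  then show ?case
    using gsubD(2)[OF assms(1) gsubD(3)[OF assms(1), of "f x" "q x"], of "\<lambda>c. \<Sum>i\<in>F. q i * f i c"] by simp
qed (simp_all add: gsubD(1)[OF assms(1)])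

lemma sum_apply: "(sum f A) s = (\<Sum>i\<in>A. f i s)" for f :: "'i \<Rightarrow> 'j \<Rightarrow> 'c::comm_monoid_add"
  by (induct A rule: infinite_finite_induct) simp_all

lemma bd_subspace: fixes Y :: "'k::field pvec set" assumes "gsub a Y" shows "Fv.subspace (bd a p j Y)"
  unfolding bd_def by (rule FF.linear_subspace_image[OF linear_kd KK_subspace[OF assms]])

lemma hv_expand:
  fixes y :: "'k::comm_ring_1 pvec"
  assumes "y \<in> Fn n"
  shows "\<exists>D. finite D \<and> y = (\<lambda>c. \<Sum>j\<in>D. hv a j y c)"
proof -
  define D where "D = (\<Union>c\<in>{..<n}. (\<lambda>m. int (mon_deg m) + a c) ` keys (y c))"
  have fD: "finite D" by (simp add: D_def)
  have "y c = (\<Sum>j\<in>D. hv a j y c)" for c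
  proof (rule poly_mapping_eqI)
    fix m
    have "lkp (\<Sum>j\<in>D. hv a j y c) m = (\<Sum>j\<in>D. if j = int (mon_deg m) + a c then lkp (y c) m else 0)"
      unfolding lookup_sum hv_def by (rule sum.cong[OF refl]) (auto simp: lkp_hc)
    also have "\<dots> = lkp (y c) m"
    proof (cases "lkp (y c) m = 0")
      case False
      then have "c < n" using assms unfolding Fn_def by (metis (mono_tags, lifting) mem_Collect_eq not_le lookup_zero)
      moreover have "m \<in> keys (y c)" using False by (simp add: in_keys_iff)
      ultimately have "int (mon_deg m) + a c \<in> D" unfolding D_def by blast
      then show ?thesis using fD by simp
    next
      case True
      then show ?thesis by (intro trans[OF sum.neutral]) simp_all
    qed
    finally show "lkp (y c) m = lkp (\<Sum>j\<in>D. hv a j y c) m" by simp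
  qed
  then show ?thesis using fD by blast
qed

text \<open>Lift a basis of the homology in exterior degree 0, degree by degree. The lifts generate
  by the graded form of Nakayama, and a relation with a nonzero constant coefficient would be a
  linear relation between basis elements modulo boundaries.\<close>

lemma minimal_generators:
  fixes Y :: "'k::field pvec set"
  assumes Y: "gsub a Y" "Y \<subseteq> Fn n" "Y \<subseteq> irrv" and fin: "finite {j. kh a 0 j Y \<noteq> 0}"
  shows "\<exists>b M. gradedM (nt b) a (length b) n M \<and> mapp (length b) n M ` Fn (length b) = Y \<and>
     kerp (length b) n M \<subseteq> irrv \<and> (\<forall>r. \<forall>c<length b. lkp (M r c) 0 = 0)"
proof -
  have "\<exists>B. finite B \<and> B \<subseteq> KK a 0 j Y \<and> card B + Fv.dim (bd a 0 j Y) = Fv.dim (KK a 0 j Y) \<and>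
    (\<forall>x\<in>KK a 0 j Y. \<exists>c. x - (\<Sum>b\<in>B. fs (c b) b) \<in> bd a 0 j Y) \<and>
    (\<forall>c. (\<Sum>b\<in>B. fs (c b) b) \<in> bd a 0 j Y \<longrightarrow> (\<forall>b\<in>B. c b = 0))" for j
    by (rule Fv.complement_basis_ex[OF KK_fd[OF Y(2)] KK_subspace[OF Y(1)] bd_subspace[OF Y(1)]])
      (use bd_cyc[OF Y(1), of 0 j] in \<open>simp add: cyc_0\<close>)
  then have "\<forall>j. \<exists>B. finite B \<and> B \<subseteq> KK a 0 j Y \<and> card B + Fv.dim (bd a 0 j Y) = Fv.dim (KK a 0 j Y) \<and>
    (\<forall>x\<in>KK a 0 j Y. \<exists>c. x - (\<Sum>b\<in>B. fs (c b) b) \<in> bd a 0 j Y) \<and>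
    (\<forall>c. (\<Sum>b\<in>B. fs (c b) b) \<in> bd a 0 j Y \<longrightarrow> (\<forall>b\<in>B. c b = 0))" by (rule allI)
  from choice[OF this] obtain B where B0: "\<forall>j. finite (B j) \<and> B j \<subseteq> KK a 0 j Y \<and> card (B j) + Fv.dim (bd a 0 j Y) = Fv.dim (KK a 0 j Y) \<and>
    (\<forall>x\<in>KK a 0 j Y. \<exists>c. x - (\<Sum>b\<in>B j. fs (c b) b) \<in> bd a 0 j Y) \<and>
    (\<forall>c. (\<Sum>b\<in>B j. fs (c b) b) \<in> bd a 0 j Y \<longrightarrow> (\<forall>b\<in>B j. c b = 0))" ..
  have B: "finite (B j)" "B j \<subseteq> KK a 0 j Y" "card (B j) + Fv.dim (bd a 0 j Y) = Fv.dim (KK a 0 j Y)"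
    "\<And>x. x \<in> KK a 0 j Y \<Longrightarrow> \<exists>c. x - (\<Sum>b\<in>B j. fs (c b) b) \<in> bd a 0 j Y"
    "\<And>c b. (\<Sum>b\<in>B j. fs (c b) b) \<in> bd a 0 j Y \<Longrightarrow> b \<in> B j \<Longrightarrow> c b = 0" for j
    using spec[OF B0, of j] by (simp_all only: Ball_def)
  define J where "J = {j. kh a 0 j Y \<noteq> 0}"
  have BJ: "B j = {}" if "j \<notin> J" for j
    using kh_eq[OF Y(1,2), of 0 j] B(1)[of j] B(3)[of j] that by (simp add: J_def cyc_0)
  have "finite (Sigma J B)" using fin B(1) by (simp add: J_def)
  then obtain xs where xs: "set xs = Sigma J B" "distinct xs" using finite_distinct_list by blast
  define N where "N = length xs"
  define F where "F c = snd (xs ! c)" for c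
  define b where "b = map fst xs"
  have lb: "length b = N" by (simp add: b_def N_def)
  have nb: "nt b c = fst (xs ! c)" if "c < N" for c using that by (simp add: nt_def b_def N_def)
  define M where "M r c = F c ({}, r)" for r c
  have FB: "F c \<in> B (nt b c)" if "c < N" for c
  proof -
    have "xs ! c \<in> Sigma J B" using that xs(1) nth_mem N_def by metis
    then show ?thesis unfolding nb[OF that] F_def by auto
  qed
  have FK: "F c \<in> KK a 0 (nt b c) Y" if "c < N" for c using FB[OF that] B(2) by blast
  have F0: "F c (S, r) = 0" if "c < N" "S \<noteq> {}" for c S r
    using that ksuppD(2)[OF KK_D(1)[OF FK[OF that(1)]], of S r] ksuppD_finite[OF KK_D(1)[OF FK[OF that(1)]], of S r] by auto
  have F1: "F c (S, r) = 0" if "c < N" "\<not> r < n" for c S r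
    using KK_D(3)[OF FK[OF that(1)], of S] Y(2) that(2) by (auto simp: Fn_def)
  have col: "(\<lambda>r. M r c) \<in> Y" if "c < N" for c unfolding M_def by (rule KK_D(3)[OF FK[OF that]])
  have gr: "gradedM (nt b) a N n M" unfolding gradedM_def M_def
  proof (intro allI impI)
    fix r c assume "c < N"
    from KK_D(2)[OF FK[OF this], of r "{}"] show "homogeneous (nt b c - a r) (F c ({}, r))" by simp
  qed
  have irr: "lkp (M r c) 0 = 0" if "c < N" for r c using col[OF that] Y(3) unfolding irrv_def by blast
  have mp: "mapp N n M v = (\<lambda>r. \<Sum>c<N. v c * M r c)" for v
  proof
    fix r show "mapp N n M v r = (\<Sum>c<N. v c * M r c)"
      unfolding mapp_def M_def using F1[of _ r "{}"] by (auto simp: mult.commute)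
  qed
  define Im where "Im = mapp N n M ` Fn N"
  have gIm: "gsub a Im" unfolding Im_def by (rule gsub_image[OF gr gsub_Fn])
  have ImY: "Im \<subseteq> Y"
  proof
    fix u assume "u \<in> Im"
    then obtain v where u: "u = mapp N n M v" unfolding Im_def by blast
    show "u \<in> Y" unfolding u mp by (rule gsub_mult_sum[OF Y(1)]) (use col in simp)
  qed
  have BIm: "(\<lambda>r. f ({}, r)) \<in> Im" if f: "f \<in> B j" for f j
  proof -
    have "j \<in> J" using BJ f by blast
    then have "(j, f) \<in> set xs" unfolding xs(1) using f by blast
    then obtain i where i: "i < N" "xs ! i = (j, f)" unfolding in_set_conv_nth N_def by blast
    define v :: "'k pvec" where "v = (\<lambda>c. if c = i then 1 else 0)"
    have "(\<Sum>c<N. v c * M r c) = f ({}, r)" for r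
    proof -
      have "(\<Sum>c<N. v c * M r c) = (\<Sum>c<N. if c = i then M r c else 0)" by (rule sum.cong) (auto simp: v_def)
      then show ?thesis using i by (simp add: M_def F_def)
    qed
    then have "mapp N n M v = (\<lambda>r. f ({}, r))" unfolding mp by simp
    moreover have "v \<in> Fn N" using i(1) by (simp add: v_def Fn_def)
    ultimately show ?thesis unfolding Im_def by (metis image_eqI)
  qed
  \<comment> \<open>A lower bound for the degrees of the basis vectors: below \<open>m0\<close>
    every homogeneous vector is 0, which starts the induction on the degree in
    \<open>claim\<close>.\<close>
  define m0 where "m0 = - (\<Sum>c<n. \<bar>a c\<bar>)"
  have m0: "m0 \<le> a c" if "c < n" for c
    using member_le_sum[of c "{..<n}" "\<lambda>c. \<bar>a c\<bar>"] that by (simp add: m0_def)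
  have claim: "(\<lambda>r. f ({}, r)) \<in> Im" if "f \<in> KK a 0 j Y" "j < m0 + int k" for f j k
    using that
  proof (induct k arbitrary: f j)
    case 0
    have "f ({}, r) = 0" for r
    proof (cases "r < n")
      case True
      then show ?thesis using homogeneous_neg[OF KK_D(2)[OF 0(1), of r "{}"]] m0[OF True] 0(2) by simp
    next
      case False
      then show ?thesis using KK_D(3)[OF 0(1), of "{}"] Y(2) by (auto simp: Fn_def)
    qed
    then show ?case using gsubD(1)[OF gIm] by simp
  next
    case (Suc k)
    obtain c where c: "f - (\<Sum>b\<in>B j. fs (c b) b) \<in> bd a 0 j Y" using B(4)[OF Suc(2)] ..
    then obtain h where h: "h \<in> KK a (Suc 0) j Y" "f - (\<Sum>b\<in>B j. fs (c b) b) = kd 4 h" unfolding bd_def by (rule imageE)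
    have hIm: "(\<lambda>r. h ({v}, r)) \<in> Im" for v
    proof -
      have "ch (\<lambda>r. h ({v}, r)) \<in> KK a 0 (j - 1) Y"
        by (rule ch_KK[OF Y(1) KK_D(3)[OF h(1)]]) (use KK_D(2)[OF h(1), of _ "{v}"] in \<open>simp add: algebra_simps\<close>)
      from Suc(1)[OF this] Suc(3) show ?thesis by (simp add: ch_def)
    qed
    have "f ({}, r) = (\<Sum>b\<in>B j. kc (c b) * b ({}, r)) + (\<Sum>v<4. xv v * h ({v}, r))" for r
      using fun_cong[OF h(2), of "({}, r)"] unfolding kd_empty
      by (simp add: sum_apply fs_def algebra_simps)
    then have fe: "(\<lambda>r. f ({}, r)) = (\<lambda>r. (\<Sum>b\<in>B j. kc (c b) * b ({}, r)) + (\<Sum>v<4. xv v * h ({v}, r)))" by (rule ext)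
    show ?case unfolding fe
    proof (rule gsubD(2)[OF gIm])
      show "(\<lambda>r. \<Sum>b\<in>B j. kc (c b) * b ({}, r)) \<in> Im"
        by (rule gsub_mult_sum[OF gIm, where f="\<lambda>b r. b ({}, r)"]) (rule BIm)
      show "(\<lambda>r. \<Sum>v<4. xv v * h ({v}, r)) \<in> Im"
        by (rule gsub_mult_sum[OF gIm, where f="\<lambda>v r. h ({v}, r)"]) (rule hIm)
    qed
  qed
  have YIm: "Y \<subseteq> Im"
  proof
    fix y assume y: "y \<in> Y"
    then have "y \<in> Fn n" using Y(2) by blast
    from hv_expand[OF this, of a] obtain D where D: "y = (\<lambda>c. \<Sum>j\<in>D. hv a j y c)" by blast
    have "hv a j y \<in> Im" for j
    proof -
      have "ch (hv a j y) \<in> KK a 0 j Y" by (rule ch_KK[OF Y(1) gsubD(4)[OF Y(1) y]]) (simp add: hv_def)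
      from claim[OF this, of "nat (j - m0 + 1)"] show ?thesis by (simp add: ch_def)
    qed
    then have "(\<lambda>c. \<Sum>j\<in>D. 1 * hv a j y c) \<in> Im" by (rule gsub_mult_sum[OF gIm])
    then show "y \<in> Im" using D by simp
  qed
  have ker: "lkp (v c0) 0 = 0" if v: "v \<in> Fn N" "mapp N n M v = (\<lambda>r. 0)" for v c0
  proof (cases "c0 < N")
    case False
    then show ?thesis using v(1) by (simp add: Fn_def)
  next
    case True
    \<comment> \<open>Take the relation in the degree \<open>j0\<close> of the generator
      \<open>c0\<close>: generators of other degrees contribute boundaries by
      \<open>bd_mult\<close>, those of degree \<open>j0\<close> contribute through their constant
      coefficients alone.\<close>
    define j0 where "j0 = nt b c0"
    define A where "A = {c \<in> {..<N}. nt b c = j0}"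
    define G where "G c = (\<lambda>s. hc (j0 - nt b c) (v c) * F c s)" for c
    have "hv a j0 (mapp N n M v) = (\<lambda>r. 0)" unfolding v(2) by (simp add: hv_def)
    then have mz: "mapp N n M (hv (nt b) j0 v) = (\<lambda>r. 0)" unfolding mapp_hv[OF gr] .
    have Gz: "(\<Sum>c<N. G c) = 0"
    proof
      fix s :: "nat set \<times> nat"
      obtain S r where s: "s = (S, r)" by fastforce
      have "(\<Sum>c<N. G c s) = 0"
      proof (cases "S = {}")
        case True
        then show ?thesis using fun_cong[OF mz, of r] by (simp add: mp G_def hv_def M_def s)
      next
        case False
        then show ?thesis by (intro sum.neutral) (simp add: G_def s F0)
      qed
      then show "(\<Sum>c<N. G c) s = 0 s" by (simp add: sum_apply)
    qed
    have Grest: "G c \<in> bd a 0 j0 Y" if "c \<in> {..<N} - A" for c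
      unfolding G_def
    proof (rule bd_mult[OF Y(1)])
      show "F c \<in> KK a 0 (nt b c) Y" using FK that by simp
      show "lkp (hc (j0 - nt b c) (v c)) 0 = 0" using that by (auto simp: A_def lkp_hc)
    qed simp
    have GA: "G c = fs (lkp (v c) 0) (F c)" if "c \<in> A" for c
    proof -
      have "hc 0 (v c) = kc (lkp (v c) 0)" using homogeneous_degree_0[of "hc 0 (v c)"] by (simp add: lkp_hc)
      then show ?thesis using that by (simp add: G_def fs_def A_def)
    qed
    have "(\<Sum>c<N. G c) = (\<Sum>c\<in>{..<N} - A. G c) + (\<Sum>c\<in>A. G c)"
      by (rule sum.subset_diff) (auto simp: A_def)
    then have "(\<Sum>c\<in>A. G c) = - (\<Sum>c\<in>{..<N} - A. G c)" unfolding Gz by (simp add: eq_neg_iff_add_eq_0 add.commute)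
    also have "\<dots> \<in> bd a 0 j0 Y"
      by (rule Fv.subspace_neg[OF bd_subspace[OF Y(1)]], rule Fv.subspace_sum[OF bd_subspace[OF Y(1)]], rule Grest)
    finally have sA: "(\<Sum>c\<in>A. fs (lkp (v c) 0) (F c)) \<in> bd a 0 j0 Y" using GA by simp
    have bij: "bij_betw F A (B j0)"
    proof (rule bij_betwI')
      fix x y assume xy: "x \<in> A" "y \<in> A"
      have "xs ! x = xs ! y" if "F x = F y"
        using xy that nb by (intro prod_eqI) (auto simp: A_def F_def)
      then show "F x = F y \<longleftrightarrow> x = y" using xy nth_eq_iff_index_eq[OF xs(2), of x y] by (auto simp: A_def N_def)
    next
      fix x assume "x \<in> A" then show "F x \<in> B j0" using FB[of x] by (auto simp: A_def)
    next
      fix f assume f: "f \<in> B j0"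
      have "j0 \<in> J" using BJ f by blast
      then have "(j0, f) \<in> set xs" unfolding xs(1) using f by blast
      then obtain i where "i < N" "xs ! i = (j0, f)" unfolding in_set_conv_nth N_def by blast
      then show "\<exists>x\<in>A. f = F x" using nb by (intro bexI[of _ i]) (auto simp: A_def F_def)
    qed
    define g where "g = the_inv_into A F"
    have gF: "g (F c) = c" if "c \<in> A" for c
      using the_inv_into_f_f[OF bij_betw_imp_inj_on[OF bij] that] by (simp add: g_def)
    have "(\<Sum>f\<in>B j0. fs (lkp (v (g f)) 0) f) = (\<Sum>c\<in>A. fs (lkp (v (g (F c))) 0) (F c))"
      using sum.reindex_bij_betw[OF bij, of "\<lambda>f. fs (lkp (v (g f)) 0) f"] by simp
    also have "\<dots> = (\<Sum>c\<in>A. fs (lkp (v c) 0) (F c))" by (rule sum.cong[OF refl]) (simp add: gF)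
    finally have "(\<Sum>f\<in>B j0. fs (lkp (v (g f)) 0) f) \<in> bd a 0 j0 Y" using sA by simp
    from B(5)[OF this FB[OF True, folded j0_def]]
    show ?thesis using gF[of c0] True by (simp add: A_def j0_def)
  qed
  have "kerp N n M \<subseteq> irrv" using ker unfolding kerp_def irrv_def by blast
  moreover have "mapp N n M ` Fn N = Y" using ImY YIm unfolding Im_def by blast
  ultimately show ?thesis using gr irr lb by (intro exI[of _ b] exI[of _ M]) simp
qed

text \<open>By \<open>kh_shift\<close> the kernel again has its homology in finitely many degrees,
  which makes the step repeatable.\<close>

lemma resolution_step:
  fixes Y :: "'k::field pvec set"
  assumes Y: "gsub a Y" "Y \<subseteq> Fn n" "Y \<subseteq> irrv" and fin: "\<And>p. finite {j. kh a p j Y \<noteq> 0}"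
  shows "\<exists>b M. gradedM (nt b) a (length b) n M \<and> mapp (length b) n M ` Fn (length b) = Y \<and>
     kerp (length b) n M \<subseteq> irrv \<and> (\<forall>r. \<forall>c<length b. lkp (M r c) 0 = 0) \<and>
     (\<forall>p. finite {j. kh (nt b) p j (kerp (length b) n M) \<noteq> 0})"
proof -
  obtain b M where bM: "gradedM (nt b) a (length b) n M" "mapp (length b) n M ` Fn (length b) = Y"
     "kerp (length b) n M \<subseteq> irrv" "\<forall>r. \<forall>c<length b. lkp (M r c) 0 = 0"
    using minimal_generators[OF Y fin] by (elim exE conjE)
  have "finite {j. kh (nt b) p j (kerp (length b) n M) \<noteq> 0}" for p
    using fin[of "Suc p"] kh_shift[OF bM(1,3), of p] unfolding bM(2) by simp
  with bM show ?thesis by (intro exI[of _ b] exI[of _ M]) simp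
qed

text \<open>Dependent choice over triples \<open>(a, b, M)\<close> of row degrees, column degrees
  and a matrix. The finiteness assumed in \<open>fin\<close> keeps every term of finite rank; it
  will be read off from the explicit Koszul homology.\<close>

theorem minimal_resolution_exists:
  fixes I :: "(4, 'k::field) mpoly set"
  assumes I: "qideal I" "\<And>p e. p \<in> I \<Longrightarrow> hc e p \<in> I" "\<And>p. p \<in> I \<Longrightarrow> lkp p 0 = 0"
    and fin: "\<And>p. finite {j. kh (\<lambda>_. 0) p j (I1 I) \<noteq> 0}"
  shows "\<exists>a d \<epsilon>. minimal_graded_free_resolution I a d \<epsilon>"
proof -
  define im where "im b a M = mapp (length b) (length a) M ` Fn (length b)" for a b :: "int list" and M :: "nat \<Rightarrow> nat \<Rightarrow> (4, 'k) mpoly"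
  define ke where "ke b a M = kerp (length b) (length a) M" for a b :: "int list" and M :: "nat \<Rightarrow> nat \<Rightarrow> (4, 'k) mpoly"
  define P where "P = (\<lambda>(i::nat) (x :: int list \<times> int list \<times> (nat \<Rightarrow> nat \<Rightarrow> (4, 'k) mpoly)). case x of (a, b, M) \<Rightarrow>
    gradedM (nt b) (nt a) (length b) (length a) M \<and> ke b a M \<subseteq> irrv \<and> (\<forall>r. \<forall>c<length b. lkp (M r c) 0 = 0) \<and>
    (\<forall>p. finite {j. kh (nt b) p j (ke b a M) \<noteq> 0}) \<and> (i = 0 \<longrightarrow> a = [0] \<and> im b a M = I1 I))"
  define R where "R = (\<lambda>(i::nat) (x :: int list \<times> int list \<times> (nat \<Rightarrow> nat \<Rightarrow> (4, 'k) mpoly)) y. case x of (a, b, M) \<Rightarrow>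
    case y of (a', b', M' :: nat \<Rightarrow> nat \<Rightarrow> (4, 'k) mpoly) \<Rightarrow> a' = b \<and> im b' a' M' = ke b a M)"
  have I1F: "I1 I \<subseteq> Fn 1" unfolding I1_def by blast
  have I1z: "v c = 0" if "v \<in> I1 I" "c \<noteq> 0" for v c using that unfolding I1_def Fn_def by auto
  have g1: "gsub (nt [0]) (I1 I)" unfolding gsub_def
  proof (intro conjI ballI allI)
    show "(\<lambda>c. 0) \<in> I1 I" using qidealD(1)[OF I(1)] by (simp add: I1_def Fn_def)
    show "(\<lambda>c. u c + v c) \<in> I1 I" if "u \<in> I1 I" "v \<in> I1 I" for u v
      using that qidealD(2)[OF I(1)] by (simp add: I1_def Fn_def)
    show "(\<lambda>c. q * v c) \<in> I1 I" if "v \<in> I1 I" for v q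
      using that qidealD(3)[OF I(1)] by (simp add: I1_def Fn_def)
    show "hv (nt [0]) j v \<in> I1 I" if "v \<in> I1 I" for v j
      using that I(2) by (simp add: I1_def Fn_def hv_def)
  qed
  have i1: "I1 I \<subseteq> irrv"
  proof
    fix v assume v: "v \<in> I1 I"
    have "lkp (v c) 0 = 0" for c using I1z[OF v, of c] I(3)[of "v 0"] v by (cases "c = 0") (auto simp: I1_def)
    then show "v \<in> irrv" by (simp add: irrv_def)
  qed
  have k1: "kh (nt [0]) p j (I1 I) = kh (\<lambda>_. 0) p j (I1 I)" for p j
    by (rule kh_cong[OF I1F]) (simp add: nt_def)
  have start: "\<exists>x. P 0 x"
  proof -
    obtain b M where "gradedM (nt b) (nt [0]) (length b) 1 M" "mapp (length b) 1 M ` Fn (length b) = I1 I"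
       "kerp (length b) 1 M \<subseteq> irrv" "\<forall>r. \<forall>c<length b. lkp (M r c) 0 = 0"
       "\<forall>p. finite {j. kh (nt b) p j (kerp (length b) 1 M) \<noteq> 0}"
      using resolution_step[OF g1 I1F i1, unfolded k1, OF fin] by (elim exE conjE)
    then show ?thesis by (intro exI[of _ "([0], b, M)"]) (simp add: P_def im_def ke_def)
  qed
  have step: "\<exists>y. P (Suc i) y \<and> R i x y" if "P i x" for i x
  proof -
    obtain a b M where x: "x = (a, b, M)" using prod_cases3 by blast
    have Px: "gradedM (nt b) (nt a) (length b) (length a) M" "ke b a M \<subseteq> irrv" "\<And>p. finite {j. kh (nt b) p j (ke b a M) \<noteq> 0}"
      using that unfolding P_def x by simp_all
    have gk: "gsub (nt b) (ke b a M)" unfolding ke_def by (rule gsub_kerp[OF Px(1)])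
    have kF: "ke b a M \<subseteq> Fn (length b)" unfolding ke_def by (rule kerp_Fn)
    obtain b' M' where "gradedM (nt b') (nt b) (length b') (length b) M'" "mapp (length b') (length b) M' ` Fn (length b') = ke b a M"
       "kerp (length b') (length b) M' \<subseteq> irrv" "\<forall>r. \<forall>c<length b'. lkp (M' r c) 0 = 0"
       "\<forall>p. finite {j. kh (nt b') p j (kerp (length b') (length b) M') \<noteq> 0}"
      using resolution_step[OF gk kF Px(2,3)] by (elim exE conjE)
    then show ?thesis by (intro exI[of _ "(b, b', M')"]) (simp add: P_def R_def x im_def ke_def)
  qed
  obtain f where f: "\<And>i. P i (f i)" "\<And>i. R i (f i) (f (Suc i))"
    using dependent_nat_choice[of P R, OF start step] by blast
  define a where "a i = fst (f i)" for i
  define d where "d i = snd (snd (f i))" for i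
  have b: "fst (snd (f i)) = a (Suc i)" for i
    using f(2)[of i] unfolding R_def a_def by (cases "f i"; cases "f (Suc i)") simp
  have fe: "f i = (a i, a (Suc i), d i)" for i by (simp only: a_def d_def b[unfolded a_def, symmetric] prod.collapse)
  have p1: "gradedM (nt (a (Suc i))) (nt (a i)) (length (a (Suc i))) (length (a i)) (d i)"
    and p2: "\<forall>r. \<forall>c<length (a (Suc i)). lkp (d i r c) 0 = 0" for i
    using f(1)[of i] unfolding fe[of i] P_def by simp_all
  have p0: "a 0 = [0]" "im (a 1) (a 0) (d 0) = I1 I" using f(1)[of 0] unfolding fe[of 0] P_def prod.case One_nat_def by blast+
  have r: "im (a (Suc (Suc i))) (a (Suc i)) (d (Suc i)) = ke (a (Suc i)) (a i) (d i)" for i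
    using f(2)[of i] unfolding fe R_def by simp
  have "cres I (\<lambda>i. length (a i)) d (\<lambda>_. 1)" unfolding cres_def
  proof (intro conjI allI)
    fix x show "\<exists>v\<in>Fn (length (a 0)). x - (\<Sum>j<length (a 0). 1 * v j) \<in> I"
      by (rule bexI[of _ "\<lambda>c. if c = 0 then x else 0"]) (simp_all add: p0(1) qidealD(1)[OF I(1)] Fn_def)
  next
    show "{v \<in> Fn (length (a 0)). (\<Sum>j<length (a 0). 1 * v j) \<in> I} = mapp (length (a 1)) (length (a 0)) (d 0) ` Fn (length (a 1))"
      using p0(2) unfolding im_def I1_def by (simp add: p0(1))
  next
    fix i show "kerp (length (a (Suc i))) (length (a i)) (d i) =
         mapp (length (a (Suc (Suc i)))) (length (a (Suc i))) (d (Suc i)) ` Fn (length (a (Suc (Suc i))))"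
      using r[of i] unfolding im_def ke_def by simp
  qed
  then have "minimal_graded_free_resolution I a d (\<lambda>_. 1)"
    unfolding minimal_graded_free_resolution_def cyclic_resolution_iff_cres
    using p1 p2 by (auto simp: p0(1) gradedM_def nt_def irrelevant_iff homogeneous_def keys_one mon_deg_def)
  then show ?thesis by blast
qed

section \<open>Koszul homology of an Artinian Gorenstein algebra of socle degree three\<close>

lemma kd_sum: "kd r f (S, c) = (\<Sum>v\<in>{..<r} - S. (-1) ^ card (S \<inter> {..<v}) * xv v * f (insert v S, c))"
proof (induct r)
  case (Suc r)
  show ?case
  proof (cases "r \<in> S")
    case True
    then have "{..<Suc r} - S = {..<r} - S" by (auto simp: less_Suc_eq)
    then show ?thesis using Suc True by (simp add: kd_Suc_in)
  next
    case False
    then have "{..<Suc r} - S = insert r ({..<r} - S)" by (auto simp: less_Suc_eq)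
    then show ?thesis using Suc False by (simp add: kd_Suc_notin add.commute)
  qed
qed (simp add: kd_0)

definition Sub :: "nat \<Rightarrow> nat set set" where "Sub p = {S. S \<subseteq> {..<4} \<and> card S = p}"

lemma finite_Sub [simp]: "finite (Sub p)"
  by (rule finite_subset[of _ "Pow {..<4}"]) (auto simp: Sub_def)

lemma card_Sub: "card (Sub p) = 4 choose p"
  unfolding Sub_def using n_subsets[of "{..<4::nat}" p] by simp

lemma SubD: assumes "S \<in> Sub p" shows "S \<subseteq> {..<4}" "card S = p" "finite S"
  using assms finite_subset[of S "{..<4}"] by (auto simp: Sub_def)

text \<open>The transpose of \<open>kd 4\<close> in the exterior basis, that is, exterior
  multiplication by the element whose coefficients are the four variables.\<close>

definition dl :: "'k::comm_ring_1 kchain \<Rightarrow> nat set \<Rightarrow> (4, 'k) mpoly" where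
  "dl g T = (\<Sum>u\<in>T. (-1) ^ card (T \<inter> {..<u}) * xv u * g (T - {u}, 0))"

text \<open>Both sides sum over the same pairs: a set with an index to be added, or the enlarged set
  with that index marked.\<close>

lemma kd_dl_adjoint:
  "(\<Sum>S\<in>Sub p. g (S, 0) * kd 4 f (S, 0)) = (\<Sum>T\<in>Sub (Suc p). f (T, 0) * dl g T)"
proof -
  let ?A = "Sigma (Sub p) (\<lambda>S. {..<4} - S)" and ?B = "Sigma (Sub (Suc p)) (\<lambda>T. T)"
  let ?F = "\<lambda>x. case x of (S, v) \<Rightarrow> g (S, 0) * ((-1) ^ card (S \<inter> {..<v}) * xv v * f (insert v S, 0))"
  let ?G = "\<lambda>x. case x of (T, u) \<Rightarrow> f (T, 0) * ((-1) ^ card (T \<inter> {..<u}) * xv u * g (T - {u}, 0))"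
  have "(\<Sum>S\<in>Sub p. g (S, 0) * kd 4 f (S, 0)) = sum ?F ?A"
    unfolding kd_sum sum_distrib_left by (rule sum.Sigma) auto
  also have "\<dots> = sum ?G ?B"
  proof (rule sum.reindex_bij_witness[where i="\<lambda>(T, u). (T - {u}, u)" and j="\<lambda>(S, v). (insert v S, v)"])
    fix x assume x: "x \<in> ?A"
    obtain S v where xe: "x = (S, v)" by fastforce
    have S: "S \<in> Sub p" and v: "v < 4" "v \<notin> S" using x unfolding xe by auto
    note S' = SubD[OF S]
    show "(case case x of (S, v) \<Rightarrow> (insert v S, v) of (T, u) \<Rightarrow> (T - {u}, u)) = x" using v unfolding xe by auto
    show "(case x of (S, v) \<Rightarrow> (insert v S, v)) \<in> ?B" using S' v unfolding xe by (auto simp: Sub_def)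
    have "insert v S \<inter> {..<v} = S \<inter> {..<v}" "insert v S - {v} = S" using v by auto
    then show "?G (case x of (S, v) \<Rightarrow> (insert v S, v)) = ?F x" unfolding xe by (simp add: ac_simps)
  next
    fix x assume x: "x \<in> ?B"
    obtain T u where xe: "x = (T, u)" by fastforce
    have T: "T \<in> Sub (Suc p)" and u: "u \<in> T" using x unfolding xe by auto
    note T' = SubD[OF T]
    show "(case case x of (T, u) \<Rightarrow> (T - {u}, u) of (S, v) \<Rightarrow> (insert v S, v)) = x" using u unfolding xe by auto
    show "(case x of (T, u) \<Rightarrow> (T - {u}, u)) \<in> ?A" using T' u unfolding xe by (auto simp: Sub_def)
  qed
  also have "\<dots> = (\<Sum>T\<in>Sub (Suc p). f (T, 0) * dl g T)"
    unfolding dl_def sum_distrib_left by (rule sum.Sigma[symmetric]) (auto dest: SubD)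
  finally show ?thesis .
qed

abbreviation "W p j \<equiv> KK (\<lambda>_. 0) p j (Fn 1)"

lemma W_iff: "f \<in> W p j \<longleftrightarrow> (\<forall>S\<in>Sub p. homogeneous (j - int p) (f (S, 0))) \<and> (\<forall>S c. \<not> (S \<in> Sub p \<and> c = 0) \<longrightarrow> f (S, c) = 0)"
  for f :: "'k::field kchain"
proof -
  have "f \<in> W p j \<longleftrightarrow> (\<forall>S c. S \<in> Sub p \<and> c < 1 \<longrightarrow> homogeneous (j - int p) (f (S, c))) \<and>
      (\<forall>S c. \<not> (S \<in> Sub p \<and> c < 1) \<longrightarrow> f (S, c) = 0)"
    unfolding KK_Fn_eq fun_space_def Hom_def Sub_def[symmetric] by (simp add: Ball_def split_paired_All)
  then show ?thesis by (simp add: Ball_def)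
qed

lemma W_hom: "f \<in> W p j \<Longrightarrow> homogeneous (j - int p) (f (S, c))" for f :: "'k::field kchain"
  using KK_D(2)[of f "\<lambda>_. 0" p j "Fn 1" c S] by simp

lemma dim_W: "Fv.dim (W p j :: 'k::field kchain set) = (4 choose p) * Qv.dim (Hom (j - int p) :: (4, 'k) mpoly set)"
proof -
  have "Fv.dim (W p j :: 'k kchain set) = (\<Sum>s\<in>Sub p \<times> {..<1::nat}. Qv.dim (Hom (j - int p) :: (4, 'k) mpoly set))"
    unfolding KK_Fn_eq Sub_def
    using fun_space_dim[OF finite_kindex[of p 1], of "\<lambda>s. Hom (j - int p - 0) :: (4, 'k) mpoly set"]
    by (simp add: Qv_subspace_Hom Qv_fd_Hom)
  then show ?thesis by (simp add: card_Sub card_cartesian_product)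
qed

definition sg :: "nat set \<Rightarrow> (4, 'k::comm_ring_1) mpoly \<Rightarrow> 'k kchain" where
  "sg T q = (\<lambda>(S, c). if S = T \<and> c = 0 then q else 0)"

lemma sg_W: "T \<in> Sub p \<Longrightarrow> homogeneous (j - int p) q \<Longrightarrow> sg T q \<in> W p j" for q :: "(4, 'k::field) mpoly"
  unfolding W_iff by (auto simp: sg_def)

lemma lkp_lin: "u < 4 \<Longrightarrow> v < 4 \<Longrightarrow> lkp (xv u * kc c) (Poly_Mapping.single (of_nat v) 1) = (if u = v then c else 0)"
proof -
  assume uv: "u < 4" "v < 4"
  have "lkp (kc c * xv u) (Poly_Mapping.single (of_nat v) 1) = c * lkp (xv u) (Poly_Mapping.single (of_nat v) 1)"
    by (rule lkp_kc_mult)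
  also have "lkp (xv u) (Poly_Mapping.single (of_nat v) 1) = (if u = v then 1 else 0)"
  proof (cases "u = v")
    case True
    then show ?thesis by (simp add: xv_def variable_def)
  next
    case False
    then have "(of_nat u :: 4) \<noteq> of_nat v" using of_nat_4_inj[OF uv] by simp
    then have "Poly_Mapping.single (of_nat u :: 4) (1::nat) \<noteq> Poly_Mapping.single (of_nat v) 1"
      by (metis lookup_single_eq lookup_single_not_eq one_neq_zero)
    then show ?thesis using False by (simp add: xv_def variable_def lookup_single_not_eq)
  qed
  finally show ?thesis by (simp add: mult.commute)
qed

lemma lin_coeff: "A \<subseteq> {..<4} \<Longrightarrow> v < 4 \<Longrightarrow>
  lkp (\<Sum>u\<in>A. xv u * kc (c u)) (Poly_Mapping.single (of_nat v) 1) = (if v \<in> A then c v else 0)"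
proof -
  assume A: "A \<subseteq> {..<4}" and v: "v < 4"
  then have "finite A" using finite_subset by blast
  have "lkp (\<Sum>u\<in>A. xv u * kc (c u)) (Poly_Mapping.single (of_nat v) 1) = (\<Sum>u\<in>A. if u = v then c u else 0)"
    unfolding lookup_sum by (rule sum.cong[OF refl]) (use A v in \<open>auto simp: lkp_lin[unfolded One_nat_def]\<close>)
  then show ?thesis using \<open>finite A\<close> by simp
qed

lemma hom1_expand:
  fixes p :: "(4, 'k::comm_ring_1) mpoly"
  assumes "homogeneous 1 p"
  shows "p = (\<Sum>i<4. xv i * kc (lkp p (Poly_Mapping.single (of_nat i) 1)))"
proof -
  have "lkp p 0 = 0"
  proof (rule ccontr)
    assume "lkp p 0 \<noteq> 0"
    then have "0 \<in> keys p" by (simp add: in_keys_iff)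
    then have "int (mon_deg (0 :: 4 \<Rightarrow>\<^sub>0 nat)) = 1" using assms unfolding homogeneous_def by blast
    then show False by (simp add: mon_deg_def)
  qed
  then obtain q where q: "p = (\<Sum>i<4. xv i * q i)" using varid_4[of p] unfolding varid_def by blast
  have "p = hc 1 p" using hc_id[OF assms] by simp
  also have "\<dots> = (\<Sum>i<4. xv i * hc 0 (q i))" unfolding q by (simp add: hc_sum hc_xv_mult)
  also have "\<dots> = (\<Sum>i<4. xv i * kc (lkp (q i) 0))"
  proof (rule sum.cong[OF refl])
    fix i
    have "hc 0 (q i) = kc (lkp (q i) 0)" using homogeneous_degree_0[of "hc 0 (q i)"] by (simp add: lkp_hc)
    then show "xv i * hc 0 (q i) = xv i * kc (lkp (q i) 0)" by simp
  qed
  finally have p: "p = (\<Sum>i<4. xv i * kc (lkp (q i) 0))" .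
  have "lkp p (Poly_Mapping.single (of_nat i) 1) = lkp (q i) 0" if "i < 4" for i
  proof -
    have "lkp (\<Sum>i<4. xv i * kc (lkp (q i) 0)) (Poly_Mapping.single (of_nat i) 1) = lkp (q i) 0"
      using lin_coeff[of "{..<4}" i "\<lambda>i. lkp (q i) 0"] that by simp
    then show ?thesis unfolding p[symmetric] .
  qed
  then show ?thesis using p by simp
qed

lemma dim_Hom_0: "Qv.dim (Hom 0 :: (4, 'k::field) mpoly set) = 1"
proof -
  have "(Hom 0 :: (4, 'k) mpoly set) = range kc" using homogeneous_degree_0 by (auto simp: Hom_def)
  then show ?thesis using fd_constants(3) by simp
qed

lemma dim_Hom_1: "Qv.dim (Hom 1 :: (4, 'k::field) mpoly set) = 4"
proof -
  let ?C = "fun_space {..<4::nat} (\<lambda>_. range kc :: (4, 'k) mpoly set)"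
  define f where "f c = (\<Sum>i<4. xv i * c i)" for c :: "nat \<Rightarrow> (4, 'k) mpoly"
  note C = fun_space_dim[of "{..<4::nat}" "\<lambda>_. range kc :: (4, 'k) mpoly set", OF _ fd_constants(1,2)]
  have lin: "Vector_Spaces.linear fs qs f"
    by (rule linear_FQ_I) (simp_all add: f_def fs_def qs_def distrib_left sum.distrib sum_distrib_left mult.left_commute)
  have inj: "c = 0" if c: "c \<in> ?C" "f c = 0" for c
  proof
    fix i
    have e: "c i = kc (lkp (c i) 0)" if "i < 4" for i
    proof -
      have "c i \<in> range kc" using c(1) that unfolding fun_space_def by blast
      then show ?thesis by (auto simp: lkp_kc)
    qed
    have "(\<Sum>i<4. xv i * kc (lkp (c i) 0)) = f c" unfolding f_def by (rule sum.cong[OF refl]) (use e in simp)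
    then have "lkp (c i) 0 = 0" if "i < 4" using lin_coeff[of "{..<4}" i "\<lambda>i. lkp (c i) 0"] that c(2) by simp
    then show "c i = 0 i" using e[of i] c(1) by (cases "i < 4") (auto simp: fun_space_def)
  qed
  have im: "f ` ?C = Hom 1"
  proof (rule equalityI; rule subsetI)
    fix p assume "p \<in> f ` ?C"
    then obtain c where c: "p = f c" "c \<in> ?C" by blast
    have "homogeneous (1 + 0) (xv i * c i)" if "i < 4" for i
    proof -
      have "c i \<in> range kc" using c(2) that unfolding fun_space_def by blast
      then show ?thesis by (intro homogeneous_mult[OF homogeneous_xv]) auto
    qed
    then show "p \<in> Hom 1" unfolding c(1) f_def Hom_def by (auto intro: homogeneous_sum)
  next
    fix p :: "(4, 'k) mpoly" assume p: "p \<in> Hom 1"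
    define c :: "nat \<Rightarrow> (4, 'k) mpoly" where "c i = (if i < 4 then kc (lkp p (Poly_Mapping.single (of_nat i) 1)) else 0)" for i :: nat
    have "p = f c" using hom1_expand[of p] p by (simp add: Hom_def f_def c_def)
    moreover have "c \<in> ?C" by (simp add: fun_space_def c_def)
    ultimately show "p \<in> f ` ?C" by blast
  qed
  have "Qv.dim (f ` ?C) = Fv.dim ?C"
    by (rule FQ.linear_inj_dim[OF lin fun_space_subspace[OF fd_constants(1)] _ inj]) (use C in auto)
  then show ?thesis using C unfolding im by (simp add: fd_constants(3))
qed

section \<open>Duality with respect to the socle\<close>

abbreviation dQ :: "'k::field itself \<Rightarrow> int \<Rightarrow> nat" where
  "dQ t e \<equiv> Qv.dim (Hom e :: (4, 'k) mpoly set)"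

text \<open>\<open>s\<close> spans the top degree of the quotient, and \<open>soc\<close> is what
  the Gorenstein property contributes: nothing of lower degree is annihilated by all
  variables.\<close>

locale cubic_artin =
  fixes I :: "(4, 'k::field) mpoly set" and s :: "(4, 'k) mpoly"
  assumes qI: "qideal I"
    and hI: "p \<in> I \<Longrightarrow> hc e p \<in> I"
    and I2: "p \<in> I \<Longrightarrow> m \<in> keys p \<Longrightarrow> 2 \<le> mon_deg m"
    and I4: "(\<And>m. m \<in> keys p \<Longrightarrow> 4 \<le> mon_deg m) \<Longrightarrow> p \<in> I"
    and s3: "homogeneous 3 s" and sI: "s \<notin> I"
    and s1: "homogeneous 3 p \<Longrightarrow> \<exists>c. p - kc c * s \<in> I"
    and soc: "homogeneous e p \<Longrightarrow> e < 3 \<Longrightarrow> (\<And>i. i < 4 \<Longrightarrow> xv i * p \<in> I) \<Longrightarrow> p \<in> I"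
begin

lemma I_low: assumes "p \<in> I" "homogeneous e p" "e < 2" shows "p = 0"
proof (rule poly_mapping_eqI)
  fix m show "lkp p m = lkp 0 m"
    using I2[OF assms(1), of m] assms(2,3) unfolding homogeneous_def by (cases "m \<in> keys p") (fastforce simp: in_keys_iff)+
qed

lemma I_high: assumes "homogeneous e p" "4 \<le> e" shows "p \<in> I"
  by (rule I4) (use assms in \<open>fastforce simp: homogeneous_def\<close>)

text \<open>The coordinate along \<open>s\<close> of the component of degree 3 modulo
  \<open>I\<close>; other components do not count.\<close>

definition tau :: "(4, 'k) mpoly \<Rightarrow> 'k" where "tau p = (THE c. hc 3 p - kc c * s \<in> I)"

lemma kc_s: "kc c * s \<in> I \<longleftrightarrow> c = 0"
proof
  assume h: "kc c * s \<in> I"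
  show "c = 0"
  proof (rule ccontr)
    assume c: "c \<noteq> 0"
    have "kc (inverse c) * (kc c * s) \<in> I" by (rule qidealD(3)[OF qI h])
    then show False using sI c by (simp flip: mult.assoc kc_mult)
  qed
next
  assume "c = 0"
  then show "kc c * s \<in> I" using qidealD(1)[OF qI] by simp
qed

lemma tau_unique: assumes "hc 3 p - kc c * s \<in> I" "hc 3 p - kc d * s \<in> I" shows "c = d"
proof -
  have "(hc 3 p - kc c * s) - (hc 3 p - kc d * s) = kc (d - c) * s" by (simp add: kc_diff algebra_simps)
  then show ?thesis using qidealD(6)[OF qI assms] kc_s[of "d - c"] by simp
qed

lemma tau: "hc 3 p - kc (tau p) * s \<in> I"
proof -
  obtain c where c: "hc 3 p - kc c * s \<in> I" using s1[OF homogeneous_hc] by blast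
  show ?thesis unfolding tau_def by (rule theI[of _ c]) (use c tau_unique in auto)
qed

lemma tau_eqI: "hc 3 p - kc c * s \<in> I \<Longrightarrow> tau p = c" by (rule tau_unique[OF tau])

lemma tau_add: "tau (p + q) = tau p + tau q"
proof (rule tau_eqI)
  have "hc 3 (p + q) - kc (tau p + tau q) * s = (hc 3 p - kc (tau p) * s) + (hc 3 q - kc (tau q) * s)"
    by (simp add: hc_add kc_add algebra_simps)
  then show "hc 3 (p + q) - kc (tau p + tau q) * s \<in> I" using qidealD(2)[OF qI tau[of p] tau[of q]] by simp
qed

lemma tau_kc: "tau (kc c * p) = c * tau p"
proof (rule tau_eqI)
  have "hc 3 (kc c * p) - kc (c * tau p) * s = kc c * (hc 3 p - kc (tau p) * s)"
    by (simp only: hc_kc_mult kc_mult right_diff_distrib mult.assoc)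
  then show "hc 3 (kc c * p) - kc (c * tau p) * s \<in> I" using qidealD(3)[OF qI tau[of p], of "kc c"] by simp
qed

lemma tau_I: "p \<in> I \<Longrightarrow> tau p = 0" by (rule tau_eqI) (simp add: hI)

lemma tau_0: "tau 0 = 0" by (rule tau_I[OF qidealD(1)[OF qI]])

lemma tau_sum: "tau (sum f A) = (\<Sum>i\<in>A. tau (f i))"
  by (induct A rule: infinite_finite_induct) (simp_all add: tau_add tau_0)

lemma tau_diff: "tau (p - q) = tau p - tau q"
proof -
  have "tau (p - q) + tau q = tau p" by (simp flip: tau_add)
  then show ?thesis by (simp add: algebra_simps)
qed

lemma tau_zero_I: "homogeneous 3 p \<Longrightarrow> tau p = 0 \<Longrightarrow> p \<in> I" using tau[of p] by (simp add: hc_id)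

text \<open>Induction on \<open>d\<close>: by \<open>soc\<close> it is enough that the products of
  \<open>u\<close> with the variables lie in \<open>I\<close>, and these pair trivially with degree
  \<open>d\<close> because \<open>u\<close> does with degree \<open>d + 1\<close>.\<close>

lemma nondegenerate:
  assumes "homogeneous (3 - int d) u" "\<And>q. homogeneous (int d) q \<Longrightarrow> tau (q * u) = 0"
  shows "u \<in> I"
  using assms
proof (induct d arbitrary: u)
  case 0
  then show ?case using tau_zero_I[of u] 0(2)[of 1] by (simp add: homogeneous_def mon_deg_def)
next
  case (Suc d)
  show ?case
  proof (rule soc[OF Suc(2)])
    fix i assume "i < (4::nat)"
    show "xv i * u \<in> I"
    proof (rule Suc(1))
      show "homogeneous (3 - int d) (xv i * u)" using homogeneous_mult[OF homogeneous_xv[of i] Suc(2)] by (simp add: algebra_simps)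
      fix q :: "(4, 'k) mpoly" assume "homogeneous (int d) q"
      then have "homogeneous (int (Suc d)) (xv i * q)" using homogeneous_mult[OF homogeneous_xv[of i], of "int d" q] by simp
      from Suc(3)[OF this] show "tau (q * (xv i * u)) = 0" by (simp add: ac_simps)
    qed
  qed simp
qed

abbreviation "N p j \<equiv> KK (\<lambda>_. 0) p j (I1 I)"

lemma gI1: "gsub (\<lambda>_. 0) (I1 I)" unfolding gsub_def
proof (intro conjI ballI allI)
  show "(\<lambda>c. 0) \<in> I1 I" using qidealD(1)[OF qI] by (simp add: I1_def Fn_def)
  show "(\<lambda>c. u c + v c) \<in> I1 I" if "u \<in> I1 I" "v \<in> I1 I" for u v
    using that qidealD(2)[OF qI] by (simp add: I1_def Fn_def)
  show "(\<lambda>c. q * v c) \<in> I1 I" if "v \<in> I1 I" for v q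
    using that qidealD(3)[OF qI] by (simp add: I1_def Fn_def)
  show "hv (\<lambda>_. 0) j v \<in> I1 I" if "v \<in> I1 I" for v j
    using that hI by (simp add: I1_def Fn_def hv_def)
qed

lemma I1_Fn: "I1 I \<subseteq> Fn 1" by (auto simp: I1_def)

lemma N_iff: "f \<in> N p j \<longleftrightarrow> f \<in> W p j \<and> (\<forall>S\<in>Sub p. f (S, 0) \<in> I)"
proof
  assume f: "f \<in> N p j"
  then have "f \<in> W p j" using KK_mono[OF I1_Fn] by blast
  moreover have "f (S, 0) \<in> I" for S using KK_D(3)[OF f, of S] by (simp add: I1_def)
  ultimately show "f \<in> W p j \<and> (\<forall>S\<in>Sub p. f (S, 0) \<in> I)" by blast
next
  assume f: "f \<in> W p j \<and> (\<forall>S\<in>Sub p. f (S, 0) \<in> I)"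
  then have w: "f \<in> W p j" by blast
  have "f (S, 0) \<in> I" for S using f qidealD(1)[OF qI] unfolding W_iff by (cases "S \<in> Sub p") auto
  then show "f \<in> N p j" using KK_D[OF w] by (intro KK_I) (simp_all add: I1_def)
qed

lemma subspace_I: "Qv.subspace (Hom e \<inter> I)"
  by (rule Qv.subspaceI) (use qidealD[OF qI] in \<open>auto simp: Hom_def qs_def intro: homogeneous_add homogeneous_kc_mult\<close>)

lemma fd_I: "Qv.fd (Hom e \<inter> I)" by (rule Qv.fd_subset[OF Qv_fd_Hom]) blast

lemma dim_N: "Fv.dim (N p j) = (4 choose p) * Qv.dim (Hom (j - int p) \<inter> I)"
proof -
  have "N p j = fun_space (Sub p \<times> {..<1::nat}) (\<lambda>_. Hom (j - int p) \<inter> I)"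
    by (rule Set.set_eqI) (unfold N_iff W_iff, auto simp: fun_space_def Hom_def)
  moreover have "Fv.dim (fun_space (Sub p \<times> {..<1::nat}) (\<lambda>_. Hom (j - int p) \<inter> I)) = (\<Sum>s\<in>Sub p \<times> {..<1::nat}. Qv.dim (Hom (j - int p) \<inter> I))"
    using fun_space_dim[of "Sub p \<times> {..<1::nat}" "\<lambda>_. Hom (j - int p) \<inter> I"] subspace_I fd_I by simp
  ultimately show ?thesis by (simp add: card_Sub card_cartesian_product)
qed

abbreviation "dI e \<equiv> Qv.dim (Hom e \<inter> I)"

lemma zero_dim: "Qv.dim {0 :: (4, 'k) mpoly} = 0" by (rule Qv.dim_zero)

lemma dI_low: "e < 2 \<Longrightarrow> dI e = 0"
proof -
  assume "e < 2"
  then have "Hom e \<inter> I = {0}" using I_low[of _ e] qidealD(1)[OF qI] by (auto simp: Hom_def)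
  then show ?thesis using zero_dim by simp
qed

lemma dQ_high: "4 \<le> e \<Longrightarrow> dQ TYPE('k) e = dI e"
proof -
  assume "4 \<le> e"
  then have "Hom e \<inter> I = Hom e" using I_high[of e] by (auto simp: Hom_def)
  then show ?thesis by simp
qed

text \<open>The radicals of the pairing of degrees \<open>d\<close> and \<open>3 - d\<close> are the
  respective parts of \<open>I\<close>. Polynomials are viewed as functions on the unit type to fit
  \<open>bilinear_rank\<close>.\<close>

lemma hilbert_sym:
  assumes "d \<le> 3"
  shows "dQ TYPE('k) (3 - int d) + dI (int d) = dQ TYPE('k) (int d) + dI (3 - int d)"
proof -
  define F where "F V = fun_space {()} (\<lambda>_. V)" for V :: "(4, 'k) mpoly set"
  have F: "Fv.subspace (F V)" "Fv.fd (F V)" "Fv.dim (F V) = Qv.dim V" if "Qv.subspace V" "Qv.fd V" for V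
    using that fun_space_dim[of "{()}" "\<lambda>_. V"] fun_space_subspace[of "{()}" "\<lambda>_. V"] by (simp_all add: F_def)
  have Fm: "f \<in> F V \<longleftrightarrow> f () \<in> V" for f V by (simp add: F_def fun_space_def)
  define b where "b u x = tau (u () * x ())" for u x :: "unit \<Rightarrow> (4, 'k) mpoly"
  let ?U = "F (Hom (int d))" and ?Y = "F (Hom (3 - int d))"
  have b: "b (x + y) z = b x z + b y z" "b (fs c x) z = c * b x z" "b z (x + y) = b z x + b z y" "b z (fs c x) = c * b z x" for x y z c
    by (simp_all add: b_def fs_def distrib_left distrib_right tau_add mult.assoc mult.left_commute[of _ "kc c"] tau_kc)
  have 1: "{u \<in> ?U. \<forall>x\<in>?Y. b u x = 0} = F (Hom (int d) \<inter> I)"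
  proof (rule Set.set_eqI, rule iffI)
    fix u assume u: "u \<in> {u \<in> ?U. \<forall>x\<in>?Y. b u x = 0}"
    have "u () \<in> I"
    proof (rule nondegenerate[of "3 - d"])
      show "homogeneous (3 - int (3 - d)) (u ())" using u assms by (simp add: Fm Hom_def of_nat_diff)
      fix q :: "(4, 'k) mpoly" assume "homogeneous (int (3 - d)) q"
      then have "(\<lambda>_. q) \<in> ?Y" using assms by (simp add: Fm Hom_def of_nat_diff)
      then have "b u (\<lambda>_. q) = 0" using u by blast
      then show "tau (q * u ()) = 0" by (simp add: b_def mult.commute)
    qed
    then show "u \<in> F (Hom (int d) \<inter> I)" using u by (simp add: Fm)
  next
    fix u assume "u \<in> F (Hom (int d) \<inter> I)"
    then show "u \<in> {u \<in> ?U. \<forall>x\<in>?Y. b u x = 0}" using tau_I[OF qidealD(4)[OF qI]] by (simp add: Fm b_def)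
  qed
  have 2: "{x \<in> ?Y. \<forall>u\<in>?U. b u x = 0} = F (Hom (3 - int d) \<inter> I)"
  proof (rule Set.set_eqI, rule iffI)
    fix x assume x: "x \<in> {x \<in> ?Y. \<forall>u\<in>?U. b u x = 0}"
    have "x () \<in> I"
    proof (rule nondegenerate[of d])
      show "homogeneous (3 - int d) (x ())" using x by (simp add: Fm Hom_def)
      fix q :: "(4, 'k) mpoly" assume "homogeneous (int d) q"
      then have "(\<lambda>_. q) \<in> ?U" by (simp add: Fm Hom_def)
      then have "b (\<lambda>_. q) x = 0" using x by blast
      then show "tau (q * x ()) = 0" by (simp add: b_def)
    qed
    then show "x \<in> F (Hom (3 - int d) \<inter> I)" using x by (simp add: Fm)
  next
    fix x assume "x \<in> F (Hom (3 - int d) \<inter> I)"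
    then show "x \<in> {x \<in> ?Y. \<forall>u\<in>?U. b u x = 0}" using tau_I[OF qidealD(3)[OF qI]] by (simp add: Fm b_def)
  qed
  note HF = F[OF Qv_subspace_Hom Qv_fd_Hom] and IF = F[OF subspace_I fd_I]
  have "Fv.dim ?Y + Fv.dim {u \<in> ?U. \<forall>x\<in>?Y. b u x = 0} = Fv.dim ?U + Fv.dim {x \<in> ?Y. \<forall>u\<in>?U. b u x = 0}"
    by (rule bilinear_rank[OF b HF(1,2) HF(1,2)])
  then show ?thesis unfolding 1 2 HF(3) IF(3) .
qed

text \<open>\<open>I\<close> starts in degree 2, which settles degrees 0 and 1; symmetry transfers
  the values to degrees 3 and 2.\<close>

lemma hilbert: "dQ TYPE('k) 0 = 1" "dQ TYPE('k) 1 = 4" "dQ TYPE('k) 2 = dI 2 + 4" "dQ TYPE('k) 3 = dI 3 + 1"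
  using hilbert_sym[of 1] hilbert_sym[of 0] dI_low[of 1] dI_low[of 0] by (simp_all add: dim_Hom_0 dim_Hom_1)

abbreviation "Ls p j \<equiv> Lsp (\<lambda>_. 0) p j 1 (I1 I)"

lemma Ls_iff: "f \<in> Ls p j \<longleftrightarrow> f \<in> W (Suc p) j \<and> (\<forall>S\<in>Sub p. kd 4 f (S, 0) \<in> I)"
  unfolding Lsp_def using KK_kd[OF gsub_Fn, of f "\<lambda>_. 0" p j 1 4] by (auto simp: N_iff)

text \<open>The homology is \<open>Lsp\<close> modulo \<open>Dsp\<close>, and by
  \<open>dim_sum_preimage\<close> the dimension of the sum \<open>Dsp\<close> is governed by the
  next \<open>Ls\<close>. So only the dimensions of the spaces \<open>Ls\<close> remain to be
  found.\<close>

lemma kh_dim: "kh (\<lambda>_. 0) p j (I1 I) + Fv.dim (W (Suc (Suc p)) j :: 'k kchain set) + Fv.dim (N (Suc p) j)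
   = Fv.dim (Ls p j) + Fv.dim (Ls (Suc p) j)"
proof -
  have "I1 I \<subseteq> irrv"
  proof
    fix v assume v: "v \<in> I1 I"
    have "lkp (v c) 0 = 0" for c
    proof (cases "c = 0")
      case True
      then have "v c \<in> I" using v by (simp add: I1_def)
      from I2[OF this, of 0] show ?thesis by (auto simp: in_keys_iff mon_deg_def)
    next
      case False
      then show ?thesis using v by (simp add: I1_def Fn_def)
    qed
    then show "v \<in> irrv" by (simp add: irrv_def)
  qed
  note 1 = kh_subspace_step[OF gI1 I1_Fn cyc_bd_free[OF I1_Fn this], of p j]
  have "Dsp (\<lambda>_. 0) p j 1 (I1 I) = {y + kd 4 x |x y. x \<in> W (Suc (Suc p)) j \<and> y \<in> N (Suc p) j}"
    unfolding Dsp_def by blast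
  then have "Fv.dim (Dsp (\<lambda>_. 0) p j 1 (I1 I)) + Fv.dim (Ls (Suc p) j) = Fv.dim (W (Suc (Suc p)) j :: 'k kchain set) + Fv.dim (N (Suc p) j)"
    using FF.dim_sum_preimage[OF linear_kd KK_subspace[OF gsub_Fn] KK_fd[OF order_refl] KK_subspace[OF gI1] KK_fd[OF I1_Fn],
      of 4 "\<lambda>_. 0" "Suc (Suc p)" j 1 "Suc p" j] unfolding Lsp_def[of _ "Suc p"] by simp
  then show ?thesis using 1 by simp
qed

text \<open>Cycles modulo \<open>I\<close> of the transposed complex, with coefficients of degree
  \<open>e\<close>. The number \<open>z\<close> is the dimension of \<open>Ms 1 1\<close>.\<close>

definition Ms :: "nat \<Rightarrow> int \<Rightarrow> 'k kchain set" where
  "Ms p e = {g \<in> W p (int p + e). \<forall>T\<in>Sub (Suc p). dl g T \<in> I}"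

lemma dl_hom: fixes g :: "'k kchain" assumes "g \<in> W p (int p + e)" shows "homogeneous (e + 1) (dl g T)"
  unfolding dl_def
proof (rule homogeneous_sum)
  fix u
  have "homogeneous (0 + 1 + e) ((-1) ^ card (T \<inter> {..<u}) * xv u * g (T - {u}, 0))"
    by (intro homogeneous_mult hom_sign homogeneous_xv) (use W_hom[OF assms] in simp)
  then show "homogeneous (e + 1) ((-1) ^ card (T \<inter> {..<u}) * xv u * g (T - {u}, 0))" by (simp add: add.commute)
qed

text \<open>Pair chains with coefficients of degrees \<open>2 - e\<close> and \<open>e\<close> by
  applying \<open>tau\<close> to one times the differential of the other. Testing with chains that
  have a single coefficient, the radicals are \<open>Ls\<close> directly and \<open>Ms\<close> after
  passing to the adjoint.\<close>

lemma duality: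
  assumes "e \<le> 2"
  shows "Fv.dim (W (Suc p) (int (Suc p) + int e) :: 'k kchain set) + Fv.dim (Ms p (2 - int e))
     = Fv.dim (W p (int p + (2 - int e)) :: 'k kchain set) + Fv.dim (Ls p (int (Suc p) + int e))"
proof -
  let ?U = "W p (int p + (2 - int e)) :: 'k kchain set" and ?Y = "W (Suc p) (int (Suc p) + int e) :: 'k kchain set"
  define b where "b g f = (\<Sum>S\<in>Sub p. tau (g (S, 0) * kd 4 f (S, 0)))" for g f :: "'k kchain"
  have b: "b (x + y) z = b x z + b y z" "b (fs c x) z = c * b x z" "b z (x + y) = b z x + b z y" "b z (fs c x) = c * b z x" for x y z c
    unfolding b_def kd_add kd_fs
    by (simp_all add: fs_def distrib_left distrib_right tau_add mult.assoc mult.left_commute[of _ "kc c"] tau_kc sum.distrib sum_distrib_left)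
  have adj: "b g f = (\<Sum>T\<in>Sub (Suc p). tau (f (T, 0) * dl g T))" for g f
    unfolding b_def by (simp add: kd_dl_adjoint flip: tau_sum)
  have 1: "{g \<in> ?U. \<forall>f\<in>?Y. b g f = 0} = Ms p (2 - int e)"
  proof (rule Set.set_eqI, rule iffI)
    fix g assume g: "g \<in> {g \<in> ?U. \<forall>f\<in>?Y. b g f = 0}"
    then have gU: "g \<in> ?U" by blast
    have "dl g T \<in> I" if T: "T \<in> Sub (Suc p)" for T
    proof (rule nondegenerate[of e])
      show "homogeneous (3 - int e) (dl g T)" using dl_hom[OF gU, of T] by simp
      fix q :: "(4, 'k) mpoly" assume "homogeneous (int e) q"
      then have "sg T q \<in> ?Y" by (intro sg_W[OF T]) simp
      then have "b g (sg T q) = 0" using g by blast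
      moreover have "b g (sg T q) = (\<Sum>T'\<in>Sub (Suc p). if T' = T then tau (q * dl g T') else 0)"
        unfolding adj by (rule sum.cong[OF refl]) (simp add: sg_def tau_0)
      ultimately show "tau (q * dl g T) = 0" using T by simp
    qed
    then show "g \<in> Ms p (2 - int e)" using gU unfolding Ms_def by blast
  next
    fix g assume "g \<in> Ms p (2 - int e)"
    then show "g \<in> {g \<in> ?U. \<forall>f\<in>?Y. b g f = 0}" unfolding Ms_def adj
      using tau_I[OF qidealD(3)[OF qI]] by simp
  qed
  have 2: "{f \<in> ?Y. \<forall>g\<in>?U. b g f = 0} = Ls p (int (Suc p) + int e)"
  proof (rule Set.set_eqI, rule iffI)
    fix f assume f: "f \<in> {f \<in> ?Y. \<forall>g\<in>?U. b g f = 0}"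
    then have fY: "f \<in> ?Y" by blast
    have "kd 4 f (S, 0) \<in> I" if S: "S \<in> Sub p" for S
    proof (rule nondegenerate[of "2 - e"])
      show "homogeneous (3 - int (2 - e)) (kd 4 f (S, 0))"
        using W_hom[OF KK_kd[OF gsub_Fn fY], of 4 S 0] assms by (simp add: of_nat_diff)
      fix q :: "(4, 'k) mpoly" assume "homogeneous (int (2 - e)) q"
      then have "sg S q \<in> ?U" by (intro sg_W[OF S]) (use assms in \<open>simp add: of_nat_diff\<close>)
      then have "b (sg S q) f = 0" using f by blast
      moreover have "b (sg S q) f = (\<Sum>S'\<in>Sub p. if S' = S then tau (q * kd 4 f (S', 0)) else 0)"
        unfolding b_def by (rule sum.cong[OF refl]) (simp add: sg_def tau_0)
      ultimately show "tau (q * kd 4 f (S, 0)) = 0" using S by simp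
    qed
    then show "f \<in> Ls p (int (Suc p) + int e)" using fY unfolding Ls_iff by blast
  next
    fix f assume "f \<in> Ls p (int (Suc p) + int e)"
    then show "f \<in> {f \<in> ?Y. \<forall>g\<in>?U. b g f = 0}" unfolding Ls_iff b_def
      using tau_I[OF qidealD(3)[OF qI]] by simp
  qed
  have "Fv.dim ?Y + Fv.dim {g \<in> ?U. \<forall>f\<in>?Y. b g f = 0} = Fv.dim ?U + Fv.dim {f \<in> ?Y. \<forall>g\<in>?U. b g f = 0}"
    by (rule bilinear_rank[OF b KK_subspace[OF gsub_Fn] KK_fd[OF order_refl] KK_subspace[OF gsub_Fn] KK_fd[OF order_refl]])
  then show ?thesis unfolding 1 2 .
qed

end

section \<open>Small index sets and their complements\<close>

lemma fd_zero_dim: assumes "Fv.subspace A" "A \<subseteq> {0}" shows "Fv.dim A = 0"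
proof -
  have "A = {0}" using Fv.subspace_0[OF assms(1)] assms(2) by blast
  then show ?thesis by (simp add: Fv.dim_zero)
qed

lemma dl_pair: assumes "c < d" shows "dl g {c, d} = xv c * g ({d}, 0) - xv d * g ({c}, 0)"
proof -
  have "{c, d} \<inter> {..<c} = {}" "{c, d} \<inter> {..<d} = {c}" "{c, d} - {c} = {d}" "{c, d} - {d} = {c}" using assms by auto
  then show ?thesis using assms by (simp add: dl_def)
qed

lemma Sub_1: "S \<in> Sub 1 \<longleftrightarrow> (\<exists>v<4. S = {v})" "S \<in> Sub (Suc 0) \<longleftrightarrow> (\<exists>v<4. S = {v})"
  by (auto simp: Sub_def card_1_singleton_iff)

lemma W_eqI:
  fixes f g :: "'k::field kchain"
  assumes "f \<in> W p j" "g \<in> W p i" "\<And>S. S \<in> Sub p \<Longrightarrow> f (S, 0) = g (S, 0)"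
  shows "f = g"
proof
  fix x :: "nat set \<times> nat"
  obtain S c where x: "x = (S, c)" by fastforce
  show "f x = g x"
  proof (cases "S \<in> Sub p \<and> c = 0")
    case True
    then show ?thesis using assms(3) x by simp
  next
    case False
    then show ?thesis using assms(1,2) x unfolding W_iff by metis
  qed
qed

lemma W_zeroI: "f \<in> W p j \<Longrightarrow> (\<And>S. S \<in> Sub p \<Longrightarrow> f (S, 0) = 0) \<Longrightarrow> f = 0" for f :: "'k::field kchain"
  using W_eqI[of f p j 0 j] Fv.subspace_0[OF KK_subspace[OF gsub_Fn[of "\<lambda>_. 0" 1], of p j]] by simp

lemma Sub_2: assumes "T \<in> Sub 2" shows "\<exists>c d. c < d \<and> d < 4 \<and> T = {c, d}"
proof -
  obtain c d where T: "T = {c, d}" "c \<noteq> d" using SubD(2)[OF assms] unfolding card_2_iff by blast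
  then have "c < 4" "d < 4" using SubD(1)[OF assms] by auto
  show ?thesis
  proof (cases "c < d")
    case True
    then show ?thesis using T(1) \<open>d < 4\<close> by blast
  next
    case False
    then have "d < c" "T = {d, c}" using T by auto
    then show ?thesis using \<open>c < 4\<close> by blast
  qed
qed

lemma Sub_compl: "S \<in> Sub p \<Longrightarrow> p \<le> 4 \<Longrightarrow> {..<4} - S \<in> Sub (4 - p)"
proof -
  assume S: "S \<in> Sub p"
  have "card ({..<4} - S) = 4 - p" using card_Diff_subset[OF SubD(3)[OF S] SubD(1)[OF S]] SubD(2)[OF S] by simp
  then show ?thesis by (simp add: Sub_def)
qed

lemma Sub_empty: "4 < p \<Longrightarrow> Sub p = {}"
proof (rule equals0I)
  fix S assume "4 < p" "S \<in> Sub p"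
  then show False using card_mono[of "{..<4}" S] SubD[of S p] by simp
qed

text \<open>The identification of exterior degrees 3 and 1 by complements; the sign is chosen so
  that \<open>kd\<close> becomes \<open>dl\<close> up to sign.\<close>

definition hodge :: "'k::comm_ring_1 kchain \<Rightarrow> 'k kchain" where
  "hodge f = (\<lambda>(S, c). if S \<in> Sub 1 \<and> c = 0 then (-1) ^ the_elem S * f ({..<4} - S, 0) else 0)"

lemma hodge_single: "v < 4 \<Longrightarrow> hodge f ({v}, 0) = (-1) ^ v * f ({..<4} - {v}, 0)"
  by (auto simp: hodge_def Sub_1)

lemma linear_hodge: "Vector_Spaces.linear fs fs (hodge :: 'k::field kchain \<Rightarrow> _)"
  by (rule linear_FF_I) (auto simp: hodge_def fs_def fun_eq_iff distrib_left mult.left_commute)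

text \<open>Two terms on each side, for restoring \<open>c\<close> or \<open>d\<close>. Among the
  remaining indices only \<open>d - 1\<close> lie below \<open>d\<close>, as \<open>c\<close> is
  missing, and this shift yields the minus sign of \<open>dl_pair\<close>.\<close>

lemma kd_hodge:
  assumes "c < d" "d < 4"
  shows "kd 4 f ({..<4} - {c, d}, 0) = (-1) ^ (c + d) * dl (hodge f) {c, d}"
proof -
  let ?S = "{..<4} - {c, d}"
  have 1: "{..<4} - ?S = {c, d}" "insert c ?S = {..<4} - {d}" "insert d ?S = {..<4} - {c}" using assms by auto
  have "?S \<inter> {..<c} = {..<c}" "?S \<inter> {..<d} = {..<d} - {c}" using assms by auto
  then have 2: "card (?S \<inter> {..<c}) = c" "card (?S \<inter> {..<d}) = d - 1" using assms by (simp_all add: card_Diff_subset)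
  have "kd 4 f (?S, 0) = (-1) ^ c * xv c * f ({..<4} - {d}, 0) + (-1) ^ (d - 1) * xv d * f ({..<4} - {c}, 0)"
    unfolding kd_sum 1 using assms by (simp add: 1 2)
  moreover have "(-1) ^ (d - 1) = - ((-1) ^ d :: (4, 'a) mpoly)" using assms by (cases d) simp_all
  ultimately have 3: "kd 4 f (?S, 0) = (-1) ^ c * xv c * f ({..<4} - {d}, 0) - (-1) ^ d * xv d * f ({..<4} - {c}, 0)"
    by simp
  have m: "(-1) ^ n * (-1) ^ n = (1 :: (4, 'a) mpoly)" for n by (simp flip: power_mult_distrib)
  have "(-1) ^ (c + d) * (-1) ^ d = (-1) ^ c * ((-1) ^ d * (-1) ^ d :: (4, 'a) mpoly)"
    "(-1) ^ (c + d) * (-1) ^ c = (-1) ^ d * ((-1) ^ c * (-1) ^ c :: (4, 'a) mpoly)"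
    by (simp_all only: power_add ac_simps)
  then have m': "(-1) ^ (c + d) * (-1) ^ d = ((-1) ^ c :: (4, 'a) mpoly)" "(-1) ^ (c + d) * (-1) ^ c = ((-1) ^ d :: (4, 'a) mpoly)"
    by (simp_all only: m mult_1_right)
  have "(-1) ^ (c + d) * dl (hodge f) {c, d} = (-1) ^ (c + d) *
      (xv c * ((-1) ^ d * f ({..<4} - {d}, 0)) - xv d * ((-1) ^ c * f ({..<4} - {c}, 0)))"
    unfolding dl_pair[OF assms(1)] using assms by (simp add: hodge_single)
  also have "\<dots> = ((-1) ^ (c + d) * (-1) ^ d) * xv c * f ({..<4} - {d}, 0) - ((-1) ^ (c + d) * (-1) ^ c) * xv d * f ({..<4} - {c}, 0)"
    by (simp only: right_diff_distrib ac_simps)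
  finally show ?thesis unfolding m' 3 by simp
qed

section \<open>The dimensions of the spaces \<open>Ls\<close> and \<open>Ms\<close>\<close>

context cubic_artin
begin

lemma sign_I: "(-1) ^ n * p \<in> I \<longleftrightarrow> p \<in> I"
proof
  assume "(-1) ^ n * p \<in> I"
  then have "(-1) ^ n * ((-1) ^ n * p) \<in> I" by (rule qidealD(3)[OF qI])
  then show "p \<in> I" by (simp flip: mult.assoc power_mult_distrib)
qed (rule qidealD(3)[OF qI])

lemma Ls_subspace: "Fv.subspace (Ls p j)" by (rule Lsp_subspace[OF gI1])

lemma Ms_subspace: "Fv.subspace (Ms p e)"
proof -
  have d: "dl (f + g) T = dl f T + dl g T" "dl (fs c f) T = kc c * dl f T" for f g :: "'k kchain" and c T
    by (simp_all add: dl_def fs_def distrib_left sum.distrib sum_distrib_left mult.left_commute)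
  have W: "Fv.subspace (W p (int p + e) :: 'k kchain set)" by (rule KK_subspace[OF gsub_Fn])
  show ?thesis
  proof (rule Fv.subspaceI)
    show "0 \<in> Ms p e" using Fv.subspace_0[OF W] qidealD(1)[OF qI] by (simp add: Ms_def dl_def)
    show "f + g \<in> Ms p e" if "f \<in> Ms p e" "g \<in> Ms p e" for f g
      using that Fv.subspace_add[OF W] qidealD(2)[OF qI] by (simp add: Ms_def d)
    show "fs c f \<in> Ms p e" if "f \<in> Ms p e" for c f
      using that Fv.subspace_scale[OF W] qidealD(3)[OF qI] by (simp add: Ms_def d)
  qed
qed

text \<open>For constant coefficients \<open>dl\<close> produces linear forms, and a linear form in
  \<open>I\<close> is 0. Up to sign, the coefficient of \<open>xv v\<close> in the form at
  \<open>insert v S\<close> is the value of \<open>g\<close> at \<open>S\<close>;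
  \<open>p < 4\<close> leaves an index \<open>v\<close> outside \<open>S\<close>.\<close>

lemma Ms_0: assumes "p < 4" shows "Fv.dim (Ms p 0) = 0"
proof (rule fd_zero_dim[OF Ms_subspace], rule subsetI)
  fix g assume g: "g \<in> Ms p 0"
  then have gW: "g \<in> W p (int p + 0)" and dI: "\<And>T. T \<in> Sub (Suc p) \<Longrightarrow> dl g T \<in> I" unfolding Ms_def by auto
  have gc: "g (S, 0) = kc (lkp (g (S, 0)) 0)" for S using homogeneous_degree_0[of "g (S, 0)"] W_hom[OF gW, of S 0] by simp
  have "g (S, 0) = 0" if S: "S \<in> Sub p" for S
  proof -
    note S' = SubD[OF S]
    have "\<not> {..<4} \<subseteq> S" using card_mono[OF S'(3), of "{..<4}"] S'(2) assms by auto
    then obtain v where v: "v < 4" "v \<notin> S" by blast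
    let ?T = "insert v S"
    have T: "?T \<in> Sub (Suc p)" using S' v by (auto simp: Sub_def)
    have "homogeneous 1 (dl g ?T)" using dl_hom[OF gW, of ?T] by simp
    then have z: "dl g ?T = 0" using I_low[OF dI[OF T]] by simp
    have kp: "(-1) ^ n = (kc ((-1) ^ n) :: (4, 'k) mpoly)" for n by (induct n) (simp_all add: kc_mult kc_minus)
    have "dl g ?T = (\<Sum>u\<in>?T. xv u * kc ((-1) ^ card (?T \<inter> {..<u}) * lkp (g (?T - {u}, 0)) 0))"
      unfolding dl_def
    proof (rule sum.cong[OF refl])
      fix u
      have "(-1) ^ card (?T \<inter> {..<u}) * xv u * g (?T - {u}, 0) = kc ((-1) ^ card (?T \<inter> {..<u})) * xv u * kc (lkp (g (?T - {u}, 0)) 0)"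
        using gc[of "?T - {u}"] kp by simp
      then show "(-1) ^ card (?T \<inter> {..<u}) * xv u * g (?T - {u}, 0) = xv u * kc ((-1) ^ card (?T \<inter> {..<u}) * lkp (g (?T - {u}, 0)) 0)"
        by (simp add: kc_mult ac_simps)
    qed
    then have "(-1) ^ card (?T \<inter> {..<v}) * lkp (g (?T - {v}, 0)) 0 = 0"
      using lin_coeff[of ?T v "\<lambda>u. (-1) ^ card (?T \<inter> {..<u}) * lkp (g (?T - {u}, 0)) 0"] z v(1) S'(1) by simp
    moreover have "?T - {v} = S" using v by auto
    ultimately show ?thesis using gc[of S] by simp
  qed
  then have "g = 0" by (rule W_zeroI[OF gW])
  then show "g \<in> {0}" by simp
qed

lemma Ms_0_1: "Fv.dim (Ms 0 1) = 0"
proof (rule fd_zero_dim[OF Ms_subspace], rule subsetI)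
  fix g assume g: "g \<in> Ms 0 1"
  then have gW: "g \<in> W 0 1" and dI: "\<And>T. T \<in> Sub 1 \<Longrightarrow> dl g T \<in> I" unfolding Ms_def by auto
  have h: "homogeneous 1 (g ({}, 0))" using W_hom[OF gW, of "{}" 0] by simp
  have "xv v * g ({}, 0) \<in> I" if "v < 4" for v
    using dI[of "{v}"] that by (simp add: Sub_1 dl_def)
  then have "g ({}, 0) \<in> I" by (intro soc[OF h]) simp_all
  then have "g ({}, 0) = 0" using I_low[OF _ h] by simp
  moreover have "Sub 0 = {{}}" using finite_subset[of _ "{..<4::nat}"] by (auto simp: Sub_def)
  ultimately have "g = 0" by (intro W_zeroI[OF gW]) simp
  then show "g \<in> {0}" by simp
qed

text \<open>Indexed by the degree \<open>e\<close> of the coefficients, on which the answer depends,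
  instead of the internal degree.\<close>

abbreviation "L p e \<equiv> Fv.dim (Ls p (int (Suc p) + e))"

text \<open>The differential has coefficients in \<open>I\<close> of degree at most 1, so it
  vanishes; exactness then makes the chain the boundary of one with coefficients of negative
  degree.\<close>

lemma L_low: assumes "e \<le> 0" shows "L p e = 0"
proof (rule fd_zero_dim[OF Ls_subspace], rule subsetI)
  fix f assume f: "f \<in> Ls p (int (Suc p) + e)"
  then have fW: "f \<in> W (Suc p) (int (Suc p) + e)" and fI: "\<And>S. S \<in> Sub p \<Longrightarrow> kd 4 f (S, 0) \<in> I" unfolding Ls_iff by auto
  have dW: "kd 4 f \<in> W p (int (Suc p) + e)" by (rule KK_kd[OF gsub_Fn fW])
  have "kd 4 f (S, 0) = 0" if "S \<in> Sub p" for S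
    using I_low[OF fI[OF that], of "e + 1"] W_hom[OF dW, of S 0] assms by (simp add: algebra_simps)
  then have "kd 4 f = 0" by (rule W_zeroI[OF dW])
  from KK_exact[OF fW this] obtain g where g: "g \<in> W (Suc (Suc p)) (int (Suc p) + e)" "f = kd 4 g" by auto
  have "g = 0"
  proof
    fix x :: "nat set \<times> nat"
    obtain S c where x: "x = (S, c)" by fastforce
    show "g x = 0 x" using homogeneous_neg[OF W_hom[OF g(1), of S c]] assms by (simp add: x)
  qed
  then show "f \<in> {0}" using g(2) by (simp add: kd_0_fun)
qed

text \<open>The coefficients of the differential have degree at least 4, where \<open>I\<close> is
  everything.\<close>

lemma L_high: assumes "3 \<le> e" shows "L p e = (4 choose Suc p) * dQ TYPE('k) e"
proof -
  have "Ls p (int (Suc p) + e) = W (Suc p) (int (Suc p) + e)"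
  proof (rule equalityI; rule subsetI)
    fix f :: "'k kchain" assume fW: "f \<in> W (Suc p) (int (Suc p) + e)"
    have "kd 4 f \<in> W p (int (Suc p) + e)" by (rule KK_kd[OF gsub_Fn fW])
    then have "kd 4 f (S, 0) \<in> I" for S
      using I_high[OF W_hom, of "kd 4 f" p "int (Suc p) + e"] assms by simp
    then show "f \<in> Ls p (int (Suc p) + e)" using fW unfolding Ls_iff by blast
  next
    fix f assume "f \<in> Ls p (int (Suc p) + e)"
    then show "f \<in> W (Suc p) (int (Suc p) + e)" unfolding Ls_iff by blast
  qed
  then have "L p e = Fv.dim (W (Suc p) (int (Suc p) + e) :: 'k kchain set)" by (rule arg_cong)
  also have "\<dots> = (4 choose Suc p) * dQ TYPE('k) (int (Suc p) + e - int (Suc p))" by (rule dim_W)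
  finally show ?thesis by simp
qed

lemma L_void: assumes "4 \<le> p" shows "L p e = 0"
proof (rule fd_zero_dim[OF Ls_subspace], rule subsetI)
  fix f assume "f \<in> Ls p (int (Suc p) + e)"
  then have fW: "f \<in> W (Suc p) (int (Suc p) + e)" unfolding Ls_iff by blast
  have "Sub (Suc p) = {}" by (rule Sub_empty) (use assms in simp)
  then have "f = 0" by (intro W_zeroI[OF fW]) simp
  then show "f \<in> {0}" by simp
qed

lemma L_2: assumes "p < 4" shows "L p 2 + (4 choose p) = (4 choose Suc p) * dQ TYPE('k) 2"
proof -
  have "(4 choose Suc p) * dQ TYPE('k) (int (Suc p) + 2 - int (Suc p)) + 0 = (4 choose p) * dQ TYPE('k) (int p + 0 - int p) + L p 2"
    using duality[of 2 p] Ms_0[OF assms] unfolding dim_W by simp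
  then show ?thesis by (simp add: hilbert(1))
qed

lemma L_1_duality: "(4 choose Suc p) * 4 + Fv.dim (Ms p 1) = (4 choose p) * 4 + L p 1"
proof -
  have "(4 choose Suc p) * dQ TYPE('k) (int (Suc p) + 1 - int (Suc p)) + Fv.dim (Ms p 1) = (4 choose p) * dQ TYPE('k) (int p + 1 - int p) + L p 1"
    using duality[of 1 p] unfolding dim_W by simp
  then show ?thesis by (simp add: hilbert(2))
qed

text \<open>The chain has a single coefficient, a linear form, and its products with the variables
  are the coefficients of the differential up to sign.\<close>

lemma L_1_top: "L 3 1 = 0"
proof (rule fd_zero_dim[OF Ls_subspace], rule subsetI)
  fix f assume "f \<in> Ls 3 (int (Suc 3) + 1)"
  then have fW: "f \<in> W 4 5" and fI: "\<And>S. S \<in> Sub 3 \<Longrightarrow> kd 4 f (S, 0) \<in> I" unfolding Ls_iff by auto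
  have h: "homogeneous 1 (f ({..<4}, 0))" using W_hom[OF fW, of "{..<4}" 0] by simp
  have "xv v * f ({..<4}, 0) \<in> I" if v: "v < 4" for v
  proof -
    have S: "{..<4} - {v} \<in> Sub 3" using Sub_compl[of "{v}" 1] v by (simp add: Sub_1)
    have "{..<4} - ({..<4} - {v}) = {v}" "insert v ({..<4} - {v}) = {..<4}" using v by auto
    then have "kd 4 f ({..<4} - {v}, 0) = (-1) ^ card (({..<4} - {v}) \<inter> {..<v}) * (xv v * f ({..<4}, 0))"
      unfolding kd_sum by (simp add: mult.assoc)
    then show ?thesis using fI[OF S] sign_I by simp
  qed
  then have "f ({..<4}, 0) \<in> I" by (intro soc[OF h]) simp_all
  then have z: "f ({..<4}, 0) = 0" using I_low[OF _ h] by simp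
  have "S = {..<4}" if "S \<in> Sub 4" for S
    using SubD[OF that] card_subset_eq[of "{..<4}" S] by simp
  then have "f = 0" using z by (intro W_zeroI[OF fW]) metis
  then show "f \<in> {0}" by simp
qed

text \<open>Under \<open>kd_hodge\<close> the defining conditions of the two spaces correspond, one
  for each pair of indices.\<close>

lemma L_1_hodge: "L 2 1 = Fv.dim (Ms 1 1)"
proof -
  have pairs: "(\<forall>S\<in>Sub 2. kd 4 f (S, 0) \<in> I) \<longleftrightarrow> (\<forall>T\<in>Sub 2. dl (hodge f) T \<in> I)" for f :: "'k kchain"
  proof -
    have 1: "kd 4 f ({..<4} - T, 0) \<in> I \<longleftrightarrow> dl (hodge f) T \<in> I" if T: "T \<in> Sub 2" for T
    proof -
      obtain c d where cd: "c < d" "d < 4" "T = {c, d}" using Sub_2[OF T] by blast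
      show ?thesis unfolding cd(3) kd_hodge[OF cd(1,2)] sign_I ..
    qed
    have 2: "{..<4} - T \<in> Sub 2" if "T \<in> Sub 2" for T using Sub_compl[OF that] by simp
    have 3: "{..<4} - ({..<4} - S) = S" if "S \<in> Sub 2" for S using SubD(1)[OF that] by blast
    show ?thesis using 1 2 3 by metis
  qed
  have hW: "hodge f \<in> W 1 2" if "f \<in> W 3 4" for f :: "'k kchain"
  proof -
    have "homogeneous 1 (hodge f ({v}, 0))" if "v < 4" for v
    proof -
      have "homogeneous (0 + 1) ((-1) ^ v * f ({..<4} - {v}, 0))"
        by (rule homogeneous_mult[OF hom_sign]) (use W_hom[OF \<open>f \<in> W 3 4\<close>] in simp)
      then show ?thesis using that by (simp add: hodge_single)
    qed
    then have "\<forall>S\<in>Sub 1. homogeneous (2 - int 1) (hodge f (S, 0))" by (simp add: Ball_def Sub_1) auto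
    then show ?thesis unfolding W_iff by (auto simp: hodge_def)
  qed
  have comp: "\<exists>v<4. S = {..<4} - {v}" if "S \<in> Sub 3" for S
  proof -
    have "{..<4} - S \<in> Sub 1" using Sub_compl[OF that] by simp
    then obtain v where v: "v < 4" "{..<4} - S = {v}" unfolding Sub_1 by blast
    then have "S = {..<4} - {v}" using SubD(1)[OF that] by blast
    then show ?thesis using v(1) by blast
  qed
  have LsE: "f \<in> Ls 2 4 \<longleftrightarrow> f \<in> W 3 4 \<and> (\<forall>S\<in>Sub 2. kd 4 f (S, 0) \<in> I)" for f using Ls_iff[of f 2 4] by simp
  have MsE: "g \<in> Ms 1 1 \<longleftrightarrow> g \<in> W 1 2 \<and> (\<forall>T\<in>Sub 2. dl g T \<in> I)" for g by (simp add: Ms_def numeral_2_eq_2)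
  have im: "hodge ` Ls 2 4 = Ms 1 1"
  proof (rule equalityI; rule subsetI)
    fix g assume "g \<in> hodge ` Ls 2 4"
    then obtain f where g: "g = hodge f" and f0: "f \<in> Ls 2 4" by (rule imageE)
    have f: "f \<in> W 3 4" "\<forall>S\<in>Sub 2. kd 4 f (S, 0) \<in> I" by (rule f0[unfolded LsE, THEN conjunct1], rule f0[unfolded LsE, THEN conjunct2])
    show "g \<in> Ms 1 1" unfolding MsE g using hW[OF f(1)] f(2)[unfolded pairs] by (rule conjI)
  next
    fix g assume g: "g \<in> Ms 1 1"
    have gW: "g \<in> W 1 2" by (rule g[unfolded MsE, THEN conjunct1])
    have gI: "\<forall>T\<in>Sub 2. dl g T \<in> I" by (rule g[unfolded MsE, THEN conjunct2])
    define f :: "'k kchain" where "f = (\<lambda>(S, c). if S \<in> Sub 3 \<and> c = 0 then (-1) ^ the_elem ({..<4} - S) * g ({..<4} - S, 0) else 0)"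
    have dd: "{..<4} - ({..<4} - {v}) = {v}" if "v < 4" for v :: nat using that by auto
    have S3: "{..<4} - {v} \<in> Sub 3" if "v < 4" for v using Sub_compl[of "{v}" 1] that by (simp add: Sub_1)
    have fv: "f ({..<4} - {v}, 0) = (-1) ^ v * g ({v}, 0)" if "v < 4" for v
      using that S3[OF that] by (simp add: f_def dd)
    have "hodge f ({v}, 0) = g ({v}, 0)" if "v < 4" for v
      using that by (simp add: hodge_single fv flip: mult.assoc power_mult_distrib)
    then have hgv: "\<forall>S\<in>Sub 1. hodge f (S, 0) = g (S, 0)" by (simp add: Ball_def Sub_1) auto
    have "homogeneous 1 (f (S, 0))" if S: "S \<in> Sub 3" for S
    proof -
      obtain v where v: "v < 4" "S = {..<4} - {v}" using comp[OF S] by blast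
      have "homogeneous (0 + 1) ((-1) ^ v * g ({v}, 0))"
        by (rule homogeneous_mult[OF hom_sign]) (use W_hom[OF gW] in simp)
      then show ?thesis unfolding v(2) fv[OF v(1)] by simp
    qed
    then have fW: "f \<in> W 3 4" unfolding W_iff by (auto simp: f_def)
    have hg: "hodge f = g" by (rule W_eqI[OF hW[OF fW] gW]) (use hgv in blast)
    note fW
    moreover have "\<forall>S\<in>Sub 2. kd 4 f (S, 0) \<in> I" unfolding pairs hg by (rule gI)
    ultimately have "f \<in> Ls 2 4" unfolding LsE by (rule conjI)
    then show "g \<in> hodge ` Ls 2 4" using hg by blast
  qed
  have "Fv.dim (hodge ` Ls 2 4) = Fv.dim (Ls 2 4)"
  proof (rule FF.linear_inj_dim[OF linear_hodge Ls_subspace Lsp_fd])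
    fix f assume f: "f \<in> Ls 2 4" "hodge f = 0"
    then have fW: "f \<in> W 3 4" unfolding LsE by blast
    have "f (S, 0) = 0" if S: "S \<in> Sub 3" for S
    proof -
      obtain v where v: "v < 4" "S = {..<4} - {v}" using comp[OF S] by blast
      have "(-1) ^ v * f (S, 0) = 0" using hodge_single[OF v(1), of f] f(2) v(2) by simp
      then have "(-1) ^ v * ((-1) ^ v * f (S, 0)) = 0" by simp
      then show ?thesis by (simp flip: mult.assoc power_mult_distrib)
    qed
    then show "f = 0" by (rule W_zeroI[OF fW])
  qed
  then show ?thesis unfolding im by simp
qed

end

text \<open>Here \<open>p\<close> is the exterior degree in the homology of \<open>I\<close>, so it
  describes the term \<open>p + 1\<close> of the resolution. The entry \<open>z - 1\<close> does not
  truncate, because \<open>z\<close> will be positive.\<close>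

definition betti :: "nat \<Rightarrow> nat \<Rightarrow> int \<Rightarrow> nat" where
  "betti z p j = (if p = 0 then (if j = 2 then 6 else if j = 3 then z - 1 else 0)
    else if p = 1 then (if j = 3 \<or> j = 4 then 4 + z else 0)
    else if p = 2 then (if j = 4 then z - 1 else if j = 5 then 6 else 0)
    else if p = 3 then (if j = 7 then 1 else 0) else 0)"

context cubic_artin
begin

text \<open>With \<open>j = p + 1 + e\<close>, \<open>kh_dim\<close> involves \<open>L p e\<close>
  and \<open>L (Suc p) (e - 1)\<close>. All of these are known; \<open>z\<close> enters only for
  \<open>e = 1\<close> in exterior degrees 2 and 3.\<close>

theorem kh_betti:
  assumes z: "Fv.dim (Ms 1 1) = z" "1 \<le> z"
  shows "kh (\<lambda>_. 0) p j (I1 I) = betti z p j"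
proof -
  define e where "e = j - int (Suc p)"
  have j: "j = int (Suc p) + e" by (simp add: e_def)
  have ch: "(4::nat) choose 0 = 1" "(4::nat) choose Suc 0 = 4" "(4::nat) choose Suc (Suc 0) = 6"
    "(4::nat) choose Suc (Suc (Suc 0)) = 4" "(4::nat) choose Suc (Suc (Suc (Suc 0))) = 1"
    "(4::nat) choose Suc (Suc (Suc (Suc (Suc 0)))) = 0" by (simp_all add: eval_nat_numeral)
  have K: "kh (\<lambda>_. 0) p j (I1 I) + (4 choose Suc (Suc p)) * dQ TYPE('k) (e - 1) + (4 choose Suc p) * dI e = L p e + L (Suc p) (e - 1)"
    using kh_dim[of p j] unfolding dim_W dim_N j by (simp add: algebra_simps)
  \<comment> \<open>From \<open>L_1_duality\<close>, using \<open>Ms_0_1\<close> for the first: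
    \<open>12 = 4 * 4 - 4\<close> and \<open>8 + z = 6 * 4 + z - 4 * 4\<close>.\<close>
  have L1: "L 0 1 = 12" "L (Suc 0) 1 = 8 + z" "L (Suc (Suc 0)) 1 = z" "L (Suc (Suc (Suc 0))) 1 = 0"
    using L_1_duality[of 0] L_1_duality[of 1] Ms_0_1 z(1) L_1_hodge L_1_top by (simp_all add: ch numeral_2_eq_2 numeral_3_eq_3)
  have L2: "L 0 2 + 1 = 4 * dQ TYPE('k) 2" "L (Suc 0) 2 + 4 = 6 * dQ TYPE('k) 2" "L (Suc (Suc 0)) 2 + 6 = 4 * dQ TYPE('k) 2" "L (Suc (Suc (Suc 0))) 2 + 4 = dQ TYPE('k) 2"
    using L_2[of 0] L_2[of "Suc 0"] L_2[of "Suc (Suc 0)"] L_2[of "Suc (Suc (Suc 0))"] by (simp_all add: ch)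
  have c0: "(4::nat) choose Suc p = 0" "(4::nat) choose Suc (Suc p) = 0" if "4 \<le> p" using that by (simp_all add: binomial_eq_0)
  consider "4 \<le> p" | "p = 0" | "p = Suc 0" | "p = Suc (Suc 0)" | "p = Suc (Suc (Suc 0))" by linarith
  note pc = this
  consider "e \<le> 0" | "e = 1" | "e = 2" | "e = 3" | "4 \<le> e" by linarith
  then show ?thesis
  proof cases
    case 1
    then have "kh (\<lambda>_. 0) p j (I1 I) = 0" using K L_low[of e p] L_low[of "e - 1" "Suc p"] by simp
    moreover have "betti z p j = 0" using 1 unfolding j betti_def by auto
    ultimately show ?thesis by simp
  next
    case 2
    have K': "kh (\<lambda>_. 0) p j (I1 I) + (4 choose Suc (Suc p)) = L p 1"
      using K L_low[of 0 "Suc p"] dI_low[of 1] hilbert(1) unfolding 2 by simp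
    show ?thesis using pc
    proof cases
      case 1
      then have "kh (\<lambda>_. 0) p j (I1 I) = 0" using K' L_void[OF 1, of 1] c0 by simp
      then show ?thesis using 1 unfolding betti_def by simp
    qed (use K' L1 z(2) in \<open>simp_all add: ch betti_def j 2\<close>)
  next
    case 3
    have K': "kh (\<lambda>_. 0) p j (I1 I) + (4 choose Suc (Suc p)) * 4 + (4 choose Suc p) * dI 2 = L p 2 + L (Suc p) 1"
      using K hilbert(2) unfolding 3 by simp
    show ?thesis using pc
    proof cases
      case 1
      then have "kh (\<lambda>_. 0) p j (I1 I) = 0" using K' L_void[of p 2] L_void[of "Suc p" 1] c0 by simp
      then show ?thesis using 1 unfolding betti_def by simp
    next
      case 5
      then show ?thesis using K' L2(4) hilbert(3) L_void[of "Suc p" 1] by (simp add: ch betti_def j 3)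
    qed (use K' L1 L2 hilbert(3) z(2) in \<open>simp_all add: ch betti_def j 3\<close>)
  next
    case 4
    have K': "kh (\<lambda>_. 0) p j (I1 I) + (4 choose Suc (Suc p)) * dQ TYPE('k) 2 + (4 choose Suc p) * dI 3 = (4 choose Suc p) * dQ TYPE('k) 3 + L (Suc p) 2"
      using K L_high[of 3 p] unfolding 4 by simp
    show ?thesis using pc
    proof cases
      case 1
      then have "kh (\<lambda>_. 0) p j (I1 I) = 0" using K' L_void[of "Suc p" 2] c0 by simp
      then show ?thesis using 1 unfolding betti_def by simp
    next
      case 5
      then show ?thesis using K' hilbert(4) L_void[of "Suc p" 2] by (simp add: ch betti_def j 4)
    qed (use K' L2 hilbert(4) in \<open>simp_all add: ch betti_def j 4\<close>)
  next
    case 5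
    then have "kh (\<lambda>_. 0) p j (I1 I) = 0" using K L_high[of e p] L_high[of "e - 1" "Suc p"] dQ_high[of e] by simp
    moreover have "betti z p j = 0" using 5 unfolding j betti_def by auto
    ultimately show ?thesis by simp
  qed
qed

end

section \<open>The socle form and its centroid\<close>

lemma kvs_pair_vec: "kvs_pair (fs :: 'k::field \<Rightarrow> ('i \<Rightarrow> ('v, 'k) mpoly) \<Rightarrow> _) ((*s) :: 'k \<Rightarrow> 'k^'n \<Rightarrow> 'k^'n)"
  by (intro kvs_pair.intro Fv.kvs_axioms kvs.intro vec.vector_space_axioms)

definition lin :: "'k::field^4 \<Rightarrow> (4, 'k) mpoly" where
  "lin w = (\<Sum>i<4. xv i * kc (w $ of_nat i))"

definition cf :: "(4, 'k::field) mpoly \<Rightarrow> 'k^4" where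
  "cf p = (\<chi> i. lkp p (Poly_Mapping.single i 1))"

lemma sum_of_nat_4: "(\<Sum>j\<in>UNIV. f (j :: 4)) = (\<Sum>v<4. f (of_nat v))"
proof -
  have "x \<in> (of_nat :: nat \<Rightarrow> 4) ` {..<4}" for x
  proof -
    obtain i where "i < 4" "x = of_nat i" using of_nat_4_surj[of x] by blast
    then show ?thesis by blast
  qed
  then have "bij_betw (of_nat :: nat \<Rightarrow> 4) {..<4} UNIV"
    unfolding bij_betw_def inj_on_def using of_nat_4_inj by auto
  from sum.reindex_bij_betw[OF this, of f] show ?thesis by simp
qed

lemma lin_hom [simp]: "homogeneous 1 (lin w)"
proof -
  have "homogeneous (1 + 0) (xv i * kc (w $ of_nat i))" for i :: nat by (intro homogeneous_mult) simp_all
  then show ?thesis unfolding lin_def by (auto intro: homogeneous_sum)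
qed

lemma lin_cf: "homogeneous 1 p \<Longrightarrow> lin (cf p) = p"
  unfolding lin_def cf_def using hom1_expand[of p] by simp

lemma cf_lin: "cf (lin w) = w"
proof -
  have "lkp (lin w) (Poly_Mapping.single i 1) = w $ i" for i :: 4
  proof -
    obtain v where v: "v < 4" "i = of_nat v" using of_nat_4_surj by blast
    show ?thesis unfolding v(2) lin_def using lin_coeff[of "{..<4}" v "\<lambda>i. w $ of_nat i"] v(1) by simp
  qed
  then show ?thesis by (simp add: cf_def vec_eq_iff)
qed

lemma cf_add: "cf (p + q) = cf p + cf q" by (simp add: cf_def vec_eq_iff lookup_add)

lemma cf_kc: "cf (kc c * p) = c *s cf p" by (simp add: cf_def vec_eq_iff lkp_kc_mult)

lemma cf_sum: "cf (sum f A) = (\<Sum>i\<in>A. cf (f i))"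
  by (induct A rule: infinite_finite_induct) (simp_all add: cf_add, simp_all add: cf_def vec_eq_iff)

lemma lin_add: "lin (u + v) = lin u + lin v" by (simp add: lin_def kc_add distrib_left sum.distrib)

lemma lin_scale: "lin (c *s u) = kc c * lin u"
  by (simp add: lin_def kc_mult sum_distrib_left mult.left_commute)

lemma lin_axis: "v < 4 \<Longrightarrow> lin (axis (of_nat v) 1) = xv v"
proof -
  assume v: "v < 4"
  have "lin (axis (of_nat v) 1) = (\<Sum>i<4. if i = v then xv i else (0 :: (4, 'a) mpoly))"
    unfolding lin_def by (rule sum.cong[OF refl]) (use v in \<open>auto simp: axis_def of_nat_4_inj\<close>)
  then show ?thesis using v by simp
qed

lemma mv_axis: "M *v u = (\<Sum>v<4. u $ of_nat v *s (M *v axis (of_nat v) 1))" for M :: "'k::field^4^4"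
proof -
  have "M *v u = M *v (\<Sum>j\<in>UNIV. u $ j *s axis j 1)" by (simp add: basis_expansion)
  also have "\<dots> = (\<Sum>j\<in>UNIV. u $ j *s (M *v axis j 1))"
    by (simp add: vec.linear_sum[OF matrix_vector_mul_linear_gen] vec.linear_scale[OF matrix_vector_mul_linear_gen])
  finally show ?thesis by (simp add: sum_of_nat_4)
qed

section \<open>Dual cycles of exterior degree 1 as matrices in the centroid\<close>

locale cubic_artin_0 = cubic_artin I s for I :: "(4, 'k::field_char_0) mpoly set" and s
begin

definition T :: "'k^4 \<Rightarrow> 'k^4 \<Rightarrow> 'k^4 \<Rightarrow> 'k" where "T u v w = tau (lin u * lin v * lin w)"

sublocale cubic_form T
proof
  show "T (x + y) v w = T x v w + T y v w" for x y v w
    by (simp add: T_def lin_add distrib_right tau_add)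
  show "T (c *s x) v w = c * T x v w" for c x v w
    by (simp add: T_def lin_scale mult.assoc tau_kc)
  show "T x y z = T y x z" for x y z by (simp add: T_def mult.commute)
  show "T x y z = T x z y" for x y z by (simp add: T_def ac_simps)
  \<comment> \<open>By the perfect pairing, the products of the form with the variables lie in
    \<open>I\<close>; then \<open>soc\<close> applies, and \<open>I\<close> contains no linear form
    but 0.\<close>
  fix u assume u: "\<And>v w. T u v w = 0"
  have "lin u \<in> I"
  proof (rule soc[OF lin_hom])
    fix i assume i: "i < (4::nat)"
    show "xv i * lin u \<in> I"
    proof (rule nondegenerate[of 1])
      show "homogeneous (3 - int 1) (xv i * lin u)" using homogeneous_mult[OF homogeneous_xv[of i] lin_hom[of u]] by simp
      fix q :: "(4, 'k) mpoly" assume q: "homogeneous (int 1) q"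
      have "T u (axis (of_nat i) 1) (cf q) = 0" by (rule u)
      then show "tau (q * (xv i * lin u)) = 0" using q by (simp add: T_def lin_axis[OF i] lin_cf ac_simps)
    qed
  qed simp
  then have "lin u = 0" by (rule I_low[OF _ lin_hom]) simp
  then have "cf (lin u) = 0" by (simp add: cf_def vec_eq_iff)
  then show "u = 0" by (simp add: cf_lin)
qed

text \<open>The value, at the form with coordinates \<open>u\<close>, of the linear map that takes
  \<open>xv v\<close> to \<open>g ({v}, 0)\<close>; \<open>mat_of g\<close> is the matrix of this
  map.\<close>

definition G :: "'k kchain \<Rightarrow> 'k^4 \<Rightarrow> (4, 'k) mpoly" where "G g u = (\<Sum>v<4. kc (u $ of_nat v) * g ({v}, 0))"

definition mat_of :: "'k kchain \<Rightarrow> 'k^4^4" where "mat_of g = (\<chi> i j. cf (G g (axis j 1)) $ i)"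

lemma G_axis: "v < 4 \<Longrightarrow> G g (axis (of_nat v) 1) = g ({v}, 0)"
proof -
  assume v: "v < 4"
  have "G g (axis (of_nat v) 1) = (\<Sum>i<4. if i = v then g ({i}, 0) else 0)"
    unfolding G_def by (rule sum.cong[OF refl]) (use v in \<open>auto simp: axis_def of_nat_4_inj\<close>)
  then show ?thesis using v by simp
qed

lemma mat_of_axis: "mat_of g *v axis j 1 = cf (G g (axis j 1))"
proof -
  have "(mat_of g *v axis j 1) $ i = cf (G g (axis j 1)) $ i" for i
  proof -
    have "(mat_of g *v axis j 1) $ i = (\<Sum>k\<in>UNIV. if k = j then mat_of g $ i $ k else 0)"
      unfolding matrix_vector_mult_def by (simp add: axis_def if_distrib cong: if_cong)
    then show ?thesis by (simp add: mat_of_def)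
  qed
  then show ?thesis by (simp add: vec_eq_iff)
qed

lemma mat_of_mult: "mat_of g *v u = cf (G g u)"
proof -
  have "mat_of g *v u = (\<Sum>v<4. u $ of_nat v *s cf (G g (axis (of_nat v) 1)))"
    by (subst mv_axis) (simp only: mat_of_axis)
  also have "\<dots> = (\<Sum>v<4. u $ of_nat v *s cf (g ({v}, 0)))" by (rule sum.cong[OF refl]) (simp add: G_axis)
  also have "\<dots> = cf (G g u)" unfolding G_def cf_sum cf_kc ..
  finally show ?thesis .
qed

lemma Ms_W: "g \<in> Ms 1 1 \<Longrightarrow> g \<in> W 1 2" unfolding Ms_def by simp

lemma Ms_iff: "g \<in> Ms 1 1 \<longleftrightarrow> g \<in> W 1 2 \<and> (\<forall>a<4. \<forall>b<4. xv a * g ({b}, 0) - xv b * g ({a}, 0) \<in> I)"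
proof
  assume g: "g \<in> Ms 1 1"
  have lt: "xv a * g ({b}, 0) - xv b * g ({a}, 0) \<in> I" if "a < b" "b < 4" for a b
  proof -
    have "{a, b} \<in> Sub 2" using that by (auto simp: Sub_def)
    then have "dl g {a, b} \<in> I" using g unfolding Ms_def by (simp add: numeral_2_eq_2)
    then show ?thesis unfolding dl_pair[OF that(1)] .
  qed
  have "xv a * g ({b}, 0) - xv b * g ({a}, 0) \<in> I" if "a < 4" "b < 4" for a b
  proof -
    consider "a < b" | "a = b" | "b < a" by linarith
    then show ?thesis
    proof cases
      case 3
      then show ?thesis using qidealD(5)[OF qI lt[OF 3 that(1)]] by simp
    qed (use lt that qidealD(1)[OF qI] in simp_all)
  qed
  then show "g \<in> W 1 2 \<and> (\<forall>a<4. \<forall>b<4. xv a * g ({b}, 0) - xv b * g ({a}, 0) \<in> I)" using Ms_W[OF g] by blast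
next
  assume g: "g \<in> W 1 2 \<and> (\<forall>a<4. \<forall>b<4. xv a * g ({b}, 0) - xv b * g ({a}, 0) \<in> I)"
  have "dl g T \<in> I" if T: "T \<in> Sub 2" for T
  proof -
    obtain c d where cd: "c < d" "d < 4" "T = {c, d}" using Sub_2[OF T] by blast
    show ?thesis unfolding cd(3) dl_pair[OF cd(1)] using g cd by auto
  qed
  then show "g \<in> Ms 1 1" using g unfolding Ms_def by (simp add: numeral_2_eq_2)
qed

lemma G_hom: "g \<in> W 1 2 \<Longrightarrow> homogeneous 1 (G g u)"
  unfolding G_def by (intro homogeneous_sum homogeneous_kc_mult) (use W_hom[of g 1 2] in simp)

text \<open>The difference \<open>G g u * lin v - lin u * G g v\<close> expands bilinearly into the
  elements of \<open>I\<close> that define \<open>Ms 1 1\<close>, and \<open>tau\<close> kills its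
  product with \<open>lin w\<close>.\<close>

lemma mat_of_centroid: assumes g: "g \<in> Ms 1 1" shows "mat_of g \<in> centroid"
  unfolding centroid_def
proof (intro CollectI allI)
  fix u v w
  note gW = Ms_W[OF g]
  have pr: "g ({a}, 0) * xv b - xv a * g ({b}, 0) \<in> I" if "a < 4" "b < 4" for a b
    using g that unfolding Ms_iff by (simp add: mult.commute)
  have "G g u * lin v - lin u * G g v =
     (\<Sum>a<4. \<Sum>b<4. kc (u $ of_nat a) * kc (v $ of_nat b) * (g ({a}, 0) * xv b - xv a * g ({b}, 0)))"
    unfolding G_def lin_def sum_product sum_subtractf[symmetric]
    by (intro sum.cong refl) (simp add: algebra_simps)
  also have "\<dots> \<in> I"
    by (intro qideal_sum[OF qI], rule qidealD(3)[OF qI], rule pr) auto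
  finally have "lin w * (G g u * lin v - lin u * G g v) \<in> I" by (rule qidealD(3)[OF qI])
  then have "tau (lin w * (G g u * lin v - lin u * G g v)) = 0" by (rule tau_I)
  then have "tau (lin w * (G g u * lin v)) = tau (lin w * (lin u * G g v))" by (simp add: right_diff_distrib tau_diff)
  then show "T (mat_of g *v u) v w = T u (mat_of g *v v) w"
    unfolding T_def mat_of_mult lin_cf[OF G_hom[OF gW]] by (simp add: mult.commute)
qed

text \<open>\<open>mat_of\<close> identifies \<open>Ms 1 1\<close> with the centroid. Composed with
  evaluation at \<open>v0\<close> it becomes a linear isomorphism onto the subspace whose dimension
  \<open>centroid_codim\<close> restricts.\<close>

theorem dim_Ms: "Fv.dim (Ms 1 1) \<in> {1, 2, 4}"
proof -
  obtain v0 where v0: "inj_on (\<lambda>M. M *v v0) centroid" "vec.dim ((\<lambda>M. M *v v0) ` centroid) \<in> {1, 2, 4}"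
    by (rule centroid_codim)
  define \<Theta> where "\<Theta> g = cf (G g v0)" for g
  have lin: "Vector_Spaces.linear fs (*s) \<Theta>"
  proof (unfold_locales)
    show "\<Theta> (f + g) = \<Theta> f + \<Theta> g" for f g
      by (simp add: \<Theta>_def G_def distrib_left sum.distrib cf_add)
    show "\<Theta> (fs c f) = c *s \<Theta> f" for c f
    proof -
      have "G (fs c f) v0 = kc c * G f v0" by (simp add: G_def fs_def sum_distrib_left mult.left_commute)
      then show ?thesis by (simp add: \<Theta>_def cf_kc)
    qed
  qed
  have inj: "g = 0" if g: "g \<in> Ms 1 1" "\<Theta> g = 0" for g
  proof -
    have z: "(0 :: 'k^4^4) *v u = 0" for u by (simp add: matrix_vector_mult_def vec_eq_iff)
    have "0 \<in> centroid" by (simp add: centroid_def z zero1 zero2)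
    moreover have "mat_of g *v v0 = 0 *v v0" using g(2) by (simp add: mat_of_mult \<Theta>_def z)
    ultimately have m: "mat_of g = 0" using inj_onD[OF v0(1) _ mat_of_centroid[OF g(1)]] by blast
    have "g ({v}, 0) = 0" if "v < 4" for v
    proof -
      have "cf (G g (axis (of_nat v) 1)) = 0" using mat_of_mult[of g "axis (of_nat v) 1"] by (simp add: m z)
      then have "lin (cf (g ({v}, 0))) = lin 0" using that by (simp add: G_axis)
      then show ?thesis using lin_cf[of "g ({v}, 0)"] W_hom[OF Ms_W[OF g(1)], of "{v}" 0] by (simp add: lin_def)
    qed
    then show ?thesis by (intro W_zeroI[OF Ms_W[OF g(1)]]) (auto simp: Sub_1)
  qed
  have im: "\<Theta> ` Ms 1 1 = (\<lambda>M. M *v v0) ` centroid"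
  proof (rule equalityI; rule subsetI)
    fix x assume "x \<in> \<Theta> ` Ms 1 1"
    then obtain g where "x = mat_of g *v v0" "g \<in> Ms 1 1" by (auto simp: \<Theta>_def mat_of_mult)
    then show "x \<in> (\<lambda>M. M *v v0) ` centroid" using mat_of_centroid by blast
  next
    fix x assume "x \<in> (\<lambda>M. M *v v0) ` centroid"
    then obtain M where M: "x = M *v v0" "M \<in> centroid" by blast
    define g :: "'k kchain" where "g = (\<lambda>(S, c). if S \<in> Sub 1 \<and> c = 0 then lin (M *v axis (of_nat (the_elem S)) 1) else 0)"
    have gv: "g ({v}, 0) = lin (M *v axis (of_nat v) 1)" if "v < 4" for v using that by (simp add: g_def Sub_1)
    have "g \<in> W 1 2" unfolding W_iff by (auto simp: g_def)
    \<comment> \<open>The centroid identity says exactly that these elements of degree 2 pair to 0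
      with every linear form.\<close>
    moreover have "xv a * g ({b}, 0) - xv b * g ({a}, 0) \<in> I" if ab: "a < 4" "b < 4" for a b
    proof (rule nondegenerate[of 1])
      show "homogeneous (3 - int 1) (xv a * g ({b}, 0) - xv b * g ({a}, 0))"
        unfolding gv[OF ab(1)] gv[OF ab(2)]
        using homogeneous_diff[OF homogeneous_mult[OF homogeneous_xv lin_hom] homogeneous_mult[OF homogeneous_xv lin_hom]] by simp
      fix q :: "(4, 'k) mpoly" assume "homogeneous (int 1) q"
      then have q: "q = lin (cf q)" by (simp add: lin_cf)
      let ?a = "axis (of_nat a) 1 :: 'k^4" and ?b = "axis (of_nat b) 1 :: 'k^4"
      have "T (M *v ?a) ?b (cf q) = T ?a (M *v ?b) (cf q)" using M(2) unfolding centroid_def by blast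
      then have "tau (q * (xv a * g ({b}, 0))) = tau (q * (xv b * g ({a}, 0)))"
        unfolding T_def gv[OF ab(1)] gv[OF ab(2)] lin_axis[OF ab(1)] lin_axis[OF ab(2)] q[symmetric] by (simp add: ac_simps)
      then show "tau (q * (xv a * g ({b}, 0) - xv b * g ({a}, 0))) = 0" by (simp add: right_diff_distrib tau_diff)
    qed
    ultimately have gM: "g \<in> Ms 1 1" unfolding Ms_iff by blast
    have "\<Theta> g = (\<Sum>v<4. v0 $ of_nat v *s cf (g ({v}, 0)))" unfolding \<Theta>_def G_def cf_sum cf_kc ..
    also have "\<dots> = (\<Sum>v<4. v0 $ of_nat v *s (M *v axis (of_nat v) 1))"
      by (rule sum.cong[OF refl]) (simp add: gv cf_lin)
    also have "\<dots> = M *v v0" by (rule mv_axis[symmetric])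
    finally have "x = \<Theta> g" using M(1) by simp
    then show "x \<in> \<Theta> ` Ms 1 1" using gM by (rule image_eqI)
  qed
  have fd: "Fv.fd (Ms 1 1)"
    by (rule Fv.fd_subset[OF KK_fd[OF order_refl, of "\<lambda>_. 0" 1 2 1]]) (rule subsetI, rule Ms_W)
  have "vec.dim (\<Theta> ` Ms 1 1) = Fv.dim (Ms 1 1)"
    by (rule kvs_pair.linear_inj_dim[OF kvs_pair_vec lin Ms_subspace fd inj])
  then show ?thesis using v0(2) unfolding im by simp
qed

end

section \<open>From the values of \<open>z\<close> to the three tables\<close>

lemma twists_simps:
  "twists Ns 0 = (\<Sum>(m, j)\<leftarrow>nth_default [] Ns 0. replicate_mset m j)"
  "twists (N # Ns) (Suc i) = twists Ns i" "twists [] i = {#}"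
  "twists (N # Ns) 0 = (\<Sum>(m, j)\<leftarrow>N. replicate_mset m j)"
  by (simp_all add: twists_def nth_default_def)

text \<open>For \<open>z = 1, 2, 4\<close> the entries \<open>4 + z\<close> are 5, 6, 8 and the
  entries \<open>z - 1\<close> are 0, 1, 3.\<close>

lemma table_of_counts:
  assumes z: "z \<in> {1, 2, 4 :: nat}" and B: "B 0 = {#0#}" "\<And>i j. count (B (Suc i)) j = betti z i j"
  shows "B \<in> {twists [[(1,0)], [(6,2)],        [(5,3), (5,4)], [(6,5)],        [(1,7)]],
            twists [[(1,0)], [(6,2), (1,3)], [(6,3), (6,4)], [(1,4), (6,5)], [(1,7)]],
            twists [[(1,0)], [(6,2), (3,3)], [(8,3), (8,4)], [(3,4), (6,5)], [(1,7)]]}"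
proof -
  have split: "B = T" if "T 0 = {#0#}" "\<And>i j. count (T (Suc i)) j = betti z i j" for T
  proof
    fix i show "B i = T i" using B that by (cases i) (auto intro: multiset_eqI)
  qed
  consider "z = 1" | "z = 2" | "z = 4" using z by auto
  then show ?thesis
  proof cases
    case 1
    have "B = twists [[(1,0)], [(6,2)], [(5,3), (5,4)], [(6,5)], [(1,7)]]"
    proof (rule split)
      fix i j
      consider "i = 0" | "i = 1" | "i = 2" | "i = 3" | k where "i = Suc (Suc (Suc (Suc k)))"
        by (metis One_nat_def not0_implies_Suc numeral_2_eq_2 numeral_3_eq_3)
      then show "count (twists [[(1,0)], [(6,2)], [(5,3), (5,4)], [(6,5)], [(1,7)]] (Suc i)) j = betti z i j"
        by cases (simp_all add: twists_simps betti_def 1 numeral_2_eq_2 numeral_3_eq_3 del: replicate_mset_Suc)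
    qed (simp add: twists_simps)
    then show ?thesis by blast
  next
    case 2
    have "B = twists [[(1,0)], [(6,2), (1,3)], [(6,3), (6,4)], [(1,4), (6,5)], [(1,7)]]"
    proof (rule split)
      fix i j
      consider "i = 0" | "i = 1" | "i = 2" | "i = 3" | k where "i = Suc (Suc (Suc (Suc k)))"
        by (metis One_nat_def not0_implies_Suc numeral_2_eq_2 numeral_3_eq_3)
      then show "count (twists [[(1,0)], [(6,2), (1,3)], [(6,3), (6,4)], [(1,4), (6,5)], [(1,7)]] (Suc i)) j = betti z i j"
        by cases (simp_all add: twists_simps betti_def 2 numeral_2_eq_2 numeral_3_eq_3 del: replicate_mset_Suc)
    qed (simp add: twists_simps)
    then show ?thesis by blast
  next
    case 3
    have "B = twists [[(1,0)], [(6,2), (3,3)], [(8,3), (8,4)], [(3,4), (6,5)], [(1,7)]]"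
    proof (rule split)
      fix i j
      consider "i = 0" | "i = 1" | "i = 2" | "i = 3" | k where "i = Suc (Suc (Suc (Suc k)))"
        by (metis One_nat_def not0_implies_Suc numeral_2_eq_2 numeral_3_eq_3)
      then show "count (twists [[(1,0)], [(6,2), (3,3)], [(8,3), (8,4)], [(3,4), (6,5)], [(1,7)]] (Suc i)) j = betti z i j"
        by cases (simp_all add: twists_simps betti_def 3 numeral_2_eq_2 numeral_3_eq_3 del: replicate_mset_Suc)
    qed (simp add: twists_simps)
    then show ?thesis by blast
  qed
qed

theorem mainTheorem2:
  fixes I :: "(4, 'k::{alg_closed_field, field_char_0}) mpoly set"
  assumes "homogeneous_ideal I"
    and "gorenstein_ideal mpoly_ring I"
    and "ideal_power mpoly_ring irrelevant_ideal 4 \<subseteq> I"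
    and "I \<subseteq> ideal_power mpoly_ring irrelevant_ideal 2"
    and "has_hilbert_function I (poly.coeff [:1, 4, 4, 1:])"
  shows "(\<exists>!B. is_betti_table I B) \<and>
    (\<forall>B. is_betti_table I B \<longrightarrow>
       B \<in> {twists [[(1,0)], [(6,2)],        [(5,3), (5,4)], [(6,5)],        [(1,7)]],
            twists [[(1,0)], [(6,2), (1,3)], [(6,3), (6,4)], [(1,4), (6,5)], [(1,7)]],
            twists [[(1,0)], [(6,2), (3,3)], [(8,3), (8,4)], [(3,4), (6,5)], [(1,7)]]})"
proof -
  have qI: "qideal I" using assms(2) unfolding gorenstein_ideal_def perfect_ideal_def ideal_iff_qideal by blast
  have gor: "gorenstein_ring (mpoly_ring Quot I)" using assms(2) unfolding gorenstein_ideal_def by blast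
  have hI: "hc e p \<in> I" if "p \<in> I" for p e by (rule homogeneous_ideal_hc[OF assms(1) that])
  have I4: "p \<in> I" if "\<And>m. m \<in> keys p \<Longrightarrow> 4 \<le> mon_deg m" for p
  proof (rule mem_qideal_keys[OF qI])
    fix m c assume "m \<in> keys p"
    from ideal_power_mem[OF that[OF this]] show "Poly_Mapping.single m c \<in> I" using assms(3) by blast
  qed
  have I2: "2 \<le> mon_deg m" if "p \<in> I" "m \<in> keys p" for p m
    by (rule ideal_power_deg[of p 2 m]) (use that assms(4) in blast)+
  have I0: "lkp p 0 = 0" if "p \<in> I" for p
    using I2[OF that, of 0] by (auto simp: in_keys_iff mon_deg_def)
  interpret artin I by unfold_locales (use qI I4 I0 in blast)+
  obtain s where s: "homogeneous (int 3) s" "s \<notin> I" "\<forall>p. homogeneous (int 3) p \<longrightarrow> (\<exists>c. p - kc c * s \<in> I)"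
    using hilbert_one[OF assms(5), of 3] by (auto simp: numeral_3_eq_3)
  \<comment> \<open>\<open>s\<close> lies in the socle for reasons of degree.\<close>
  have xs: "xv i * s \<in> I" for i
  proof (rule I4)
    fix m assume "m \<in> keys (xv i * s)"
    then show "4 \<le> mon_deg m" using homogeneous_mult[OF homogeneous_xv[of i] s(1)] unfolding homogeneous_def by force
  qed
  interpret cubic_artin_0 I s
  proof
    fix e p assume p: "homogeneous e p" "e < 3" "\<And>i. i < 4 \<Longrightarrow> xv i * p \<in> I"
    \<comment> \<open>A socle element is a multiple of \<open>s\<close> modulo \<open>I\<close>. As
      \<open>s\<close> has no component of degree \<open>e\<close>, the component of the difference
      in that degree is \<open>p\<close> itself.\<close>
    obtain c where c: "p - kc c * s \<in> I" using gorenstein_socle[OF gor s(2) xs p(3)] by blast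
    have "hc e (kc c * s) = 0" using hc_other[OF homogeneous_kc_mult[OF s(1)]] p(2) by simp
    then have "hc e (p - kc c * s) = p" using hc_add[of e "p - kc c * s" "kc c * s"] hc_id[OF p(1)] by simp
    then show "p \<in> I" using hI[OF c, of e] by simp
  qed (use qI hI I2 I4 s in auto)
  define z where "z = Fv.dim (Ms 1 1)"
  have z: "z \<in> {1, 2, 4}" unfolding z_def by (rule dim_Ms)
  then have kh: "kh (\<lambda>_. 0) p j (I1 I) = betti z p j" for p j
    by (intro kh_betti) (auto simp: z_def)
  have counts: "B 0 = {#0#} \<and> (\<forall>i j. count (B (Suc i)) j = betti z i j)" if B: "is_betti_table I B" for B
  proof -
    obtain a d \<epsilon> where a: "minimal_graded_free_resolution I a d \<epsilon>" "B = (\<lambda>i. mset (a i))"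
      using B unfolding is_betti_table_def by blast
    show ?thesis using betti_koszul[OF qI I0 a(1)] unfolding a(2) kh by simp
  qed
  \<comment> \<open>Existence comes after the computation of Koszul homology, because that
    computation shows that only finitely many degrees occur.\<close>
  have "\<exists>a d \<epsilon>. minimal_graded_free_resolution I a d \<epsilon>"
  proof (rule minimal_resolution_exists[OF qI hI I0])
    fix p
    have "{j. kh (\<lambda>_. 0) p j (I1 I) \<noteq> 0} \<subseteq> {2, 3, 4, 5, 7}" unfolding kh by (auto simp: betti_def split: if_splits)
    then show "finite {j. kh (\<lambda>_. 0) p j (I1 I) \<noteq> 0}" by (rule finite_subset) simp
  qed
  then obtain B where "is_betti_table I B" unfolding is_betti_table_def by blast
  moreover have "B' = B" if "is_betti_table I B'" "is_betti_table I B" for B B'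
  proof
    fix i show "B' i = B i" using counts[OF that(1)] counts[OF that(2)] by (cases i) (auto intro: multiset_eqI)
  qed
  ultimately have "\<exists>!B. is_betti_table I B" by blast
  moreover have "B \<in> {twists [[(1,0)], [(6,2)],        [(5,3), (5,4)], [(6,5)],        [(1,7)]],
            twists [[(1,0)], [(6,2), (1,3)], [(6,3), (6,4)], [(1,4), (6,5)], [(1,7)]],
            twists [[(1,0)], [(6,2), (3,3)], [(8,3), (8,4)], [(3,4), (6,5)], [(1,7)]]}"
    if "is_betti_table I B" for B
    by (rule table_of_counts[OF z]) (use counts[OF that] in blast)+
  ultimately show ?thesis by blast
qed

end
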